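(* Let $E=\mathbb R^{p+q}$, $M=\mathbb R^p$, $\pi:E\to M$ the canonical projection, and $n\ge1$. Given $\nabla=(x^{i},u^{j},u_{i_{1}}^{j},u_{i_1,i_2}^j,\dots,u_{i_{1},\dots,i_{n+1}}^{j})$ and $\nabla'=(y^{i},v^{j},v_{i_{1}}^{j},v_{i_1,i_2}^j,\dots,v_{i_{1},\dots,i_{n+1}}^{j})$ in $\mathcal{J}^{n+1}(\pi)$, we have $\pi_{n+1,n}(\nabla)=\pi_{n+1,n}(\nabla')$ if and only if $$\pi_{n+1,n}\big(\theta_{\mathbb{J}^{D^{n+1}}(\pi)}^{\mathcal{J}^{n+1}(\pi)}(\nabla)\big)=\pi_{n+1,n}\big(\theta_{\mathbb{J}^{D^{n+1}}(\pi)}^{\mathcal{J}^{n+1}(\pi)}(\nabla')\big),$$ in which case $$\theta_{\mathbb{S}^{D^{n+1}}(\pi)}^{\mathcal{S}^{n+1}(\pi)}(\nabla\dot{-}\nabla')=\theta_{\mathbb{J}^{D^{n+1}}(\pi)}^{\mathcal{J}^{n+1}(\pi)}(\nabla)\dot{-}\theta_{\mathbb{J}^{D^{n+1}}(\pi)}^{\mathcal{J}^{n+1}(\pi)}(\nabla').$$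
   Context: Everything takes place in the category of Fr\"olicher spaces; every "mapping" is smooth. For a Weil algebra $W=C^\infty(\mathbb R^k)/I$ and a Fr\"olicher space $X$, $X\otimes W$ is the quotient of $C^\infty(\mathbb R^k,X)$ by $f\sim g$ iff $h\circ f-h\circ g\in I$ for all smooth $h:X\to\mathbb R$; functorial in $X$ and $W$. Infinitesimal objects such as $D=\{d:d^2=0\}$, $D_m=\{d:d^{m+1}=0\}$, $D^n=D\times\dots\times D$ have Weil algebras $\mathcal W_{\mathbb D}$ of functions (quotient of $C^\infty(\mathbb R^k)$ by the ideal generated by the equations), and a polynomial map $f:\mathbb D\to\mathbb D'$ with $f(0)=0$ induces $\mathrm{id}_X\otimes\mathcal W_f:X\otimes\mathcal W_{\mathbb D'}\to X\otimes\mathcal W_{\mathbb D}$ ("composition with $f$"). $(X\otimes\mathcal W_{\mathbb D})_x$ is the fibre over $x$ of $X\otimes\mathcal W_{\mathbb D}\to X$. Brackets $[\delta\mapsto f(\delta)]$ denote classes. First approach. For a smooth map $\rho:Y\to M$ and $y\in Y$, $\mathbf J^1_y(\rho)$ is the set of mappings $\nabla_y:(M\otimes\mathcal W_D)_{\rho(y)}\to(Y\otimes\mathcal W_D)_y$ with $(\rho\otimes\mathrm{id})(\nabla_y(t))=t$, $\nabla_y(\alpha t)=\alpha\nabla_y(t)$ for $\alpha\in\mathbb R$, and, for all $m$ with $\mu:D\times D_m\to D$, $\mu(d,e)=ed$, $(\nabla_y\otimes\mathrm{id}_{\mathcal W_{D_m}})\circ(\mathrm{id}_M\otimes\mathcal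 W_\mu)=(\mathrm{id}_Y\otimes\mathcal W_\mu)\circ\nabla_y$. $\mathbf J^1(\rho)=\bigcup_y\mathbf J^1_y(\rho)$ has projections $\rho_{1,0}$ to $Y$ and $\rho_1=\rho\circ\rho_{1,0}$ to $M$, and the fibrewise mapping-space structure: a curve $c$ is smooth iff its base curve in $Y$ is smooth and $r\mapsto c(g(r))(t(r))$ is smooth for all smooth $g:\mathbb R\to\mathbb R$ and smooth $t:\mathbb R\to M\otimes\mathcal W_D$ for which this makes sense (the spaces $\mathbb J^{D^n}(\pi)$ below get the analogous structure over $E$). Put $\mathbf J^0(\pi)=E$, $\pi_0=\pi$. For $n\ge1$, $\mathbf J^{n+1}(\pi)\subset\mathbf J^1(\pi_n)$ consists of those $\nabla_x$, with $x=\nabla_y\in\mathbf J^n(\pi)$, such that: (i) $(\pi_{n,n-1}\otimes\mathrm{id}_{\mathcal W_D})(\nabla_x(t))=\nabla_y(t)$ for all $t$; (ii) $P(\gamma)=P(\gamma^\tau)^\tau$ for all $\gamma\in(M\otimes\mathcal W_{D^2})_{\pi_n(x)}$, where $\tau$ interchanges the variables of $D^2$ and $P(\gamma)\in\mathbf J^{n-1}(\pi)\otimes\mathcal W_{D^2}$ is $(d_1,d_2)\mapsto(\nabla_x(\gamma(\cdot,0))(d_1))(\gamma(d_1,\cdot))(d_2)$; formally, apply $\mathrm{ev}\otimes\mathrm{id}_{\mathcal W_D}$, $\mathrm{ev}(\nabla,t)=\nabla(t)$, to the pair of $\nabla_x(\gamma(\cdot,0))\in\mathbf J^n(\pi)\otimes\mathcal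 W_D$ and $\gamma$ viewed as $d_1\mapsto\gamma(d_1,\cdot)$ in $(M\otimes\mathcal W_D)\otimes\mathcal W_D$. Second approach. For $\gamma\in X\otimes\mathcal W_{D^n}$: $\alpha\underset{i}{\cdot}\gamma$ is the composition with $(d_1,\dots,d_n)\mapsto(d_1,\dots,\alpha d_i,\dots,d_n)$, and $\gamma^\sigma$ ($\sigma\in\mathbf S_n$) with $(d_1,\dots,d_n)\mapsto(d_{\sigma(1)},\dots,d_{\sigma(n)})$. A $D^n$-pseudotangential at $x\in E$ is a mapping $\nabla_x:(M\otimes\mathcal W_{D^n})_{\pi(x)}\to(E\otimes\mathcal W_{D^n})_x$ with: (1) $(\pi\otimes\mathrm{id})(\nabla_x(\gamma))=\gamma$; (2) $\nabla_x(\alpha\underset{i}{\cdot}\gamma)=\alpha\underset{i}{\cdot}\nabla_x(\gamma)$; (3) for all $m\ge1$, $1\le i\le n$, with $\mu_i(d_1,\dots,d_n,e)=(d_1,\dots,ed_i,\dots,d_n)$ on $D^n\times D_m$, $(\nabla_x\otimes\mathrm{id}_{\mathcal W_{D_m}})\circ(\mathrm{id}_M\otimes\mathcal W_{\mu_i})=(\mathrm{id}_E\otimes\mathcal W_{\mu_i})\circ\nabla_x$; (4) $\nabla_x(\gamma^\sigma)=(\nabla_x(\gamma))^\sigma$. For a $D^{n+1}$-pseudotangential $\nabla_x$, $\hat\pi_{n+1,n}(\nabla_x)(\gamma)$ is the composition with $(d_1,\dots,d_n)\mapsto(d_1,\dots,d_n,0)$ of $\nabla_x$ applied to the composition of $\gamma$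 with $(d_1,\dots,d_{n+1})\mapsto(d_1,\dots,d_n)$. A $D$-tangential is a $D$-pseudotangential; a $D^{n+1}$-tangential is a $D^{n+1}$-pseudotangential $\nabla_x$ such that $\hat\pi_{n+1,n}(\nabla_x)$ is a $D^n$-tangential and, with $\kappa(d_1,\dots,d_{n+1})=(d_1,\dots,d_{n-1},d_nd_{n+1})$, $\nabla_x((\mathrm{id}_M\otimes\mathcal W_\kappa)(\gamma))=(\mathrm{id}_E\otimes\mathcal W_\kappa)(\hat\pi_{n+1,n}(\nabla_x)(\gamma))$ for all $\gamma\in(M\otimes\mathcal W_{D^n})_{\pi(x)}$. $\mathbb J^{D^n}(\pi)$ is the set of all $D^n$-tangentials at all $x\in E$; $\pi_{n+1,n}:\mathbb J^{D^{n+1}}(\pi)\to\mathbb J^{D^n}(\pi)$ is the restriction of $\hat\pi_{n+1,n}$. The map $\varphi_n:\mathbf J^n(\pi)\to\mathbb J^{D^n}(\pi)$: $\varphi_1=\mathrm{id}$, and $\varphi_{n+1}(\nabla_x)(\gamma)$ is $(d_1,\dots,d_{n+1})\mapsto\varphi_n\big(\nabla_x(\gamma(0,\dots,0,\cdot))(d_{n+1})\big)\big(\gamma(\cdot,\dots,\cdot,d_{n+1})\big)(d_1,\dots,d_n)$ for $\gamma\in M\otimes\mathcal W_{D^{n+1}}$ (evaluation prolonged by $\mathcal W_D$). Symmetric forms. $(E\otimes\mathcal W_D)_x^\perp$ is the set of $t\in(E\otimes\mathcal W_D)_x$ with $(\pi\otimes\mathrm{id})(t)$ the zero tangent vector. $\mathbb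 S_x^{D^n}(\pi)$ is the set of mappings $\omega:(M\otimes\mathcal W_{D^n})_{\pi(x)}\to(E\otimes\mathcal W_D)_x^\perp$ with $\omega(\alpha\underset{i}{\cdot}\gamma)=\alpha\omega(\gamma)$; $(\omega\otimes\mathrm{id}_{\mathcal W_{D_m}})\circ(\mathrm{id}_M\otimes\mathcal W_{\mu_i})=(\mathrm{id}_E\otimes\mathcal W_{(d,e)\mapsto de})\circ\omega$; $\omega(\gamma^\sigma)=\omega(\gamma)$; and $\omega=0$ on compositions of elements of $(M\otimes\mathcal W_{D^{n-1}})_{\pi(x)}$ with $(d_1,\dots,d_n)\mapsto(d_1,\dots,d_{n-2},d_{n-1}d_n)$. $\mathbb S^{D^n}(\pi)=\bigcup_x\mathbb S^{D^n}_x(\pi)$. Difference. If $\gamma_\pm\in E\otimes\mathcal W_{D^{n+1}}$ agree on $D\{n+1\}_n=\{d\in D^{n+1}:d_1\cdots d_{n+1}=0\}$, then $\gamma_+\dot-\gamma_-\in E\otimes\mathcal W_D$ is the tangent vector at their common base point whose direction is the difference of the coefficients of $d_1\cdots d_{n+1}$. For $\nabla^\pm\in\mathbb J^{D^{n+1}}(\pi)$ with equal images under $\pi_{n+1,n}$, $(\nabla^+\dot-\nabla^-)(\gamma)=\nabla^+(\gamma)\dot-\nabla^-(\gamma)$, an element of $\mathbb S^{D^{n+1}}(\pi)$. Coordinate jets. $D(p)_n\subset\mathbb R^p$ is defined by the vanishing of all products of $n+1$ coordinates; $\mathcal J^n(\pi)$ is the set of $\gamma\in E\otimes\mathcal W_{D(p)_n}$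 with $(\pi\otimes\mathrm{id})(\gamma)$ constant, identified by Taylor coefficients with tuples $(x^i,u^j,u^j_{i_1},\dots,u^j_{i_1,\dots,i_n})$, $1\le i\le p$, $1\le j\le q$, $1\le i_1\le\dots\le i_n\le p$; where a coefficient $u^j_{i_1,\dots,i_r}$ of such a jet occurs with unordered indices it is understood by symmetry. $\pi_{n+1,n}:\mathcal J^{n+1}(\pi)\to\mathcal J^n(\pi)$ forgets the coefficients of order $n+1$. $\mathcal S^{n+1}(\pi)$ is the set of tuples $(x^i,u^j,u^j_{i_1,\dots,i_{n+1}})$ (same index ranges, $1\le i_1\le\dots\le i_{n+1}\le p$), i.e. of elements of $E\otimes\mathcal W_{D(N)}$, $N=\binom{p+n}{n+1}$, $D(N)=D(N)_1$, with constant projection to $M$. If $\pi_{n+1,n}(\nabla)=\pi_{n+1,n}(\nabla')$, then $\nabla\dot-\nabla'=(x^i,u^j,u^j_{i_1,\dots,i_{n+1}}-v^j_{i_1,\dots,i_{n+1}})\in\mathcal S^{n+1}(\pi)$. $\theta_{\mathbf{J}^{n}(\pi)}^{\mathcal{J}^{n}(\pi)}$ (write $\theta_n$) is defined inductively: $\theta_1(x^i,u^j,u^j_i)$ sends $[\delta\mapsto(x^i)+(y^i)\delta]$ to $[\delta\mapsto(x^i,u^j)+(y^i,\sum_iu^j_iy^i)\delta]$, and $\theta_{n+1}(x^i,u^j,\dots,u^j_{i_1,\dots,i_{n+1}})$ sends $[\delta\mapsto(x^i)+(y^i)\delta]$ to $[\delta\mapsto\theta_n((x^i,u^j,u^j_{i_1},\dots,u^j_{i_1,\dots,i_n})+(y^i,\sum_{i_1=1}^pu^j_{i_1}y^{i_1},\dots,\sum_{i_{n+1}=1}^pu^j_{i_1,\dots,i_{n+1}}y^{i_{n+1}})\delta)]$.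 $\theta_{\mathbb{J}^{D^{n}}(\pi)}^{\mathcal{J}^{n}(\pi)}=\varphi_n\circ\theta_{\mathbf{J}^{n}(\pi)}^{\mathcal{J}^{n}(\pi)}$. Finally $\theta_{\mathbb{S}^{D^{n}}(\pi)}^{\mathcal{S}^{n}(\pi)}:\mathcal S^n(\pi)\to\mathbb S^{D^n}(\pi)$ is defined by letting $\theta_{\mathbb{S}^{D^{n}}(\pi)}^{\mathcal{S}^{n}(\pi)}(x^i,u^j,u^j_{i_1,\dots,i_n})$ send $[(\delta_1,\dots,\delta_n)\mapsto(x^i)+\sum_{r=1}^n\sum_{1\le k_1<\dots<k_r\le n}\delta_{k_1}\cdots\delta_{k_r}(y^i_{k_1,\dots,k_r})]$ to $\big[\delta\mapsto\big(x^i,u^j+\delta\sum_{1\le i_1\le\dots\le i_n\le p}y_1^{i_1}\cdots y_n^{i_n}u^j_{i_1,\dots,i_n}\big)\big]\in(E\otimes\mathcal W_D)^\perp_{(x^i,u^j)}$.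
   Formalization: In the map θ from S^n(π) to symmetric forms, the sum over i_1≤…≤i_n is replaced by the sum over all index tuples in {1..p}^n, u extended by symmetry; the ordered sum is not invariant under permutations and makes the claimed equality fail for p≥2. *)

theory Defs
  imports Complex_Main "HOL-Library.Multiset" "HOL-Library.FuncSet" "HOL-Combinatorics.Permutations"
begin

section \<open>Froelicher spaces\<close>

definition smooth_fun :: "(real \<Rightarrow> real) \<Rightarrow> bool" where
  "smooth_fun c \<longleftrightarrow>
    (\<exists>D. D 0 = c \<and> (\<forall>k x. (D k has_real_derivative D (Suc k) x) (at x)))"

text \<open>A Froelicher structure is given by its smooth curves; the smooth real functions are
  the dual of the curves. Members are only meaningful on \<open>pts\<close>.\<close>

record 'a frolicher =
  pts :: "'a set"
  curves :: "(real \<Rightarrow> 'a) set"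

definition funs :: "'a frolicher \<Rightarrow> ('a \<Rightarrow> real) set" where
  "funs X = {h. \<forall>c\<in>curves X. smooth_fun (h \<circ> c)}"

definition smooth_maps :: "'a frolicher \<Rightarrow> 'b frolicher \<Rightarrow> ('a \<Rightarrow> 'b) set" where
  "smooth_maps X Y = {f. f ` pts X \<subseteq> pts Y \<and> (\<forall>c\<in>curves X. f \<circ> c \<in> curves Y)}"

definition subspace :: "'a frolicher \<Rightarrow> 'a set \<Rightarrow> 'a frolicher" where
  "subspace X A = \<lparr>pts = pts X \<inter> A, curves = {c \<in> curves X. range c \<subseteq> A}\<rparr>"

definition frol_product :: "'a frolicher \<Rightarrow> 'b frolicher \<Rightarrow> ('a \<times> 'b) frolicher" where
  "frol_product X Y = \<lparr>pts = pts X \<times> pts Y,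
     curves = {c. fst \<circ> c \<in> curves X \<and> snd \<circ> c \<in> curves Y}\<rparr>"

definition fibre_product ::
    "'a frolicher \<Rightarrow> 'b frolicher \<Rightarrow> ('a \<Rightarrow> 'c) \<Rightarrow> ('b \<Rightarrow> 'c) \<Rightarrow> ('a \<times> 'b) frolicher" where
  "fibre_product X Y f g = subspace (frol_product X Y) {(x, y). f x = g y}"

definition quotient :: "('a \<Rightarrow> 'b) \<Rightarrow> 'a frolicher \<Rightarrow> 'b frolicher" where
  "quotient q X = \<lparr>pts = q ` pts X,
     curves = {c. range c \<subseteq> q ` pts X \<and>
       (\<forall>h. (\<forall>b\<in>curves X. smooth_fun (h \<circ> q \<circ> b)) \<longrightarrow> smooth_fun (h \<circ> c))}\<rparr>"

definition transport :: "('a \<Rightarrow> 'b) \<Rightarrow> 'a frolicher \<Rightarrow> 'b frolicher" where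
  "transport i X = \<lparr>pts = i ` pts X, curves = (\<lambda>c. i \<circ> c) ` curves X\<rparr>"

text \<open>Coordinates are numbered from 0, and $\mathbb{R}^k$ consists of the sequences vanishing from
  index \<open>k\<close> on, so that $\mathbb{R}^k \subseteq \mathbb{R}^{k+1}$ is the inclusion $d \mapsto (d,0)$.
  By Boman's theorem \<open>funs (Rn k)\<close> is the set of all $C^\infty$ functions on $\mathbb{R}^k$.\<close>

type_synonym vec = "nat \<Rightarrow> real"

definition Rn :: "nat \<Rightarrow> vec frolicher" where
  "Rn k = \<lparr>pts = {x. \<forall>i\<ge>k. x i = 0},
     curves = {c. (\<forall>t. \<forall>i\<ge>k. c t i = 0) \<and> (\<forall>i. smooth_fun (\<lambda>t. c t i))}\<rparr>"

definition mapping_space :: "nat \<Rightarrow> 'a frolicher \<Rightarrow> (vec \<Rightarrow> 'a) frolicher" where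
  "mapping_space k X = \<lparr>pts = smooth_maps (Rn k) X,
     curves = {\<Gamma>. range \<Gamma> \<subseteq> smooth_maps (Rn k) X \<and>
       (\<forall>g c. smooth_fun g \<longrightarrow> c \<in> curves (Rn k) \<longrightarrow> (\<lambda>r. \<Gamma> (g r) (c r)) \<in> curves X)}\<rparr>"

definition trunc :: "nat \<Rightarrow> vec \<Rightarrow> vec" where
  "trunc k x = (\<lambda>i. if i < k then x i else 0)"


section \<open>Infinitesimal objects and Weil prolongations\<close>

text \<open>An infinitesimal object is given by the number of its coordinates and its equations; its
  Weil algebra is $C^\infty(\mathbb{R}^k)$ modulo the ideal generated by the equations.\<close>

record infinitesimal =
  nvars :: nat
  eqns :: "(vec \<Rightarrow> real) set"

definition ideal :: "infinitesimal \<Rightarrow> (vec \<Rightarrow> real) set" where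
  "ideal W = {a. \<exists>S b. finite S \<and> S \<subseteq> eqns W \<and> (\<forall>g\<in>S. b g \<in> funs (Rn (nvars W))) \<and>
      (\<forall>x\<in>pts (Rn (nvars W)). a x = (\<Sum>g\<in>S. b g x * g x))}"

definition weil_equiv :: "'a frolicher \<Rightarrow> infinitesimal \<Rightarrow> (vec \<Rightarrow> 'a) \<Rightarrow> (vec \<Rightarrow> 'a) \<Rightarrow> bool" where
  "weil_equiv X W f g \<longleftrightarrow>
     f \<in> smooth_maps (Rn (nvars W)) X \<and> g \<in> smooth_maps (Rn (nvars W)) X \<and>
     (\<forall>h\<in>funs X. (\<lambda>d. h (f d) - h (g d)) \<in> ideal W)"

text \<open>An equivalence class is encoded by one chosen representative, the same for all its members:
  \<open>cls X W f = cls X W g\<close> iff \<open>f\<close> and \<open>g\<close> are equivalent. With classes as sets the recursion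
  through tangent vectors in the datatype of iterated jets below would be impossible.\<close>

definition cls :: "'a frolicher \<Rightarrow> infinitesimal \<Rightarrow> (vec \<Rightarrow> 'a) \<Rightarrow> (vec \<Rightarrow> 'a)" where
  "cls X W f = (SOME g. weil_equiv X W f g)"

definition tens :: "'a frolicher \<Rightarrow> infinitesimal \<Rightarrow> (vec \<Rightarrow> 'a) frolicher"  (infixl \<open>\<otimes>\<^sub>W\<close> 70) where
  "X \<otimes>\<^sub>W W = quotient (cls X W) (mapping_space (nvars W) X)"

definition base :: "(vec \<Rightarrow> 'a) \<Rightarrow> 'a" where
  "base t = t (\<lambda>_. 0)"

definition fibre :: "'a frolicher \<Rightarrow> infinitesimal \<Rightarrow> 'a \<Rightarrow> (vec \<Rightarrow> 'a) frolicher" where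
  "fibre X W x = subspace (X \<otimes>\<^sub>W W) {t. base t = x}"

text \<open>\<open>tmap Y W \<phi>\<close> is $\phi \otimes \mathrm{id}_W$ for \<open>\<phi>\<close> with values in \<open>Y\<close>;
  \<open>wcomp X W f\<close> is $\mathrm{id}_X \otimes \mathcal{W}_f$ for \<open>f\<close> defined on the object \<open>W\<close>.\<close>

definition tmap :: "'b frolicher \<Rightarrow> infinitesimal \<Rightarrow> ('a \<Rightarrow> 'b) \<Rightarrow> (vec \<Rightarrow> 'a) \<Rightarrow> (vec \<Rightarrow> 'b)" where
  "tmap Y W \<phi> t = cls Y W (\<phi> \<circ> t)"

definition wcomp :: "'a frolicher \<Rightarrow> infinitesimal \<Rightarrow> (vec \<Rightarrow> vec) \<Rightarrow> (vec \<Rightarrow> 'a) \<Rightarrow> (vec \<Rightarrow> 'a)" where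
  "wcomp X W f t = cls X W (t \<circ> f)"

definition D_pow :: "nat \<Rightarrow> infinitesimal" where
  "D_pow n = \<lparr>nvars = n, eqns = {\<lambda>d. (d i)\<^sup>2 |i. i < n}\<rparr>"

abbreviation "DD \<equiv> D_pow 1"

definition D_ord :: "nat \<Rightarrow> infinitesimal" where
  "D_ord m = \<lparr>nvars = 1, eqns = {\<lambda>d. d 0 ^ (m + 1)}\<rparr>"

definition D_jet :: "nat \<Rightarrow> nat \<Rightarrow> infinitesimal" where
  "D_jet p n = \<lparr>nvars = p,
     eqns = {\<lambda>d. \<Prod>i\<in>#K. d i |K. set_mset K \<subseteq> {..<p} \<and> size K = n + 1}\<rparr>"

definition vec2 :: "real \<Rightarrow> real \<Rightarrow> vec" where
  "vec2 a b = (\<lambda>i. if i = 0 then a else if i = 1 then b else 0)"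

definition scale :: "nat \<Rightarrow> real \<Rightarrow> vec \<Rightarrow> vec" where
  "scale i \<alpha> d = d(i := \<alpha> * d i)"

definition kappa :: "nat \<Rightarrow> vec \<Rightarrow> vec" where
  "kappa n d = (\<lambda>i. if i = n - 1 then d (n - 1) * d n else if i < n - 1 then d i else 0)"

text \<open>The canonical map from $X \otimes \mathcal{W}_{V \times W}$ to
  $(X \otimes \mathcal{W}_V) \otimes \mathcal{W}_W$ and its inverse, where \<open>U\<close> is the product of
  \<open>V\<close> and \<open>W\<close>, and \<open>j e d\<close> is the point of \<open>U\<close> with \<open>V\<close>-component \<open>d\<close> and \<open>W\<close>-component \<open>e\<close>.\<close>

definition wsplit ::
    "'a frolicher \<Rightarrow> infinitesimal \<Rightarrow> infinitesimal \<Rightarrow> (vec \<Rightarrow> vec \<Rightarrow> vec) \<Rightarrow> (vec \<Rightarrow> 'a) \<Rightarrow> (vec \<Rightarrow> vec \<Rightarrow> 'a)"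
  where "wsplit X V W j t = cls (X \<otimes>\<^sub>W V) W (\<lambda>e. wcomp X V (j e) t)"

definition wunsplit ::
    "'a frolicher \<Rightarrow> infinitesimal \<Rightarrow> infinitesimal \<Rightarrow> infinitesimal \<Rightarrow> (vec \<Rightarrow> vec \<Rightarrow> vec) \<Rightarrow>
      (vec \<Rightarrow> vec \<Rightarrow> 'a) \<Rightarrow> (vec \<Rightarrow> 'a)"
  where "wunsplit X U V W j = inv_into (pts (X \<otimes>\<^sub>W U)) (wsplit X V W j)"

text \<open>For \<open>f\<close> defined on \<open>P\<close>, a fibre product of \<open>X\<close> and \<open>Y\<close>: the element
  $(f \otimes \mathrm{id}_W)(s, t)$ of $Z \otimes W$, where the pair $(s,t)$ of
  elements of $X \otimes W$ and $Y \otimes W$ is viewed as an element of $P \otimes W$.\<close>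

definition apply_pair ::
    "'a frolicher \<Rightarrow> 'b frolicher \<Rightarrow> ('a \<times> 'b) frolicher \<Rightarrow> 'c frolicher \<Rightarrow> infinitesimal \<Rightarrow>
      ('a \<times> 'b \<Rightarrow> 'c) \<Rightarrow> (vec \<Rightarrow> 'a) \<Rightarrow> (vec \<Rightarrow> 'b) \<Rightarrow> (vec \<Rightarrow> 'c)" where
  "apply_pair X Y P Z W f s t =
     tmap Z W f (THE z. z \<in> pts (P \<otimes>\<^sub>W W) \<and> tmap X W fst z = s \<and> tmap Y W snd z = t)"

text \<open>For \<open>A\<close> a space of elements of $X \otimes \mathcal{W}_{V}$ and \<open>B\<close> one of
  elements of $Y \otimes \mathcal{W}_{V'}$, this is
  $(\phi \otimes \mathrm{id}_{\mathcal{W}_{D_m}}) \circ (\mathrm{id}_X \otimes \mathcal{W}_{\mu_i})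
   = (\mathrm{id}_Y \otimes \mathcal{W}_{\mu_j}) \circ \phi$ on \<open>A\<close>. Here
  $(\mathrm{id}_X \otimes \mathcal{W}_{\mu_i})(t)$ is written in
  $(X \otimes \mathcal{W}_V) \otimes \mathcal{W}_{D_m}$, namely as the class of
  $e \mapsto t(d_1, \dots, e d_i, \dots, d_n)$, which is a map into \<open>A\<close>.\<close>

definition mu_compatible ::
    "'a frolicher \<Rightarrow> infinitesimal \<Rightarrow> (vec \<Rightarrow> 'a) frolicher \<Rightarrow> nat \<Rightarrow>
     'b frolicher \<Rightarrow> infinitesimal \<Rightarrow> (vec \<Rightarrow> 'b) frolicher \<Rightarrow> nat \<Rightarrow>
     nat \<Rightarrow> ((vec \<Rightarrow> 'a) \<Rightarrow> (vec \<Rightarrow> 'b)) \<Rightarrow> bool" where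
  "mu_compatible X V A i Y V' B j m \<phi> \<longleftrightarrow>
    (\<forall>t\<in>pts A. tmap B (D_ord m) \<phi> (cls A (D_ord m) (\<lambda>e. wcomp X V (scale i (e 0)) t))
             = cls B (D_ord m) (\<lambda>e. wcomp Y V' (scale j (e 0)) (\<phi> t)))"


section \<open>Taylor coefficients\<close>

text \<open>The elements of $\mathbb{R}^m \otimes W$ are classes of polynomials in the monomials of a
  basis of \<open>W\<close>. A monomial is the multiset of its indices.\<close>

definition jet_basis :: "nat \<Rightarrow> nat \<Rightarrow> nat multiset set" where
  "jet_basis p n = {K. set_mset K \<subseteq> {..<p} \<and> size K \<le> n}"

definition pow_basis :: "nat \<Rightarrow> nat multiset set" where
  "pow_basis n = mset_set ` Pow {..<n}"

definition poly_elt ::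
    "nat \<Rightarrow> infinitesimal \<Rightarrow> nat multiset set \<Rightarrow> (nat multiset \<Rightarrow> vec) \<Rightarrow> (vec \<Rightarrow> vec)" where
  "poly_elt m W B a = cls (Rn m) W (\<lambda>d j. \<Sum>K\<in>B. a K j * (\<Prod>i\<in>#K. d i))"

definition coefs ::
    "nat \<Rightarrow> infinitesimal \<Rightarrow> nat multiset set \<Rightarrow> (vec \<Rightarrow> vec) \<Rightarrow> (nat multiset \<Rightarrow> vec)" where
  "coefs m W B t = (THE a. (\<forall>K. a K \<in> pts (Rn m)) \<and> (\<forall>K. K \<notin> B \<longrightarrow> a K = (\<lambda>_. 0)) \<and>
     t = poly_elt m W B a)"

abbreviation pow_coefs :: "nat \<Rightarrow> nat \<Rightarrow> (vec \<Rightarrow> vec) \<Rightarrow> (nat multiset \<Rightarrow> vec)" where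
  "pow_coefs m n \<equiv> coefs m (D_pow n) (pow_basis n)"


section \<open>The first approach: iterated jets\<close>

definition J1_fibre ::
    "'y frolicher \<Rightarrow> 'm frolicher \<Rightarrow> ('y \<Rightarrow> 'm) \<Rightarrow> 'y \<Rightarrow> ((vec \<Rightarrow> 'm) \<Rightarrow> (vec \<Rightarrow> 'y)) set" where
  "J1_fibre Y M \<rho> y = {N.
     let A = fibre M DD (\<rho> y); B = fibre Y DD y in
     N \<in> smooth_maps A B \<inter> extensional (pts A) \<and>
     (\<forall>t\<in>pts A. tmap M DD \<rho> (N t) = t) \<and>
     (\<forall>\<alpha>. \<forall>t\<in>pts A. N (wcomp M DD (scale 0 \<alpha>) t) = wcomp Y DD (scale 0 \<alpha>) (N t)) \<and>
     (\<forall>m. mu_compatible M DD A 0 Y DD B 0 m N)}"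

definition J1 ::
    "'y frolicher \<Rightarrow> 'm frolicher \<Rightarrow> ('y \<Rightarrow> 'm) \<Rightarrow> ('y \<times> ((vec \<Rightarrow> 'm) \<Rightarrow> (vec \<Rightarrow> 'y))) frolicher" where
  "J1 Y M \<rho> = (let J = (SIGMA y:pts Y. J1_fibre Y M \<rho> y) in
     \<lparr>pts = J,
      curves = {c. range c \<subseteq> J \<and> fst \<circ> c \<in> curves Y \<and>
        (\<forall>g t. smooth_fun g \<longrightarrow> t \<in> curves (M \<otimes>\<^sub>W DD) \<longrightarrow>
           (\<forall>r. base (t r) = \<rho> (fst (c (g r)))) \<longrightarrow>
           (\<lambda>r. snd (c (g r)) (t r)) \<in> curves (Y \<otimes>\<^sub>W DD))}\<rparr>)"

text \<open>A common type for the points of all $\mathbf{J}^n(\pi)$: \<open>Nab x N\<close> is the element $\nabla$ of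
  $\mathbf{J}^1_x(\pi_n)$.\<close>

datatype jtower =
    Pt (unPt: vec)
  | Nab (under: jtower) (conn: "(vec \<Rightarrow> vec) \<Rightarrow> (vec \<Rightarrow> jtower)")

primrec jbase :: "jtower \<Rightarrow> vec" where
  "jbase (Pt e) = e"
| "jbase (Nab x N) = jbase x"

definition jproj :: "nat \<Rightarrow> jtower \<Rightarrow> vec" where
  "jproj p z = trunc p (jbase z)"

text \<open>The map \<open>P\<close>, where \<open>X'\<close> is $\mathbf{J}^n(\pi)$ and \<open>X\<close> is $\mathbf{J}^{n-1}(\pi)$.\<close>

definition iterate_conn ::
    "nat \<Rightarrow> jtower frolicher \<Rightarrow> jtower frolicher \<Rightarrow> ((vec \<Rightarrow> vec) \<Rightarrow> (vec \<Rightarrow> jtower)) \<Rightarrow>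
      (vec \<Rightarrow> vec) \<Rightarrow> (vec \<Rightarrow> jtower)" where
  "iterate_conn p X X' N \<gamma> = (let M = Rn p; pair = (\<lambda>e d. vec2 (e 0) (d 0)) in
     wunsplit X (D_pow 2) DD DD pair
       (apply_pair X' (M \<otimes>\<^sub>W DD) (fibre_product X' (M \<otimes>\<^sub>W DD) (jproj p) base) (X \<otimes>\<^sub>W DD) DD
          (\<lambda>(x', t). conn x' t)
          (N (wcomp M DD (\<lambda>d. vec2 (d 0) 0) \<gamma>))
          (wsplit M DD DD pair \<gamma>)))"

definition holonomic ::
    "nat \<Rightarrow> jtower frolicher \<Rightarrow> jtower frolicher \<Rightarrow> (jtower \<times> ((vec \<Rightarrow> vec) \<Rightarrow> (vec \<Rightarrow> jtower))) set" where
  "holonomic p X X' = {(x, N).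
     (\<forall>t\<in>pts (fibre (Rn p) DD (jproj p x)). tmap X DD under (N t) = conn x t) \<and>
     (\<forall>\<gamma>\<in>pts (fibre (Rn p) (D_pow 2) (jproj p x)).
        let \<tau> = (\<lambda>d. vec2 (d 1) (d 0)) in
        iterate_conn p X X' N \<gamma> =
          wcomp X (D_pow 2) \<tau> (iterate_conn p X X' N (wcomp (Rn p) (D_pow 2) \<tau> \<gamma>)))}"

fun jet_tower :: "nat \<Rightarrow> nat \<Rightarrow> nat \<Rightarrow> jtower frolicher" where
  "jet_tower p q 0 = transport Pt (Rn (p + q))"
| "jet_tower p q (Suc 0) =
     transport (\<lambda>(x, N). Nab x N) (J1 (jet_tower p q 0) (Rn p) (jproj p))"
| "jet_tower p q (Suc (Suc k)) =
     transport (\<lambda>(x, N). Nab x N)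
       (subspace (J1 (jet_tower p q (Suc k)) (Rn p) (jproj p))
          (holonomic p (jet_tower p q k) (jet_tower p q (Suc k))))"


section \<open>The second approach: tangentials\<close>

text \<open>A (pseudo)tangential is recorded together with its base point.\<close>

type_synonym tangential = "vec \<times> ((vec \<Rightarrow> vec) \<Rightarrow> (vec \<Rightarrow> vec))"

definition pseudotangentials :: "nat \<Rightarrow> nat \<Rightarrow> nat \<Rightarrow> tangential set" where
  "pseudotangentials p q n = {(x, N).
     let M = Rn p; E = Rn (p + q); A = fibre M (D_pow n) (trunc p x); B = fibre E (D_pow n) x in
     x \<in> pts E \<and> N \<in> smooth_maps A B \<inter> extensional (pts A) \<and>
     (\<forall>\<gamma>\<in>pts A. tmap M (D_pow n) (trunc p) (N \<gamma>) = \<gamma>) \<and>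
     (\<forall>\<alpha>. \<forall>i<n. \<forall>\<gamma>\<in>pts A.
        N (wcomp M (D_pow n) (scale i \<alpha>) \<gamma>) = wcomp E (D_pow n) (scale i \<alpha>) (N \<gamma>)) \<and>
     (\<forall>m\<ge>1. \<forall>i<n. mu_compatible M (D_pow n) A i E (D_pow n) B i m N) \<and>
     (\<forall>\<sigma>. \<sigma> permutes {..<n} \<longrightarrow> (\<forall>\<gamma>\<in>pts A.
        N (wcomp M (D_pow n) (\<lambda>d. d \<circ> \<sigma>) \<gamma>) = wcomp E (D_pow n) (\<lambda>d. d \<circ> \<sigma>) (N \<gamma>)))}"

text \<open>The map $\hat\pi_{n+1,n}$; the inclusion $(d_1,\dots,d_n) \mapsto (d_1,\dots,d_n,0)$ is the
  identity on sequences.\<close>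

definition pi_hat :: "nat \<Rightarrow> nat \<Rightarrow> nat \<Rightarrow> tangential \<Rightarrow> tangential" where
  "pi_hat p q n = (\<lambda>(x, N). (x, \<lambda>\<gamma>\<in>pts (fibre (Rn p) (D_pow n) (trunc p x)).
     wcomp (Rn (p + q)) (D_pow n) (\<lambda>d. d) (N (wcomp (Rn p) (D_pow (n + 1)) (trunc n) \<gamma>))))"

text \<open>The set $\mathbb{J}^{D^n}(\pi)$, for \<open>n \<ge> 1\<close>.\<close>

fun tangentials :: "nat \<Rightarrow> nat \<Rightarrow> nat \<Rightarrow> tangential set" where
  "tangentials p q (Suc 0) = pseudotangentials p q 1"
| "tangentials p q (Suc (Suc k)) = {(x, N) \<in> pseudotangentials p q (k + 2).
     pi_hat p q (k + 1) (x, N) \<in> tangentials p q (Suc k) \<and>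
     (\<forall>\<gamma>\<in>pts (fibre (Rn p) (D_pow (k + 1)) (trunc p x)).
        N (wcomp (Rn p) (D_pow (k + 2)) (kappa (k + 1)) \<gamma>) =
        wcomp (Rn (p + q)) (D_pow (k + 2)) (kappa (k + 1)) (snd (pi_hat p q (k + 1) (x, N)) \<gamma>))}"

definition tangential_proj :: "nat \<Rightarrow> nat \<Rightarrow> nat \<Rightarrow> tangential \<Rightarrow> tangential" where
  "tangential_proj p q n = restrict (pi_hat p q n) (tangentials p q (n + 1))"

text \<open>The map $\varphi_n$, for \<open>n \<ge> 1\<close>.\<close>

fun phi :: "nat \<Rightarrow> nat \<Rightarrow> nat \<Rightarrow> jtower \<Rightarrow> tangential" where
  "phi p q (Suc 0) z =
     (jbase z, \<lambda>\<gamma>\<in>pts (fibre (Rn p) DD (jproj p z)). tmap (Rn (p + q)) DD unPt (conn z \<gamma>))"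
| "phi p q (Suc (Suc k)) z =
     (let n = Suc k; M = Rn p; E = Rn (p + q); J = jet_tower p q n; T = M \<otimes>\<^sub>W D_pow n;
          append = (\<lambda>e d. d(n := e 0))
      in (jbase z, \<lambda>\<gamma>\<in>pts (fibre M (D_pow (n + 1)) (jproj p z)).
            wunsplit E (D_pow (n + 1)) (D_pow n) DD append
              (apply_pair J T (fibre_product J T (jproj p) base) (E \<otimes>\<^sub>W D_pow n) DD
                 (\<lambda>(z', \<gamma>'). snd (phi p q (Suc k) z') \<gamma>')
                 (conn z (wcomp M DD (\<lambda>d i. if i = n then d 0 else 0) \<gamma>))
                 (wsplit M (D_pow n) DD append \<gamma>))))"


section \<open>Symmetric forms and differences\<close>

definition vertical :: "nat \<Rightarrow> nat \<Rightarrow> vec \<Rightarrow> (vec \<Rightarrow> vec) frolicher" where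
  "vertical p q x = subspace (fibre (Rn (p + q)) DD x)
     {t. tmap (Rn p) DD (trunc p) t = cls (Rn p) DD (\<lambda>_. trunc p x)}"

definition symmetric_forms :: "nat \<Rightarrow> nat \<Rightarrow> nat \<Rightarrow> tangential set" where
  "symmetric_forms p q n = {(x, \<omega>).
     let M = Rn p; E = Rn (p + q); A = fibre M (D_pow n) (trunc p x); B = vertical p q x in
     x \<in> pts E \<and> \<omega> \<in> smooth_maps A B \<inter> extensional (pts A) \<and>
     (\<forall>\<alpha>. \<forall>i<n. \<forall>\<gamma>\<in>pts A.
        \<omega> (wcomp M (D_pow n) (scale i \<alpha>) \<gamma>) = wcomp E DD (scale 0 \<alpha>) (\<omega> \<gamma>)) \<and>
     (\<forall>m\<ge>1. \<forall>i<n. mu_compatible M (D_pow n) A i E DD B 0 m \<omega>) \<and>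
     (\<forall>\<sigma>. \<sigma> permutes {..<n} \<longrightarrow> (\<forall>\<gamma>\<in>pts A. \<omega> (wcomp M (D_pow n) (\<lambda>d. d \<circ> \<sigma>) \<gamma>) = \<omega> \<gamma>)) \<and>
     (n \<ge> 2 \<longrightarrow> (\<forall>\<gamma>\<in>pts (fibre M (D_pow (n - 1)) (trunc p x)).
        \<omega> (wcomp M (D_pow n) (kappa (n - 1)) \<gamma>) = cls E DD (\<lambda>_. x)))}"

text \<open>The difference of \<open>\<gamma>\<close> and \<open>\<gamma>'\<close> in $\mathbb{R}^m \otimes \mathcal{W}_{D^n}$ agreeing where
  $d_1 \cdots d_n = 0$, and the difference of two tangentials with the same projection.\<close>

definition elt_diff :: "nat \<Rightarrow> nat \<Rightarrow> (vec \<Rightarrow> vec) \<Rightarrow> (vec \<Rightarrow> vec) \<Rightarrow> (vec \<Rightarrow> vec)" where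
  "elt_diff m n \<gamma> \<gamma>' = (let top = mset_set {..<n} in
     cls (Rn m) DD (\<lambda>\<delta> j. base \<gamma> j + \<delta> 0 * (pow_coefs m n \<gamma> top j - pow_coefs m n \<gamma>' top j)))"

definition tangential_diff :: "nat \<Rightarrow> nat \<Rightarrow> nat \<Rightarrow> tangential \<Rightarrow> tangential \<Rightarrow> tangential" where
  "tangential_diff p q n S S' = (fst S,
     \<lambda>\<gamma>\<in>pts (fibre (Rn p) (D_pow n) (trunc p (fst S))). elt_diff (p + q) n (snd S \<gamma>) (snd S' \<gamma>))"


section \<open>Coordinate jets\<close>

definition coord_jets :: "nat \<Rightarrow> nat \<Rightarrow> nat \<Rightarrow> (vec \<Rightarrow> vec) set" where
  "coord_jets p q n = {\<gamma> \<in> pts (Rn (p + q) \<otimes>\<^sub>W D_jet p n).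
     \<exists>x\<in>pts (Rn p). tmap (Rn p) (D_jet p n) (trunc p) \<gamma> = cls (Rn p) (D_jet p n) (\<lambda>_. x)}"

text \<open>\<open>jet_u p q n \<gamma> j {#i\<^sub>1, \<dots>, i\<^sub>r#}\<close> is the coordinate $u^j_{i_1,\dots,i_r}$ of \<open>\<gamma>\<close>, the
  coefficient of $d_{i_1} \cdots d_{i_r}$ in component \<open>p + j\<close>; for the empty multiset it is $u^j$.\<close>

definition jet_coefs :: "nat \<Rightarrow> nat \<Rightarrow> nat \<Rightarrow> (vec \<Rightarrow> vec) \<Rightarrow> (nat multiset \<Rightarrow> vec)" where
  "jet_coefs p q n = coefs (p + q) (D_jet p n) (jet_basis p n)"

definition jet_x :: "nat \<Rightarrow> nat \<Rightarrow> nat \<Rightarrow> (vec \<Rightarrow> vec) \<Rightarrow> vec" where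
  "jet_x p q n \<gamma> = trunc p (jet_coefs p q n \<gamma> {#})"

definition jet_u :: "nat \<Rightarrow> nat \<Rightarrow> nat \<Rightarrow> (vec \<Rightarrow> vec) \<Rightarrow> nat \<Rightarrow> nat multiset \<Rightarrow> real" where
  "jet_u p q n \<gamma> j K = jet_coefs p q n \<gamma> K (p + j)"

definition coord_jet_proj :: "nat \<Rightarrow> nat \<Rightarrow> nat \<Rightarrow> (vec \<Rightarrow> vec) \<Rightarrow> (vec \<Rightarrow> vec)" where
  "coord_jet_proj p q n \<gamma> = poly_elt (p + q) (D_jet p n) (jet_basis p n)
     (\<lambda>K. if size K \<le> n then jet_coefs p q (n + 1) \<gamma> K else (\<lambda>_. 0))"

text \<open>Elements $(x^i, u^j, u^j_{i_1,\dots,i_n})$ of $\mathcal{S}^n(\pi)$; the indices of the last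
  component form a multiset of size \<open>n\<close>.\<close>

type_synonym symbol = "vec \<times> vec \<times> (nat \<Rightarrow> nat multiset \<Rightarrow> real)"

definition coord_jet_diff :: "nat \<Rightarrow> nat \<Rightarrow> nat \<Rightarrow> (vec \<Rightarrow> vec) \<Rightarrow> (vec \<Rightarrow> vec) \<Rightarrow> symbol" where
  "coord_jet_diff p q n \<gamma> \<gamma>' = (jet_x p q n \<gamma>, (\<lambda>j. jet_u p q n \<gamma> j {#}),
     (\<lambda>j K. if size K = n then jet_u p q n \<gamma> j K - jet_u p q n \<gamma>' j K else 0))"


section \<open>The maps from coordinate jets\<close>

text \<open>The point $(x^i, u^j)$ of $\mathbb{R}^{p+q}$.\<close>

definition join :: "nat \<Rightarrow> nat \<Rightarrow> vec \<Rightarrow> vec \<Rightarrow> vec" where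
  "join p q x u = (\<lambda>i. if i < p then x i else if i < p + q then u (i - p) else 0)"

text \<open>\<open>theta p q n x u\<close> only depends on \<open>u j K\<close> for \<open>size K \<le> n\<close>. In the recursion
  $u^j_{i_1,\dots,i_r}$ moves in the direction $\sum_i u^j_{i_1,\dots,i_r,i}\, y^i$; as
  $\mathbf{J}^0(\pi) = E$, the case \<open>n = 1\<close> is an instance of it.\<close>

fun theta :: "nat \<Rightarrow> nat \<Rightarrow> nat \<Rightarrow> vec \<Rightarrow> (nat \<Rightarrow> nat multiset \<Rightarrow> real) \<Rightarrow> jtower" where
  "theta p q 0 x u = Pt (join p q x (\<lambda>j. u j {#}))"
| "theta p q (Suc n) x u = Nab (theta p q n x u)
     (\<lambda>t\<in>pts (fibre (Rn p) DD x).
        let y = pow_coefs p 1 t {#0#} in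
        cls (jet_tower p q n) DD (\<lambda>\<delta>.
          theta p q n (\<lambda>i. x i + y i * \<delta> 0)
            (\<lambda>j K. u j K + (\<Sum>i<p. u j (add_mset i K) * y i) * \<delta> 0)))"

definition theta_J :: "nat \<Rightarrow> nat \<Rightarrow> nat \<Rightarrow> (vec \<Rightarrow> vec) \<Rightarrow> jtower" where
  "theta_J p q n \<gamma> = theta p q n (jet_x p q n \<gamma>) (jet_u p q n \<gamma>)"

definition theta_JD :: "nat \<Rightarrow> nat \<Rightarrow> nat \<Rightarrow> (vec \<Rightarrow> vec) \<Rightarrow> tangential" where
  "theta_JD p q n \<gamma> = phi p q n (theta_J p q n \<gamma>)"

text \<open>The sum is over all index tuples $(i_1,\dots,i_n)$, the coefficients being extended
  symmetrically. The sum over $i_1 \le \dots \le i_n$ alone is not invariant under permutations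
  of the $y_k$, so it would not define an element of $\mathbb{S}^{D^n}(\pi)$.\<close>

definition theta_SD :: "nat \<Rightarrow> nat \<Rightarrow> nat \<Rightarrow> symbol \<Rightarrow> tangential" where
  "theta_SD p q n = (\<lambda>(x, u, w). (join p q x u,
     \<lambda>\<gamma>\<in>pts (fibre (Rn p) (D_pow n) x).
       let y = (\<lambda>k. pow_coefs p n \<gamma> {#k#}) in
       cls (Rn (p + q)) DD (\<lambda>\<delta>. join p q x (\<lambda>j. u j + \<delta> 0 *
         (\<Sum>f\<in>{..<n} \<rightarrow>\<^sub>E {..<p}. (\<Prod>k<n. y k (f k)) * w j (image_mset f (mset_set {..<n})))))))"

end

theory Submission
  imports "HOL-Analysis.Analysis" Defs
begin

text \<open>A coordinate jet with coordinates $(x, u)$ is the jet at $x$ of a polynomial section $s$ of $\pi$. Its image in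
  $\mathbf{J}^n(\pi)$ is the iterated jet of $s$, and induction on $n$ shows that \<open>\<phi>\<^sub>n\<close> turns it into the
  tangential $\gamma \mapsto s \circ \gamma$. For such a map all conditions on tangentials are instances of functoriality, and
  its projection is again $\gamma \mapsto s \circ \gamma$, one order lower. Applied to
  $(d_1, \dots, d_r) \mapsto x + \sum_k d_k e_{i_k}$ it yields the derivatives of $s$ of order $r$, whence the equivalence.
  If two jets agree up to order $n$, their sections differ by a homogeneous polynomial of degree $n + 1$. Its coefficient of
  $d_1 \cdots d_{n+1}$ along $\gamma$ depends only on the linear part of $\gamma$, and is the value of the symmetric form.

  The induction on $n$ requires that $\mathbf{J}^n(\pi)$ is a coordinate space: the elements of
  $\mathbf{J}^1$ are linear, being smooth and homogeneous, and holonomy makes their coefficients symmetric.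

  Smoothness being tested on curves only, Taylor expansion modulo an ideal rests on the fact that the quotient in
  $f(x) = f(0) + x\,g(x)$ is smooth in $x$ and the other variables. This is derived as in Boman's theorem,
  from smooth curves through rapidly converging sequences of points.\<close>

section \<open>Smooth functions of one and two variables\<close>

text \<open>Membership in an ideal asks for coefficients that are smooth along curves, so a Taylor
  expansion counts only if its remainder has such coefficients. The quotients must also be smooth in
  parameters, because curves in a prolongation are families of maps. The second obstacle is the
  encoding: a class is a chosen representative about whose values nothing is known beyond its
  equivalence, \<open>wunsplit\<close> is an inverse function, and \<open>apply_pair\<close> is a
  definite description. They can be computed where injectivity and uniqueness are known and the
  evaluation maps are smooth. For this purpose every space that occurs is shown to be isomorphic to
  some R^I, a property inherited by prolongations and fibre products; elements are then compared by
  finitely many Taylor coefficients. A section is carried along with all its iterated partial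
  derivatives, so that the direction prescribed by the recursion for \<open>theta\<close> is the
  chain rule.\<close>

text \<open>Iterating a choice of derivatives inside the class produces the whole tower that
  \<open>smooth_fun\<close> asks for. Smoothness proofs therefore look for a class of functions
  closed under differentiation.\<close>

lemma smooth_coinduct:
  assumes "P c" and step: "\<And>f. P f \<Longrightarrow> \<exists>f'. P f' \<and> (\<forall>x. (f has_real_derivative f' x) (at x))"
  shows "smooth_fun c"
proof -
  obtain F where F: "\<And>f. P f \<Longrightarrow> P (F f) \<and> (\<forall>x. (f has_real_derivative F f x) (at x))"
    using step by metis
  define D where "D k = (F ^^ k) c" for k
  have "P (D k)" for k
    by (induction k) (auto simp: D_def assms(1) F)
  then have "(D k has_real_derivative D (Suc k) x) (at x)" for k x
    using F by (simp add: D_def)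
  moreover have "D 0 = c" by (simp add: D_def)
  ultimately show ?thesis unfolding smooth_fun_def by blast
qed

lemma smooth_fun_deriv:
  assumes "smooth_fun f"
  shows "(f has_real_derivative deriv f x) (at x)" "smooth_fun (deriv f)"
proof -
  obtain D where D: "D 0 = f" "\<And>k x. (D k has_real_derivative D (Suc k) x) (at x)"
    using assms unfolding smooth_fun_def by blast
  have d: "deriv f x = D 1 x" for x
    using DERIV_imp_deriv[OF D(2)[of 0 x]] by (simp add: D(1))
  show "(f has_real_derivative deriv f x) (at x)"
    using D(2)[of 0 x] D(1) d by simp
  have "deriv f = D 1" using d by auto
  then show "smooth_fun (deriv f)"
    unfolding smooth_fun_def using D(2) by (intro exI[of _ "\<lambda>k. D (Suc k)"]) simp
qed

text \<open>The derivative of a product or a composite mixes all operations, so no single operation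
  gives a class closed under differentiation. The algebra generated by all of them is closed, and
  one coinduction settles all the closure rules.\<close>

inductive smooth_alg :: "(real \<Rightarrow> real) \<Rightarrow> bool" where
  base: "smooth_fun f \<Longrightarrow> smooth_alg f"
| add: "smooth_alg f \<Longrightarrow> smooth_alg g \<Longrightarrow> smooth_alg (\<lambda>x. f x + g x)"
| mult: "smooth_alg f \<Longrightarrow> smooth_alg g \<Longrightarrow> smooth_alg (\<lambda>x. f x * g x)"
| comp: "smooth_fun f \<Longrightarrow> smooth_alg g \<Longrightarrow> smooth_alg (\<lambda>x. f (g x))"
| inv: "smooth_alg f \<Longrightarrow> (\<And>x. f x \<noteq> 0) \<Longrightarrow> smooth_alg (\<lambda>x. inverse (f x))"

lemma smooth_const [simp, intro]: "smooth_fun (\<lambda>x. c)"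
  unfolding smooth_fun_def
  by (intro exI[of _ "\<lambda>k x. if k = 0 then c else 0"]) auto

lemma smooth_id [simp, intro]: "smooth_fun (\<lambda>x. x)"
  unfolding smooth_fun_def
  by (intro exI[of _ "\<lambda>k x. if k = 0 then x else if k = 1 then 1 else 0"]) auto

lemma smooth_alg_imp_smooth: "smooth_alg f \<Longrightarrow> smooth_fun f"
proof (erule smooth_coinduct)
  fix f assume "smooth_alg f"
  then show "\<exists>f'. smooth_alg f' \<and> (\<forall>x. (f has_real_derivative f' x) (at x))"
  proof induction
    case (base f)
    then show ?case using smooth_fun_deriv smooth_alg.base by blast
  next
    case (add f g)
    then obtain f' g' where "smooth_alg f'" "smooth_alg g'"
      "\<And>x. (f has_real_derivative f' x) (at x)" "\<And>x. (g has_real_derivative g' x) (at x)" by blast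
    then show ?case
      by (intro exI[of _ "\<lambda>x. f' x + g' x"] conjI allI smooth_alg.add DERIV_add)
  next
    case (mult f g)
    then obtain f' g' where *: "smooth_alg f'" "smooth_alg g'"
      "\<And>x. (f has_real_derivative f' x) (at x)" "\<And>x. (g has_real_derivative g' x) (at x)" by blast
    have "((\<lambda>x. f x * g x) has_real_derivative f' x * g x + g' x * f x) (at x)" for x
      using *(3,4) DERIV_mult by blast
    then show ?case
      using * mult.hyps by (intro exI[of _ "\<lambda>x. f' x * g x + g' x * f x"] conjI allI smooth_alg.add smooth_alg.mult) auto
  next
    case (comp f g)
    then obtain g' where *: "smooth_alg g'" "\<And>x. (g has_real_derivative g' x) (at x)" by blast
    have "((\<lambda>x. f (g x)) has_real_derivative deriv f (g x) * g' x) (at x)" for x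
      using DERIV_chain2[OF smooth_fun_deriv(1)[OF comp.hyps(1)] *(2)] .
    then show ?case
      using smooth_alg.mult[OF smooth_alg.comp[OF smooth_fun_deriv(2)[OF comp.hyps(1)] comp.hyps(2)] *(1)]
      by blast
  next
    case (inv f)
    then obtain f' where *: "smooth_alg f'" "\<And>x. (f has_real_derivative f' x) (at x)" by blast
    have "((\<lambda>x. inverse (f x)) has_real_derivative ((- 1) * f' x) * (inverse (f x) * inverse (f x))) (at x)" for x
      using DERIV_inverse_fun[OF *(2) inv.hyps(2), of x] by (simp add: algebra_simps)
    then show ?case
      using * inv.hyps
      by (intro exI[of _ "\<lambda>x. ((- 1) * f' x) * (inverse (f x) * inverse (f x))"] conjI allI smooth_alg.mult
          smooth_alg.inv smooth_alg.base[OF smooth_const]) auto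
  qed
qed

lemma smooth_add [intro]: "smooth_fun f \<Longrightarrow> smooth_fun g \<Longrightarrow> smooth_fun (\<lambda>x. f x + g x)"
  by (rule smooth_alg_imp_smooth, rule smooth_alg.add) (auto intro: smooth_alg.base)

lemma smooth_mult [intro]: "smooth_fun f \<Longrightarrow> smooth_fun g \<Longrightarrow> smooth_fun (\<lambda>x. f x * g x)"
  by (rule smooth_alg_imp_smooth, rule smooth_alg.mult) (auto intro: smooth_alg.base)

lemma smooth_compose: "smooth_fun f \<Longrightarrow> smooth_fun g \<Longrightarrow> smooth_fun (\<lambda>x. f (g x))"
  by (rule smooth_alg_imp_smooth, rule smooth_alg.comp) (auto intro: smooth_alg.base)

lemma smooth_inverse: "smooth_fun f \<Longrightarrow> (\<And>x. f x \<noteq> 0) \<Longrightarrow> smooth_fun (\<lambda>x. inverse (f x))"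
  by (rule smooth_alg_imp_smooth, rule smooth_alg.inv) (auto intro: smooth_alg.base)

lemma smooth_minus [intro]: "smooth_fun f \<Longrightarrow> smooth_fun (\<lambda>x. - f x)"
  using smooth_mult[OF smooth_const[of "-1"], of f] by simp

lemma smooth_diff [intro]: "smooth_fun f \<Longrightarrow> smooth_fun g \<Longrightarrow> smooth_fun (\<lambda>x. f x - g x)"
  using smooth_add[OF _ smooth_minus, of f g] by simp

lemma smooth_power [intro]: "smooth_fun f \<Longrightarrow> smooth_fun (\<lambda>x. f x ^ n)"
  by (induction n) (simp_all add: smooth_mult)

lemma smooth_sum [intro]: "(\<And>i. i \<in> A \<Longrightarrow> smooth_fun (f i)) \<Longrightarrow> smooth_fun (\<lambda>x. \<Sum>i\<in>A. f i x)"
  by (induction A rule: infinite_finite_induct) (simp_all add: smooth_add)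

lemma smooth_fun_cont: "smooth_fun f \<Longrightarrow> isCont f x"
  using smooth_fun_deriv(1) DERIV_isCont by blast

lemma smooth_higher: "smooth_fun f \<Longrightarrow> smooth_fun ((deriv ^^ k) f)"
  by (induction k) (simp_all add: smooth_fun_deriv)

lemma smooth_higher_deriv:
  "smooth_fun f \<Longrightarrow> ((deriv ^^ k) f has_real_derivative (deriv ^^ Suc k) f x) (at x)"
  using smooth_fun_deriv(1)[OF smooth_higher] by simp

section \<open>A flat function and a smooth cutoff\<close>

text \<open>The polynomial makes the class of these functions closed under differentiation.\<close>

definition flat :: "real poly \<Rightarrow> real \<Rightarrow> real" where
  "flat p x = (if x > 0 then poly p (1 / x) * exp (- (1 / x)) else 0)"

lemma poly_exp_tendsto_0: "((\<lambda>y. poly p y * exp (- y)) \<longlongrightarrow> (0::real)) at_top"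
proof -
  have "(\<lambda>y. poly p y * exp (- y)) = (\<lambda>y. \<Sum>i\<le>degree p. coeff p i * (y ^ i / exp y))"
    by (simp add: poly_altdef exp_minus sum_distrib_right divide_inverse mult.assoc)
  moreover have "((\<lambda>y. \<Sum>i\<le>degree p. coeff p i * (y ^ i / exp y)) \<longlongrightarrow> 0) at_top"
    by (intro tendsto_null_sum tendsto_mult_right_zero tendsto_power_div_exp_0)
  ultimately show ?thesis by simp
qed

lemma flat_has_derivative: "\<exists>q. \<forall>x. (flat p has_real_derivative flat q x) (at x)"
proof (intro exI allI)
  \<comment> \<open>Differentiating p(1/x) exp(-1/x) gives (p(1/x) - p'(1/x)) exp(-1/x) / x^2; the
    factor 1/x^2 is the polynomial X^2 at 1/x.\<close>
  let ?q = "[:0, 0, 1:] * (p - pderiv p)"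
  fix x :: real
  consider "x < 0" | "x = 0" | "x > 0" by linarith
  then show "(flat p has_real_derivative flat ?q x) (at x)"
  proof cases
    case 1
    have "((\<lambda>_. 0) has_real_derivative 0) (at x)" by simp
    moreover have "\<forall>\<^sub>F y in nhds x. flat p y = 0"
      using eventually_nhds_in_open[of "{..<0}" x] 1
      by (auto simp: flat_def elim!: eventually_mono)
    ultimately have "(flat p has_real_derivative 0) (at x)"
      by (subst DERIV_cong_ev[OF refl _ refl, of _ "\<lambda>_. 0"]) auto
    then show ?thesis using 1 by (simp add: flat_def)
  next
    case 3
    have "((\<lambda>y. poly p (1 / y) * exp (- (1 / y))) has_real_derivative
        (poly (pderiv p) (1 / x) * (- (1 / x^2))) * exp (- (1 / x)) +
        (exp (- (1 / x)) * (1 / x^2)) * poly p (1 / x)) (at x)"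
    proof (rule DERIV_mult)
      have "((\<lambda>y. 1 / y) has_real_derivative - (1 / x^2)) (at x)"
        using 3 by (auto intro!: derivative_eq_intros simp: power2_eq_square)
      from DERIV_chain2[OF poly_DERIV this]
      show "((\<lambda>x. poly p (1 / x)) has_real_derivative poly (pderiv p) (1 / x) * - (1 / x\<^sup>2)) (at x)" .
      show "((\<lambda>x. exp (- (1 / x))) has_real_derivative exp (- (1 / x)) * (1 / x\<^sup>2)) (at x)"
        using 3 by (auto intro!: derivative_eq_intros simp: power2_eq_square)
    qed
    moreover have "(poly (pderiv p) (1 / x) * (- (1 / x^2))) * exp (- (1 / x)) +
        (exp (- (1 / x)) * (1 / x^2)) * poly p (1 / x) = flat ?q x"
      using 3 by (simp add: flat_def power2_eq_square algebra_simps)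
    moreover have "\<forall>\<^sub>F y in nhds x. flat p y = poly p (1 / y) * exp (- (1 / y))"
      using eventually_nhds_in_open[of "{0<..}" x] 3
      by (auto simp: flat_def elim!: eventually_mono)
    ultimately show ?thesis
      by (subst DERIV_cong_ev[OF refl _ refl, of _ "\<lambda>y. poly p (1 / y) * exp (- (1 / y))"]) auto
  next
    case 2
    have "((\<lambda>y. flat p y / y) \<longlongrightarrow> 0) (at_right 0)"
    proof -
      \<comment> \<open>The difference quotient at 0 is again of the flat form, with polynomial X p,
        so the decay of the exponential makes it tend to 0.\<close>
      have "((\<lambda>y. poly ([:0, 1:] * p) (inverse y) * exp (- inverse y)) \<longlongrightarrow> 0) (at_right (0::real))"
        using filterlim_compose[OF poly_exp_tendsto_0 filterlim_inverse_at_top_right] .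
      moreover have "\<forall>\<^sub>F y in at_right 0. poly ([:0, 1:] * p) (inverse y) * exp (- inverse y) = flat p y / y"
        using eventually_at_right_less[of "0::real"]
        by eventually_elim (auto simp: flat_def divide_inverse)
      ultimately show ?thesis using Lim_transform_eventually by fast
    qed
    moreover have "((\<lambda>y. flat p y / y) \<longlongrightarrow> 0) (at_left 0)"
    proof (rule tendsto_eventually)
      show "\<forall>\<^sub>F y in at_left 0. flat p y / y = 0"
        using eventually_at_leftI[of "-1" "0::real"] by (auto simp: flat_def)
    qed
    ultimately have "((\<lambda>y. flat p y / y) \<longlongrightarrow> 0) (at 0)"
      using filterlim_split_at by blast
    then have "(flat p has_real_derivative 0) (at 0)"
      by (simp add: has_field_derivative_iff flat_def)
    then show ?thesis using 2 by (simp add: flat_def)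
  qed
qed

lemma smooth_flat: "smooth_fun (flat p)"
  by (rule smooth_coinduct[where P = "\<lambda>f. \<exists>p. f = flat p"]) (metis flat_has_derivative)+

text \<open>The usual quotient f(a) / (f(a) + f(b)) with f(x) = exp(-1/x) for x > 0. The arguments a
  = 2 - x^2 and b = x^2 - 1 add up to 1, so one of them is positive and the denominator never
  vanishes.\<close>

definition cutoff :: "real \<Rightarrow> real" where
  "cutoff x = flat 1 (2 - x\<^sup>2) / (flat 1 (2 - x\<^sup>2) + flat 1 (x\<^sup>2 - 1))"

lemma smooth_cutoff: "smooth_fun cutoff"
proof -
  have "flat 1 (2 - x\<^sup>2) + flat 1 (x\<^sup>2 - 1) \<noteq> 0" for x
  proof -
    have "2 - x\<^sup>2 > 0 \<or> x\<^sup>2 - 1 > 0" by linarith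
    then have "flat 1 (2 - x\<^sup>2) + flat 1 (x\<^sup>2 - 1) > 0"
      by (auto simp: flat_def add_pos_nonneg add_nonneg_pos)
    then show ?thesis by simp
  qed
  then show ?thesis
    unfolding cutoff_def [abs_def] divide_inverse
    by (intro smooth_mult smooth_inverse smooth_add smooth_compose[OF smooth_flat] smooth_diff
        smooth_power smooth_const smooth_id) auto
qed

lemma cutoff_near: "\<bar>x\<bar> \<le> 1 \<Longrightarrow> cutoff x = 1"
proof -
  assume "\<bar>x\<bar> \<le> 1"
  then have "x\<^sup>2 \<le> 1" using abs_square_le_1 by blast
  then show "cutoff x = 1" by (simp add: cutoff_def flat_def)
qed

lemma cutoff_far: "\<bar>x\<bar> \<ge> 2 \<Longrightarrow> cutoff x = 0"
proof -
  assume "\<bar>x\<bar> \<ge> 2"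
  then have "x\<^sup>2 \<ge> 2\<^sup>2" using abs_le_square_iff[of 2 x] by simp
  then show "cutoff x = 0" by (simp add: cutoff_def flat_def)
qed

lemma bounded_compact_support:
  assumes "smooth_fun \<psi>" "\<And>x. \<bar>x\<bar> > 2 \<Longrightarrow> \<psi> x = 0"
  obtains C where "\<And>x. \<bar>\<psi> x\<bar> \<le> C"
proof -
  have "compact (\<psi> ` {-2..2})"
    using assms(1) by (intro compact_continuous_image continuous_at_imp_continuous_on) (auto simp: smooth_fun_cont)
  then have "bounded (\<psi> ` {-2..2})" by (rule compact_imp_bounded)
  then obtain C where C: "\<And>x. x \<in> {-2..2} \<Longrightarrow> \<bar>\<psi> x\<bar> \<le> C"
    unfolding bounded_iff by (metis image_eqI real_norm_def)
  have "\<bar>\<psi> x\<bar> \<le> max C 0" for x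
  proof (cases "\<bar>x\<bar> > 2")
    case True
    then show ?thesis using assms(2)[of x] by simp
  next
    case False
    then have "x \<in> {-2..2}" by auto
    then show ?thesis using C[of x] by linarith
  qed
  then show thesis using that by blast
qed

lemma deriv_compact_support:
  assumes "\<And>x. \<bar>x\<bar> > 2 \<Longrightarrow> \<psi> x = (0::real)" "\<bar>x\<bar> > 2"
  shows "deriv \<psi> x = 0"
proof -
  have "open {x::real. \<bar>x\<bar> > 2}"
    by (intro open_Collect_less continuous_intros)
  then have "eventually (\<lambda>y. \<psi> y = 0) (nhds x)"
    using eventually_nhds_in_open[of "{x::real. \<bar>x\<bar> > 2}" x] assms by (auto elim!: eventually_mono)
  then have "deriv \<psi> x = deriv (\<lambda>_. 0) x"
    by (intro deriv_cong_ev) auto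
  then show ?thesis by simp
qed

section \<open>Smooth curves through rapidly converging sequences\<close>

text \<open>Each differentiation of the bump at 2^(-n) costs a factor 2^(n + 3). For n > k the
  weight 2^(-n^2) is at most 2^(-n(k + 1)), which pays for \<open>k\<close> such factors and leaves
  a geometric series.\<close>

lemma summable_fast:
  "summable (\<lambda>n. (1 / 2) ^ (n\<^sup>2) * (2 ^ (n + 3)) ^ k :: real)"
proof (rule summable_comparison_test_ev)
  show "summable (\<lambda>n. 8 ^ k * (1 / 2) ^ n :: real)"
    by (intro summable_mult summable_geometric) auto
  show "\<forall>\<^sub>F n in sequentially. norm ((1 / 2) ^ n\<^sup>2 * (2 ^ (n + 3)) ^ k :: real) \<le> 8 ^ k * (1 / 2) ^ n"
    using eventually_ge_at_top[of "k + 1"]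
  proof eventually_elim
    case (elim n)
    have "n * (k + 1) \<le> n * n" using elim by (intro mult_le_mono2)
    then have "(1 / 2 :: real) ^ n\<^sup>2 \<le> (1 / 2) ^ (n * (k + 1))"
      by (intro power_decreasing) (auto simp: power2_eq_square)
    then have "(1 / 2) ^ n\<^sup>2 * (2 ^ (n + 3)) ^ k \<le> (1 / 2) ^ (n * (k + 1)) * (2 ^ (n + 3) :: real) ^ k"
      by (intro mult_right_mono) auto
    also have "\<dots> = (1 / 2) ^ n * ((1 / 2) ^ (n * k) * 2 ^ (n * k)) * 8 ^ k"
      by (simp add: power_add power_mult power_mult_distrib)
    also have "(1 / 2 :: real) ^ (n * k) * 2 ^ (n * k) = 1"
      by (simp add: power_one_over)
    finally show ?case by (simp add: mult.commute)
  qed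
qed

text \<open>If \<psi> vanishes outside [-2, 2], the \<open>n\<close>-th term lives within 2^(-n) / 4
  of the point 2^(-n), so the bumps are disjoint. The index \<open>k\<close> counts the chain rule
  factors; with it, the derivative of such a series is another one.\<close>

definition bump_series :: "(nat \<Rightarrow> real) \<Rightarrow> (real \<Rightarrow> real) \<Rightarrow> nat \<Rightarrow> real \<Rightarrow> real" where
  "bump_series a \<psi> k r = (\<Sum>n. a n * (2 ^ (n + 3)) ^ k * \<psi> (2 ^ (n + 3) * (r - (1 / 2) ^ n)))"

lemma bump_series_deriv:
  assumes a: "\<And>n. \<bar>a n\<bar> \<le> (1 / 2) ^ (n\<^sup>2)"
    and \<psi>: "smooth_fun \<psi>" "\<And>x. \<bar>x\<bar> > 2 \<Longrightarrow> \<psi> x = 0"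
  shows "(bump_series a \<psi> k has_real_derivative bump_series a (deriv \<psi>) (Suc k) r) (at r)"
proof -
  have le: "\<bar>a n * (2 ^ (n + 3)) ^ l * \<phi> y\<bar> \<le> C * ((1 / 2) ^ (n\<^sup>2) * (2 ^ (n + 3)) ^ l)"
    if "\<And>x. \<bar>\<phi> x\<bar> \<le> C" for \<phi> C n y l
  proof -
    have "\<bar>a n * (2 ^ (n + 3)) ^ l * \<phi> y\<bar> = \<bar>a n\<bar> * (2 ^ (n + 3)) ^ l * \<bar>\<phi> y\<bar>"
      by (simp add: abs_mult)
    also have "\<dots> \<le> (1 / 2) ^ (n\<^sup>2) * (2 ^ (n + 3)) ^ l * C"
      using a that by (intro mult_mono mult_nonneg_nonneg) auto
    finally show ?thesis by (simp add: mult_ac)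
  qed
  obtain C where C: "\<And>x. \<bar>deriv \<psi> x\<bar> \<le> C"
    using bounded_compact_support[OF smooth_fun_deriv(2)[OF \<psi>(1)] deriv_compact_support[OF \<psi>(2)]] by blast
  obtain C0 where C0: "\<And>x. \<bar>\<psi> x\<bar> \<le> C0"
    using bounded_compact_support[OF \<psi>] by blast
  have uc: "uniformly_convergent_on UNIV
      (\<lambda>n r. \<Sum>i<n. a i * (2 ^ (i + 3)) ^ Suc k * deriv \<psi> (2 ^ (i + 3) * (r - (1 / 2) ^ i)))"
    by (rule Weierstrass_m_test'[where M = "\<lambda>n. C * ((1 / 2) ^ (n\<^sup>2) * (2 ^ (n + 3)) ^ Suc k)"])
      (unfold real_norm_def, rule le, rule C, rule summable_mult[OF summable_fast])
  have sm: "summable (\<lambda>n. a n * (2 ^ (n + 3)) ^ k * \<psi> (2 ^ (n + 3) * (0 - (1 / 2) ^ n)))"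
    by (rule summable_comparison_test'[where N = 0, OF summable_mult[OF summable_fast, of C0 k]])
      (unfold real_norm_def, rule le, rule C0)
  have "((\<lambda>r. \<Sum>n. a n * (2 ^ (n + 3)) ^ k * \<psi> (2 ^ (n + 3) * (r - (1 / 2) ^ n))) has_real_derivative
    (\<Sum>n. a n * (2 ^ (n + 3)) ^ Suc k * deriv \<psi> (2 ^ (n + 3) * (r - (1 / 2) ^ n)))) (at r)"
  proof (rule has_field_derivative_series'(2)[where S = UNIV and ?x0.0 = 0
        and f = "\<lambda>n r. a n * (2 ^ (n + 3)) ^ k * \<psi> (2 ^ (n + 3) * (r - (1 / 2) ^ n))"
        and f' = "\<lambda>n r. a n * (2 ^ (n + 3)) ^ Suc k * deriv \<psi> (2 ^ (n + 3) * (r - (1 / 2) ^ n))"])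
    fix n x
    show "((\<lambda>r. a n * (2 ^ (n + 3)) ^ k * \<psi> (2 ^ (n + 3) * (r - (1 / 2) ^ n))) has_real_derivative
           a n * (2 ^ (n + 3)) ^ Suc k * deriv \<psi> (2 ^ (n + 3) * (x - (1 / 2) ^ n))) (at x)"
      by (rule derivative_eq_intros DERIV_chain2[OF smooth_fun_deriv(1)[OF \<psi>(1)]] refl)+ simp
  qed (use uc sm in simp_all)
  then show ?thesis unfolding bump_series_def by simp
qed

lemma smooth_bump_series:
  assumes a: "\<And>n. \<bar>a n\<bar> \<le> (1 / 2) ^ (n\<^sup>2)"
    and "smooth_fun \<psi>" "\<And>x. \<bar>x\<bar> > 2 \<Longrightarrow> \<psi> x = 0"
  shows "smooth_fun (bump_series a \<psi> 0)"
proof (rule smooth_coinduct[where P = "\<lambda>f. \<exists>\<psi> k. f = bump_series a \<psi> k \<and> smooth_fun \<psi> \<and> (\<forall>x. \<bar>x\<bar> > 2 \<longrightarrow> \<psi> x = 0)"])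
  fix f assume "\<exists>\<psi> k. f = bump_series a \<psi> k \<and> smooth_fun \<psi> \<and> (\<forall>x. \<bar>x\<bar> > 2 \<longrightarrow> \<psi> x = 0)"
  then obtain \<psi> k where *: "f = bump_series a \<psi> k" "smooth_fun \<psi>" "\<And>x. \<bar>x\<bar> > 2 \<Longrightarrow> \<psi> x = 0" by blast
  show "\<exists>f'. (\<exists>\<psi> k. f' = bump_series a \<psi> k \<and> smooth_fun \<psi> \<and> (\<forall>x. \<bar>x\<bar> > 2 \<longrightarrow> \<psi> x = 0)) \<and>
      (\<forall>x. (f has_real_derivative f' x) (at x))"
  proof (rule exI[of _ "bump_series a (deriv \<psi>) (Suc k)"], intro conjI allI)
    show "\<exists>\<phi> l. bump_series a (deriv \<psi>) (Suc k) = bump_series a \<phi> l \<and> smooth_fun \<phi> \<and> (\<forall>x. \<bar>x\<bar> > 2 \<longrightarrow> \<phi> x = 0)"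
      using smooth_fun_deriv(2)[OF *(2)] deriv_compact_support[OF *(3)]
      by (intro exI[of _ "deriv \<psi>"] exI[of _ "Suc k"]) simp
    show "(f has_real_derivative bump_series a (deriv \<psi>) (Suc k) x) (at x)" for x
      unfolding *(1) by (rule bump_series_deriv[OF a *(2,3)])
  qed
next
  show "\<exists>\<phi> l. bump_series a \<psi> 0 = bump_series a \<phi> l \<and> smooth_fun \<phi> \<and> (\<forall>x. \<bar>x\<bar> > 2 \<longrightarrow> \<phi> x = 0)"
    using assms(2,3) by (intro exI[of _ \<psi>] exI[of _ 0]) simp
qed

text \<open>A point within 2^(-m) / 8 of 2^(-m) has distance at least 2^(-n) / 4 from every other
  centre 2^(-n). After scaling by 2^(n + 3) this is at least 2, where \<psi> vanishes, so only the
  \<open>m\<close>-th bump is seen.\<close>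

lemma bump_series_near:
  assumes \<psi>: "\<And>x. \<bar>x\<bar> \<ge> 2 \<Longrightarrow> \<psi> x = 0" and u: "\<bar>u\<bar> \<le> (1 / 2) ^ m / 8"
  shows "bump_series a \<psi> 0 ((1 / 2) ^ m + u) = a m * \<psi> (2 ^ (m + 3) * u)"
proof -
  have z: "\<psi> (2 ^ (n + 3) * ((1 / 2) ^ m + u - (1 / 2) ^ n)) = 0" if "n \<noteq> m" for n
  proof -
    have "\<bar>(1 / 2) ^ m + u - (1 / 2) ^ n\<bar> \<ge> (1 / 2) ^ n / 4"
    proof (cases "n < m")
      case True
      have "(1 / 2 :: real) ^ m \<le> (1 / 2) ^ Suc n" using True by (intro power_decreasing) auto
      then have "(1 / 2 :: real) ^ m \<le> (1 / 2) ^ n / 2" by simp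
      then show ?thesis using u by linarith
    next
      case False
      then have "(1 / 2 :: real) ^ n \<le> (1 / 2) ^ Suc m" using that by (intro power_decreasing) auto
      then have "(1 / 2 :: real) ^ n \<le> (1 / 2) ^ m / 2" by simp
      then show ?thesis using u by linarith
    qed
    then have "2 ^ (n + 3) * \<bar>(1 / 2) ^ m + u - (1 / 2) ^ n\<bar> \<ge> 2 ^ (n + 3) * ((1 / 2 :: real) ^ n / 4)"
      by (intro mult_left_mono) auto
    also have "2 ^ (n + 3) * ((1 / 2 :: real) ^ n / 4) = 2"
      by (simp add: power_add power_one_over)
    finally show ?thesis by (intro \<psi>) (simp add: abs_mult)
  qed
  have "(\<lambda>n. a n * (2 ^ (n + 3)) ^ 0 * \<psi> (2 ^ (n + 3) * ((1 / 2) ^ m + u - (1 / 2) ^ n)))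
      = (\<lambda>n. if n = m then a m * \<psi> (2 ^ (m + 3) * u) else 0)"
    using z by auto
  then show ?thesis
    unfolding bump_series_def using sums_unique[OF sums_single[of m "\<lambda>n. a m * \<psi> (2 ^ (m + 3) * u)"]]
    by simp
qed

text \<open>The curve passes at time $2^{-n}$ through the $n$-th point of a rapidly converging sequence, with a given velocity.
  Composing a function with such curves turns bad behaviour along the sequence into a contradiction.\<close>

lemma special_curve:
  assumes a: "\<And>n. \<bar>a n\<bar> \<le> (1 / 2) ^ (n\<^sup>2)" and b: "\<And>n. \<bar>b n\<bar> \<le> (1 / 2) ^ (n\<^sup>2)"
  obtains c where "smooth_fun c"
    "\<And>n u. \<bar>u\<bar> \<le> (1 / 2) ^ n / 8 \<Longrightarrow> c ((1 / 2) ^ n + u) = x + a n + b n * u"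
proof -
  \<comment> \<open>The division undoes the scaling of the argument inside the \<open>n\<close>-th
    bump, so that the slope of the curve is \<open>b n\<close> itself.\<close>
  define b' where "b' n = b n / 2 ^ (n + 3)" for n
  have b': "\<bar>b' n\<bar> \<le> (1 / 2) ^ (n\<^sup>2)" for n
  proof -
    have "\<bar>b n\<bar> / 2 ^ (n + 3) \<le> \<bar>b n\<bar> / 1"
      by (intro divide_left_mono one_le_power) auto
    then show ?thesis using b[of n] by (simp add: b'_def)
  qed
  \<comment> \<open>The identity near 0, cut off to compact support: its bumps supply the
    velocities, those of \<open>cutoff\<close> supply the positions.\<close>
  define \<psi> where "\<psi> x = x * cutoff x" for x
  have \<psi>: "smooth_fun \<psi>" unfolding \<psi>_def [abs_def] by (intro smooth_mult smooth_id smooth_cutoff)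
  have far: "\<bar>x\<bar> \<ge> 2 \<Longrightarrow> \<psi> x = 0" for x by (simp add: \<psi>_def cutoff_far)
  define c where "c r = x + (bump_series a cutoff 0 r + bump_series b' \<psi> 0 r)" for r
  show thesis
  proof (rule that[of c])
    show "smooth_fun c"
      unfolding c_def [abs_def]
      by (intro smooth_add smooth_const smooth_bump_series a b' \<psi> smooth_cutoff far cutoff_far) auto
    fix n u assume u: "\<bar>u :: real\<bar> \<le> (1 / 2) ^ n / 8"
    have "\<bar>2 ^ (n + 3) * u\<bar> = 2 ^ (n + 3) * \<bar>u\<bar>" by (simp add: abs_mult)
    also have "\<dots> \<le> 2 ^ (n + 3) * ((1 / 2) ^ n / 8)" using u by (intro mult_left_mono) auto
    also have "\<dots> = 1" by (simp add: power_add power_one_over)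
    finally have "cutoff (2 ^ (n + 3) * u) = 1" by (rule cutoff_near)
    then show "c ((1 / 2) ^ n + u) = x + a n + b n * u"
      unfolding c_def using bump_series_near[of cutoff u n a, OF cutoff_far u] bump_series_near[of \<psi> u n b', OF far u]
      by (simp add: \<psi>_def b'_def)
  qed
qed

section \<open>Functions of two variables: local bounds on derivatives\<close>

text \<open>Smoothness on the plane as a Froelicher space. All that is given is the behaviour along
  pairs of smooth curves; continuity and the smoothness of partial derivatives have to be
  derived.\<close>

definition smooth2 :: "(real \<Rightarrow> real \<Rightarrow> real) \<Rightarrow> bool" where
  "smooth2 F \<longleftrightarrow> (\<forall>x y. smooth_fun x \<longrightarrow> smooth_fun y \<longrightarrow> smooth_fun (\<lambda>r. F (x r) (y r)))"

lemma smooth2D: "smooth2 F \<Longrightarrow> smooth_fun x \<Longrightarrow> smooth_fun y \<Longrightarrow> smooth_fun (\<lambda>r. F (x r) (y r))"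
  unfolding smooth2_def by blast

lemma smooth2_swap: "smooth2 F \<Longrightarrow> smooth2 (\<lambda>t s. F s t)"
  unfolding smooth2_def by blast

lemma smooth2_fst: "smooth2 F \<Longrightarrow> smooth_fun (\<lambda>t. F t s)"
  using smooth2D[of F "\<lambda>t. t" "\<lambda>_. s"] by simp

lemma smooth2_snd: "smooth2 F \<Longrightarrow> smooth_fun (F t)"
  using smooth2D[of F "\<lambda>_. t" "\<lambda>s. s"] by simp

lemma higher_deriv_affine:
  assumes "smooth_fun f"
  shows "(deriv ^^ p) (\<lambda>u. f (a + e * u)) = (\<lambda>u. e ^ p * (deriv ^^ p) f (a + e * u))"
proof (induction p)
  case (Suc p)
  have "((\<lambda>u. e ^ p * (deriv ^^ p) f (a + e * u)) has_real_derivative e ^ p * ((deriv ^^ Suc p) f (a + e * u) * e)) (at u)" for u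
    by (rule derivative_eq_intros DERIV_chain2[OF smooth_higher_deriv[OF assms]] refl)+ simp
  then have "deriv (\<lambda>u. e ^ p * (deriv ^^ p) f (a + e * u)) u = e ^ p * ((deriv ^^ Suc p) f (a + e * u) * e)" for u
    by (rule DERIV_imp_deriv)
  then have "deriv (\<lambda>u. e ^ p * (deriv ^^ p) f (a + e * u)) = (\<lambda>u. e ^ Suc p * (deriv ^^ Suc p) f (a + e * u))"
    by (simp add: fun_eq_iff mult_ac)
  then show ?case by (simp only: Suc funpow.simps comp_def)
qed simp

text \<open>Suppose the \<open>p\<close>-th partial derivative is unbounded near \<open>z\<close>. A
  smooth curve can visit rapidly converging points of large derivative at the times 2^(-n), moving
  there only in the first variable with speed 2^(-n^2). Then the \<open>p\<close>-th derivative of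
  the composite at these times is the partial derivative times 2^(-n^2 p), and it must stay bounded
  near time 0.\<close>

lemma smooth2_locally_bounded:
  assumes F: "smooth2 F"
  shows "\<exists>e>0. \<exists>B. \<forall>y. dist y z < e \<longrightarrow> \<bar>(deriv ^^ p) (\<lambda>t. F t (snd y)) (fst y)\<bar> \<le> B"
proof (rule ccontr)
  define g where "g y = (deriv ^^ p) (\<lambda>t. F t (snd y)) (fst y)" for y
  assume "\<not> ?thesis"
  then have "\<forall>e>0. \<forall>B. \<exists>y. dist y z < e \<and> \<bar>g y\<bar> > B" unfolding g_def by (metis not_le)
  \<comment> \<open>The factor (2^(n^2))^p makes up for the speed of the curve, so that the
    derivative of the composite still exceeds \<open>n\<close>.\<close>
  then have "\<exists>y. dist y z < (1 / 2) ^ (n\<^sup>2) \<and> \<bar>g y\<bar> > real n * (2 ^ (n\<^sup>2)) ^ p" for n :: nat by simp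
  then obtain y where y: "\<And>n::nat. dist (y n) z < (1 / 2) ^ (n\<^sup>2)" "\<And>n. \<bar>g (y n)\<bar> > real n * (2 ^ (n\<^sup>2)) ^ p"
    by metis
  have "\<bar>fst (y n) - fst z\<bar> \<le> (1 / 2) ^ (n\<^sup>2)" for n
    using y(1)[of n] dist_fst_le[of "y n" z] by (simp add: dist_real_def)
  then obtain c1 where c1: "smooth_fun c1"
      "\<And>n u. \<bar>u\<bar> \<le> (1 / 2) ^ n / 8 \<Longrightarrow> c1 ((1 / 2) ^ n + u) = fst z + (fst (y n) - fst z) + (1 / 2) ^ (n\<^sup>2) * u"
    using special_curve[of "\<lambda>n. fst (y n) - fst z" "\<lambda>n. (1 / 2) ^ (n\<^sup>2)" "fst z"] by auto
  have "\<bar>snd (y n) - snd z\<bar> \<le> (1 / 2) ^ (n\<^sup>2)" for n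
    using y(1)[of n] dist_snd_le[of "y n" z] by (simp add: dist_real_def)
  then obtain c2 where c2: "smooth_fun c2"
      "\<And>n u. \<bar>u\<bar> \<le> (1 / 2) ^ n / 8 \<Longrightarrow> c2 ((1 / 2) ^ n + u) = snd z + (snd (y n) - snd z) + 0 * u"
    using special_curve[of "\<lambda>n. snd (y n) - snd z" "\<lambda>n. 0" "snd z"] by auto
  define h where "h r = F (c1 r) (c2 r)" for r
  have h: "smooth_fun h" unfolding h_def [abs_def] by (rule smooth2D[OF F c1(1) c2(1)])
  have val: "(deriv ^^ p) h ((1 / 2) ^ n) = ((1 / 2) ^ (n\<^sup>2)) ^ p * g (y n)" for n
  proof -
    define f where "f t = F t (snd (y n))" for t
    define e :: real where "e = (1 / 2) ^ (n\<^sup>2)"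
    define r0 :: real where "r0 = (1 / 2) ^ n"
    have "eventually (\<lambda>r. r \<in> ball r0 (r0 / 8)) (nhds r0)"
      by (intro eventually_nhds_in_open) (auto simp: r0_def)
    then have "eventually (\<lambda>r. h r = f ((fst (y n) - e * r0) + e * r)) (nhds r0)"
    proof eventually_elim
      case (elim r)
      then have "\<bar>r - r0\<bar> \<le> (1 / 2) ^ n / 8" by (simp add: dist_real_def r0_def abs_minus_commute)
      from c1(2)[OF this] c2(2)[OF this]
      have "c1 r = (fst (y n) - e * r0) + e * r" "c2 r = snd (y n)"
        by (simp_all add: r0_def [symmetric] e_def [symmetric] algebra_simps)
      then show ?case by (simp add: h_def f_def)
    qed
    then have "(deriv ^^ p) h r0 = (deriv ^^ p) (\<lambda>r. f ((fst (y n) - e * r0) + e * r)) r0"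
      by (rule higher_deriv_cong_ev) simp
    also have "\<dots> = e ^ p * (deriv ^^ p) f (fst (y n))"
      using higher_deriv_affine[OF smooth2_fst[OF F, of "snd (y n)"], of p "fst (y n) - e * r0" e]
      by (simp add: f_def [abs_def])
    finally show ?thesis by (simp add: r0_def e_def g_def f_def [abs_def])
  qed
  have "(\<lambda>n. (deriv ^^ p) h ((1 / 2) ^ n)) \<longlonglongrightarrow> (deriv ^^ p) h 0"
    by (rule isCont_tendsto_compose[OF smooth_fun_cont[OF smooth_higher[OF h]]]) (auto intro!: LIMSEQ_realpow_zero)
  then have "Bseq (\<lambda>n. (deriv ^^ p) h ((1 / 2) ^ n))" by (intro convergent_imp_Bseq convergentI)
  then obtain K where K: "\<And>n. \<bar>(deriv ^^ p) h ((1 / 2) ^ n)\<bar> \<le> K" unfolding Bseq_def by auto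
  obtain n :: nat where n: "real n > K" using reals_Archimedean2 by blast
  have "real n = ((1 / 2) ^ (n\<^sup>2)) ^ p * (real n * (2 ^ (n\<^sup>2)) ^ p)"
    by (simp add: power_one_over)
  also have "\<dots> \<le> ((1 / 2) ^ (n\<^sup>2)) ^ p * \<bar>g (y n)\<bar>"
    using y(2)[of n] by (intro mult_left_mono) auto
  also have "\<dots> = \<bar>(deriv ^^ p) h ((1 / 2) ^ n)\<bar>" by (simp add: val abs_mult)
  finally show False using K[of n] n by linarith
qed

lemma smooth2_bounded:
  assumes F: "smooth2 F"
  obtains B where "\<And>t s. \<bar>t\<bar> \<le> R \<Longrightarrow> \<bar>s\<bar> \<le> R \<Longrightarrow> \<bar>(deriv ^^ p) (\<lambda>t. F t s) t\<bar> \<le> B"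
proof -
  define g where "g y = (deriv ^^ p) (\<lambda>t. F t (snd y)) (fst y)" for y
  define K where "K = {-R..R} \<times> {-R..R}"
  have "compact K" unfolding K_def by (intro compact_Times) auto
  obtain e B where eB: "\<And>z. e z > 0" "\<And>z y. dist y z < e z \<Longrightarrow> \<bar>g y\<bar> \<le> B z"
    using smooth2_locally_bounded[OF F, of _ p] unfolding g_def by metis
  have "K \<subseteq> (\<Union>z\<in>K. ball z (e z))" using eB(1) by auto
  then obtain T where T: "T \<subseteq> K" "finite T" "K \<subseteq> (\<Union>z\<in>T. ball z (e z))"
    using compactE_image[OF \<open>compact K\<close>, of K "\<lambda>z. ball z (e z)"] by auto
  have bd: "\<bar>g y\<bar> \<le> (\<Sum>z\<in>T. \<bar>B z\<bar>)" if "y \<in> K" for y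
  proof -
    have "y \<in> (\<Union>z\<in>T. ball z (e z))" using T(3) that by (rule subsetD)
    then obtain z where z: "z \<in> T" "dist y z < e z" by (auto simp: dist_commute)
    have "\<bar>B z\<bar> \<le> (\<Sum>z\<in>T. \<bar>B z\<bar>)" using z(1) T(2) by (intro member_le_sum) auto
    then show ?thesis using eB(2)[OF z(2)] by linarith
  qed
  then have "\<bar>(deriv ^^ p) (\<lambda>t. F t s) t\<bar> \<le> (\<Sum>z\<in>T. \<bar>B z\<bar>)"
    if "\<bar>t\<bar> \<le> R" "\<bar>s\<bar> \<le> R" for t s
    using bd[of "(t, s)"] that by (simp add: K_def g_def abs_le_iff)
  then show thesis using that by blast
qed

section \<open>Geometric convergence passes to derivatives\<close>

text \<open>The derivative at 0, expressed by finitely many values up to an error of high order. On short intervals this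
  bounds the derivative of a small function whose higher derivatives do not grow too fast.\<close>

definition difference_functional :: "nat \<Rightarrow> ((real \<Rightarrow> real) \<Rightarrow> real) \<Rightarrow> real \<Rightarrow> bool" where
  "difference_functional N A K \<longleftrightarrow> K \<ge> 0 \<and>
    (\<forall>\<phi> \<psi> c. A (\<lambda>x. \<phi> x + c * \<psi> x) = A \<phi> + c * A \<psi>) \<and>
    (\<forall>\<phi> B. (\<forall>x\<in>{0..1}. \<bar>\<phi> x\<bar> \<le> B) \<longrightarrow> \<bar>A \<phi>\<bar> \<le> K * B) \<and>
    (\<forall>i\<le>N + 1. A (\<lambda>x. x ^ i) = (if i = 1 then 1 else 0))"

lemma difference_functionalD:
  assumes "difference_functional N A K"
  shows "K \<ge> 0" "A (\<lambda>x. \<phi> x + c * \<psi> x) = A \<phi> + c * A \<psi>"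
    "(\<And>x. x \<in> {0..1} \<Longrightarrow> \<bar>\<phi> x\<bar> \<le> B) \<Longrightarrow> \<bar>A \<phi>\<bar> \<le> K * B"
    "i \<le> N + 1 \<Longrightarrow> A (\<lambda>x. x ^ i) = (if i = 1 then 1 else 0)"
  using assms unfolding difference_functional_def by simp_all

text \<open>Richardson extrapolation, starting from \<phi>(1) - \<phi>(0): combining a functional
  with its copy at half the scale removes one more power from the error and keeps the value on x
  equal to 1.\<close>

lemma difference_functional_exists: "\<exists>A K. difference_functional N A K"
proof (induction N)
  case 0
  show ?case
    unfolding difference_functional_def
  proof (intro exI[of _ "\<lambda>\<phi>. \<phi> 1 - \<phi> 0"] exI[of _ 2] conjI allI impI)
    fix \<phi> :: "real \<Rightarrow> real" and B assume "\<forall>x\<in>{0..1}. \<bar>\<phi> x\<bar> \<le> B"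
    then have "\<bar>\<phi> 1\<bar> \<le> B" "\<bar>\<phi> 0\<bar> \<le> B" by auto
    then show "\<bar>\<phi> 1 - \<phi> 0\<bar> \<le> 2 * B" by linarith
  next
    fix i :: nat assume "i \<le> 0 + 1"
    then have "i = 0 \<or> i = 1" by auto
    then show "1 ^ i - 0 ^ i = (if i = 1 then 1 else (0 :: real))" by auto
  qed (auto simp: algebra_simps)
next
  case (Suc N)
  then obtain A K where A: "difference_functional N A K" by blast
  note K = difference_functionalD(1)[OF A] and lin = difference_functionalD(2)[OF A]
    and bd = difference_functionalD(3)[OF A] and val = difference_functionalD(4)[OF A]
  \<comment> \<open>Halving the argument multiplies the value on x^(N + 2) by \<open>q\<close>, so
    the combination below vanishes there; \<alpha> restores the value 1 on x, where halving gives
    the factor 1/2.\<close>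
  define q :: real where "q = (1 / 2) ^ (N + 2)"
  define \<alpha> where "\<alpha> = 1 / (1 / 2 - q)"
  have "q < 1 / 2" unfolding q_def using power_strict_decreasing[of 1 "N + 2" "1 / 2 :: real"] by simp
  then have \<alpha>: "\<alpha> * (1 / 2 - q) = 1" by (simp add: \<alpha>_def)
  define A' where "A' \<phi> = \<alpha> * A (\<lambda>x. \<phi> (x / 2)) - \<alpha> * q * A \<phi>" for \<phi>
  have "A (\<lambda>x. 0) = 0" using lin[of "\<lambda>_. 0" 1 "\<lambda>_. 0"] by simp
  then have smul: "A (\<lambda>x. c * \<psi> x) = c * A \<psi>" for c \<psi> using lin[of "\<lambda>_. 0" c \<psi>] by simp
  show ?case
    unfolding difference_functional_def
  proof (intro exI[of _ A'] exI[of _ "\<bar>\<alpha>\<bar> * K + \<bar>\<alpha> * q\<bar> * K"] conjI allI impI)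
    show "0 \<le> \<bar>\<alpha>\<bar> * K + \<bar>\<alpha> * q\<bar> * K" using K by simp
    fix \<phi> \<psi> :: "real \<Rightarrow> real" and c
    show "A' (\<lambda>x. \<phi> x + c * \<psi> x) = A' \<phi> + c * A' \<psi>"
      unfolding A'_def lin by (simp add: algebra_simps)
  next
    fix \<phi> :: "real \<Rightarrow> real" and B assume *: "\<forall>x\<in>{0..1}. \<bar>\<phi> x\<bar> \<le> B"
    have 1: "\<bar>A \<phi>\<bar> \<le> K * B" using bd * by blast
    have 2: "\<bar>A (\<lambda>x. \<phi> (x / 2))\<bar> \<le> K * B" using * by (intro bd) auto
    have "\<bar>A' \<phi>\<bar> \<le> \<bar>\<alpha> * A (\<lambda>x. \<phi> (x / 2))\<bar> + \<bar>\<alpha> * q * A \<phi>\<bar>" unfolding A'_def by (rule abs_triangle_ineq4)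
    also have "\<dots> = \<bar>\<alpha>\<bar> * \<bar>A (\<lambda>x. \<phi> (x / 2))\<bar> + \<bar>\<alpha> * q\<bar> * \<bar>A \<phi>\<bar>" by (simp add: abs_mult)
    also have "\<dots> \<le> \<bar>\<alpha>\<bar> * (K * B) + \<bar>\<alpha> * q\<bar> * (K * B)" using 1 2 by (intro add_mono mult_left_mono) auto
    finally show "\<bar>A' \<phi>\<bar> \<le> (\<bar>\<alpha>\<bar> * K + \<bar>\<alpha> * q\<bar> * K) * B" by (simp add: algebra_simps)
  next
    fix i assume i: "i \<le> Suc N + 1"
    have h: "A (\<lambda>x. (x / 2) ^ i) = (1 / 2) ^ i * A (\<lambda>x. x ^ i)"
      using smul[of "(1 / 2) ^ i" "\<lambda>x. x ^ i"] by (simp add: power_divide)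
    show "A' (\<lambda>x. x ^ i) = (if i = 1 then 1 else 0)"
    proof (cases "i = N + 2")
      case True
      then show ?thesis unfolding A'_def h q_def by simp
    next
      case False
      then show ?thesis using val[of i] i \<alpha> unfolding A'_def h by (auto simp: algebra_simps)
    qed
  qed
qed

definition geom_decay :: "(nat \<Rightarrow> real \<Rightarrow> real) \<Rightarrow> bool" where
  "geom_decay d \<longleftrightarrow> (\<forall>R. \<exists>C \<rho>. 0 < \<rho> \<and> \<rho> < 1 \<and> (\<forall>j t. \<bar>t\<bar> \<le> R \<longrightarrow> \<bar>d j t\<bar> \<le> C * \<rho> ^ j))"

text \<open>The growth 2^j is that of difference quotients with step 2^(-j) of a function all of
  whose derivatives are locally bounded.\<close>

definition mild_growth :: "(nat \<Rightarrow> real \<Rightarrow> real) \<Rightarrow> bool" where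
  "mild_growth d \<longleftrightarrow> (\<forall>j. smooth_fun (d j)) \<and>
    (\<forall>m R. \<exists>C. \<forall>j t. \<bar>t\<bar> \<le> R \<longrightarrow> \<bar>(deriv ^^ m) (d j) t\<bar> \<le> C * 2 ^ j)"

lemma mild_growth_deriv: "mild_growth d \<Longrightarrow> mild_growth (\<lambda>j. deriv (d j))"
  unfolding mild_growth_def
proof (intro conjI allI)
  assume *: "(\<forall>j. smooth_fun (d j)) \<and> (\<forall>m R. \<exists>C. \<forall>j t. \<bar>t\<bar> \<le> R \<longrightarrow> \<bar>(deriv ^^ m) (d j) t\<bar> \<le> C * 2 ^ j)"
  show "smooth_fun (deriv (d j))" for j using * smooth_fun_deriv(2) by blast
  fix m R
  show "\<exists>C. \<forall>j t. \<bar>t\<bar> \<le> R \<longrightarrow> \<bar>(deriv ^^ m) (deriv (d j)) t\<bar> \<le> C * 2 ^ j"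
    using conjunct2[OF *, rule_format, of R "Suc m"] by (simp only: funpow_Suc_right comp_def)
qed

text \<open>An interpolation argument. On an interval of length \<delta> the derivative is a
  combination of values divided by \<delta>, up to a Taylor remainder of order N + 2. With \<delta>
  = \<sigma>^j and \<sigma>^2 = \<rho> the values contribute \<rho>^j / \<delta> = \<sigma>^j, while
  the remainder contributes \<delta>^(N + 1) 2^j.\<close>

lemma geom_decay_deriv:
  assumes m: "mild_growth d" and g: "geom_decay d"
  shows "geom_decay (\<lambda>j. deriv (d j))"
  unfolding geom_decay_def
proof
  fix R :: real
  have sm: "smooth_fun (d j)" for j using m unfolding mild_growth_def by blast
  obtain C0 \<rho> where \<rho>: "0 < \<rho>" "\<rho> < 1" and C0: "\<And>j t. \<bar>t\<bar> \<le> R + 1 \<Longrightarrow> \<bar>d j t\<bar> \<le> C0 * \<rho> ^ j"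
    using g unfolding geom_decay_def by blast
  define \<sigma> where "\<sigma> = sqrt \<rho>"
  have \<sigma>: "0 < \<sigma>" "\<sigma> < 1" "\<sigma> * \<sigma> = \<rho>" using \<rho> by (auto simp: \<sigma>_def)
  \<comment> \<open>The order at which the remainder beats the growth: 2 \<sigma>^(N + 1) is at most
    1/2, so the remainder decays geometrically as well.\<close>
  obtain N where N: "\<sigma> ^ N < 1 / 4" using real_arch_pow_inv[of "1 / 4" \<sigma>] \<sigma> by auto
  have "\<sigma> ^ Suc N \<le> \<sigma> ^ N" using \<sigma> by (intro power_decreasing) auto
  then have N1: "2 * \<sigma> ^ Suc N \<le> 1 / 2" using N by simp
  obtain A K where A: "difference_functional N A K" using difference_functional_exists by blast
  note K = difference_functionalD(1)[OF A] and lin = difference_functionalD(2)[OF A]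
    and bd = difference_functionalD(3)[OF A] and val = difference_functionalD(4)[OF A]
  have A0: "A (\<lambda>x. 0) = 0" using lin[of "\<lambda>_. 0" 1 "\<lambda>_. 0"] by simp
  have Asum: "A (\<lambda>x. \<Sum>i<n. c i * x ^ i) = (\<Sum>i<n. c i * A (\<lambda>x. x ^ i))" for n :: nat and c
    by (induction n) (use A0 lin in auto)
  obtain C where C: "\<And>j t. \<bar>t\<bar> \<le> R + 1 \<Longrightarrow> \<bar>(deriv ^^ (N + 2)) (d j) t\<bar> \<le> C * 2 ^ j"
    using m unfolding mild_growth_def by meson
  define \<tau> where "\<tau> = max \<sigma> (1 / 2)"
  have \<tau>: "0 < \<tau>" "\<tau> < 1" using \<sigma> by (auto simp: \<tau>_def)
  have main: "\<bar>deriv (d j) t\<bar> \<le> (K * \<bar>C0\<bar> + K * \<bar>C\<bar>) * \<tau> ^ j" if t: "\<bar>t\<bar> \<le> R" for j t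
  proof -
    define \<delta> where "\<delta> = \<sigma> ^ j"
    have \<delta>: "0 < \<delta>" "\<delta> \<le> 1" using \<sigma> by (auto simp: \<delta>_def power_le_one)
    define D where "D i x = \<delta> ^ i * (deriv ^^ i) (d j) (t + \<delta> * x)" for i x
    define c where "c i = D i 0 / fact i" for i
    define rest where "rest x = d j (t + \<delta> * x) + (- 1) * (\<Sum>i<N + 2. c i * x ^ i)" for x
    have DD: "\<forall>i x. (D i has_real_derivative D (Suc i) x) (at x)"
    proof (intro allI)
      fix i x
      have "((\<lambda>x. t + \<delta> * x) has_real_derivative \<delta>) (at x)"
        by (auto intro!: derivative_eq_intros)
      from DERIV_cmult[OF DERIV_chain2[OF smooth_higher_deriv[OF sm] this], of "\<delta> ^ i" i j]
      show "(D i has_real_derivative D (Suc i) x) (at x)"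
        unfolding D_def by (simp add: mult_ac)
    qed
    have near: "\<bar>t + \<delta> * x\<bar> \<le> R + 1" if "\<bar>x\<bar> \<le> 1" for x
    proof -
      have "\<bar>\<delta> * x\<bar> \<le> 1 * 1" unfolding abs_mult using \<delta> that by (intro mult_mono) auto
      then show ?thesis using t by linarith
    qed
    have r: "\<bar>rest x\<bar> \<le> \<delta> ^ (N + 2) * (\<bar>C\<bar> * 2 ^ j)" if x: "x \<in> {0..1}" for x
    proof -
      have "D 0 = (\<lambda>x. d j (t + \<delta> * x))" by (simp add: D_def fun_eq_iff)
      from Maclaurin_all_le[OF this DD, of x "N + 2"] obtain y where
        y: "\<bar>y\<bar> \<le> \<bar>x\<bar>" "rest x = D (N + 2) y / fact (N + 2) * x ^ (N + 2)"
        by (auto simp: rest_def c_def)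
      have "\<bar>D (N + 2) y\<bar> = \<delta> ^ (N + 2) * \<bar>(deriv ^^ (N + 2)) (d j) (t + \<delta> * y)\<bar>"
        unfolding D_def abs_mult using \<delta> by simp
      also have "\<dots> \<le> \<delta> ^ (N + 2) * (\<bar>C\<bar> * 2 ^ j)"
      proof (rule mult_left_mono)
        have "\<bar>(deriv ^^ (N + 2)) (d j) (t + \<delta> * y)\<bar> \<le> C * 2 ^ j" using x y(1) by (intro C near) auto
        also have "\<dots> \<le> \<bar>C\<bar> * 2 ^ j" by (intro mult_right_mono) auto
        finally show "\<bar>(deriv ^^ (N + 2)) (d j) (t + \<delta> * y)\<bar> \<le> \<bar>C\<bar> * 2 ^ j" .
      qed (use \<delta> in simp)
      finally have 1: "\<bar>D (N + 2) y\<bar> \<le> \<delta> ^ (N + 2) * (\<bar>C\<bar> * 2 ^ j)" .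
      have "\<bar>rest x\<bar> = \<bar>D (N + 2) y\<bar> * (\<bar>x\<bar> ^ (N + 2) / fact (N + 2))"
        unfolding y(2) by (simp add: abs_mult power_abs)
      also have "\<dots> \<le> \<bar>D (N + 2) y\<bar> * 1"
      proof (rule mult_left_mono)
        have "\<bar>x\<bar> ^ (N + 2) \<le> 1" using x by (intro power_le_one) auto
        moreover have "(1::real) \<le> fact (N + 2)" by (rule fact_ge_1)
        ultimately have "\<bar>x\<bar> ^ (N + 2) \<le> fact (N + 2)" by linarith
        then show "\<bar>x\<bar> ^ (N + 2) / fact (N + 2) \<le> 1" by (subst divide_le_eq_1_pos) auto
      qed simp
      finally show ?thesis using 1 by linarith
    qed
    have "(\<lambda>x. d j (t + \<delta> * x)) = (\<lambda>x. rest x + 1 * (\<Sum>i<N + 2. c i * x ^ i))"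
      by (simp add: rest_def)
    then have "A (\<lambda>x. d j (t + \<delta> * x)) = A rest + (\<Sum>i<N + 2. c i * A (\<lambda>x. x ^ i))"
      using lin[of rest 1 "\<lambda>x. \<Sum>i<N + 2. c i * x ^ i"] by (simp only: Asum mult_1)
    also have "(\<Sum>i<N + 2. c i * A (\<lambda>x. x ^ i)) = (\<Sum>i<N + 2. if i = 1 then c i else 0)"
      by (intro sum.cong) (auto simp: val)
    also have "\<dots> = c 1" by (simp add: sum.delta)
    also have "c 1 = \<delta> * deriv (d j) t" by (simp add: c_def D_def)
    finally have eq: "\<delta> * deriv (d j) t = A (\<lambda>x. d j (t + \<delta> * x)) - A rest" by simp
    have b1: "\<bar>A (\<lambda>x. d j (t + \<delta> * x))\<bar> \<le> K * (\<bar>C0\<bar> * \<rho> ^ j)"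
    proof (rule bd)
      fix x :: real assume "x \<in> {0..1}"
      then have "\<bar>d j (t + \<delta> * x)\<bar> \<le> C0 * \<rho> ^ j" by (intro C0 near) auto
      also have "\<dots> \<le> \<bar>C0\<bar> * \<rho> ^ j" using \<rho> by (intro mult_right_mono) auto
      finally show "\<bar>d j (t + \<delta> * x)\<bar> \<le> \<bar>C0\<bar> * \<rho> ^ j" .
    qed
    have b2: "\<bar>A rest\<bar> \<le> K * (\<delta> ^ (N + 2) * (\<bar>C\<bar> * 2 ^ j))" using r by (intro bd) auto
    have "\<delta> * \<bar>deriv (d j) t\<bar> = \<bar>\<delta> * deriv (d j) t\<bar>" using \<delta> by (simp add: abs_mult)
    also have "\<dots> \<le> \<bar>A (\<lambda>x. d j (t + \<delta> * x))\<bar> + \<bar>A rest\<bar>" unfolding eq by (rule abs_triangle_ineq4)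
    also have "\<dots> \<le> K * (\<bar>C0\<bar> * \<rho> ^ j) + K * (\<delta> ^ (N + 2) * (\<bar>C\<bar> * 2 ^ j))" using b1 b2 by (rule add_mono)
    also have "\<rho> ^ j = \<delta> * \<delta>" unfolding \<delta>_def \<sigma>(3)[symmetric] by (simp add: power_mult_distrib)
    also have "K * (\<bar>C0\<bar> * (\<delta> * \<delta>)) + K * (\<delta> ^ (N + 2) * (\<bar>C\<bar> * 2 ^ j))
        = \<delta> * (K * \<bar>C0\<bar> * \<delta> + K * \<bar>C\<bar> * (\<delta> ^ Suc N * 2 ^ j))" by (simp add: algebra_simps)
    finally have "\<bar>deriv (d j) t\<bar> \<le> K * \<bar>C0\<bar> * \<delta> + K * \<bar>C\<bar> * (\<delta> ^ Suc N * 2 ^ j)"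
      using \<delta> by (simp only: mult_le_cancel_left_pos)
    also have "\<delta> ^ Suc N * 2 ^ j = (2 * \<sigma> ^ Suc N) ^ j"
      by (simp add: \<delta>_def power_mult_distrib flip: power_mult power_Suc) (simp add: mult.commute)
    also have "K * \<bar>C0\<bar> * \<delta> + K * \<bar>C\<bar> * (2 * \<sigma> ^ Suc N) ^ j \<le> K * \<bar>C0\<bar> * \<tau> ^ j + K * \<bar>C\<bar> * \<tau> ^ j"
    proof (intro add_mono mult_left_mono)
      show "\<delta> \<le> \<tau> ^ j" unfolding \<delta>_def using \<sigma> by (intro power_mono) (auto simp: \<tau>_def)
      show "(2 * \<sigma> ^ Suc N) ^ j \<le> \<tau> ^ j" using \<sigma> N1 by (intro power_mono) (auto simp: \<tau>_def)
    qed (use K in auto)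
    finally show ?thesis by (simp add: algebra_simps)
  qed
  then show "\<exists>C \<rho>. 0 < \<rho> \<and> \<rho> < 1 \<and> (\<forall>j t. \<bar>t\<bar> \<le> R \<longrightarrow> \<bar>deriv (d j) t\<bar> \<le> C * \<rho> ^ j)"
    using \<tau> by blast
qed

lemma geom_decay_summable:
  assumes "geom_decay d" shows "summable (\<lambda>j. d j t)"
proof -
  obtain C \<rho> where "0 < \<rho>" "\<rho> < 1" and C: "\<And>j s. \<bar>s\<bar> \<le> \<bar>t\<bar> \<Longrightarrow> \<bar>d j s\<bar> \<le> C * \<rho> ^ j"
    using assms unfolding geom_decay_def by blast
  then have "summable (\<lambda>j. C * \<rho> ^ j)" by (intro summable_mult summable_geometric) auto
  then show ?thesis by (rule summable_comparison_test'[where N = 0]) (use C in auto)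
qed

text \<open>Both properties pass to the sequence of derivatives, and the decay permits termwise
  differentiation; the class of such sums is closed under differentiation.\<close>

lemma smooth_geom_series:
  assumes "mild_growth d" "geom_decay d"
  shows "smooth_fun (\<lambda>t. \<Sum>j. d j t)"
proof (rule smooth_coinduct[where P = "\<lambda>G. \<exists>d. G = (\<lambda>t. \<Sum>j. d j t) \<and> mild_growth d \<and> geom_decay d"])
  show "\<exists>e. (\<lambda>t. \<Sum>j. d j t) = (\<lambda>t. \<Sum>j. e j t) \<and> mild_growth e \<and> geom_decay e"
    using assms by (intro exI[of _ d]) simp
next
  fix G assume "\<exists>d. G = (\<lambda>t. \<Sum>j. d j t) \<and> mild_growth d \<and> geom_decay d"
  then obtain d where G: "G = (\<lambda>t. \<Sum>j. d j t)" and d: "mild_growth d" "geom_decay d" by (elim exE conjE)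
  have d': "geom_decay (\<lambda>j. deriv (d j))" by (rule geom_decay_deriv[OF d])
  have "(G has_real_derivative (\<Sum>j. deriv (d j) x)) (at x)" for x
    unfolding G
  proof (rule has_field_derivative_series'(2)[where S = "{x - 1..x + 1}" and ?x0.0 = x and f = d and f' = "\<lambda>j. deriv (d j)"])
    obtain C \<rho> where \<rho>: "0 < \<rho>" "\<rho> < 1" and C: "\<And>j s. \<bar>s\<bar> \<le> \<bar>x\<bar> + 1 \<Longrightarrow> \<bar>deriv (d j) s\<bar> \<le> C * \<rho> ^ j"
      using d' unfolding geom_decay_def by blast
    show "uniformly_convergent_on {x - 1..x + 1} (\<lambda>n t. \<Sum>i<n. deriv (d i) t)"
    proof (rule Weierstrass_m_test'[where M = "\<lambda>j. C * \<rho> ^ j"])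
      show "norm (deriv (d n) y) \<le> C * \<rho> ^ n" if "y \<in> {x - 1..x + 1}" for n y
        using that C[of y n] by (simp add: abs_if split: if_splits)
      show "summable (\<lambda>j. C * \<rho> ^ j)" using \<rho> by (intro summable_mult summable_geometric) auto
    qed
    fix n y
    have "(d n has_real_derivative deriv (d n) y) (at y)"
      using d(1) unfolding mild_growth_def by (intro smooth_fun_deriv(1)) blast
    then show "(d n has_real_derivative deriv (d n) y) (at y within {x - 1..x + 1})"
      by (rule has_field_derivative_at_within)
  qed (use geom_decay_summable[OF d(2)] in \<open>auto simp: interior_cbox\<close>)
  then show "\<exists>f'. (\<exists>d. f' = (\<lambda>t. \<Sum>j. d j t) \<and> mild_growth d \<and> geom_decay d) \<and> (\<forall>x. (G has_real_derivative f' x) (at x))"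
    using mild_growth_deriv[OF d(1)] d'
    by (intro exI[of _ "\<lambda>t. \<Sum>j. deriv (d j) t"] conjI allI exI[of _ "\<lambda>j. deriv (d j)"]) auto
qed

section \<open>Smoothness of partial derivatives\<close>

lemma higher_deriv_lincomb:
  assumes "smooth_fun f" "smooth_fun g"
  shows "(deriv ^^ m) (\<lambda>t. a * f t + b * g t) = (\<lambda>t. a * (deriv ^^ m) f t + b * (deriv ^^ m) g t)"
proof (induction m)
  case (Suc m)
  have "deriv (\<lambda>t. a * (deriv ^^ m) f t + b * (deriv ^^ m) g t) = (\<lambda>t. a * (deriv ^^ Suc m) f t + b * (deriv ^^ Suc m) g t)"
  proof
    fix t
    show "deriv (\<lambda>t. a * (deriv ^^ m) f t + b * (deriv ^^ m) g t) t = a * (deriv ^^ Suc m) f t + b * (deriv ^^ Suc m) g t"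
      by (intro DERIV_imp_deriv DERIV_add DERIV_cmult smooth_higher_deriv assms)
  qed
  then show ?case by (simp only: Suc funpow.simps comp_def)
qed simp

text \<open>The difference quotients \<open>G j\<close> with step $2^{-j}$ converge geometrically, with all their derivatives.\<close>

lemma smooth2_partial_aux:
  assumes F: "smooth2 F"
  shows "smooth_fun (\<lambda>t. deriv (F t) 0)"
proof -
  define h :: "nat \<Rightarrow> real" where "h j = (1 / 2) ^ j" for j
  define G where "G j t = 2 ^ j * F t (h j) + (- (2 ^ j)) * F t 0" for j t
  define d where "d j t = 1 * G (Suc j) t + (- 1) * G j t" for j t
  have sF: "smooth_fun (\<lambda>t. F t s)" for s by (rule smooth2_fst[OF F])
  have sG: "smooth_fun (G j)" for j
    unfolding G_def by (intro smooth_add smooth_mult smooth_const sF)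
  have h: "0 < h j" "h j \<le> 1" for j by (auto simp: h_def power_le_one)
  have mild: "mild_growth d"
    unfolding mild_growth_def
  proof (intro conjI allI)
    show "smooth_fun (d j)" for j unfolding d_def by (intro smooth_add smooth_mult smooth_const sG)
    fix m R
    obtain B where B: "\<And>t s. \<bar>t\<bar> \<le> max R 1 \<Longrightarrow> \<bar>s\<bar> \<le> max R 1 \<Longrightarrow> \<bar>(deriv ^^ m) (\<lambda>t. F t s) t\<bar> \<le> B"
      using smooth2_bounded[OF F] by blast
    have bG: "\<bar>(deriv ^^ m) (G j) t\<bar> \<le> 2 * B * 2 ^ j" if "\<bar>t\<bar> \<le> R" for j t
    proof -
      have "(deriv ^^ m) (G j) t = 2 ^ j * (deriv ^^ m) (\<lambda>t. F t (h j)) t + (- (2 ^ j)) * (deriv ^^ m) (\<lambda>t. F t 0) t"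
        unfolding G_def by (simp only: higher_deriv_lincomb[OF sF sF])
      also have "\<bar>\<dots>\<bar> \<le> 2 ^ j * \<bar>(deriv ^^ m) (\<lambda>t. F t (h j)) t\<bar> + 2 ^ j * \<bar>(deriv ^^ m) (\<lambda>t. F t 0) t\<bar>"
        using abs_triangle_ineq[of "2 ^ j * (deriv ^^ m) (\<lambda>t. F t (h j)) t" "(- (2 ^ j)) * (deriv ^^ m) (\<lambda>t. F t 0) t"]
        by (simp add: abs_mult)
      also have "\<dots> \<le> 2 ^ j * B + 2 ^ j * B"
        using that h[of j] by (intro add_mono mult_left_mono B) (auto simp: abs_if)
      finally show ?thesis by simp
    qed
    have "\<bar>(deriv ^^ m) (d j) t\<bar> \<le> 6 * B * 2 ^ j" if "\<bar>t\<bar> \<le> R" for j t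
    proof -
      have "(deriv ^^ m) (d j) t = 1 * (deriv ^^ m) (G (Suc j)) t + (- 1) * (deriv ^^ m) (G j) t"
        unfolding d_def by (simp only: higher_deriv_lincomb[OF sG sG])
      then show ?thesis using bG[OF that, of j] bG[OF that, of "Suc j"] by simp
    qed
    then show "\<exists>C. \<forall>j t. \<bar>t\<bar> \<le> R \<longrightarrow> \<bar>(deriv ^^ m) (d j) t\<bar> \<le> C * 2 ^ j" by blast
  qed
  \<comment> \<open>Second-order Taylor expansion of \<open>F t\<close> at 0: the error of the
    difference quotient is the step 2^(-j) times a bounded second derivative.\<close>
  have approx: "\<exists>B. \<forall>j t. \<bar>t\<bar> \<le> R \<longrightarrow> \<bar>G j t - deriv (F t) 0\<bar> \<le> B * (1 / 2) ^ j" for R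
  proof -
    obtain B where B: "\<And>s t. \<bar>s\<bar> \<le> max R 1 \<Longrightarrow> \<bar>t\<bar> \<le> max R 1 \<Longrightarrow> \<bar>(deriv ^^ 2) (\<lambda>s. F t s) s\<bar> \<le> B"
      using smooth2_bounded[OF smooth2_swap[OF F]] by blast
    have "\<bar>G j t - deriv (F t) 0\<bar> \<le> B * (1 / 2) ^ j" if t: "\<bar>t\<bar> \<le> R" for j t
    proof -
      have "\<forall>m x. ((deriv ^^ m) (F t) has_real_derivative (deriv ^^ Suc m) (F t) x) (at x)"
        using smooth_higher_deriv[OF smooth2_snd[OF F]] by blast
      from Maclaurin_all_le[OF _ this, of "F t" "h j" 2] obtain y where
        y: "\<bar>y\<bar> \<le> \<bar>h j\<bar>" "F t (h j) = F t 0 + deriv (F t) 0 * h j + (deriv ^^ 2) (F t) y / 2 * (h j)\<^sup>2"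
        by (auto simp: numeral_2_eq_2)
      have hh: "2 ^ j * h j = 1" by (simp add: h_def power_one_over)
      have "G j t = 2 ^ j * (F t (h j) - F t 0)" by (simp add: G_def algebra_simps)
      also have "\<dots> = 2 ^ j * h j * (deriv (F t) 0 + (deriv ^^ 2) (F t) y / 2 * h j)"
        unfolding y(2) by (simp add: algebra_simps power2_eq_square)
      finally have "G j t - deriv (F t) 0 = (deriv ^^ 2) (F t) y / 2 * h j" by (simp add: hh)
      then have "\<bar>G j t - deriv (F t) 0\<bar> = \<bar>(deriv ^^ 2) (F t) y\<bar> / 2 * h j"
        using h(1)[of j] by (simp only: abs_mult abs_divide abs_of_pos abs_numeral)
      also have "\<dots> \<le> B * h j"
      proof (rule mult_right_mono)
        have "\<bar>(deriv ^^ 2) (F t) y\<bar> \<le> B" using B[of y t] y(1) h[of j] t by auto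
        then show "\<bar>(deriv ^^ 2) (F t) y\<bar> / 2 \<le> B" by linarith
      qed (use h[of j] in simp)
      finally show ?thesis by (simp add: h_def)
    qed
    then show ?thesis by blast
  qed
  have decay: "geom_decay d"
    unfolding geom_decay_def
  proof
    fix R :: real
    obtain B where B: "\<And>j t. \<bar>t\<bar> \<le> R \<Longrightarrow> \<bar>G j t - deriv (F t) 0\<bar> \<le> B * (1 / 2) ^ j"
      using approx by blast
    have "\<bar>d j t\<bar> \<le> (3 / 2 * B) * (1 / 2) ^ j" if "\<bar>t\<bar> \<le> R" for j t
    proof -
      have "\<bar>G (Suc j) t - deriv (F t) 0\<bar> \<le> B * (1 / 2) ^ j / 2" using B[OF that, of "Suc j"] by simp
      then show ?thesis using B[OF that, of j] unfolding d_def by linarith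
    qed
    then show "\<exists>C \<rho>. 0 < \<rho> \<and> \<rho> < 1 \<and> (\<forall>j t. \<bar>t\<bar> \<le> R \<longrightarrow> \<bar>d j t\<bar> \<le> C * \<rho> ^ j)"
      by (intro exI[of _ "3 / 2 * B"] exI[of _ "1 / 2"]) auto
  qed
  have "(\<lambda>j. G j t) \<longlonglongrightarrow> deriv (F t) 0" for t
  proof -
    obtain B where B: "\<And>j. \<bar>G j t - deriv (F t) 0\<bar> \<le> B * (1 / 2) ^ j" using approx[of "\<bar>t\<bar>"] by blast
    have lim0: "(\<lambda>j. B * (1 / 2) ^ j) \<longlonglongrightarrow> 0"
      by (rule tendsto_mult_right_zero[OF LIMSEQ_realpow_zero]) auto
    have "(\<lambda>j. G j t - deriv (F t) 0) \<longlonglongrightarrow> 0"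
      by (rule Lim_null_comparison[OF _ lim0], rule always_eventually, rule allI, unfold real_norm_def, rule B)
    then show ?thesis by (simp add: LIM_zero_iff)
  qed
  \<comment> \<open>Telescoping: the partial derivative is the first difference quotient plus the
    sum of all successive corrections, and that sum is smooth in \<open>t\<close>.\<close>
  then have "(\<lambda>j. d j t) sums (deriv (F t) 0 - G 0 t)" for t
    using telescope_sums[of "\<lambda>j. G j t" "deriv (F t) 0"] by (simp add: d_def)
  then have "deriv (F t) 0 = (\<Sum>j. d j t) + G 0 t" for t
    using sums_unique[of "\<lambda>j. d j t" "deriv (F t) 0 - G 0 t"] by simp
  then show ?thesis using smooth_add[OF smooth_geom_series[OF mild decay] sG[of 0]] by simp
qed

text \<open>Following a curve moves the point of differentiation to 0: s \<mapsto>
  \<open>F (x r) (y r + s)\<close> depends smoothly on \<open>r\<close> and \<open>s\<close>, and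
  its derivative at s = 0 is the partial derivative at \<open>y r\<close>.\<close>

lemma smooth2_partial:
  assumes F: "smooth2 F" shows "smooth2 (\<lambda>t. deriv (F t))"
  unfolding smooth2_def
proof (intro allI impI)
  fix x y assume xy: "smooth_fun x" "smooth_fun y"
  have "smooth2 (\<lambda>r s. F (x r) (y r + s))"
    unfolding smooth2_def
    by (intro allI impI smooth2D[OF F] smooth_add smooth_compose[OF xy(1)] smooth_compose[OF xy(2)])
  then have "smooth_fun (\<lambda>r. deriv (\<lambda>s. F (x r) (y r + s)) 0)" by (rule smooth2_partial_aux)
  moreover have "deriv (\<lambda>s. F (x r) (y r + s)) 0 = deriv (F (x r)) (y r)" for r
    using higher_deriv_affine[OF smooth2_snd[OF F, of "x r"], of 1 "y r" 1] by (simp add: fun_eq_iff)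
  ultimately show "smooth_fun (\<lambda>r. deriv (F (x r)) (y r))" by simp
qed

section \<open>Hadamard quotients as integrals\<close>

text \<open>Locally bounded first partial derivatives make the function Lipschitz in each variable.
  Joint continuity is what differentiation under the integral sign asks for.\<close>

lemma smooth2_continuous:
  assumes F: "smooth2 F" shows "isCont (\<lambda>z. F (fst z) (snd z)) z"
proof -
  define R where "R = \<bar>fst z\<bar> + \<bar>snd z\<bar> + 1"
  obtain B1 where B1: "\<And>t s. \<bar>t\<bar> \<le> R \<Longrightarrow> \<bar>s\<bar> \<le> R \<Longrightarrow> \<bar>(deriv ^^ 1) (\<lambda>t. F t s) t\<bar> \<le> B1"
    using smooth2_bounded[OF F] by blast
  obtain B2 where B2: "\<And>s t. \<bar>s\<bar> \<le> R \<Longrightarrow> \<bar>t\<bar> \<le> R \<Longrightarrow> \<bar>(deriv ^^ 1) (\<lambda>s. F t s) s\<bar> \<le> B2"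
    using smooth2_bounded[OF smooth2_swap[OF F]] by blast
  have lip1: "norm (F t s - F t' s) \<le> B1 * norm (t - t')" if "\<bar>t\<bar> \<le> R" "\<bar>t'\<bar> \<le> R" "\<bar>s\<bar> \<le> R" for t t' s
    by (rule field_differentiable_bound[where S = "{-R..R}" and f = "\<lambda>t. F t s"
          and f' = "deriv (\<lambda>t. F t s)"])
      (use that B1 in \<open>auto intro: has_field_derivative_at_within[OF smooth_fun_deriv(1)[OF smooth2_fst[OF F]]] simp: abs_le_iff\<close>)
  have lip2: "norm (F t s - F t s') \<le> B2 * norm (s - s')" if "\<bar>s\<bar> \<le> R" "\<bar>s'\<bar> \<le> R" "\<bar>t\<bar> \<le> R" for t s s'
    by (rule field_differentiable_bound[where S = "{-R..R}" and f = "F t"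
          and f' = "deriv (F t)"])
      (use that B2 in \<open>auto intro: has_field_derivative_at_within[OF smooth_fun_deriv(1)[OF smooth2_snd[OF F]]] simp: abs_le_iff\<close>)
  have "((\<lambda>w. F (fst w) (snd w) - F (fst z) (snd z)) \<longlongrightarrow> 0) (at z)"
  proof (rule Lim_null_comparison)
    show "\<forall>\<^sub>F w in at z. norm (F (fst w) (snd w) - F (fst z) (snd z))
        \<le> B1 * norm (fst w - fst z) + B2 * norm (snd w - snd z)"
      unfolding eventually_at
    proof (intro exI[of _ 1] conjI ballI impI)
      fix w assume "w \<noteq> z \<and> dist w z < 1"
      then have "\<bar>fst w - fst z\<bar> < 1" "\<bar>snd w - snd z\<bar> < 1"
        using dist_fst_le[of w z] dist_snd_le[of w z] by (auto simp: dist_real_def)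
      then have "\<bar>fst w\<bar> \<le> R" "\<bar>snd w\<bar> \<le> R" "\<bar>fst z\<bar> \<le> R" "\<bar>snd z\<bar> \<le> R" unfolding R_def by linarith+
      then have "norm (F (fst w) (snd w) - F (fst z) (snd w)) \<le> B1 * norm (fst w - fst z)"
          "norm (F (fst z) (snd w) - F (fst z) (snd z)) \<le> B2 * norm (snd w - snd z)"
        using lip1 lip2 by blast+
      then show "norm (F (fst w) (snd w) - F (fst z) (snd z)) \<le> B1 * norm (fst w - fst z) + B2 * norm (snd w - snd z)"
        by simp
    qed simp
    have "((\<lambda>w. B1 * norm (fst w - fst z) + B2 * norm (snd w - snd z)) \<longlongrightarrow>
        B1 * norm (fst z - fst z) + B2 * norm (snd z - snd z)) (at z)"
      by (intro tendsto_intros)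
    then show "((\<lambda>w. B1 * norm (fst w - fst z) + B2 * norm (snd w - snd z)) \<longlongrightarrow> 0) (at z)" by simp
  qed
  then show ?thesis unfolding isCont_def by (simp add: LIM_zero_iff)
qed

text \<open>Differentiating under the integral sign gives an integral of the same kind, since
  partial derivatives of \<open>smooth2\<close> functions are \<open>smooth2\<close>.\<close>

lemma smooth_integral:
  assumes "smooth2 K" shows "smooth_fun (\<lambda>r. integral {0..1} (\<lambda>x. K x r))"
proof (rule smooth_coinduct[where P = "\<lambda>g. \<exists>K. smooth2 K \<and> g = (\<lambda>r. integral {0..1} (\<lambda>x. K x r))"])
  show "\<exists>L. smooth2 L \<and> (\<lambda>r. integral {0..1} (\<lambda>x. K x r)) = (\<lambda>r. integral {0..1} (\<lambda>x. L x r))"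
    using assms by (intro exI[of _ K]) simp
next
  fix g assume "\<exists>K. smooth2 K \<and> g = (\<lambda>r. integral {0..1} (\<lambda>x. K x r))"
  then obtain K where K: "smooth2 K" and g: "g = (\<lambda>r. integral {0..1} (\<lambda>x. K x r))" by (elim exE conjE)
  have K': "smooth2 (\<lambda>x. deriv (K x))" by (rule smooth2_partial[OF K])
  have "(g has_real_derivative integral {0..1} (\<lambda>x. deriv (K x) r)) (at r)" for r
  proof -
    have "((\<lambda>r. integral (cbox 0 1) ((\<lambda>r x. K x r) r)) has_real_derivative integral (cbox 0 1) ((\<lambda>r x. deriv (K x) r) r)) (at r within UNIV)"
    proof (rule leibniz_rule_field_derivative)
      fix x t :: real
      show "((\<lambda>r. K t r) has_real_derivative deriv (K t) x) (at x within UNIV)"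
        using smooth_fun_deriv(1)[OF smooth2_snd[OF K]] by simp
      have "continuous_on {0..1} (\<lambda>t. K t x)"
        by (intro continuous_at_imp_continuous_on ballI smooth_fun_cont smooth2_fst[OF K])
      then show "(\<lambda>t. K t x) integrable_on cbox 0 1" by (simp add: integrable_continuous_real)
    next
      have "continuous_on UNIV (\<lambda>z. deriv (K (fst (prod.swap z))) (snd (prod.swap z)))"
        by (intro continuous_at_imp_continuous_on ballI isCont_o2[where f = prod.swap and g = "\<lambda>z. deriv (K (fst z)) (snd z)"]
            smooth2_continuous[OF K'] isCont_swap)
      then show "continuous_on (UNIV \<times> cbox 0 1) (\<lambda>(x, t). deriv (K t) x)"
        by (rule continuous_on_subset[OF continuous_on_eq]) auto
    qed auto
    then show ?thesis by (simp add: g)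
  qed
  then show "\<exists>f'. (\<exists>K. smooth2 K \<and> f' = (\<lambda>r. integral {0..1} (\<lambda>x. K x r))) \<and> (\<forall>x. (g has_real_derivative f' x) (at x))"
    using K' by (intro exI[of _ "\<lambda>r. integral {0..1} (\<lambda>x. deriv (K x) r)"] conjI allI exI[of _ "\<lambda>x. deriv (K x)"]) auto
qed

definition quo :: "(real \<Rightarrow> real) \<Rightarrow> real \<Rightarrow> real" where
  "quo f s = (if s = 0 then deriv f 0 else (f s - f 0) / s)"

text \<open>The fundamental theorem along the segment from 0 to \<open>s\<close>. The integral has
  no exceptional case at \<open>s = 0\<close>, so smooth dependence on everything can be read
  off.\<close>

lemma quo_eq_integral:
  assumes "smooth_fun f" shows "quo f s = integral {0..1} (\<lambda>x. deriv f (x * s))"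
proof (cases "s = 0")
  case False
  have "((\<lambda>x. deriv f (x * s)) has_integral (f (1 * s) / s - f (0 * s) / s)) {0..1}"
  proof (rule fundamental_theorem_of_calculus)
    fix x :: real
    have "((\<lambda>x. x * s) has_real_derivative s) (at x)" by (auto intro!: derivative_eq_intros)
    from DERIV_cdivide[OF DERIV_chain2[OF smooth_fun_deriv(1)[OF assms] this], of s]
    have "((\<lambda>x. f (x * s) / s) has_real_derivative deriv f (x * s)) (at x)" using False by simp
    then show "((\<lambda>x. f (x * s) / s) has_vector_derivative deriv f (x * s)) (at x within {0..1})"
      unfolding has_real_derivative_iff_has_vector_derivative [symmetric] by (rule has_field_derivative_at_within)
  qed simp
  then show ?thesis using False by (simp add: quo_def integral_unique diff_divide_distrib)
qed (simp add: quo_def)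

text \<open>Hadamard's lemma with a parameter \<open>r\<close>, in which the numerator and the point
  of evaluation both move with \<open>r\<close>. All expansions below rest on it.\<close>

lemma smooth_quo:
  assumes F: "smooth2 F" and \<sigma>: "smooth_fun \<sigma>"
  shows "smooth_fun (\<lambda>r. quo (\<lambda>s. F s r) (\<sigma> r))"
proof -
  have D: "smooth2 (\<lambda>r. deriv (\<lambda>s. F s r))" by (rule smooth2_partial[OF smooth2_swap[OF F]])
  have "smooth2 (\<lambda>x r. deriv (\<lambda>s. F s r) (x * \<sigma> r))"
    unfolding smooth2_def by (intro allI impI smooth2D[OF D] smooth_mult smooth_compose[OF \<sigma>])
  from smooth_integral[OF this] show ?thesis by (simp add: quo_eq_integral[OF smooth2_fst[OF F]])
qed

section \<open>Smooth functions of several variables and Taylor coefficients\<close>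

text \<open>The domain consists of all families, with no bound on the number of variables. Functions
  on \<open>Rn k\<close> are handled through composition with \<open>trunc k\<close>, which keeps
  side conditions on the domain out of the calculations.\<close>

definition smoothn :: "(('i \<Rightarrow> real) \<Rightarrow> real) \<Rightarrow> bool" where
  "smoothn f \<longleftrightarrow> (\<forall>v. (\<forall>i. smooth_fun (\<lambda>t. v t i)) \<longrightarrow> smooth_fun (\<lambda>t. f (v t)))"

text \<open>The first argument holds parameters, the second the variables in which quotients and
  Taylor coefficients are taken.\<close>

definition smoothp :: "(('j \<Rightarrow> real) \<Rightarrow> ('i \<Rightarrow> real) \<Rightarrow> real) \<Rightarrow> bool" where
  "smoothp G \<longleftrightarrow> (\<forall>c v. (\<forall>j. smooth_fun (\<lambda>t. c t j)) \<longrightarrow> (\<forall>i. smooth_fun (\<lambda>t. v t i)) \<longrightarrow>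
     smooth_fun (\<lambda>t. G (c t) (v t)))"

lemma smoothnD: "smoothn f \<Longrightarrow> (\<And>i. smooth_fun (\<lambda>t. v t i)) \<Longrightarrow> smooth_fun (\<lambda>t. f (v t))"
  unfolding smoothn_def by blast

lemma smoothpD: "smoothp G \<Longrightarrow> (\<And>j. smooth_fun (\<lambda>t. c t j)) \<Longrightarrow> (\<And>i. smooth_fun (\<lambda>t. v t i)) \<Longrightarrow>
    smooth_fun (\<lambda>t. G (c t) (v t))"
  unfolding smoothp_def by blast

lemma smoothn_const [simp, intro]: "smoothn (\<lambda>v. c)"
  unfolding smoothn_def by simp

lemma smoothn_coord [simp, intro]: "smoothn (\<lambda>v. v i)"
  unfolding smoothn_def by simp

lemma smoothn_add: "smoothn f \<Longrightarrow> smoothn g \<Longrightarrow> smoothn (\<lambda>v. f v + g v)"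
  unfolding smoothn_def by (simp add: smooth_add)

lemma smoothn_mult: "smoothn f \<Longrightarrow> smoothn g \<Longrightarrow> smoothn (\<lambda>v. f v * g v)"
  unfolding smoothn_def by (simp add: smooth_mult)

lemma smoothn_diff: "smoothn f \<Longrightarrow> smoothn g \<Longrightarrow> smoothn (\<lambda>v. f v - g v)"
  unfolding smoothn_def by (simp add: smooth_diff)

lemma smoothn_sum: "(\<And>i. i \<in> A \<Longrightarrow> smoothn (f i)) \<Longrightarrow> smoothn (\<lambda>v. \<Sum>i\<in>A. f i v)"
  unfolding smoothn_def by (simp add: smooth_sum)

lemma smoothn_compose:
  assumes "smoothn f" "\<And>i. smoothn (\<lambda>v. g v i)" shows "smoothn (\<lambda>v. f (g v))"
  unfolding smoothn_def by (intro allI impI smoothnD[OF assms(1)] smoothnD[OF assms(2)]) simp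

lemma smoothn_if [intro]: "smoothn f \<Longrightarrow> smoothn g \<Longrightarrow> smoothn (\<lambda>v. if P then f v else g v)"
  by (cases P) simp_all

lemma smooth_if [intro]: "smooth_fun f \<Longrightarrow> smooth_fun g \<Longrightarrow> smooth_fun (\<lambda>v. if P then f v else g v)"
  by (cases P) simp_all

lemma smoothn_trunc: "smoothn f \<Longrightarrow> smoothn (\<lambda>v. f (trunc k v))"
  by (erule smoothn_compose[where f = f and g = "trunc k"]) (simp add: trunc_def smoothn_if)

lemma smoothp_fst: "smoothp G \<Longrightarrow> smoothn (\<lambda>e. G e v)"
  unfolding smoothp_def smoothn_def by simp

lemma smoothp_snd: "smoothp G \<Longrightarrow> smoothn (G e)"
  unfolding smoothp_def smoothn_def by simp

lemma smoothp_of_snd: "smoothn f \<Longrightarrow> smoothp (\<lambda>e. f)"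
  unfolding smoothp_def smoothn_def by simp

text \<open>The Hadamard quotient in the variable \<open>i\<close>, with the remaining variables as
  parameters.\<close>

definition Q :: "'i \<Rightarrow> (('i \<Rightarrow> real) \<Rightarrow> real) \<Rightarrow> ('i \<Rightarrow> real) \<Rightarrow> real" where
  "Q i f v = quo (\<lambda>s. f (v(i := s))) (v i)"

text \<open>Along a curve, the replaced variable and the time of the curve are the two variables of
  a \<open>smooth2\<close> function, to which \<open>smooth_quo\<close> applies.\<close>

lemma smoothp_Q:
  assumes G: "smoothp G" shows "smoothp (\<lambda>e. Q i (G e))"
  unfolding smoothp_def Q_def
proof (intro allI impI)
  fix c :: "real \<Rightarrow> 'a \<Rightarrow> real" and v :: "real \<Rightarrow> 'b \<Rightarrow> real"
  assume c: "\<forall>j. smooth_fun (\<lambda>t. c t j)" and v: "\<forall>i. smooth_fun (\<lambda>t. v t i)"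
  have "smooth2 (\<lambda>s t. G (c t) ((v t)(i := s)))"
    unfolding smooth2_def
  proof (intro allI impI smoothpD[OF G])
    fix x y :: "real \<Rightarrow> real" and j assume xy: "smooth_fun x" "smooth_fun y"
    show "smooth_fun (\<lambda>r. c (y r) j)" using smooth_compose[of "\<lambda>t. c t j"] c xy by blast
    fix k
    show "smooth_fun (\<lambda>r. ((v (y r))(i := x r)) k)"
      using smooth_compose[of "\<lambda>t. v t k" y] v xy by (cases "k = i") auto
  qed
  then show "smooth_fun (\<lambda>t. quo (\<lambda>s. G (c t) ((v t)(i := s))) (v t i))"
    using v by (intro smooth_quo) auto
qed

lemma smoothn_Q: "smoothn f \<Longrightarrow> smoothn (Q i f)"
  using smoothp_snd[OF smoothp_Q[OF smoothp_of_snd]] .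

lemma smooth_section: "smoothn f \<Longrightarrow> smooth_fun (\<lambda>s. f (v(i := s)))"
  by (erule smoothnD[where f = f and v = "\<lambda>s. v(i := s)"]) (simp add: fun_upd_def smooth_if)

lemma Q_expand: "f v = f (v(i := 0)) + v i * Q i f v"
proof (cases "v i = 0")
  case True
  then have "v(i := 0) = v" by auto
  then show ?thesis using True by simp
qed (simp add: Q_def quo_def)

lemma Q_const [simp]: "Q i (\<lambda>v. c) = (\<lambda>v. 0)"
  by (simp add: Q_def quo_def fun_eq_iff)

lemma quo_lincomb:
  assumes "smooth_fun f" "smooth_fun g"
  shows "quo (\<lambda>s. f s + c * g s) s = quo f s + c * quo g s"
proof -
  have "deriv (\<lambda>s. f s + c * g s) 0 = deriv f 0 + c * deriv g 0"
    by (intro DERIV_imp_deriv DERIV_add DERIV_cmult smooth_fun_deriv assms)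
  then show ?thesis unfolding quo_def by (simp add: field_simps)
qed

lemma Q_lincomb:
  "smoothn f \<Longrightarrow> smoothn g \<Longrightarrow> Q i (\<lambda>v. f v + c * g v) = (\<lambda>v. Q i f v + c * Q i g v)"
  unfolding Q_def by (simp add: quo_lincomb smooth_section)

lemma Q_var_same:
  assumes "smoothn b" shows "Q i (\<lambda>v. v i * b v) = b"
proof
  fix v
  have "((\<lambda>s. s * b (v(i := s))) has_real_derivative 1 * b (v(i := 0)) + deriv (\<lambda>s. b (v(i := s))) 0 * 0) (at 0)"
    by (intro DERIV_mult DERIV_ident smooth_fun_deriv(1) smooth_section assms)
  then have "deriv (\<lambda>s. s * b (v(i := s))) 0 = b (v(i := 0))" by (simp add: DERIV_imp_deriv)
  moreover have "v i = 0 \<Longrightarrow> v(i := 0) = v" by auto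
  ultimately show "Q i (\<lambda>v. v i * b v) v = b v"
    by (simp add: Q_def quo_def)
qed

lemma Q_var_other:
  assumes "smoothn b" "i \<noteq> j" shows "Q i (\<lambda>v. v j * b v) = (\<lambda>v. v j * Q i b v)"
proof
  fix v
  have "Q i (\<lambda>v. v j * b v) v = quo (\<lambda>s. 0 + v j * b (v(i := s))) (v i)" using assms(2) by (simp add: Q_def)
  also have "\<dots> = quo (\<lambda>s. 0) (v i) + v j * quo (\<lambda>s. b (v(i := s))) (v i)"
    by (rule quo_lincomb) (auto intro: smooth_section assms)
  finally show "Q i (\<lambda>v. v j * b v) v = v j * Q i b v" by (simp add: Q_def quo_def)
qed

lemma Q_trunc: "i < k \<Longrightarrow> Q i (\<lambda>v. f (trunc k v)) = (\<lambda>v. Q i f (trunc k v))"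
proof
  fix v assume "i < k"
  then have "trunc k (v(i := s)) = (trunc k v)(i := s)" for s by (auto simp: trunc_def)
  with \<open>i < k\<close> show "Q i (\<lambda>v. f (trunc k v)) v = Q i f (trunc k v)"
    by (simp add: Q_def) (simp add: trunc_def)
qed

section \<open>Taylor coefficients\<close>

text \<open>Taylor coefficients at 0 as iterated quotients, so that no factorials occur.\<close>

primrec tcl :: "nat list \<Rightarrow> (vec \<Rightarrow> real) \<Rightarrow> real" where
  "tcl [] f = f (\<lambda>_. 0)"
| "tcl (i # l) f = tcl l (Q i f)"

text \<open>Sorting fixes the order in which the quotients are taken; the rule
  \<open>tc_var\<close>, by which coefficients are computed, does not mention that order.\<close>

definition tc :: "nat multiset \<Rightarrow> (vec \<Rightarrow> real) \<Rightarrow> real" where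
  "tc K f = tcl (sorted_list_of_multiset K) f"

lemma tcl_lincomb:
  "smoothn f \<Longrightarrow> smoothn g \<Longrightarrow> tcl l (\<lambda>v. f v + c * g v) = tcl l f + c * tcl l g"
  by (induction l arbitrary: f g) (simp_all add: Q_lincomb smoothn_Q)

lemma tcl_const: "tcl l (\<lambda>v. c) = (if l = [] then c else 0)"
  by (induction l arbitrary: c) auto

text \<open>The quotient in the variable \<open>i\<close> cancels the factor, and every quotient in
  another variable passes over it. So the factor survives until the first occurrence of
  \<open>i\<close> in the list consumes it.\<close>

lemma tcl_var:
  "smoothn b \<Longrightarrow> tcl l (\<lambda>v. v i * b v) = (if i \<in> set l then tcl (remove1 i l) b else 0)"
proof (induction l arbitrary: b)
  case (Cons j l)
  show ?case
  proof (cases "i = j")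
    case True
    then show ?thesis using Q_var_same[OF Cons.prems, of i] by simp
  next
    case False
    then have "tcl (j # l) (\<lambda>v. v i * b v) = tcl l (\<lambda>v. v i * Q j b v)"
      using Q_var_other[OF Cons.prems, of j i] by simp
    also have "\<dots> = (if i \<in> set l then tcl (remove1 i l) (Q j b) else 0)"
      by (rule Cons.IH[OF smoothn_Q[OF Cons.prems]])
    finally show ?thesis using False by simp
  qed
qed simp

lemma tcl_trunc: "set l \<subseteq> {..<k} \<Longrightarrow> tcl l (\<lambda>v. f (trunc k v)) = tcl l f"
proof (induction l arbitrary: f)
  case Nil then show ?case by (simp add: trunc_def)
next
  case (Cons i l)
  then show ?case using Cons.IH[of "Q i f"] by (simp add: Q_trunc)
qed

lemma smooth_tcl: "smoothp G \<Longrightarrow> smoothn (\<lambda>e. tcl l (G e))"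
proof (induction l arbitrary: G)
  case Nil then show ?case by (simp add: smoothp_fst)
next
  case (Cons i l) then show ?case using Cons.IH[OF smoothp_Q[OF Cons.prems]] by simp
qed

lemma sorted_list_of_multiset_minus:
  "sorted_list_of_multiset (K - {#i#}) = remove1 i (sorted_list_of_multiset K)"
proof -
  let ?l = "remove1 i (sorted_list_of_multiset K)"
  have "sorted ?l" by (intro sorted_remove1) simp
  moreover have "mset ?l = K - {#i#}" by simp
  ultimately show ?thesis by (metis sorted_list_of_multiset_mset sorted_sort_id)
qed

lemma tc_lincomb: "smoothn f \<Longrightarrow> smoothn g \<Longrightarrow> tc K (\<lambda>v. f v + c * g v) = tc K f + c * tc K g"
  unfolding tc_def by (rule tcl_lincomb)

lemma tc_const: "tc K (\<lambda>v. c) = (if K = {#} then c else 0)"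
  unfolding tc_def by (simp add: tcl_const) (metis mset_sorted_list_of_multiset mset_zero_iff sorted_list_of_multiset_empty)

lemma tc_empty [simp]: "tc {#} f = f (\<lambda>_. 0)"
  by (simp add: tc_def)

lemma tc_var:
  "smoothn b \<Longrightarrow> tc K (\<lambda>v. v i * b v) = (if i \<in># K then tc (K - {#i#}) b else 0)"
  unfolding tc_def by (simp add: tcl_var sorted_list_of_multiset_minus)

lemma tc_add: "smoothn f \<Longrightarrow> smoothn g \<Longrightarrow> tc K (\<lambda>v. f v + g v) = tc K f + tc K g"
  using tc_lincomb[of f g K 1] by simp

lemma tc_diff: "smoothn f \<Longrightarrow> smoothn g \<Longrightarrow> tc K (\<lambda>v. f v - g v) = tc K f - tc K g"
  using tc_lincomb[of f g K "-1"] by simp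

lemma tc_cmult: "smoothn f \<Longrightarrow> tc K (\<lambda>v. c * f v) = c * tc K f"
  using tc_lincomb[of "\<lambda>_. 0" f K c] by (simp add: tc_const)

lemma tc_sum: "(\<And>i. i \<in> A \<Longrightarrow> smoothn (f i)) \<Longrightarrow> tc K (\<lambda>v. \<Sum>i\<in>A. f i v) = (\<Sum>i\<in>A. tc K (f i))"
proof (induction A rule: infinite_finite_induct)
  case (insert i A)
  then show ?case by (simp add: tc_add smoothn_sum)
qed (simp_all add: tc_const)

lemma tc_trunc: "set_mset K \<subseteq> {..<k} \<Longrightarrow> tc K (\<lambda>v. f (trunc k v)) = tc K f"
  unfolding tc_def by (rule tcl_trunc) simp

lemma smooth_tc: "smoothp G \<Longrightarrow> smoothn (\<lambda>e. tc K (G e))"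
  unfolding tc_def by (rule smooth_tcl)

definition mpow :: "nat multiset \<Rightarrow> vec \<Rightarrow> real" where
  "mpow K v = (\<Prod>i\<in>#K. v i)"

lemma mpow_empty [simp]: "mpow {#} v = 1"
  and mpow_add_mset [simp]: "mpow (add_mset i K) v = v i * mpow K v"
  and mpow_union: "mpow (K + L) v = mpow K v * mpow L v"
  by (simp_all add: mpow_def)

lemma smoothn_mpow: "smoothn (mpow K)"
proof (induction K)
  case empty show ?case using smoothn_const[of 1] by (simp add: mpow_def)
next
  case (add i K)
  have "mpow (add_mset i K) = (\<lambda>v. v i * mpow K v)" by (simp add: fun_eq_iff)
  then show ?case using smoothn_mult[OF smoothn_coord add] by simp
qed

lemma mpow_trunc: "set_mset K \<subseteq> {..<k} \<Longrightarrow> mpow K (trunc k v) = mpow K v"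
  unfolding mpow_def by (intro arg_cong[where f = prod_mset] image_mset_cong) (auto simp: trunc_def)

lemma tc_mpow_mult:
  "smoothn b \<Longrightarrow> tc K (\<lambda>v. mpow L v * b v) = (if L \<subseteq># K then tc (K - L) b else 0)"
proof (induction L arbitrary: K)
  case (add i L)
  have "tc K (\<lambda>v. mpow (add_mset i L) v * b v) = tc K (\<lambda>v. v i * (mpow L v * b v))"
    by (simp add: mult.assoc)
  also have "\<dots> = (if i \<in># K then tc (K - {#i#}) (\<lambda>v. mpow L v * b v) else 0)"
    by (intro tc_var smoothn_mult smoothn_mpow add.prems)
  finally show ?case using add.IH[OF add.prems, of "K - {#i#}"]
    by (auto simp: insert_subset_eq_iff)
qed simp

lemma tc_mpow: "tc K (mpow L) = (if K = L then 1 else 0)"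
proof -
  have "tc K (mpow L) = tc K (\<lambda>v. mpow L v * 1)" by simp
  then show ?thesis unfolding tc_mpow_mult[OF smoothn_const]
    by (auto simp: tc_const subset_mset.diff_add[symmetric] dest: subset_mset.antisym) (metis add_cancel_right_right subset_mset.add_diff_inverse)
qed

text \<open>The variables are set to zero one after the other: passing from
  \<open>trunc (Suc k)\<close> to \<open>trunc k\<close> changes the value by the variable
  \<open>k\<close> times a Hadamard quotient.\<close>

lemma first_order_expansion:
  assumes "smoothn f"
  shows "\<exists>F. (\<forall>i. smoothn (F i)) \<and> (\<forall>v. f (trunc k v) = f (\<lambda>_. 0) + (\<Sum>i<k. v i * F i v))"
proof (induction k)
  case 0
  show ?case by (intro exI[of _ "\<lambda>i v. 0"]) (simp add: trunc_def)
next
  case (Suc k)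
  then obtain F where F: "\<And>i. smoothn (F i)" "\<And>v. f (trunc k v) = f (\<lambda>_. 0) + (\<Sum>i<k. v i * F i v)" by blast
  define F' where "F' i = (if i = k then (\<lambda>v. Q k f (trunc (Suc k) v)) else F i)" for i
  have "smoothn (F' i)" for i
    unfolding F'_def using F(1) smoothn_trunc[OF smoothn_Q[OF assms]] by simp
  moreover have "f (trunc (Suc k) v) = f (\<lambda>_. 0) + (\<Sum>i<Suc k. v i * F' i v)" for v
  proof -
    have "(trunc (Suc k) v)(k := 0) = trunc k v" "trunc (Suc k) v k = v k" by (auto simp: trunc_def)
    then have "f (trunc (Suc k) v) = f (trunc k v) + v k * Q k f (trunc (Suc k) v)"
      using Q_expand[of f "trunc (Suc k) v" k] by simp
    then show ?thesis by (simp add: F(2) F'_def)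
  qed
  ultimately show ?case by blast
qed

section \<open>Points and functions of R^k, and the ideals of infinitesimal objects\<close>

lemma pts_Rn: "x \<in> pts (Rn k) \<longleftrightarrow> (\<forall>i\<ge>k. x i = 0)"
  by (simp add: Rn_def)

lemma trunc_pts [simp]: "trunc k v \<in> pts (Rn k)"
  by (simp add: Rn_def trunc_def)

lemma trunc_id: "x \<in> pts (Rn k) \<Longrightarrow> trunc k x = x"
  by (auto simp: Rn_def trunc_def)

lemma zero_pts [simp]: "(\<lambda>_. 0) \<in> pts (Rn k)"
  by (simp add: Rn_def)

lemma curves_Rn: "c \<in> curves (Rn k) \<longleftrightarrow> (\<forall>t. c t \<in> pts (Rn k)) \<and> (\<forall>i. smooth_fun (\<lambda>t. c t i))"
  by (simp add: Rn_def)

text \<open>Truncating a family of smooth functions gives a curve of \<open>Rn k\<close>, and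
  truncation leaves the curves of \<open>Rn k\<close> as they are; so the two notions test the same
  composites.\<close>

lemma funs_Rn_iff: "f \<in> funs (Rn k) \<longleftrightarrow> smoothn (\<lambda>v. f (trunc k v))"
proof
  assume f: "f \<in> funs (Rn k)"
  show "smoothn (\<lambda>v. f (trunc k v))"
    unfolding smoothn_def
  proof (intro allI impI)
    fix v :: "real \<Rightarrow> vec" assume v: "\<forall>i. smooth_fun (\<lambda>t. v t i)"
    have "smooth_fun (\<lambda>t. trunc k (v t) i)" for i using v by (cases "i < k") (auto simp: trunc_def)
    then have "(\<lambda>t. trunc k (v t)) \<in> curves (Rn k)" by (simp add: curves_Rn)
    then show "smooth_fun (\<lambda>t. f (trunc k (v t)))" using f unfolding funs_def by (auto simp: comp_def)
  qed
next
  assume f: "smoothn (\<lambda>v. f (trunc k v))"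
  show "f \<in> funs (Rn k)"
    unfolding funs_def
  proof safe
    fix c assume c: "c \<in> curves (Rn k)"
    then have "smooth_fun (\<lambda>t. f (trunc k (c t)))" by (intro smoothnD[OF f]) (simp add: curves_Rn)
    moreover have "trunc k (c t) = c t" for t using c by (simp add: curves_Rn trunc_id)
    ultimately show "smooth_fun (f \<circ> c)" by (simp add: comp_def)
  qed
qed

lemma smoothn_funs: "smoothn f \<Longrightarrow> f \<in> funs (Rn k)"
  unfolding funs_Rn_iff by (rule smoothn_trunc)

lemma funs_mult: "f \<in> funs (Rn k) \<Longrightarrow> g \<in> funs (Rn k) \<Longrightarrow> (\<lambda>x. f x * g x) \<in> funs (Rn k)"
  unfolding funs_Rn_iff by (rule smoothn_mult)

lemma funs_add: "f \<in> funs (Rn k) \<Longrightarrow> g \<in> funs (Rn k) \<Longrightarrow> (\<lambda>x. f x + g x) \<in> funs (Rn k)"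
  unfolding funs_Rn_iff by (rule smoothn_add)

lemma ideal_cong:
  assumes "a \<in> ideal W" "\<And>x. x \<in> pts (Rn (nvars W)) \<Longrightarrow> a' x = a x" shows "a' \<in> ideal W"
  using assms unfolding ideal_def by simp

lemma ideal_zero [simp]: "(\<lambda>x. 0) \<in> ideal W"
  unfolding ideal_def by (intro CollectI exI[of _ "{}"]) simp

lemma ideal_gen: "g \<in> eqns W \<Longrightarrow> g \<in> ideal W"
  unfolding ideal_def by (intro CollectI exI[of _ "{g}"] exI[of _ "\<lambda>_ _. 1"]) (simp add: smoothn_funs)

lemma ideal_mult:
  assumes "a \<in> ideal W" "c \<in> funs (Rn (nvars W))" shows "(\<lambda>x. c x * a x) \<in> ideal W"
proof -
  obtain S b where "finite S" "S \<subseteq> eqns W" "\<forall>g\<in>S. b g \<in> funs (Rn (nvars W))"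
    "\<forall>x\<in>pts (Rn (nvars W)). a x = (\<Sum>g\<in>S. b g x * g x)"
    using assms(1) unfolding ideal_def by blast
  then show ?thesis unfolding ideal_def
    by (intro CollectI exI[of _ S] exI[of _ "\<lambda>g x. c x * b g x"])
      (simp add: sum_distrib_left mult.assoc funs_mult[OF assms(2)])
qed

lemma ideal_add:
  assumes "a \<in> ideal W" "a' \<in> ideal W" shows "(\<lambda>x. a x + a' x) \<in> ideal W"
proof -
  obtain S b where S: "finite S" "S \<subseteq> eqns W" "\<forall>g\<in>S. b g \<in> funs (Rn (nvars W))"
    "\<forall>x\<in>pts (Rn (nvars W)). a x = (\<Sum>g\<in>S. b g x * g x)"
    using assms(1) unfolding ideal_def by blast
  obtain S' b' where S': "finite S'" "S' \<subseteq> eqns W" "\<forall>g\<in>S'. b' g \<in> funs (Rn (nvars W))"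
    "\<forall>x\<in>pts (Rn (nvars W)). a' x = (\<Sum>g\<in>S'. b' g x * g x)"
    using assms(2) unfolding ideal_def by blast
  \<comment> \<open>Outside their own index set the coefficients are arbitrary, so they are set to 0
    there before they are added.\<close>
  define c where "c g x = (if g \<in> S then b g x else 0) + (if g \<in> S' then b' g x else 0)" for g x
  have "c g \<in> funs (Rn (nvars W))" if "g \<in> S \<union> S'" for g
  proof -
    have "(\<lambda>x. if g \<in> S then b g x else 0) \<in> funs (Rn (nvars W))" using S(3) by (cases "g \<in> S") (auto intro: smoothn_funs)
    moreover have "(\<lambda>x. if g \<in> S' then b' g x else 0) \<in> funs (Rn (nvars W))" using S'(3) by (cases "g \<in> S'") (auto intro: smoothn_funs)
    ultimately show ?thesis unfolding c_def [abs_def] by (rule funs_add)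
  qed
  moreover have "a x + a' x = (\<Sum>g\<in>S \<union> S'. c g x * g x)" if "x \<in> pts (Rn (nvars W))" for x
  proof -
    have "(\<Sum>g\<in>S \<union> S'. c g x * g x) = (\<Sum>g\<in>S \<union> S'. if g \<in> S then b g x * g x else 0) + (\<Sum>g\<in>S \<union> S'. if g \<in> S' then b' g x * g x else 0)"
      unfolding c_def by (simp add: distrib_right if_distrib[of "\<lambda>z. z * _"] sum.distrib cong: if_cong)
    also have "(\<Sum>g\<in>S \<union> S'. if g \<in> S then b g x * g x else 0) = (\<Sum>g\<in>S. b g x * g x)"
      using S(1) S'(1) by (intro sum.mono_neutral_cong_right) auto
    also have "(\<Sum>g\<in>S \<union> S'. if g \<in> S' then b' g x * g x else 0) = (\<Sum>g\<in>S'. b' g x * g x)"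
      using S(1) S'(1) by (intro sum.mono_neutral_cong_right) auto
    finally show ?thesis using S(4) S'(4) that by simp
  qed
  ultimately show ?thesis unfolding ideal_def using S(1,2) S'(1,2)
    by (intro CollectI exI[of _ "S \<union> S'"] exI[of _ c]) simp
qed

lemma ideal_cmult: "a \<in> ideal W \<Longrightarrow> (\<lambda>x. c * a x) \<in> ideal W"
  using ideal_mult[OF _ smoothn_funs[OF smoothn_const]] .

lemma ideal_sum: "(\<And>i. i \<in> A \<Longrightarrow> f i \<in> ideal W) \<Longrightarrow> (\<lambda>x. \<Sum>i\<in>A. f i x) \<in> ideal W"
  by (induction A rule: infinite_finite_induct) (simp_all add: ideal_add)

text \<open>Coefficients pull back to smooth functions, hence only the generators have to be
  checked.\<close>

lemma ideal_compose:
  assumes a: "a \<in> ideal W'" and g: "\<And>v. v \<in> pts (Rn (nvars W)) \<Longrightarrow> g v \<in> pts (Rn (nvars W'))"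
    and sg: "\<And>i. smoothn (\<lambda>v. g v i)"
    and e: "\<And>e. e \<in> eqns W' \<Longrightarrow> (\<lambda>v. e (g v)) \<in> ideal W"
  shows "(\<lambda>v. a (g v)) \<in> ideal W"
proof -
  obtain S b where S: "finite S" "S \<subseteq> eqns W'" "\<forall>e\<in>S. b e \<in> funs (Rn (nvars W'))"
    "\<forall>x\<in>pts (Rn (nvars W')). a x = (\<Sum>e\<in>S. b e x * e x)"
    using a unfolding ideal_def by blast
  have "(\<lambda>v. \<Sum>e\<in>S. b e (g v) * e (g v)) \<in> ideal W"
  proof (intro ideal_sum ideal_mult[of "\<lambda>v. _ (g v)"])
    fix x assume x: "x \<in> S"
    show "(\<lambda>v. x (g v)) \<in> ideal W" using e x S(2) by blast
    have "smoothn (\<lambda>v. b x (trunc (nvars W') (g (trunc (nvars W) v))))"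
      by (rule smoothn_compose[where f = "\<lambda>w. b x (trunc (nvars W') w)"])
        (use S(3) x sg smoothn_trunc funs_Rn_iff in blast)+
    then show "(\<lambda>v. b x (g v)) \<in> funs (Rn (nvars W))"
      unfolding funs_Rn_iff using g by (simp add: trunc_id)
  qed
  then show ?thesis by (rule ideal_cong) (use S(4) g in simp)
qed

lemma ideal_subset:
  assumes "nvars W = nvars W'" "\<And>g. g \<in> eqns W \<Longrightarrow> g \<in> ideal W'" shows "ideal W \<subseteq> ideal W'"
  using ideal_compose[of _ W W' "\<lambda>v. v"] assms by auto

lemma nvars_simps [simp]: "nvars (D_pow n) = n" "nvars (D_ord m) = 1" "nvars (D_jet p n) = p"
  by (simp_all add: D_pow_def D_ord_def D_jet_def)

lemma eqns_D_jet: "eqns (D_jet k N) = mpow ` {K. set_mset K \<subseteq> {..<k} \<and> size K = N + 1}"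
  by (auto simp: D_jet_def mpow_def [abs_def])

lemma eqns_D_pow: "eqns (D_pow n) = (\<lambda>i. mpow {#i, i#}) ` {..<n}"
  by (auto simp: D_pow_def mpow_def [abs_def] power2_eq_square)

lemma finite_jet_basis: "finite (jet_basis p n)"
proof (rule finite_subset)
  show "jet_basis p n \<subseteq> mset ` {xs. set xs \<subseteq> {..<p} \<and> length xs \<le> n}"
  proof
    fix K assume "K \<in> jet_basis p n"
    moreover obtain xs where "mset xs = K" using ex_mset by blast
    ultimately show "K \<in> mset ` {xs. set xs \<subseteq> {..<p} \<and> length xs \<le> n}"
      by (intro image_eqI[of _ _ xs]) (auto simp: jet_basis_def)
  qed
qed (simp add: finite_lists_length_le)

section \<open>Taylor expansion modulo the ideal of a jet object\<close>

lemma jet_ideal_var: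
  assumes "a \<in> ideal (D_jet k N)" "i < k" shows "(\<lambda>v. v i * a v) \<in> ideal (D_jet k (Suc N))"
proof -
  obtain S b where S: "finite S" "S \<subseteq> eqns (D_jet k N)" "\<forall>e\<in>S. b e \<in> funs (Rn k)"
    "\<forall>x\<in>pts (Rn k). a x = (\<Sum>e\<in>S. b e x * e x)"
    using assms(1) unfolding ideal_def by auto
  have "(\<lambda>v. \<Sum>e\<in>S. b e v * (v i * e v)) \<in> ideal (D_jet k (Suc N))"
  proof (rule ideal_sum, rule ideal_mult)
    fix e assume "e \<in> S"
    then obtain K where K: "e = mpow K" "set_mset K \<subseteq> {..<k}" "size K = N + 1"
      using S(2) by (auto simp: eqns_D_jet)
    have "mpow (add_mset i K) \<in> eqns (D_jet k (Suc N))"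
      unfolding eqns_D_jet using K assms(2) by (intro imageI) simp
    moreover have "(\<lambda>v. v i * e v) = mpow (add_mset i K)" by (simp add: K fun_eq_iff)
    ultimately show "(\<lambda>v. v i * e v) \<in> ideal (D_jet k (Suc N))" using ideal_gen by simp
    show "b e \<in> funs (Rn (nvars (D_jet k (Suc N))))" using S(3) \<open>e \<in> S\<close> by simp
  qed
  then show ?thesis by (rule ideal_cong) (use S(4) in \<open>simp add: sum_distrib_left mult_ac\<close>)
qed

lemma jet_sum_shift:
  assumes "i < k"
  shows "(\<Sum>K\<in>jet_basis k N. a K * (v i * mpow K v)) =
    (\<Sum>L\<in>jet_basis k (Suc N). (if i \<in># L then a (L - {#i#}) else 0) * mpow L v)"
proof -
  have "(\<Sum>L\<in>jet_basis k (Suc N). (if i \<in># L then a (L - {#i#}) else 0) * mpow L v)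
      = (\<Sum>L\<in>{L \<in> jet_basis k (Suc N). i \<in># L}. a (L - {#i#}) * mpow L v)"
    by (rule sum.mono_neutral_cong_right) (auto simp: finite_jet_basis)
  also have "\<dots> = (\<Sum>K\<in>jet_basis k N. a K * (v i * mpow K v))"
    by (rule sum.reindex_bij_witness[where j = "\<lambda>L. L - {#i#}" and i = "\<lambda>K. add_mset i K"])
      (use assms in \<open>auto simp: jet_basis_def size_Diff_singleton dest: in_diffD multi_member_split\<close>)
  finally show ?thesis by simp
qed

text \<open>Each quotient of the first-order expansion is expanded to one order less, and
  multiplication by its variable raises both the polynomial and the remainder by one order.\<close>

lemma taylor_expansion:
  "smoothn f \<Longrightarrow> \<exists>a. (\<lambda>v. f v - (\<Sum>K\<in>jet_basis k N. a K * mpow K v)) \<in> ideal (D_jet k N)"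
proof (induction N arbitrary: f)
  case 0
  obtain F where F: "\<And>i. smoothn (F i)" "\<And>v. f (trunc k v) = f (\<lambda>_. 0) + (\<Sum>i<k. v i * F i v)"
    using first_order_expansion[OF 0] by blast
  have "(\<lambda>v. \<Sum>i<k. F i v * v i) \<in> ideal (D_jet k 0)"
  proof (intro ideal_sum ideal_mult)
    fix i assume i: "i \<in> {..<k}"
    have "mpow {#i#} \<in> eqns (D_jet k 0)" unfolding eqns_D_jet using i by (intro imageI) simp
    then show "(\<lambda>v. v i) \<in> ideal (D_jet k 0)" using ideal_gen by (simp add: mpow_def [abs_def])
    show "F i \<in> funs (Rn (nvars (D_jet k 0)))" using F(1) by (intro smoothn_funs)
  qed
  moreover have "jet_basis k 0 = {{#}}" by (auto simp: jet_basis_def)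
  ultimately show ?case
  proof (intro exI[of _ "\<lambda>_. f (\<lambda>_. 0)"], elim ideal_cong)
    fix x assume "x \<in> pts (Rn (nvars (D_jet k 0)))"
    then have "f x = f (\<lambda>_. 0) + (\<Sum>i<k. x i * F i x)" using F(2)[of x] by (simp add: trunc_id)
    then show "f x - (\<Sum>K\<in>jet_basis k 0. f (\<lambda>_. 0) * mpow K x) = (\<Sum>i<k. F i x * x i)"
      using \<open>jet_basis k 0 = {{#}}\<close> by (simp add: mult.commute)
  qed
next
  case (Suc N)
  obtain F where F: "\<And>i. smoothn (F i)" "\<And>v. f (trunc k v) = f (\<lambda>_. 0) + (\<Sum>i<k. v i * F i v)"
    using first_order_expansion[OF Suc.prems] by blast
  obtain a where a: "\<And>i. (\<lambda>v. F i v - (\<Sum>K\<in>jet_basis k N. a i K * mpow K v)) \<in> ideal (D_jet k N)"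
    using Suc.IH[OF F(1)] by metis
  \<comment> \<open>A monomial \<open>L\<close> receives a contribution from every way of splitting
    off one of its variables.\<close>
  define a' where "a' L = (if L = {#} then f (\<lambda>_. 0) else 0) + (\<Sum>i<k. if i \<in># L then a i (L - {#i#}) else 0)" for L
  have "(\<lambda>v. \<Sum>i<k. v i * (F i v - (\<Sum>K\<in>jet_basis k N. a i K * mpow K v))) \<in> ideal (D_jet k (Suc N))"
    by (intro ideal_sum jet_ideal_var a) simp
  then show ?case
  proof (intro exI[of _ a'], elim ideal_cong)
    fix x assume x: "x \<in> pts (Rn (nvars (D_jet k (Suc N))))"
    have "(\<Sum>L\<in>jet_basis k (Suc N). a' L * mpow L x) = (\<Sum>L\<in>jet_basis k (Suc N). (if L = {#} then f (\<lambda>_. 0) else 0) * mpow L x)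
       + (\<Sum>L\<in>jet_basis k (Suc N). \<Sum>i<k. (if i \<in># L then a i (L - {#i#}) else 0) * mpow L x)"
      by (simp add: a'_def distrib_right sum.distrib sum_distrib_right)
    also have "(\<Sum>L\<in>jet_basis k (Suc N). (if L = {#} then f (\<lambda>_. 0) else 0) * mpow L x) = (\<Sum>L\<in>jet_basis k (Suc N). if L = {#} then f (\<lambda>_. 0) else 0)"
      by (intro sum.cong) auto
    also have "\<dots> = f (\<lambda>_. 0)" using finite_jet_basis[of k "Suc N"] by (simp add: sum.delta jet_basis_def)
    also have "(\<Sum>L\<in>jet_basis k (Suc N). \<Sum>i<k. (if i \<in># L then a i (L - {#i#}) else 0) * mpow L x)
        = (\<Sum>i<k. \<Sum>L\<in>jet_basis k (Suc N). (if i \<in># L then a i (L - {#i#}) else 0) * mpow L x)" by (rule sum.swap)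
    also have "\<dots> = (\<Sum>i<k. \<Sum>K\<in>jet_basis k N. a i K * (x i * mpow K x))"
      by (rule sum.cong[OF refl]) (simp only: jet_sum_shift lessThan_iff)
    finally have 1: "(\<Sum>L\<in>jet_basis k (Suc N). a' L * mpow L x) = f (\<lambda>_. 0) + (\<Sum>i<k. \<Sum>K\<in>jet_basis k N. a i K * (x i * mpow K x))" .
    have "f x = f (\<lambda>_. 0) + (\<Sum>i<k. x i * F i x)" using F(2)[of x] x by (simp add: trunc_id)
    then show "f x - (\<Sum>K\<in>jet_basis k (Suc N). a' K * mpow K x) = (\<Sum>i<k. x i * (F i x - (\<Sum>K\<in>jet_basis k N. a i K * mpow K x)))"
      unfolding 1 by (simp add: right_diff_distrib sum_subtractf sum_distrib_left mult_ac)
  qed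
qed

section \<open>Monomial bases of the Weil algebras\<close>

text \<open>The monomials in \<open>B\<close> represent a basis of the Weil algebra, with the Taylor coefficients as coordinates.\<close>

definition weil :: "infinitesimal \<Rightarrow> nat multiset set \<Rightarrow> bool" where
  "weil W B \<longleftrightarrow> finite B \<and> {#} \<in> B \<and> (\<forall>K\<in>B. set_mset K \<subseteq> {..<nvars W}) \<and>
    (\<forall>f. smoothn f \<longrightarrow> (f \<in> ideal W \<longleftrightarrow> (\<forall>K\<in>B. tc K f = 0)))"

text \<open>No generator divides a basis monomial, so multiples of generators have vanishing
  coefficients on \<open>B\<close>. Conversely, modulo the ideal a function is a combination of the
  monomials in \<open>B\<close>, and by the first half its coefficients there are the Taylor
  coefficients.\<close>

lemma weilI:
  assumes B: "finite B" "{#} \<in> B" "B \<subseteq> jet_basis (nvars W) N"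
    and gens: "\<And>g. g \<in> eqns W \<Longrightarrow> \<exists>L. g = mpow L \<and> set_mset L \<subseteq> {..<nvars W} \<and> (\<forall>K\<in>B. \<not> L \<subseteq># K)"
    and rest: "\<And>K. set_mset K \<subseteq> {..<nvars W} \<Longrightarrow> K \<notin> B \<Longrightarrow> size K \<le> Suc N \<Longrightarrow> mpow K \<in> ideal W"
  shows "weil W B"
  unfolding weil_def
proof (intro conjI B allI impI)
  define k where "k = nvars W"
  show "\<forall>K\<in>B. set_mset K \<subseteq> {..<nvars W}" using B(3) by (auto simp: jet_basis_def)
  have forw: "tc K f = 0" if f: "smoothn f" "f \<in> ideal W" and K: "K \<in> B" for f K
  proof -
    obtain S b where S: "finite S" "S \<subseteq> eqns W" "\<forall>g\<in>S. b g \<in> funs (Rn k)"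
      "\<forall>x\<in>pts (Rn k). f x = (\<Sum>g\<in>S. b g x * g x)"
      using f(2) unfolding ideal_def k_def by blast
    have sb: "smoothn (\<lambda>v. b g (trunc k v))" if "g \<in> S" for g using S(3) that by (simp add: funs_Rn_iff)
    have sg: "smoothn (\<lambda>v. g (trunc k v))" if "g \<in> S" for g
      using gens[of g] S(2) that smoothn_trunc[OF smoothn_mpow] by blast
    have Kk: "set_mset K \<subseteq> {..<k}" using B(3) K by (auto simp: jet_basis_def k_def)
    then have "tc K f = tc K (\<lambda>v. f (trunc k v))" by (simp add: tc_trunc)
    also have "\<dots> = tc K (\<lambda>v. \<Sum>g\<in>S. b g (trunc k v) * g (trunc k v))" using S(4) by simp
    also have "\<dots> = (\<Sum>g\<in>S. tc K (\<lambda>v. b g (trunc k v) * g (trunc k v)))"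
      using sb sg by (intro tc_sum smoothn_mult)
    also have "\<dots> = (\<Sum>g\<in>S. 0)"
    proof (intro sum.cong refl)
      fix g assume g: "g \<in> S"
      then obtain L where L: "g = mpow L" "set_mset L \<subseteq> {..<k}" "\<not> L \<subseteq># K"
        using gens[of g] S(2) K unfolding k_def by blast
      then have "(\<lambda>v. b g (trunc k v) * g (trunc k v)) = (\<lambda>v. mpow L v * b g (trunc k v))"
        by (simp add: mpow_trunc mult.commute)
      then show "tc K (\<lambda>v. b g (trunc k v) * g (trunc k v)) = 0"
        using tc_mpow_mult[OF sb[OF g], of K L] L(3) by simp
    qed
    finally show ?thesis by simp
  qed
  fix f :: "vec \<Rightarrow> real" assume f: "smoothn f"
  show "f \<in> ideal W \<longleftrightarrow> (\<forall>K\<in>B. tc K f = 0)"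
  proof
    assume 0: "\<forall>K\<in>B. tc K f = 0"
    obtain a where a: "(\<lambda>v. f v - (\<Sum>K\<in>jet_basis k N. a K * mpow K v)) \<in> ideal (D_jet k N)"
      using taylor_expansion[OF f] by blast
    \<comment> \<open>The remainder of the Taylor expansion is generated by monomials of size N + 1,
      which is why \<open>rest\<close> reaches up to \<open>Suc N\<close>.\<close>
    have sub: "ideal (D_jet k N) \<subseteq> ideal W"
    proof (rule ideal_subset)
      fix g assume "g \<in> eqns (D_jet k N)"
      then obtain K where K: "g = mpow K" "set_mset K \<subseteq> {..<k}" "size K = N + 1" by (auto simp: eqns_D_jet)
      moreover have "K \<notin> B" using B(3) K(3) by (auto simp: jet_basis_def)
      ultimately show "g \<in> ideal W" using rest[of K] by (simp add: k_def)
    qed (simp add: k_def)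
    have "(\<lambda>v. \<Sum>K\<in>jet_basis k N - B. a K * mpow K v) \<in> ideal W"
      by (intro ideal_sum ideal_cmult rest) (auto simp: jet_basis_def k_def)
    from ideal_add[OF subsetD[OF sub a] this]
    have mod: "(\<lambda>v. f v - (\<Sum>K\<in>B. a K * mpow K v)) \<in> ideal W"
    proof (rule ideal_cong)
      fix x
      have "(\<Sum>K\<in>jet_basis k N. a K * mpow K x) = (\<Sum>K\<in>jet_basis k N - B. a K * mpow K x) + (\<Sum>K\<in>B. a K * mpow K x)"
        using B(3) by (intro sum.subset_diff finite_jet_basis) (simp add: k_def)
      then show "f x - (\<Sum>K\<in>B. a K * mpow K x) = f x - (\<Sum>K\<in>jet_basis k N. a K * mpow K x) + (\<Sum>K\<in>jet_basis k N - B. a K * mpow K x)"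
        by simp
    qed
    have sp: "smoothn (\<lambda>v. \<Sum>K\<in>B. a K * mpow K v)"
      by (intro smoothn_sum smoothn_mult smoothn_const smoothn_mpow)
    \<comment> \<open>\<open>f\<close> minus the polynomial lies in the ideal, so its coefficients
      on \<open>B\<close> vanish by \<open>forw\<close>. This identifies \<open>a K\<close> with
      \<open>tc K f\<close>, which is 0 by assumption.\<close>
    have "a K = 0" if K: "K \<in> B" for K
    proof -
      have "0 = tc K (\<lambda>v. f v - (\<Sum>K\<in>B. a K * mpow K v))"
        using forw[OF smoothn_diff[OF f sp] mod K] by simp
      also have "\<dots> = tc K f - (\<Sum>L\<in>B. a L * tc K (mpow L))"
        by (simp add: tc_diff f sp tc_sum tc_cmult smoothn_mpow smoothn_mult)
      also have "(\<Sum>L\<in>B. a L * tc K (mpow L)) = (\<Sum>L\<in>B. if L = K then a L else 0)"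
        by (intro sum.cong refl) (simp add: tc_mpow)
      also have "\<dots> = a K" using B(1) K by (simp add: sum.delta)
      finally show ?thesis using 0 K by simp
    qed
    then show "f \<in> ideal W" using mod by simp
  qed (use forw f in blast)
qed

lemma weil_D_jet: "weil (D_jet k N) (jet_basis k N)"
proof (rule weilI[where N = N])
  fix g assume "g \<in> eqns (D_jet k N)"
  then obtain L where L: "g = mpow L" "set_mset L \<subseteq> {..<k}" "size L = N + 1" by (auto simp: eqns_D_jet)
  then show "\<exists>L. g = mpow L \<and> set_mset L \<subseteq> {..<nvars (D_jet k N)} \<and> (\<forall>K\<in>jet_basis k N. \<not> L \<subseteq># K)"
    by (intro exI[of _ L]) (auto simp: jet_basis_def dest: size_mset_mono)
next
  fix K :: "nat multiset" assume "set_mset K \<subseteq> {..<nvars (D_jet k N)}" "K \<notin> jet_basis k N" "size K \<le> Suc N"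
  then have "size K = N + 1" "set_mset K \<subseteq> {..<k}" by (auto simp: jet_basis_def)
  then show "mpow K \<in> ideal (D_jet k N)" by (intro ideal_gen) (auto simp: eqns_D_jet)
qed (simp_all add: finite_jet_basis, simp add: jet_basis_def)

lemma pow_basis_iff: "K \<in> pow_basis n \<longleftrightarrow> set_mset K \<subseteq> {..<n} \<and> (\<forall>i. count K i \<le> 1)"
proof
  assume "K \<in> pow_basis n"
  then obtain A where "A \<subseteq> {..<n}" "K = mset_set A" by (auto simp: pow_basis_def)
  moreover have "finite A" using calculation(1) finite_subset by blast
  ultimately show "set_mset K \<subseteq> {..<n} \<and> (\<forall>i. count K i \<le> 1)" by (auto simp: count_mset_set')
next
  assume K: "set_mset K \<subseteq> {..<n} \<and> (\<forall>i. count K i \<le> 1)"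
  have "K = mset_set (set_mset K)"
  proof (rule multiset_eqI)
    fix i
    have "count K i \<le> 1" using K by blast
    then show "count K i = count (mset_set (set_mset K)) i"
      by (cases "i \<in># K") (auto simp: count_mset_set' count_eq_zero_iff le_Suc_eq)
  qed
  then show "K \<in> pow_basis n" using K by (auto simp: pow_basis_def)
qed

text \<open>The basis consists of the squarefree monomials. A monomial with a repeated variable is a
  multiple of one of the squares that generate the ideal.\<close>

lemma weil_D_pow: "weil (D_pow n) (pow_basis n)"
proof (rule weilI[where N = n])
  show "finite (pow_basis n)" by (simp add: pow_basis_def)
  show "pow_basis n \<subseteq> jet_basis (nvars (D_pow n)) n"
  proof
    fix K assume "K \<in> pow_basis n"
    then obtain A where "A \<subseteq> {..<n}" "K = mset_set A" by (auto simp: pow_basis_def)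
    moreover have "finite A" using calculation(1) finite_subset by blast
    moreover have "card A \<le> n" using card_mono[OF _ calculation(1)] by simp
    ultimately show "K \<in> jet_basis (nvars (D_pow n)) n" by (simp add: jet_basis_def)
  qed
next
  fix g assume "g \<in> eqns (D_pow n)"
  then obtain i where i: "i < n" "g = mpow {#i, i#}" by (auto simp: eqns_D_pow)
  have "\<not> {#i, i#} \<subseteq># K" if "K \<in> pow_basis n" for K
  proof
    assume "{#i, i#} \<subseteq># K"
    then have "2 \<le> count K i" using mset_subset_eq_count[of "{#i, i#}" K i] by simp
    then show False using that pow_basis_iff[of K n] by (metis Suc_1 not_less_eq_eq)
  qed
  then show "\<exists>L. g = mpow L \<and> set_mset L \<subseteq> {..<nvars (D_pow n)} \<and> (\<forall>K\<in>pow_basis n. \<not> L \<subseteq># K)"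
    using i by (intro exI[of _ "{#i, i#}"]) auto
next
  fix K :: "nat multiset" assume K: "set_mset K \<subseteq> {..<nvars (D_pow n)}" "K \<notin> pow_basis n"
  then obtain i where "\<not> count K i \<le> 1" by (auto simp: pow_basis_iff)
  then have i: "count K i \<ge> 2" by simp
  then have "i \<in># K" by (simp flip: count_greater_zero_iff)
  then have "i < n" using K(1) by auto
  have "{#i, i#} \<subseteq># K" using i by (auto simp: subseteq_mset_def)
  then have eq: "mpow K = (\<lambda>v. mpow (K - {#i, i#}) v * mpow {#i, i#} v)"
    by (metis (no_types, opaque_lifting) mpow_union subset_mset.diff_add ext)
  have "mpow {#i, i#} \<in> ideal (D_pow n)" using \<open>i < n\<close> by (intro ideal_gen) (auto simp: eqns_D_pow)
  then show "mpow K \<in> ideal (D_pow n)"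
    unfolding eq by (rule ideal_mult[OF _ smoothn_funs[OF smoothn_mpow]])
qed (auto simp: pow_basis_iff)

lemma weilD:
  assumes "weil W B"
  shows "finite B" "{#} \<in> B" "\<And>K. K \<in> B \<Longrightarrow> set_mset K \<subseteq> {..<nvars W}"
    "\<And>f. smoothn f \<Longrightarrow> f \<in> ideal W \<longleftrightarrow> (\<forall>K\<in>B. tc K f = 0)"
  using assms unfolding weil_def by blast+

section \<open>Weil prolongations\<close>

lemma smooth_mapsD:
  assumes "f \<in> smooth_maps X Y"
  shows "x \<in> pts X \<Longrightarrow> f x \<in> pts Y" "c \<in> curves X \<Longrightarrow> (\<lambda>t. f (c t)) \<in> curves Y"
  using assms unfolding smooth_maps_def by (auto simp: comp_def)

lemma smooth_mapsI:
  assumes "\<And>x. x \<in> pts X \<Longrightarrow> f x \<in> pts Y" "\<And>c. c \<in> curves X \<Longrightarrow> (\<lambda>t. f (c t)) \<in> curves Y"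
  shows "f \<in> smooth_maps X Y"
  using assms unfolding smooth_maps_def by (auto simp: comp_def)

lemma smooth_maps_comp: "\<phi> \<in> smooth_maps Y Z \<Longrightarrow> f \<in> smooth_maps X Y \<Longrightarrow> \<phi> \<circ> f \<in> smooth_maps X Z"
  unfolding smooth_maps_def by (auto simp: comp_def image_subset_iff)

lemma funs_smooth_maps: "h \<in> funs Y \<Longrightarrow> \<phi> \<in> smooth_maps X Y \<Longrightarrow> (\<lambda>x. h (\<phi> x)) \<in> funs X"
  unfolding funs_def smooth_maps_def by (auto simp: comp_def)

lemma smooth_maps_Rn:
  assumes "\<And>v. v \<in> pts (Rn k) \<Longrightarrow> g v \<in> pts (Rn m)" "\<And>i. smoothn (\<lambda>v. g v i)"
  shows "g \<in> smooth_maps (Rn k) (Rn m)"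
  by (intro smooth_mapsI assms) (auto simp: curves_Rn assms(1) intro!: smoothnD[OF assms(2)])

lemma weil_equiv_refl: "f \<in> smooth_maps (Rn (nvars W)) X \<Longrightarrow> weil_equiv X W f f"
  by (simp add: weil_equiv_def)

lemma weil_equiv_sym: "weil_equiv X W f g \<Longrightarrow> weil_equiv X W g f"
  using ideal_cmult[of _ W "-1"] unfolding weil_equiv_def by force

lemma weil_equiv_trans: "weil_equiv X W f g \<Longrightarrow> weil_equiv X W g h \<Longrightarrow> weil_equiv X W f h"
  unfolding weil_equiv_def using ideal_add[of _ W] by force

text \<open>Representatives are functions on all sequences, but curves of \<open>Rn\<close> and
  membership in the ideal see only their values on the points of \<open>Rn\<close>.\<close>

lemma weil_equiv_cong:
  assumes "f \<in> smooth_maps (Rn (nvars W)) X" "\<And>d. d \<in> pts (Rn (nvars W)) \<Longrightarrow> g d = f d"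
  shows "weil_equiv X W f g"
  unfolding weil_equiv_def
proof (intro conjI ballI assms(1))
  show "g \<in> smooth_maps (Rn (nvars W)) X"
  proof (rule smooth_mapsI)
    fix c assume c: "c \<in> curves (Rn (nvars W))"
    then have "(\<lambda>t. g (c t)) = (\<lambda>t. f (c t))" using assms(2) by (simp add: curves_Rn)
    then show "(\<lambda>t. g (c t)) \<in> curves X" using smooth_mapsD(2)[OF assms(1) c] by simp
  qed (use smooth_mapsD(1)[OF assms(1)] assms(2) in auto)
  show "(\<lambda>d. h (f d) - h (g d)) \<in> ideal W" for h
    by (rule ideal_cong[OF ideal_zero]) (simp add: assms(2))
qed

lemma cls_equiv: "f \<in> smooth_maps (Rn (nvars W)) X \<Longrightarrow> weil_equiv X W f (cls X W f)"
  unfolding cls_def by (rule someI[of "weil_equiv X W f"], rule weil_equiv_refl)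

text \<open>Equivalent maps are equivalent to the same maps, so the choice operator is applied to
  one and the same predicate.\<close>

lemma cls_eqI: "weil_equiv X W f g \<Longrightarrow> cls X W f = cls X W g"
  unfolding cls_def by (intro arg_cong[where f = Eps] ext iffI; metis weil_equiv_sym weil_equiv_trans)

lemma cls_eq_iff:
  assumes "f \<in> smooth_maps (Rn (nvars W)) X" "g \<in> smooth_maps (Rn (nvars W)) X"
  shows "cls X W f = cls X W g \<longleftrightarrow> weil_equiv X W f g"
  using cls_eqI cls_equiv[OF assms(1)] cls_equiv[OF assms(2)] weil_equiv_sym weil_equiv_trans by metis

lemma cls_smooth: "f \<in> smooth_maps (Rn (nvars W)) X \<Longrightarrow> cls X W f \<in> smooth_maps (Rn (nvars W)) X"
  using cls_equiv unfolding weil_equiv_def by blast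

lemma cls_cls: "f \<in> smooth_maps (Rn (nvars W)) X \<Longrightarrow> cls X W (cls X W f) = cls X W f"
  using cls_eqI[OF cls_equiv] by metis

lemma pts_tens: "pts (X \<otimes>\<^sub>W W) = cls X W ` smooth_maps (Rn (nvars W)) X"
  by (simp add: tens_def quotient_def mapping_space_def)

lemma cls_pts: "f \<in> smooth_maps (Rn (nvars W)) X \<Longrightarrow> cls X W f \<in> pts (X \<otimes>\<^sub>W W)"
  by (simp add: pts_tens)

lemma tens_cls_id: "t \<in> pts (X \<otimes>\<^sub>W W) \<Longrightarrow> cls X W t = t"
  by (auto simp: pts_tens cls_cls)

lemma tens_smooth: "t \<in> pts (X \<otimes>\<^sub>W W) \<Longrightarrow> t \<in> smooth_maps (Rn (nvars W)) X"
  by (auto simp: pts_tens cls_smooth)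

lemma curves_tens: "c \<in> curves (X \<otimes>\<^sub>W W) \<longleftrightarrow> (\<forall>r. c r \<in> pts (X \<otimes>\<^sub>W W)) \<and>
    (\<forall>h. (\<forall>b\<in>curves (mapping_space (nvars W) X). smooth_fun (\<lambda>r. h (cls X W (b r)))) \<longrightarrow> smooth_fun (\<lambda>r. h (c r)))"
  by (auto simp: tens_def quotient_def comp_def)

lemma mapping_curve_iff: "b \<in> curves (mapping_space k X) \<longleftrightarrow> (\<forall>r. b r \<in> smooth_maps (Rn k) X) \<and>
    (\<forall>g c. smooth_fun g \<longrightarrow> c \<in> curves (Rn k) \<longrightarrow> (\<lambda>r. b (g r) (c r)) \<in> curves X)"
  by (auto simp: mapping_space_def)

lemma mapping_curveI:
  assumes "\<And>r x. x \<in> pts (Rn k) \<Longrightarrow> b r x \<in> pts X"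
    "\<And>g c. smooth_fun g \<Longrightarrow> c \<in> curves (Rn k) \<Longrightarrow> (\<lambda>r. b (g r) (c r)) \<in> curves X"
  shows "b \<in> curves (mapping_space k X)"
  unfolding mapping_curve_iff
proof (intro conjI allI impI assms)
  show "b r \<in> smooth_maps (Rn k) X" for r
    using assms(1) assms(2)[of "\<lambda>_. r"] by (intro smooth_mapsI) auto
qed

lemma cls_curve: "b \<in> curves (mapping_space (nvars W) X) \<Longrightarrow> (\<lambda>r. cls X W (b r)) \<in> curves (X \<otimes>\<^sub>W W)"
  unfolding curves_tens by (auto simp: mapping_curve_iff cls_pts)

text \<open>Smooth functions on \<open>Y\<close> pull back along \<phi> to smooth functions on
  \<open>X\<close>, so \<phi> respects equivalence and the chosen representative may be traded for
  any other.\<close>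

lemma tmap_cls:
  assumes "\<phi> \<in> smooth_maps X Y" "f \<in> smooth_maps (Rn (nvars W)) X"
  shows "tmap Y W \<phi> (cls X W f) = cls Y W (\<phi> \<circ> f)"
  unfolding tmap_def
proof (rule cls_eqI, rule weil_equiv_sym)
  have "weil_equiv X W f (cls X W f)" by (rule cls_equiv[OF assms(2)])
  then show "weil_equiv Y W (\<phi> \<circ> f) (\<phi> \<circ> cls X W f)"
    unfolding weil_equiv_def using assms(1) smooth_maps_comp funs_smooth_maps by fastforce
qed

text \<open>The quotient carries the final structure: a function that is smooth on the images of
  curves of maps into \<open>Y\<close> becomes, after composition with \<open>tmap\<close>, one for
  \<open>X\<close>.\<close>

lemma tmap_smooth:
  assumes \<phi>: "\<phi> \<in> smooth_maps X Y" shows "tmap Y W \<phi> \<in> smooth_maps (X \<otimes>\<^sub>W W) (Y \<otimes>\<^sub>W W)"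
proof (rule smooth_mapsI)
  show P: "tmap Y W \<phi> t \<in> pts (Y \<otimes>\<^sub>W W)" if t: "t \<in> pts (X \<otimes>\<^sub>W W)" for t
  proof -
    obtain f where f: "f \<in> smooth_maps (Rn (nvars W)) X" "t = cls X W f" using t by (auto simp: pts_tens)
    show ?thesis unfolding f(2) tmap_cls[OF \<phi> f(1)] by (rule cls_pts[OF smooth_maps_comp[OF \<phi> f(1)]])
  qed
  fix c assume c: "c \<in> curves (X \<otimes>\<^sub>W W)"
  show "(\<lambda>r. tmap Y W \<phi> (c r)) \<in> curves (Y \<otimes>\<^sub>W W)"
    unfolding curves_tens
  proof (intro conjI allI impI)
    show "tmap Y W \<phi> (c r) \<in> pts (Y \<otimes>\<^sub>W W)" for r
      using c by (intro P) (simp add: curves_tens)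
    fix h assume h: "\<forall>b\<in>curves (mapping_space (nvars W) Y). smooth_fun (\<lambda>r. h (cls Y W (b r)))"
    have "smooth_fun (\<lambda>r. h (tmap Y W \<phi> (cls X W (b r))))" if b: "b \<in> curves (mapping_space (nvars W) X)" for b
    proof -
      have "(\<lambda>r. \<phi> \<circ> b r) \<in> curves (mapping_space (nvars W) Y)"
        using b smooth_maps_comp[OF \<phi>] smooth_mapsD(2)[OF \<phi>] by (auto simp: mapping_curve_iff)
      from bspec[OF h this] have "smooth_fun (\<lambda>r. h (cls Y W (\<phi> \<circ> b r)))" .
      then show ?thesis using b by (simp add: mapping_curve_iff tmap_cls[OF \<phi>])
    qed
    then show "smooth_fun (\<lambda>r. h (tmap Y W \<phi> (c r)))"
      using c[unfolded curves_tens, THEN conjunct2, rule_format, of "\<lambda>t. h (tmap Y W \<phi> t)"] by blast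
  qed
qed

text \<open>The last condition says that pulling back along \<open>g\<close> carries the ideal of
  \<open>W'\<close> into that of \<open>W\<close>; it makes composition with \<open>g\<close>
  independent of the representative.\<close>

definition weil_map :: "infinitesimal \<Rightarrow> infinitesimal \<Rightarrow> (vec \<Rightarrow> vec) \<Rightarrow> bool" where
  "weil_map W W' g \<longleftrightarrow> (\<forall>v\<in>pts (Rn (nvars W)). g v \<in> pts (Rn (nvars W'))) \<and>
    (\<forall>i. smoothn (\<lambda>v. g v i)) \<and> (\<forall>e\<in>eqns W'. (\<lambda>v. e (g v)) \<in> ideal W)"

lemma weil_map_smooth: "weil_map W W' g \<Longrightarrow> g \<in> smooth_maps (Rn (nvars W)) (Rn (nvars W'))"
  unfolding weil_map_def by (intro smooth_maps_Rn) auto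

lemma wcomp_cls:
  assumes g: "weil_map W W' g" and f: "f \<in> smooth_maps (Rn (nvars W')) X"
  shows "wcomp X W g (cls X W' f) = cls X W (f \<circ> g)"
  unfolding wcomp_def
proof (rule cls_eqI, rule weil_equiv_sym)
  have e: "weil_equiv X W' f (cls X W' f)" by (rule cls_equiv[OF f])
  have "(\<lambda>d. h ((f \<circ> g) d) - h ((cls X W' f \<circ> g) d)) \<in> ideal W" if "h \<in> funs X" for h
    using ideal_compose[of "\<lambda>d. h (f d) - h (cls X W' f d)" W' W g] e that g
    unfolding weil_equiv_def weil_map_def by simp
  then show "weil_equiv X W (f \<circ> g) (cls X W' f \<circ> g)"
    unfolding weil_equiv_def using smooth_maps_comp[OF _ weil_map_smooth[OF g]] f cls_smooth[OF f] by blast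
qed

lemma wcomp_pts:
  assumes "weil_map W W' g" "t \<in> pts (X \<otimes>\<^sub>W W')" shows "wcomp X W g t \<in> pts (X \<otimes>\<^sub>W W)"
proof -
  obtain f where f: "f \<in> smooth_maps (Rn (nvars W')) X" "t = cls X W' f" using assms(2) by (auto simp: pts_tens)
  show ?thesis
    unfolding f(2) wcomp_cls[OF assms(1) f(1)] by (intro cls_pts smooth_maps_comp[OF f(1)] weil_map_smooth assms(1))
qed

text \<open>A component that is a multiple of a single variable has a square that is a multiple of
  the square of that variable, hence lies in the ideal.\<close>

lemma weil_map_pow:
  assumes "\<And>v. v \<in> pts (Rn n) \<Longrightarrow> g v \<in> pts (Rn m)" "\<And>i. smoothn (\<lambda>v. g v i)"
    and "\<And>i. i < m \<Longrightarrow> (\<forall>v. g v i = 0) \<or> (\<exists>j<n. \<exists>c. smoothn c \<and> (\<forall>v. g v i = c v * v j))"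
  shows "weil_map (D_pow n) (D_pow m) g"
  unfolding weil_map_def
proof (intro conjI ballI allI)
  fix e assume "e \<in> eqns (D_pow m)"
  then obtain i where i: "i < m" "e = mpow {#i, i#}" by (auto simp: eqns_D_pow)
  from assms(3)[OF i(1)] show "(\<lambda>v. e (g v)) \<in> ideal (D_pow n)"
  proof
    assume "\<exists>j<n. \<exists>c. smoothn c \<and> (\<forall>v. g v i = c v * v j)"
    then obtain j c where j: "j < n" and c: "smoothn c" "\<And>v. g v i = c v * v j" by blast
    have "(\<lambda>v. (c v * c v) * mpow {#j, j#} v) \<in> ideal (D_pow n)"
      unfolding eqns_D_pow using j c(1)
      by (intro ideal_mult ideal_gen smoothn_funs smoothn_mult) (auto simp del: mpow_add_mset simp: eqns_D_pow)
    then show ?thesis by (simp add: i(2) c(2) mult_ac)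
  qed (simp add: i(2))
qed (use assms in auto)

text \<open>Homogeneity under every real factor makes the two maps of \<open>e\<close> agree
  pointwise, hence their classes over \<open>D_ord m\<close>. What has to be supplied is that the
  scaled family is a smooth map into the fibre.\<close>

lemma mu_compatibleI:
  assumes \<phi>: "\<phi> \<in> smooth_maps A B"
    and s: "\<And>t. t \<in> pts A \<Longrightarrow> (\<lambda>e. wcomp X V (scale i (e 0)) t) \<in> smooth_maps (Rn 1) A"
    and h: "\<And>t \<alpha>. t \<in> pts A \<Longrightarrow> \<phi> (wcomp X V (scale i \<alpha>) t) = wcomp Y V' (scale j \<alpha>) (\<phi> t)"
  shows "mu_compatible X V A i Y V' B j m \<phi>"
  unfolding mu_compatible_def
proof
  fix t assume t: "t \<in> pts A"
  show "tmap B (D_ord m) \<phi> (cls A (D_ord m) (\<lambda>e. wcomp X V (scale i (e 0)) t))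
             = cls B (D_ord m) (\<lambda>e. wcomp Y V' (scale j (e 0)) (\<phi> t))"
    using tmap_cls[OF \<phi>, of "\<lambda>e. wcomp X V (scale i (e 0)) t" "D_ord m"] s[OF t] h[OF t] by (simp add: comp_def)
qed

section \<open>Spaces with global coordinates\<close>

text \<open>Spaces isomorphic to some $\mathbb{R}^I$. The values outside \<open>I\<close> of the argument of \<open>mk\<close> are irrelevant.\<close>

definition param :: "'a frolicher \<Rightarrow> 'i set \<Rightarrow> (('i \<Rightarrow> real) \<Rightarrow> 'a) \<Rightarrow> bool" where
  "param X I mk \<longleftrightarrow> finite I \<and> pts X = range mk \<and> (\<forall>v w. mk v = mk w \<longleftrightarrow> (\<forall>i\<in>I. v i = w i)) \<and>
    curves X = {c. \<exists>v. (\<forall>i\<in>I. smooth_fun (\<lambda>t. v t i)) \<and> c = (\<lambda>t. mk (v t))}"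

text \<open>All preimages of \<open>x\<close> agree on \<open>I\<close>, so the choice does not
  matter there; elsewhere the value is 0.\<close>

definition coord :: "'i set \<Rightarrow> (('i \<Rightarrow> real) \<Rightarrow> 'a) \<Rightarrow> 'a \<Rightarrow> 'i \<Rightarrow> real" where
  "coord I mk x i = (if i \<in> I then (SOME v. mk v = x) i else 0)"

locale parametrized =
  fixes X :: "'a frolicher" and I :: "'i set" and mk :: "('i \<Rightarrow> real) \<Rightarrow> 'a"
  assumes par: "param X I mk"
begin

lemma fin: "finite I" and pts_eq: "pts X = range mk" and mk_eq: "mk v = mk w \<longleftrightarrow> (\<forall>i\<in>I. v i = w i)"
  and curves_eq: "curves X = {c. \<exists>v. (\<forall>i\<in>I. smooth_fun (\<lambda>t. v t i)) \<and> c = (\<lambda>t. mk (v t))}"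
  using par unfolding param_def by auto

lemma mk_pts [simp]: "mk v \<in> pts X" by (simp add: pts_eq)

lemma coord_mk: "coord I mk (mk v) i = (if i \<in> I then v i else 0)"
proof -
  have "mk (SOME w. mk w = mk v) = mk v" by (rule someI[of _ v]) simp
  then show ?thesis by (simp add: coord_def mk_eq)
qed

lemma mk_coord: "x \<in> pts X \<Longrightarrow> mk (coord I mk x) = x"
  by (auto simp: pts_eq mk_eq coord_mk)

lemma curve_mk: "(\<And>i. i \<in> I \<Longrightarrow> smooth_fun (\<lambda>t. v t i)) \<Longrightarrow> (\<lambda>t. mk (v t)) \<in> curves X"
  by (auto simp: curves_eq)

lemma curve_coord: "c \<in> curves X \<Longrightarrow> smooth_fun (\<lambda>t. coord I mk (c t) i)"
  by (cases "i \<in> I") (auto simp: curves_eq coord_mk)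

lemma curve_pts: "c \<in> curves X \<Longrightarrow> c t \<in> pts X"
  by (auto simp: curves_eq)

lemma coord_funs: "(\<lambda>x. coord I mk x i) \<in> funs X"
  unfolding funs_def using curve_coord by (simp add: comp_def)

lemma smooth_mk: "(\<And>i. i \<in> I \<Longrightarrow> smoothn (\<lambda>d. v d i)) \<Longrightarrow> (\<lambda>d. mk (v d)) \<in> smooth_maps (Rn k) X"
  by (intro smooth_mapsI mk_pts curve_mk smoothnD[where f = "\<lambda>d. v d _"]) (auto simp: curves_Rn)

lemma smooth_coord:
  assumes "f \<in> smooth_maps (Rn k) X" shows "smoothn (\<lambda>d. coord I mk (f (trunc k d)) i)"
  using funs_smooth_maps[OF coord_funs assms] by (simp add: funs_Rn_iff)

lemma smooth_rep:
  assumes "f \<in> smooth_maps (Rn k) X"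
  obtains v where "\<And>i. smoothn (\<lambda>d. v d i)" "\<And>d. d \<in> pts (Rn k) \<Longrightarrow> f d = mk (v d)"
proof (rule that[of "\<lambda>d. coord I mk (f (trunc k d))"])
  show "smoothn (\<lambda>d. coord I mk (f (trunc k d)) i)" for i by (rule smooth_coord[OF assms])
  show "f d = mk (coord I mk (f (trunc k d)))" if "d \<in> pts (Rn k)" for d
    using that mk_coord[OF smooth_mapsD(1)[OF assms that]] by (simp add: trunc_id)
qed

text \<open>Every class is represented by \<open>mk\<close> of coordinate functions that are smooth
  on all sequences. Calculations with classes start from such a representative, as the one chosen by
  \<open>cls\<close> is unknown.\<close>

lemma tens_rep:
  assumes "t \<in> pts (X \<otimes>\<^sub>W W)"
  obtains v where "\<And>i. smoothn (\<lambda>d. v d i)" "t = cls X W (\<lambda>d. mk (v d))"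
proof -
  obtain v where v: "\<And>i. smoothn (\<lambda>d. v d i)" "\<And>d. d \<in> pts (Rn (nvars W)) \<Longrightarrow> t d = mk (v d)"
    using smooth_rep[OF tens_smooth[OF assms]] by blast
  have "t = cls X W t" using tens_cls_id[OF assms] by simp
  also have "\<dots> = cls X W (\<lambda>d. mk (v d))"
    by (rule cls_eqI, rule weil_equiv_cong[OF tens_smooth[OF assms]]) (use v(2) in simp)
  finally show thesis using that v(1) by blast
qed

text \<open>The arguments are exchanged one coordinate at a time. Each exchange changes the value of
  \<open>H\<close> by a multiple of the difference of the two coordinates, which lies in the
  ideal.\<close>

lemma ideal_telescope:
  assumes H: "smoothn (H :: ('i \<Rightarrow> real) \<Rightarrow> real)" and v: "\<And>i. smoothn (\<lambda>d. v d i)" and w: "\<And>i. smoothn (\<lambda>d. w d i)"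
    and id: "\<And>i. i \<in> A \<Longrightarrow> (\<lambda>d. v d i - w d i) \<in> ideal W" and A: "finite A"
  shows "(\<lambda>d. H (\<lambda>i. if i \<in> A then v d i else w d i) - H (w d)) \<in> ideal W"
  using A id
proof (induction A)
  case (insert a A)
  define u where "u d i = (if i \<in> A then v d i else w d i)" for d i
  \<comment> \<open>The Hadamard quotient for the exchange of coordinate \<open>a\<close>, taken
    from \<open>w\<close> towards \<open>v\<close>; it is smooth because numerator and evaluation
    point are smooth in \<open>d\<close>.\<close>
  define q where "q d = quo (\<lambda>s. H ((u d)(a := w d a + s))) (v d a - w d a)" for d
  have u: "smoothn (\<lambda>d. u d i)" for i unfolding u_def using v w by auto
  have "smoothn q"
    unfolding smoothn_def q_def
  proof (intro allI impI)
    fix d :: "real \<Rightarrow> vec" assume d: "\<forall>i. smooth_fun (\<lambda>t. d t i)"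
    have "smooth2 (\<lambda>s t. H ((u (d t))(a := w (d t) a + s)))"
      unfolding smooth2_def
    proof (intro allI impI smoothnD[OF H])
      fix x y :: "real \<Rightarrow> real" and i assume xy: "smooth_fun x" "smooth_fun y"
      have dy: "smooth_fun (\<lambda>r. d (y r) j)" for j
        by (rule smooth_compose[of "\<lambda>t. d t j" y]) (simp_all add: d xy)
      have "smooth_fun (\<lambda>r. w (d (y r)) a)" "smooth_fun (\<lambda>r. u (d (y r)) i)"
        by (rule smoothnD[OF w, of "\<lambda>r. d (y r)"], rule dy) (rule smoothnD[OF u, of "\<lambda>r. d (y r)"], rule dy)
      then show "smooth_fun (\<lambda>r. ((u (d (y r)))(a := w (d (y r)) a + x r)) i)"
        using xy by (cases "i = a") (simp_all add: smooth_add)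
    qed
    then show "smooth_fun (\<lambda>t. quo (\<lambda>s. H ((u (d t))(a := w (d t) a + s))) (v (d t) a - w (d t) a))"
      by (rule smooth_quo) (rule smooth_diff[OF smoothnD[OF v, of d] smoothnD[OF w, of d]], simp_all add: d)
  qed
  then have "(\<lambda>d. q d * (v d a - w d a)) \<in> ideal W"
    using insert.prems[of a] by (intro ideal_mult smoothn_funs) auto
  from ideal_add[OF this insert.IH[OF insert.prems]]
  have "(\<lambda>d. q d * (v d a - w d a) + (H (u d) - H (w d))) \<in> ideal W"
    unfolding u_def [abs_def] by simp
  moreover have "q d * (v d a - w d a) = H (\<lambda>i. if i \<in> insert a A then v d i else w d i) - H (u d)" for d
  proof -
    have "q d * (v d a - w d a) = H ((u d)(a := v d a)) - H ((u d)(a := w d a))"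
      unfolding q_def quo_def by auto
    also have "(u d)(a := v d a) = (\<lambda>i. if i \<in> insert a A then v d i else w d i)" by (auto simp: u_def)
    also have "(u d)(a := w d a) = u d" using insert.hyps by (auto simp: u_def)
    finally show ?thesis .
  qed
  ultimately show ?case by simp
qed simp

text \<open>Equivalence is tested with all smooth functions on \<open>X\<close>. The coordinates are
  among them, and \<open>ideal_telescope\<close> shows that they suffice; for each coordinate the
  ideal is described by its coefficients on \<open>B\<close>.\<close>

lemma cls_mk_eq_aux:
  assumes W: "weil W B" and v: "\<And>i. smoothn (\<lambda>d. v d i)" and w: "\<And>i. smoothn (\<lambda>d. w d i)"
  shows "cls X W (\<lambda>d. mk (v d)) = cls X W (\<lambda>d. mk (w d)) \<longleftrightarrow>
    (\<forall>i\<in>I. \<forall>K\<in>B. tc K (\<lambda>d. v d i) = tc K (\<lambda>d. w d i))"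
proof -
  have tc: "(\<forall>K\<in>B. tc K (\<lambda>d. v d i) = tc K (\<lambda>d. w d i)) \<longleftrightarrow> (\<lambda>d. v d i - w d i) \<in> ideal W" for i
    using weilD(4)[OF W smoothn_diff[OF v w]] by (simp add: tc_diff v w)
  have sm: "(\<lambda>d. mk (v d)) \<in> smooth_maps (Rn (nvars W)) X" "(\<lambda>d. mk (w d)) \<in> smooth_maps (Rn (nvars W)) X"
    using v w by (intro smooth_mk; blast)+
  show ?thesis
    unfolding cls_eq_iff[OF sm] tc
  proof
    assume eq: "weil_equiv X W (\<lambda>d. mk (v d)) (\<lambda>d. mk (w d))"
    show "\<forall>i\<in>I. (\<lambda>d. v d i - w d i) \<in> ideal W"
    proof
      fix i assume "i \<in> I"
      then show "(\<lambda>d. v d i - w d i) \<in> ideal W"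
        using eq coord_funs[of i] unfolding weil_equiv_def by (auto simp: coord_mk)
    qed
  next
    assume id: "\<forall>i\<in>I. (\<lambda>d. v d i - w d i) \<in> ideal W"
    show "weil_equiv X W (\<lambda>d. mk (v d)) (\<lambda>d. mk (w d))"
      unfolding weil_equiv_def
    proof (intro conjI sm ballI)
      fix h assume h: "h \<in> funs X"
      have "smoothn (\<lambda>u. h (mk u))"
        unfolding smoothn_def using h curve_mk by (auto simp: funs_def comp_def)
      from ideal_telescope[where H = "\<lambda>u. h (mk u)" and v = v and w = w and A = I and W = W, OF this v w _ fin] id
      have "(\<lambda>d. h (mk (\<lambda>i. if i \<in> I then v d i else w d i)) - h (mk (w d))) \<in> ideal W" by blast
      moreover have "mk (\<lambda>i. if i \<in> I then v d i else w d i) = mk (v d)" for d by (simp add: mk_eq)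
      ultimately show "(\<lambda>d. h (mk (v d)) - h (mk (w d))) \<in> ideal W" by simp
    qed
  qed
qed

lemma cls_mk_eq:
  assumes W: "weil W B" and v: "\<And>i. i \<in> I \<Longrightarrow> smoothn (\<lambda>d. v d i)" and w: "\<And>i. i \<in> I \<Longrightarrow> smoothn (\<lambda>d. w d i)"
  shows "cls X W (\<lambda>d. mk (v d)) = cls X W (\<lambda>d. mk (w d)) \<longleftrightarrow>
    (\<forall>i\<in>I. \<forall>K\<in>B. tc K (\<lambda>d. v d i) = tc K (\<lambda>d. w d i))"
proof -
  define v' where "v' d i = (if i \<in> I then v d i else 0)" for d i
  define w' where "w' d i = (if i \<in> I then w d i else 0)" for d i
  have "mk (v d) = mk (v' d)" "mk (w d) = mk (w' d)" for d by (simp_all add: mk_eq v'_def w'_def)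
  moreover have "smoothn (\<lambda>d. v' d i)" "smoothn (\<lambda>d. w' d i)" for i
    using v w by (cases "i \<in> I"; simp add: v'_def w'_def)+
  ultimately show ?thesis using cls_mk_eq_aux[OF W, of v' w'] by (simp add: v'_def w'_def)
qed

lemma tc_cls:
  assumes W: "weil W B" and f: "f \<in> smooth_maps (Rn (nvars W)) X" and K: "K \<in> B"
  shows "tc K (\<lambda>d. coord I mk (cls X W f (trunc (nvars W) d)) i) = tc K (\<lambda>d. coord I mk (f (trunc (nvars W) d)) i)"
proof -
  let ?a = "\<lambda>d. coord I mk (f (trunc (nvars W) d)) i - coord I mk (cls X W f (trunc (nvars W) d)) i"
  have s: "smoothn (\<lambda>d. coord I mk (f (trunc (nvars W) d)) i)"
     "smoothn (\<lambda>d. coord I mk (cls X W f (trunc (nvars W) d)) i)"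
    using smooth_coord f cls_smooth[OF f] by blast+
  have "(\<lambda>d. coord I mk (f d) i - coord I mk (cls X W f d) i) \<in> ideal W"
    using cls_equiv[OF f] coord_funs unfolding weil_equiv_def by auto
  then have "?a \<in> ideal W" by (rule ideal_cong) (simp add: trunc_id)
  then have "tc K ?a = 0" using weilD(4)[OF W smoothn_diff[OF s]] K by blast
  then show ?thesis by (simp add: tc_diff s)
qed

text \<open>The empty monomial belongs to \<open>B\<close>, so the value at 0 is an invariant of the
  class and the chosen representative has it too.\<close>

lemma base_cls:
  assumes W: "weil W B" and f: "f \<in> smooth_maps (Rn (nvars W)) X"
  shows "base (cls X W f) = f (\<lambda>_. 0)"
proof -
  have z: "trunc (nvars W) (\<lambda>_. 0) = (\<lambda>_. 0)" by (simp add: trunc_def)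
  have "coord I mk (cls X W f (\<lambda>_. 0)) i = coord I mk (f (\<lambda>_. 0)) i" for i
    using tc_cls[OF W f weilD(2)[OF W], of i] by (simp add: z)
  then have "coord I mk (cls X W f (\<lambda>_. 0)) = coord I mk (f (\<lambda>_. 0))" by blast
  then have "mk (coord I mk (cls X W f (\<lambda>_. 0))) = mk (coord I mk (f (\<lambda>_. 0)))" by simp
  then show ?thesis
    using smooth_mapsD(1)[OF f zero_pts] smooth_mapsD(1)[OF cls_smooth[OF f] zero_pts] by (simp add: mk_coord base_def)
qed

end

lemma tc_poly:
  assumes "finite B" "K \<in> B" shows "tc K (\<lambda>d. \<Sum>L\<in>B. a L * mpow L d) = a K"
proof -
  have "tc K (\<lambda>d. \<Sum>L\<in>B. a L * mpow L d) = (\<Sum>L\<in>B. a L * tc K (mpow L))"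
    by (simp add: tc_sum tc_cmult smoothn_mpow smoothn_mult)
  also have "\<dots> = (\<Sum>L\<in>B. if L = K then a L else 0)" by (intro sum.cong refl) (simp add: tc_mpow)
  finally show ?thesis using assms by (simp add: sum.delta)
qed

lemma smoothn_poly: "smoothn (\<lambda>d. \<Sum>L\<in>B. a L * mpow L d)"
  by (intro smoothn_sum smoothn_mult smoothn_const smoothn_mpow)

definition tens_mk :: "'a frolicher \<Rightarrow> infinitesimal \<Rightarrow> nat multiset set \<Rightarrow> (('i \<Rightarrow> real) \<Rightarrow> 'a) \<Rightarrow>
    ('i \<times> nat multiset \<Rightarrow> real) \<Rightarrow> (vec \<Rightarrow> 'a)" where
  "tens_mk X W B mk a = cls X W (\<lambda>d. mk (\<lambda>i. \<Sum>L\<in>B. a (i, L) * mpow L d))"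

context parametrized
begin

lemma cls_eq_tens_mk:
  assumes W: "weil W B" and v: "\<And>i. i \<in> I \<Longrightarrow> smoothn (\<lambda>d. v d i)"
  shows "cls X W (\<lambda>d. mk (v d)) = tens_mk X W B mk (\<lambda>(i, K). tc K (\<lambda>d. v d i))"
  unfolding tens_mk_def by (subst cls_mk_eq[OF W v smoothn_poly]) (auto simp: tc_poly weilD(1)[OF W])

text \<open>The coordinates are the Taylor coefficients of the coordinates. The delicate part is the
  curves: a curve of the quotient is known only through functionals that are smooth along curves of
  maps. Taylor coefficients are such functionals, and polynomials with smooth coefficients lift back
  to curves of maps.\<close>

lemma param_tens:
  assumes W: "weil W B"
  shows "param (X \<otimes>\<^sub>W W) (I \<times> B) (tens_mk X W B mk)"
  unfolding param_def
proof (intro conjI allI)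
  show "finite (I \<times> B)" using fin weilD(1)[OF W] by blast
  have sm: "(\<lambda>d. mk (\<lambda>i. \<Sum>L\<in>B. a (i, L) * mpow L d)) \<in> smooth_maps (Rn (nvars W)) X" for a
    by (intro smooth_mk smoothn_poly)
  show pts: "pts (X \<otimes>\<^sub>W W) = range (tens_mk X W B mk)"
  proof
    show "range (tens_mk X W B mk) \<subseteq> pts (X \<otimes>\<^sub>W W)" unfolding tens_mk_def using sm by (auto intro: cls_pts)
    show "pts (X \<otimes>\<^sub>W W) \<subseteq> range (tens_mk X W B mk)"
    proof
      fix t assume "t \<in> pts (X \<otimes>\<^sub>W W)"
      then obtain v where "\<And>i. smoothn (\<lambda>d. v d i)" "t = cls X W (\<lambda>d. mk (v d))" using tens_rep by blast
      then show "t \<in> range (tens_mk X W B mk)" using cls_eq_tens_mk[OF W] by simp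
    qed
  qed
  show mkeq: "tens_mk X W B mk v = tens_mk X W B mk w \<longleftrightarrow> (\<forall>i\<in>I \<times> B. v i = w i)" for v w
    unfolding tens_mk_def cls_mk_eq[OF W smoothn_poly smoothn_poly] using weilD(1)[OF W] by (auto simp: tc_poly)
  define k where "k = nvars W"
  \<comment> \<open>The coordinate functional on classes. It is evaluated on the chosen
    representative, and \<open>tc_cls\<close> makes this harmless.\<close>
  define h where "h i K t = tc K (\<lambda>d. coord I mk (t (trunc k d)) i)" for i K and t :: "vec \<Rightarrow> 'a"
  have h_mk: "h i K (tens_mk X W B mk a) = a (i, K)" if "i \<in> I" "K \<in> B" for i K a
    unfolding h_def tens_mk_def k_def tc_cls[OF W sm that(2)]
    using that tc_trunc[OF weilD(3)[OF W that(2)], of "\<lambda>d. \<Sum>L\<in>B. a (i, L) * mpow L d"] tc_poly[OF weilD(1)[OF W] that(2)]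
    by (simp add: coord_mk)
  have h_smooth: "smooth_fun (\<lambda>r. h i K (cls X W (b r)))" if b: "b \<in> curves (mapping_space k X)" and "K \<in> B" for b i K
  proof -
    \<comment> \<open>The time of the curve is the single parameter, indexed by \<open>unit\<close>;
      \<open>smooth_tc\<close> then gives smoothness of the coefficient in time.\<close>
    define G where "G e d = coord I mk (b (e ()) (trunc k d)) i" for e :: "unit \<Rightarrow> real" and d
    have "smoothp G"
      unfolding smoothp_def G_def
    proof (intro allI impI)
      fix c :: "real \<Rightarrow> unit \<Rightarrow> real" and v :: "real \<Rightarrow> nat \<Rightarrow> real"
      assume c: "\<forall>j. smooth_fun (\<lambda>t. c t j)" and v: "\<forall>i. smooth_fun (\<lambda>t. v t i)"
      have "(\<lambda>t. trunc k (v t)) \<in> curves (Rn k)"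
        using v by (auto simp: curves_Rn) (auto simp: trunc_def)
      then have "(\<lambda>t. b (c t ()) (trunc k (v t))) \<in> curves X" using b c by (simp add: mapping_curve_iff)
      then show "smooth_fun (\<lambda>t. coord I mk (b (c t ()) (trunc k (v t))) i)" by (rule curve_coord)
    qed
    then have "smoothn (\<lambda>e. tc K (G e))" by (rule smooth_tc)
    then have "smooth_fun (\<lambda>r. tc K (G (\<lambda>_. r)))" by (rule smoothnD) simp
    moreover have "h i K (cls X W (b r)) = tc K (G (\<lambda>_. r))" for r
      unfolding h_def G_def k_def using b that(2) by (intro tc_cls[OF W]) (auto simp: mapping_curve_iff k_def)
    ultimately show ?thesis by simp
  qed
  show "curves (X \<otimes>\<^sub>W W) = {c. \<exists>v. (\<forall>i\<in>I \<times> B. smooth_fun (\<lambda>t. v t i)) \<and> c = (\<lambda>t. tens_mk X W B mk (v t))}"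
  proof (intro equalityI subsetI)
    fix c assume c: "c \<in> curves (X \<otimes>\<^sub>W W)"
    define v where "v t = (\<lambda>(i, K). h i K (c t))" for t
    have "c t = tens_mk X W B mk (v t)" for t
    proof -
      have "c t \<in> pts (X \<otimes>\<^sub>W W)" using c unfolding curves_tens by blast
      then obtain a where a: "c t = tens_mk X W B mk a" unfolding pts by blast
      have "a j = v t j" if "j \<in> I \<times> B" for j
        using that by (auto simp: v_def a h_mk)
      then show ?thesis unfolding a mkeq by blast
    qed
    moreover have "smooth_fun (\<lambda>t. v t j)" if jIB: "j \<in> I \<times> B" for j
    proof -
      obtain i K where j: "j = (i, K)" "K \<in> B" using jIB by auto
      show ?thesis
        unfolding v_def j(1) prod.case
        using c[unfolded curves_tens, THEN conjunct2, rule_format, of "h i K"] h_smooth[OF _ j(2)] by (simp add: k_def)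
    qed
    ultimately show "c \<in> {c. \<exists>v. (\<forall>i\<in>I \<times> B. smooth_fun (\<lambda>t. v t i)) \<and> c = (\<lambda>t. tens_mk X W B mk (v t))}" by blast
  next
    fix c assume "c \<in> {c. \<exists>v. (\<forall>i\<in>I \<times> B. smooth_fun (\<lambda>t. v t i)) \<and> c = (\<lambda>t. tens_mk X W B mk (v t))}"
    then obtain v where v0: "\<forall>i\<in>I \<times> B. smooth_fun (\<lambda>t. v t i)" and v2: "c = (\<lambda>t. tens_mk X W B mk (v t))"
      by (elim CollectE exE conjE)
    have v1: "smooth_fun (\<lambda>t. v t (i, K))" if "i \<in> I" "K \<in> B" for i K using v0 that by simp
    show "c \<in> curves (X \<otimes>\<^sub>W W)"
      unfolding v2 tens_mk_def
    proof (intro cls_curve mapping_curveI mk_pts curve_mk smooth_sum smooth_mult)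
      fix g :: "real \<Rightarrow> real" and e i K assume g: "smooth_fun g" "e \<in> curves (Rn (nvars W))" "i \<in> I" "K \<in> B"
      show "smooth_fun (\<lambda>x. v (g x) (i, K))" by (rule smooth_compose[OF v1[OF g(3,4)] g(1)])
      show "smooth_fun (\<lambda>x. mpow K (e x))" by (rule smoothnD[OF smoothn_mpow]) (use g(2) in \<open>simp add: curves_Rn\<close>)
    qed
  qed
qed

end

section \<open>Coordinates on Euclidean spaces and fibre products\<close>

lemma param_Rn: "param (Rn k) {..<k} (trunc k)"
  unfolding param_def
proof (intro conjI allI)
  show "pts (Rn k) = range (trunc k)" using trunc_id by (auto intro: rev_image_eqI simp: image_iff) metis
  show "trunc k v = trunc k w \<longleftrightarrow> (\<forall>i\<in>{..<k}. v i = w i)" for v w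
    by (auto simp: trunc_def fun_eq_iff)
  show "curves (Rn k) = {c. \<exists>v. (\<forall>i\<in>{..<k}. smooth_fun (\<lambda>t. v t i)) \<and> c = (\<lambda>t. trunc k (v t))}"
  proof (intro equalityI subsetI)
    fix c assume "c \<in> curves (Rn k)"
    then show "c \<in> {c. \<exists>v. (\<forall>i\<in>{..<k}. smooth_fun (\<lambda>t. v t i)) \<and> c = (\<lambda>t. trunc k (v t))}"
      by (intro CollectI exI[of _ c]) (auto simp: curves_Rn trunc_id)
  next
    fix c assume "c \<in> {c. \<exists>v. (\<forall>i\<in>{..<k}. smooth_fun (\<lambda>t. v t i)) \<and> c = (\<lambda>t. trunc k (v t))}"
    then obtain v where v: "\<And>i. i < k \<Longrightarrow> smooth_fun (\<lambda>t. v t i)" "c = (\<lambda>t. trunc k (v t))" by auto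
    have "smooth_fun (\<lambda>t. trunc k (v t) i)" for i using v(1)[of i] by (cases "i < k") (auto simp: trunc_def)
    then show "c \<in> curves (Rn k)" by (simp add: v(2) curves_Rn)
  qed
qed simp

interpretation Rn: parametrized "Rn k" "{..<k}" "trunc k" for k
  by unfold_locales (rule param_Rn)

lemma fibre_pts: "t \<in> pts (fibre X W x) \<longleftrightarrow> t \<in> pts (X \<otimes>\<^sub>W W) \<and> base t = x"
  by (simp add: fibre_def subspace_def)

lemma fibre_curves: "c \<in> curves (fibre X W x) \<longleftrightarrow> c \<in> curves (X \<otimes>\<^sub>W W) \<and> (\<forall>r. base (c r) = x)"
  by (auto simp: fibre_def subspace_def)

text \<open>\<open>coefs\<close> is a definite description; the coordinates of the prolongation show
  that the Taylor coefficients qualify and that nothing else does.\<close>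

lemma coefs_cls:
  assumes W: "weil W B" and v: "\<And>i. smoothn (\<lambda>d. v d i)" "\<And>d. v d \<in> pts (Rn m)"
  shows "coefs m W B (cls (Rn m) W v) = (\<lambda>K j. if K \<in> B \<and> j < m then tc K (\<lambda>d. v d j) else 0)"
  unfolding coefs_def
proof (rule the_equality)
  have poly: "poly_elt m W B a = tens_mk (Rn m) W B (trunc m) (\<lambda>(j, K). a K j)" if "\<forall>K. a K \<in> pts (Rn m)" for a
  proof -
    have "(\<lambda>d j. \<Sum>K\<in>B. a K j * (\<Prod>i\<in>#K. d i)) = (\<lambda>d. trunc m (\<lambda>j. \<Sum>L\<in>B. a L j * mpow L d))"
      using that by (auto simp: fun_eq_iff trunc_def mpow_def pts_Rn)
    then show ?thesis by (simp add: poly_elt_def tens_mk_def)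
  qed
  have v': "cls (Rn m) W v = tens_mk (Rn m) W B (trunc m) (\<lambda>(j, K). tc K (\<lambda>d. v d j))"
    using Rn.cls_eq_tens_mk[OF W, of m v] v by (simp add: trunc_id)
  interpret T: parametrized "Rn m \<otimes>\<^sub>W W" "{..<m} \<times> B" "tens_mk (Rn m) W B (trunc m)"
    by unfold_locales (rule Rn.param_tens[OF W])
  let ?a = "\<lambda>K j. if K \<in> B \<and> j < m then tc K (\<lambda>d. v d j) else 0"
  have a: "\<forall>K. ?a K \<in> pts (Rn m)" by (simp add: pts_Rn)
  show "(\<forall>K. ?a K \<in> pts (Rn m)) \<and> (\<forall>K. K \<notin> B \<longrightarrow> ?a K = (\<lambda>_. 0)) \<and> cls (Rn m) W v = poly_elt m W B ?a"
    unfolding v' poly[OF a] T.mk_eq using a by (auto simp: fun_eq_iff)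
  fix b assume b: "(\<forall>K. b K \<in> pts (Rn m)) \<and> (\<forall>K. K \<notin> B \<longrightarrow> b K = (\<lambda>_. 0)) \<and> cls (Rn m) W v = poly_elt m W B b"
  then have "poly_elt m W B b = tens_mk (Rn m) W B (trunc m) (\<lambda>(j, K). b K j)" by (intro poly) blast
  then have "\<forall>(j, K)\<in>{..<m} \<times> B. tc K (\<lambda>d. v d j) = b K j" using b unfolding v' by (auto simp: T.mk_eq)
  then show "b = ?a" using b by (auto simp: fun_eq_iff pts_Rn)
qed

lemma fibre_product_pts: "(x, y) \<in> pts (fibre_product X Y f g) \<longleftrightarrow> x \<in> pts X \<and> y \<in> pts Y \<and> f x = g y"
  by (auto simp: fibre_product_def subspace_def frol_product_def)

lemma fibre_product_curves: "c \<in> curves (fibre_product X Y f g) \<longleftrightarrow>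
    (\<lambda>t. fst (c t)) \<in> curves X \<and> (\<lambda>t. snd (c t)) \<in> curves Y \<and> (\<forall>t. f (fst (c t)) = g (snd (c t)))"
  by (auto simp: fibre_product_def subspace_def frol_product_def comp_def split_beta image_subset_iff)

text \<open>\<open>C\<close> is the set of coordinates of the second factor that are tied to the
  first, and \<alpha> names the matching coordinate of the first factor. The free coordinates are
  all of the first factor and the untied ones of the second.\<close>

definition fibre_product_mk ::
  "(('i \<Rightarrow> real) \<Rightarrow> 'a) \<Rightarrow> (('k \<Rightarrow> real) \<Rightarrow> 'b) \<Rightarrow> 'k set \<Rightarrow> ('k \<Rightarrow> 'i) \<Rightarrow> ('i + 'k \<Rightarrow> real) \<Rightarrow> 'a \<times> 'b" where
  "fibre_product_mk mk mk' C \<alpha> v = (mk (\<lambda>i. v (Inl i)), mk' (\<lambda>i. if i \<in> C then v (Inl (\<alpha> i)) else v (Inr i)))"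

lemma param_fibre_product:
  assumes X: "param X I mk" and Y: "param Y I' mk'" and C: "C \<subseteq> I'" "\<alpha> ` C \<subseteq> I"
    and fg: "\<And>v w. f (mk v) = g (mk' w) \<longleftrightarrow> (\<forall>i\<in>C. v (\<alpha> i) = w i)"
  shows "param (fibre_product X Y f g) (Inl ` I \<union> Inr ` (I' - C)) (fibre_product_mk mk mk' C \<alpha>)"
proof -
  interpret X: parametrized X I mk by unfold_locales (rule X)
  interpret Y: parametrized Y I' mk' by unfold_locales (rule Y)
  have eq: "(x, y) = fibre_product_mk mk mk' C \<alpha> (case_sum (coord I mk x) (coord I' mk' y))"
    if "x \<in> pts X" "y \<in> pts Y" "f x = g y" for x y
  proof -
    have "coord I mk x (\<alpha> i) = coord I' mk' y i" if "i \<in> C" for i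
      using fg[of "coord I mk x" "coord I' mk' y"] \<open>f x = g y\<close> X.mk_coord[OF \<open>x \<in> pts X\<close>] Y.mk_coord[OF \<open>y \<in> pts Y\<close>] that by simp
    then have "(\<lambda>i. if i \<in> C then coord I mk x (\<alpha> i) else coord I' mk' y i) = coord I' mk' y" by auto
    then show ?thesis using that unfolding fibre_product_mk_def by (simp only: sum.case X.mk_coord Y.mk_coord)
  qed
  have mkp: "fibre_product_mk mk mk' C \<alpha> v \<in> pts (fibre_product X Y f g)" for v
    unfolding fibre_product_mk_def fibre_product_pts using fg by simp
  show ?thesis
    unfolding param_def
  proof (intro conjI allI)
    show "finite (Inl ` I \<union> Inr ` (I' - C))" using X.fin Y.fin by simp
    show "pts (fibre_product X Y f g) = range (fibre_product_mk mk mk' C \<alpha>)"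
    proof (intro equalityI subsetI)
      fix z assume "z \<in> pts (fibre_product X Y f g)"
      moreover obtain x y where "z = (x, y)" by (cases z)
      ultimately show "z \<in> range (fibre_product_mk mk mk' C \<alpha>)" using eq[of x y] by (auto simp: fibre_product_pts)
    qed (use mkp in auto)
    show "fibre_product_mk mk mk' C \<alpha> v = fibre_product_mk mk mk' C \<alpha> w \<longleftrightarrow> (\<forall>i\<in>Inl ` I \<union> Inr ` (I' - C). v i = w i)" for v w
      unfolding fibre_product_mk_def prod.inject X.mk_eq Y.mk_eq using C by (auto simp: image_subset_iff)
    show "curves (fibre_product X Y f g) = {c. \<exists>v. (\<forall>i\<in>Inl ` I \<union> Inr ` (I' - C). smooth_fun (\<lambda>t. v t i)) \<and> c = (\<lambda>t. fibre_product_mk mk mk' C \<alpha> (v t))}"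
    proof (intro equalityI subsetI)
      fix c assume c: "c \<in> curves (fibre_product X Y f g)"
      then have c': "(\<lambda>t. fst (c t)) \<in> curves X" "(\<lambda>t. snd (c t)) \<in> curves Y" "\<And>t. f (fst (c t)) = g (snd (c t))"
        by (auto simp: fibre_product_curves)
      define v where "v t = case_sum (coord I mk (fst (c t))) (coord I' mk' (snd (c t)))" for t
      have "c t = fibre_product_mk mk mk' C \<alpha> (v t)" for t
        using eq[OF X.curve_pts[OF c'(1)] Y.curve_pts[OF c'(2)] c'(3)] by (simp add: v_def)
      moreover have "smooth_fun (\<lambda>t. v t i)" for i
        using X.curve_coord[OF c'(1)] Y.curve_coord[OF c'(2)] by (cases i) (auto simp: v_def)
      ultimately show "c \<in> {c. \<exists>v. (\<forall>i\<in>Inl ` I \<union> Inr ` (I' - C). smooth_fun (\<lambda>t. v t i)) \<and> c = (\<lambda>t. fibre_product_mk mk mk' C \<alpha> (v t))}"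
        by blast
    next
      fix c assume "c \<in> {c. \<exists>v. (\<forall>i\<in>Inl ` I \<union> Inr ` (I' - C). smooth_fun (\<lambda>t. v t i)) \<and> c = (\<lambda>t. fibre_product_mk mk mk' C \<alpha> (v t))}"
      then obtain v where v: "\<forall>i\<in>Inl ` I \<union> Inr ` (I' - C). smooth_fun (\<lambda>t. v t i)" "c = (\<lambda>t. fibre_product_mk mk mk' C \<alpha> (v t))" by blast
      have "smooth_fun (\<lambda>t. if i \<in> C then v t (Inl (\<alpha> i)) else v t (Inr i))" if "i \<in> I'" for i
        using v(1) C that by (cases "i \<in> C") auto
      then show "c \<in> curves (fibre_product X Y f g)"
        unfolding v(2) fibre_product_curves fibre_product_mk_def using v(1) fg by (auto intro!: X.curve_mk Y.curve_mk)
    qed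
  qed
qed

text \<open>Every free coordinate of the fibre product is one of its two factors, so an element of
  its prolongation is determined by its two projections. This gives the uniqueness in the definite
  description, and the map is then applied to a representative.\<close>

lemma apply_pair_cls:
  assumes X: "param X I mk" and Y: "param Y I' mk'" and C: "C \<subseteq> I'" "\<alpha> ` C \<subseteq> I"
    and fg: "\<And>v w. f (mk v) = g (mk' w) \<longleftrightarrow> (\<forall>i\<in>C. v (\<alpha> i) = w i)"
    and W: "weil W B" and v: "\<And>i. smoothn (\<lambda>d. v d i)" and w: "\<And>i. smoothn (\<lambda>d. w d i)"
    and vw: "\<And>d i. i \<in> C \<Longrightarrow> v d (\<alpha> i) = w d i"
    and \<Phi>: "\<Phi> \<in> smooth_maps (fibre_product X Y f g) Z"
  shows "apply_pair X Y (fibre_product X Y f g) Z W \<Phi> (cls X W (\<lambda>d. mk (v d))) (cls Y W (\<lambda>d. mk' (w d)))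
    = cls Z W (\<lambda>d. \<Phi> (mk (v d), mk' (w d)))"
proof -
  let ?P = "fibre_product X Y f g"
  interpret X: parametrized X I mk by unfold_locales (rule X)
  interpret Y: parametrized Y I' mk' by unfold_locales (rule Y)
  define pk where "pk = fibre_product_mk mk mk' C \<alpha>"
  interpret P: parametrized ?P "Inl ` I \<union> Inr ` (I' - C)" pk
    unfolding pk_def by unfold_locales (rule param_fibre_product[OF X Y C fg])
  have pi: "fst \<in> smooth_maps ?P X" "snd \<in> smooth_maps ?P Y"
    by (rule smooth_mapsI; auto simp: fibre_product_pts fibre_product_curves)+
  define u where "u d = case_sum (v d) (w d)" for d
  have pku: "pk (u d) = (mk (v d), mk' (w d))" for d
  proof -
    have "(\<lambda>i. if i \<in> C then v d (\<alpha> i) else w d i) = w d" using vw by auto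
    then show ?thesis unfolding pk_def u_def fibre_product_mk_def by (simp only: sum.case)
  qed
  have su: "(\<lambda>d. pk (u d)) \<in> smooth_maps (Rn (nvars W)) ?P"
    using v w by (intro P.smooth_mk) (auto simp: u_def)
  define z where "z = cls ?P W (\<lambda>d. pk (u d))"
  have "(THE z. z \<in> pts (?P \<otimes>\<^sub>W W) \<and> tmap X W fst z = cls X W (\<lambda>d. mk (v d)) \<and> tmap Y W snd z = cls Y W (\<lambda>d. mk' (w d))) = z"
  proof (rule the_equality)
    show "z \<in> pts (?P \<otimes>\<^sub>W W) \<and> tmap X W fst z = cls X W (\<lambda>d. mk (v d)) \<and> tmap Y W snd z = cls Y W (\<lambda>d. mk' (w d))"
      unfolding z_def tmap_cls[OF pi(1) su] tmap_cls[OF pi(2) su] using cls_pts[OF su] by (simp add: comp_def pku)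
    fix z' assume z': "z' \<in> pts (?P \<otimes>\<^sub>W W) \<and> tmap X W fst z' = cls X W (\<lambda>d. mk (v d)) \<and> tmap Y W snd z' = cls Y W (\<lambda>d. mk' (w d))"
    then obtain u' where u': "\<And>i. smoothn (\<lambda>d. u' d i)" "z' = cls ?P W (\<lambda>d. pk (u' d))" using P.tens_rep by blast
    have su': "(\<lambda>d. pk (u' d)) \<in> smooth_maps (Rn (nvars W)) ?P" using u'(1) by (intro P.smooth_mk)
    have 1: "cls X W (\<lambda>d. mk (\<lambda>i. u' d (Inl i))) = cls X W (\<lambda>d. mk (v d))"
      using z'[unfolded u'(2) tmap_cls[OF pi(1) su']] by (simp add: comp_def pk_def fibre_product_mk_def)
    have 2: "cls Y W (\<lambda>d. mk' (\<lambda>i. if i \<in> C then u' d (Inl (\<alpha> i)) else u' d (Inr i))) = cls Y W (\<lambda>d. mk' (w d))"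
      using z'[unfolded u'(2) tmap_cls[OF pi(2) su']] by (simp add: comp_def pk_def fibre_product_mk_def)
    have 3: "tc K (\<lambda>d. u' d (Inl i)) = tc K (\<lambda>d. u d (Inl i))" if "i \<in> I" "K \<in> B" for i K
      using 1 that X.cls_mk_eq[OF W, of "\<lambda>d i. u' d (Inl i)" v] u'(1) v by (simp add: u_def)
    have 4: "tc K (\<lambda>d. u' d (Inr i)) = tc K (\<lambda>d. u d (Inr i))" if "i \<in> I' - C" "K \<in> B" for i K
    proof -
      have "smoothn (\<lambda>d. if i \<in> C then u' d (Inl (\<alpha> i)) else u' d (Inr i))" for i
        using u'(1) by (intro smoothn_if)
      from Y.cls_mk_eq[OF W this w, THEN iffD1, OF 2]
      show ?thesis using that by (auto simp: u_def)
    qed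
    have "smoothn (\<lambda>d. u d i)" for i using v w by (cases i) (auto simp: u_def)
    then show "z' = z" unfolding u'(2) z_def
      by (subst P.cls_mk_eq[OF W u'(1)]) (use 3 4 in auto)
  qed
  then show ?thesis
    unfolding apply_pair_def using tmap_cls[OF \<Phi> su] by (simp only: z_def comp_def pku)
qed

lemma pow_basis_1: "pow_basis 1 = {{#}, {#0#}}" "pow_basis (Suc 0) = {{#}, {#0#}}"
proof -
  have "Pow {..<Suc 0} = {{}, {0::nat}}" by auto
  then show "pow_basis 1 = {{#}, {#0#}}" "pow_basis (Suc 0) = {{#}, {#0#}}" by (simp_all add: pow_basis_def)
qed

lemma tc_const_add_sum:
  "(\<And>i. smoothn (g i)) \<Longrightarrow> tc K (\<lambda>d. c + (\<Sum>i<m. g i d)) = tc K (\<lambda>d. c) + (\<Sum>i<m. tc K (g i))"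
  by (simp add: tc_add tc_sum smoothn_sum)

section \<open>Splitting off one variable\<close>

text \<open>Covers both variables that get split off: the first of two (\<open>split_pair\<close>)
  and the last of n + 1 (\<open>split_append\<close>). \<open>w\<close> is the position of the outer
  variable, and \<open>a\<close> lists the positions of the inner ones.\<close>

locale split_map =
  fixes n w :: nat and a :: "nat \<Rightarrow> nat" and j :: "vec \<Rightarrow> vec \<Rightarrow> vec"
  assumes w: "w \<le> n" and a: "bij_betw a {..<n} ({..n} - {w})"
    and j_w: "\<And>e d. j e d w = e 0" and j_a: "\<And>e d k. k < n \<Longrightarrow> j e d (a k) = d k"
    and j_any: "\<And>i. (\<exists>k. \<forall>e d. j e d i = d k) \<or> (\<forall>e d. j e d i = e 0) \<or> (\<forall>e d. j e d i = 0)"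
    and j_pts: "\<And>e d. e \<in> pts (Rn 1) \<Longrightarrow> d \<in> pts (Rn n) \<Longrightarrow> j e d \<in> pts (Rn (Suc n))"
begin

lemma a_le: "k < n \<Longrightarrow> a k \<le> n" and a_neq: "k < n \<Longrightarrow> a k \<noteq> w" and a_inj: "inj_on a {..<n}"
  using a by (auto simp: bij_betw_def)

lemma smoothp_j: assumes "smoothn f" shows "smoothp (\<lambda>e d. f (j e d))"
  unfolding smoothp_def
proof (intro allI impI)
  fix c v :: "real \<Rightarrow> vec" assume c: "\<forall>j. smooth_fun (\<lambda>t. c t j)" and v: "\<forall>i. smooth_fun (\<lambda>t. v t i)"
  show "smooth_fun (\<lambda>t. f (j (c t) (v t)))"
  proof (rule smoothnD[OF assms])
    show "smooth_fun (\<lambda>t. j (c t) (v t) i)" for i using j_any[of i] c v by (elim disjE exE) simp_all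
  qed
qed

lemma smoothn_j: "smoothn f \<Longrightarrow> smoothn (\<lambda>d. f (j e d))"
  by (rule smoothp_snd[OF smoothp_j])

definition tc2 :: "nat multiset \<Rightarrow> nat multiset \<Rightarrow> (vec \<Rightarrow> real) \<Rightarrow> real" where
  "tc2 K L f = tc L (\<lambda>e. tc K (\<lambda>d. f (j e d)))"

definition merge :: "nat multiset \<Rightarrow> nat multiset \<Rightarrow> nat multiset" where
  "merge K L = image_mset a K + image_mset (\<lambda>_. w) L"

lemma smoothn_tc_j: "smoothn f \<Longrightarrow> smoothn (\<lambda>e. tc K (\<lambda>d. f (j e d)))"
  by (rule smooth_tc[OF smoothp_j])

lemma tc2_trunc:
  assumes "set_mset K \<subseteq> {..<n}" "set_mset L \<subseteq> {..<1}"
  shows "tc2 K L (\<lambda>v. f (trunc (Suc n) v)) = tc2 K L f"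
proof -
  have "tc2 K L g = tc L (\<lambda>e. tc K (\<lambda>d. g (j (trunc 1 e) (trunc n d))))" for g
    unfolding tc2_def
    by (subst tc_trunc[OF assms(2), symmetric], subst tc_trunc[OF assms(1), symmetric]) simp
  moreover have "trunc (Suc n) (j (trunc 1 e) (trunc n d)) = j (trunc 1 e) (trunc n d)" for e d
    by (intro trunc_id j_pts trunc_pts)
  ultimately show ?thesis by simp
qed

text \<open>The analogue of the symmetry of mixed derivatives: taking inner coefficients and then
  outer ones gives the joint coefficient. A factor consisting of one variable consumes the same
  index on both sides, so a first-order expansion reduces the claim to smaller multisets.\<close>

lemma tc2_eq:
  "smoothn f \<Longrightarrow> set_mset K \<subseteq> {..<n} \<Longrightarrow> set_mset L \<subseteq> {..<1} \<Longrightarrow> tc2 K L f = tc (merge K L) f"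
proof (induction "size K + size L" arbitrary: K L f rule: less_induct)
  case less
  \<comment> \<open>The constant term has the same coefficients on both sides; every other term is a
    variable times a smooth function, to which the induction hypothesis applies after removal of
    that variable.\<close>
  obtain F where F: "\<And>i. smoothn (F i)" "\<And>v. f (trunc (Suc n) v) = f (\<lambda>_. 0) + (\<Sum>i<Suc n. v i * F i v)"
    using first_order_expansion[OF less.prems(1)] by blast
  have sF: "smoothn (\<lambda>v. v i * F i v)" for i by (intro smoothn_mult smoothn_coord F(1))
  have merge_sub: "set_mset (merge K L) \<subseteq> {..<Suc n}"
    using less.prems(2) w by (auto simp: merge_def less_Suc_eq_le intro!: a_le)
  have "tc2 K L (\<lambda>v. v i * F i v) = tc (merge K L) (\<lambda>v. v i * F i v)" if i: "i < Suc n" for i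
  proof (cases "i = w")
    case True
    have inm: "w \<in># merge K L \<longleftrightarrow> 0 \<in># L"
      using less.prems(2,3) a by (auto simp: merge_def bij_betw_def)
    have "tc2 K L (\<lambda>v. v i * F i v) = tc L (\<lambda>e. e 0 * tc K (\<lambda>d. F i (j e d)))"
      unfolding tc2_def True by (simp add: j_w tc_cmult smoothn_j F(1))
    also have "\<dots> = (if 0 \<in># L then tc2 K (L - {#0#}) (F i) else 0)"
      unfolding tc2_def by (rule tc_var[OF smoothn_tc_j[OF F(1)]])
    also have "\<dots> = (if 0 \<in># L then tc (merge K (L - {#0#})) (F i) else 0)"
    proof (cases "0 \<in># L")
      case True
      have "size (L - {#0#}) < size L" using True by (rule size_Diff1_less)
      then show ?thesis using True less.prems(2,3)
        by (simp add: less.hyps[OF _ F(1)] subset_iff) (subst less.hyps[OF _ F(1)]; auto dest: in_diffD)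
    qed simp
    also have "\<dots> = (if 0 \<in># L then tc (merge K L - {#w#}) (F i) else 0)"
      by (auto simp: merge_def dest!: multi_member_split)
    also have "\<dots> = tc (merge K L) (\<lambda>v. v i * F i v)"
      unfolding True tc_var[OF F(1)] inm ..
    finally show ?thesis by simp
  next
    case False
    then obtain k where k: "k < n" "i = a k" using a i by (auto simp: bij_betw_def) (metis DiffI atMost_iff image_iff lessThan_iff less_Suc_eq_le singletonD)
    have inm: "a k \<in># merge K L \<longleftrightarrow> k \<in># K"
    proof -
      have "a k \<noteq> w" using False k by simp
      moreover have "a k \<in> a ` set_mset K \<longleftrightarrow> k \<in> set_mset K"
        using less.prems(2) k(1) a by (intro inj_on_image_mem_iff[of a "{..<n}"]) (auto simp: bij_betw_def)
      ultimately show ?thesis by (auto simp: merge_def)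
    qed
    have "tc2 K L (\<lambda>v. v i * F i v) = tc L (\<lambda>e. if k \<in># K then tc (K - {#k#}) (\<lambda>d. F i (j e d)) else 0)"
      unfolding tc2_def k(2) using k(1) by (simp add: j_a tc_var[OF smoothn_j[OF F(1)]])
    also have "\<dots> = (if k \<in># K then tc2 (K - {#k#}) L (F i) else 0)"
      by (simp add: tc2_def tc_const)
    also have "\<dots> = (if k \<in># K then tc (merge (K - {#k#}) L) (F i) else 0)"
    proof (cases "k \<in># K")
      case True
      have 1: "size (K - {#k#}) + size L < size K + size L" using size_Diff1_less[OF True] by simp
      have 2: "set_mset (K - {#k#}) \<subseteq> {..<n}" using less.prems(2) by (auto dest: in_diffD)
      show ?thesis using True less.hyps[OF 1 F(1) 2 less.prems(3)] by simp
    qed simp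
    also have "(if k \<in># K then tc (merge (K - {#k#}) L) (F i) else 0) = (if k \<in># K then tc (merge K L - {#a k#}) (F i) else 0)"
      by (auto simp: merge_def dest!: multi_member_split)
    also have "\<dots> = tc (merge K L) (\<lambda>v. v i * F i v)"
      unfolding k(2) tc_var[OF F(1)] inm ..
    finally show ?thesis .
  qed
  note eq = this
  have "tc2 K L f = tc2 K L (\<lambda>v. f (trunc (Suc n) v))" by (rule tc2_trunc[OF less.prems(2,3), symmetric])
  also have "\<dots> = tc L (\<lambda>e. tc K (\<lambda>d. f (\<lambda>_. 0))) + (\<Sum>i<Suc n. tc2 K L (\<lambda>v. v i * F i v))"
  proof -
    have "tc2 K L (\<lambda>v. f (trunc (Suc n) v)) = tc L (\<lambda>e. tc K (\<lambda>d. f (\<lambda>_. 0) + (\<Sum>i<Suc n. j e d i * F i (j e d))))"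
      unfolding tc2_def F(2) ..
    also have "\<dots> = tc L (\<lambda>e. tc K (\<lambda>d. f (\<lambda>_. 0)) + (\<Sum>i<Suc n. tc K (\<lambda>d. j e d i * F i (j e d))))"
      by (subst tc_const_add_sum) (rule smoothn_j[OF sF], rule refl)
    also have "\<dots> = tc L (\<lambda>e. tc K (\<lambda>d. f (\<lambda>_. 0))) + (\<Sum>i<Suc n. tc L (\<lambda>e. tc K (\<lambda>d. j e d i * F i (j e d))))"
    proof -
      have c: "tc K (\<lambda>d. f (\<lambda>_. 0)) = c" if "c = (if K = {#} then f (\<lambda>_. 0) else 0)" for c
        using that by (simp add: tc_const)
      show ?thesis unfolding c[OF refl] by (rule tc_const_add_sum, rule smoothn_tc_j[OF sF])
    qed
    finally show ?thesis by (simp only: tc2_def)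
  qed
  also have "tc L (\<lambda>e. tc K (\<lambda>d. f (\<lambda>_. 0))) = tc (merge K L) (\<lambda>v. f (\<lambda>_. 0))"
    by (simp add: tc_const merge_def)
  also have "(\<Sum>i<Suc n. tc2 K L (\<lambda>v. v i * F i v)) = (\<Sum>i<Suc n. tc (merge K L) (\<lambda>v. v i * F i v))"
    by (intro sum.cong refl eq) simp
  also have "tc (merge K L) (\<lambda>v. f (\<lambda>_. 0)) + \<dots> = tc (merge K L) (\<lambda>v. f (trunc (Suc n) v))"
    unfolding F(2) using sF by (simp add: tc_add tc_sum smoothn_sum del: sum.lessThan_Suc)
  also have "\<dots> = tc (merge K L) f" by (rule tc_trunc[OF merge_sub])
  finally show ?case .
qed

lemma merge_pow_basis:
  "K \<in> pow_basis n \<Longrightarrow> L \<in> pow_basis 1 \<Longrightarrow> merge K L \<in> pow_basis (Suc n)"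
proof -
  assume K: "K \<in> pow_basis n" and L: "L \<in> pow_basis 1"
  then obtain A B where A: "A \<subseteq> {..<n}" "K = mset_set A" and B: "B \<subseteq> {..<1}" "L = mset_set B"
    by (auto simp: pow_basis_def)
  have inj: "inj_on a A" using a A(1) by (auto simp: bij_betw_def intro: inj_on_subset)
  have fin: "finite A" "finite B" using A(1) B(1) finite_subset by blast+
  have "B = {} \<or> B = {0}" using B(1) by auto
  then have "image_mset (\<lambda>_. w) L = mset_set ((\<lambda>_. w) ` B)" using B(2) by auto
  moreover have "image_mset a K = mset_set (a ` A)" using inj A(2) by (simp add: image_mset_mset_set)
  moreover have "w \<notin> a ` A" using a A(1) by (auto simp: bij_betw_def)
  then have "a ` A \<inter> (\<lambda>_. w) ` B = {}" by auto
  ultimately have "merge K L = mset_set (a ` A \<union> (\<lambda>_. w) ` B)"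
    unfolding merge_def using fin by (simp add: mset_set_Union)
  moreover have "a ` A \<union> (\<lambda>_. w) ` B \<subseteq> {..<Suc n}" using w A(1) by (auto simp: less_Suc_eq_le intro!: a_le)
  ultimately show ?thesis by (auto simp: pow_basis_def)
qed

text \<open>The source of injectivity of splitting: every coefficient over D^(n+1) reappears as an
  iterated coefficient.\<close>

lemma merge_surj:
  assumes "M \<in> pow_basis (Suc n)" obtains K L where "K \<in> pow_basis n" "L \<in> pow_basis 1" "M = merge K L"
proof -
  obtain S where S: "S \<subseteq> {..<Suc n}" "M = mset_set S" using assms by (auto simp: pow_basis_def)
  have fS: "finite S" using S(1) finite_subset by blast
  define A where "A = {k. k < n \<and> a k \<in> S}"
  define B where "B = (if w \<in> S then {0::nat} else {})"
  have aA: "a ` A = S - {w}"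
  proof
    show "a ` A \<subseteq> S - {w}" using a by (auto simp: A_def bij_betw_def)
    show "S - {w} \<subseteq> a ` A"
    proof
      fix s assume s: "s \<in> S - {w}"
      then have "s \<in> a ` {..<n}" using a S(1) by (auto simp: bij_betw_def less_Suc_eq_le)
      then show "s \<in> a ` A" using s by (auto simp: A_def)
    qed
  qed
  have inj: "inj_on a A" using a by (auto simp: bij_betw_def A_def intro: inj_on_subset)
  have "image_mset (\<lambda>_. w) (mset_set B) = mset_set (S \<inter> {w})" by (auto simp: B_def)
  moreover have "image_mset a (mset_set A) = mset_set (S - {w})" using inj aA by (simp add: image_mset_mset_set)
  moreover have "mset_set S = mset_set ((S - {w}) \<union> (S \<inter> {w}))" by (rule arg_cong[where f = mset_set]) auto
  moreover have "mset_set ((S - {w}) \<union> (S \<inter> {w})) = mset_set (S - {w}) + mset_set (S \<inter> {w})"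
    using fS by (intro mset_set_Union) auto
  ultimately have "M = merge (mset_set A) (mset_set B)" by (simp add: S(2) merge_def)
  moreover have "mset_set A \<in> pow_basis n" "mset_set B \<in> pow_basis 1" by (auto simp: pow_basis_def A_def B_def)
  ultimately show thesis using that by blast
qed

end

context parametrized
begin

text \<open>For a fixed nonzero \<open>e\<close> the map \<open>j e\<close> is no map of
  infinitesimal objects, since its component \<open>w\<close> is a nonzero constant. So the inner
  class depends on the representative of the element, and only the class in \<open>e\<close> as a
  whole is well defined. The comparison is therefore made through iterated coefficients.\<close>

lemma wsplit_eq_tens_mk:
  assumes "split_map n w a j" and v: "\<And>i. smoothn (\<lambda>d. v d i)"
  shows "wsplit X (D_pow n) DD j (cls X (D_pow (Suc n)) (\<lambda>d. mk (v d))) =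
    cls (X \<otimes>\<^sub>W D_pow n) DD (\<lambda>e. cls X (D_pow n) (\<lambda>d. mk (v (j e d))))" (is "?l = ?r")
    and "cls (X \<otimes>\<^sub>W D_pow n) DD (\<lambda>e. cls X (D_pow n) (\<lambda>d. mk (v (j e d)))) = tens_mk (X \<otimes>\<^sub>W D_pow n) DD (pow_basis 1) (tens_mk X (D_pow n) (pow_basis n) mk)
      (\<lambda>((i, K), L). tc (split_map.merge w a K L) (\<lambda>d. v d i))"
proof -
  let ?m = "\<lambda>v. tens_mk (X \<otimes>\<^sub>W D_pow n) DD (pow_basis 1) (tens_mk X (D_pow n) (pow_basis n) mk)
      (\<lambda>((i, K), L). tc (split_map.merge w a K L) (\<lambda>d. v d i))"
  interpret split_map n w a j by fact
  let ?V = "X \<otimes>\<^sub>W D_pow n" and ?mkV = "tens_mk X (D_pow n) (pow_basis n) mk"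
  interpret V: parametrized ?V "I \<times> pow_basis n" ?mkV
    by unfold_locales (rule param_tens[OF weil_D_pow])
  have eq: "cls ?V DD (\<lambda>e. cls X (D_pow n) (\<lambda>d. mk (u (j e d)))) = ?m u"
    if u: "\<And>i. smoothn (\<lambda>d. u d i)" for u
  proof -
    have "cls ?V DD (\<lambda>e. cls X (D_pow n) (\<lambda>d. mk (u (j e d)))) =
        cls ?V DD (\<lambda>e. ?mkV (\<lambda>(i, K). tc K (\<lambda>d. u (j e d) i)))"
      by (subst cls_eq_tens_mk[OF weil_D_pow]) (use smoothn_j[OF u] in auto)
    also have "\<dots> = tens_mk ?V DD (pow_basis 1) ?mkV (\<lambda>(z, L). tc L (\<lambda>e. (\<lambda>(i, K). tc K (\<lambda>d. u (j e d) i)) z))"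
      by (rule V.cls_eq_tens_mk[OF weil_D_pow]) (use smoothn_tc_j[OF u] in auto)
    also have "\<dots> = ?m u"
    proof -
      interpret VW: parametrized "?V \<otimes>\<^sub>W DD" "(I \<times> pow_basis n) \<times> pow_basis 1" "tens_mk ?V DD (pow_basis 1) ?mkV"
        by unfold_locales (rule V.param_tens[OF weil_D_pow])
      show ?thesis
        unfolding VW.mk_eq using tc2_eq[OF u, unfolded tc2_def] by (auto simp: pow_basis_iff)
    qed
    finally show ?thesis .
  qed
  show 2: "?r = ?m v" by (rule eq[OF v])
  let ?t = "cls X (D_pow (Suc n)) (\<lambda>d. mk (v d))"
  have sv: "(\<lambda>d. mk (v d)) \<in> smooth_maps (Rn (nvars (D_pow (Suc n)))) X" using v by (intro smooth_mk)
  \<comment> \<open>Coordinates of the representative that \<open>wsplit\<close> really evaluates.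
    They share with \<open>v\<close> only the coefficients on the basis, and those are all that the
    final coordinates contain.\<close>
  obtain u where u: "\<And>i. smoothn (\<lambda>d. u d i)" "\<And>d. d \<in> pts (Rn (Suc n)) \<Longrightarrow> ?t d = mk (u d)"
    using smooth_rep[OF cls_smooth[OF sv, unfolded nvars_simps]] by auto
  have "cls X (D_pow (Suc n)) (\<lambda>d. mk (u d)) = ?t"
  proof -
    have "?t = cls X (D_pow (Suc n)) ?t" by (rule cls_cls[OF sv, symmetric])
    also have "\<dots> = cls X (D_pow (Suc n)) (\<lambda>d. mk (u d))"
      by (rule cls_eqI, rule weil_equiv_cong[OF cls_smooth[OF sv]]) (simp add: u(2))
    finally show ?thesis ..
  qed
  then have tcuv: "tc K (\<lambda>d. u d i) = tc K (\<lambda>d. v d i)" if "i \<in> I" "K \<in> pow_basis (Suc n)" for i K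
    using that cls_mk_eq[where v = u and w = v, OF weil_D_pow u(1) v] by blast
  have inner: "cls X (D_pow n) (\<lambda>d. mk (u (j e d))) = wcomp X (D_pow n) (j e) ?t" if "e \<in> pts (Rn 1)" for e
    unfolding wcomp_def
    by (rule cls_eqI, rule weil_equiv_cong[OF smooth_mk]) (use smoothn_j[OF u(1)] j_pts[OF that] u(2) in auto)
  have "?l = cls ?V DD (\<lambda>e. cls X (D_pow n) (\<lambda>d. mk (u (j e d))))"
    unfolding wsplit_def
  proof (rule cls_eqI[symmetric], rule weil_equiv_cong)
    have "(\<lambda>e. cls X (D_pow n) (\<lambda>d. mk (u (j e d)))) = (\<lambda>e. ?mkV (\<lambda>(i, K). tc K (\<lambda>d. u (j e d) i)))"
      by (subst cls_eq_tens_mk[OF weil_D_pow]) (use smoothn_j[OF u(1)] in auto)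
    then show "(\<lambda>e. cls X (D_pow n) (\<lambda>d. mk (u (j e d)))) \<in> smooth_maps (Rn (nvars DD)) ?V"
      using smoothn_tc_j[OF u(1)] by (auto intro!: V.smooth_mk)
  qed (use inner in simp)
  also have "\<dots> = ?m u" by (rule eq[OF u(1)])
  also have "\<dots> = ?m v"
  proof -
    interpret VW: parametrized "?V \<otimes>\<^sub>W DD" "(I \<times> pow_basis n) \<times> pow_basis 1" "tens_mk ?V DD (pow_basis 1) ?mkV"
      by unfold_locales (rule V.param_tens[OF weil_D_pow])
    show ?thesis unfolding VW.mk_eq using tcuv merge_pow_basis by auto
  qed
  finally show "?l = ?r" unfolding 2 .
qed

text \<open>In coordinates splitting only renames coefficients by \<open>merge\<close>, which
  reaches all of them; so it is injective and its inverse returns the original element.\<close>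

lemma wunsplit_cls:
  assumes j: "split_map n w a j" and v: "\<And>i. smoothn (\<lambda>d. v d i)"
  shows "wunsplit X (D_pow (Suc n)) (D_pow n) DD j
      (cls (X \<otimes>\<^sub>W D_pow n) DD (\<lambda>e. cls X (D_pow n) (\<lambda>d. mk (v (j e d))))) = cls X (D_pow (Suc n)) (\<lambda>d. mk (v d))"
proof -
  interpret split_map n w a j by fact
  let ?V = "X \<otimes>\<^sub>W D_pow n" and ?mkV = "tens_mk X (D_pow n) (pow_basis n) mk"
  interpret V: parametrized ?V "I \<times> pow_basis n" ?mkV
    by unfold_locales (rule param_tens[OF weil_D_pow])
  interpret VW: parametrized "?V \<otimes>\<^sub>W DD" "(I \<times> pow_basis n) \<times> pow_basis 1" "tens_mk ?V DD (pow_basis 1) ?mkV"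
    by unfold_locales (rule V.param_tens[OF weil_D_pow])
  have inj: "inj_on (wsplit X (D_pow n) DD j) (pts (X \<otimes>\<^sub>W D_pow (Suc n)))"
  proof (rule inj_onI)
    fix s t assume "s \<in> pts (X \<otimes>\<^sub>W D_pow (Suc n))" "t \<in> pts (X \<otimes>\<^sub>W D_pow (Suc n))" and eq: "wsplit X (D_pow n) DD j s = wsplit X (D_pow n) DD j t"
    then obtain x y where x: "\<And>i. smoothn (\<lambda>d. x d i)" "s = cls X (D_pow (Suc n)) (\<lambda>d. mk (x d))"
      and y: "\<And>i. smoothn (\<lambda>d. y d i)" "t = cls X (D_pow (Suc n)) (\<lambda>d. mk (y d))"
      using tens_rep by metis
    from eq have "\<forall>z\<in>(I \<times> pow_basis n) \<times> pow_basis 1. (\<lambda>((i, K), L). tc (merge K L) (\<lambda>d. x d i)) z = (\<lambda>((i, K), L). tc (merge K L) (\<lambda>d. y d i)) z"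
      unfolding x(2) y(2) wsplit_eq_tens_mk[OF j x(1)] wsplit_eq_tens_mk[OF j y(1)] VW.mk_eq .
    then have "tc M (\<lambda>d. x d i) = tc M (\<lambda>d. y d i)" if "i \<in> I" "M \<in> pow_basis (Suc n)" for i M
      using merge_surj[OF that(2)] that(1) by force
    then show "s = t" unfolding x(2) y(2) using cls_mk_eq[where v = x and w = y, OF weil_D_pow x(1) y(1)] by blast
  qed
  have "cls X (D_pow (Suc n)) (\<lambda>d. mk (v d)) \<in> pts (X \<otimes>\<^sub>W D_pow (Suc n))"
    using v by (intro cls_pts smooth_mk)
  from inv_into_f_f[OF inj this] show ?thesis
    unfolding wunsplit_def wsplit_eq_tens_mk(1)[OF j v] .
qed

section \<open>Tangent vectors\<close>

definition tang :: "('i \<Rightarrow> real) \<Rightarrow> ('i \<Rightarrow> real) \<Rightarrow> (vec \<Rightarrow> 'a)" where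
  "tang \<alpha> \<beta> = cls X DD (\<lambda>d. mk (\<lambda>i. \<alpha> i + \<beta> i * d 0))"

lemma tang_smooth: "(\<lambda>d. mk (\<lambda>i. \<alpha> i + \<beta> i * d 0)) \<in> smooth_maps (Rn k) X"
  by (intro smooth_mk smoothn_add smoothn_mult smoothn_const smoothn_coord)

lemma tang_eq_tens_mk: "tang \<alpha> \<beta> = tens_mk X DD (pow_basis 1) mk (\<lambda>(i, K). if K = {#} then \<alpha> i else \<beta> i)"
  by (simp add: tang_def tens_mk_def pow_basis_1 insert_commute add.commute)

lemma tens_mk_eq_tang: "tens_mk X DD (pow_basis 1) mk c = tang (\<lambda>i. c (i, {#})) (\<lambda>i. c (i, {#0#}))"
  by (simp add: tang_def tens_mk_def pow_basis_1)

lemma tang_eq: "tang \<alpha> \<beta> = tang \<alpha>' \<beta>' \<longleftrightarrow> (\<forall>i\<in>I. \<alpha> i = \<alpha>' i \<and> \<beta> i = \<beta>' i)"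
proof -
  interpret T: parametrized "X \<otimes>\<^sub>W DD" "I \<times> pow_basis 1" "tens_mk X DD (pow_basis 1) mk"
    by unfold_locales (rule param_tens[OF weil_D_pow])
  show ?thesis unfolding tang_eq_tens_mk T.mk_eq by (auto simp: pow_basis_1)
qed

lemma tang_pts [simp]: "tang \<alpha> \<beta> \<in> pts (X \<otimes>\<^sub>W DD)"
  unfolding tang_def by (intro cls_pts tang_smooth)

lemma tang_base [simp]: "base (tang \<alpha> \<beta>) = mk \<alpha>"
  unfolding tang_def using base_cls[OF weil_D_pow tang_smooth[of \<alpha> \<beta> "nvars DD"]] by simp

lemma tang_rep:
  assumes "t \<in> pts (X \<otimes>\<^sub>W DD)" obtains \<alpha> \<beta> where "t = tang \<alpha> \<beta>"
proof -
  interpret T: parametrized "X \<otimes>\<^sub>W DD" "I \<times> pow_basis 1" "tens_mk X DD (pow_basis 1) mk"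
    by unfold_locales (rule param_tens[OF weil_D_pow])
  obtain c where "t = tens_mk X DD (pow_basis 1) mk c" using assms unfolding T.pts_eq by blast
  then show thesis using that unfolding tens_mk_eq_tang by blast
qed

lemma tang_curve:
  assumes "\<And>i. i \<in> I \<Longrightarrow> smooth_fun (\<lambda>t. \<alpha> t i)" "\<And>i. i \<in> I \<Longrightarrow> smooth_fun (\<lambda>t. \<beta> t i)"
  shows "(\<lambda>t. tang (\<alpha> t) (\<beta> t)) \<in> curves (X \<otimes>\<^sub>W DD)"
proof -
  interpret T: parametrized "X \<otimes>\<^sub>W DD" "I \<times> pow_basis 1" "tens_mk X DD (pow_basis 1) mk"
    by unfold_locales (rule param_tens[OF weil_D_pow])
  show ?thesis unfolding tang_eq_tens_mk by (rule T.curve_mk) (use assms in \<open>auto simp: pow_basis_1\<close>)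
qed

lemma tang_curve_ex:
  assumes "c \<in> curves (X \<otimes>\<^sub>W DD)"
  shows "\<exists>\<alpha> \<beta>. (\<forall>i\<in>I. smooth_fun (\<lambda>t. \<alpha> t i)) \<and> (\<forall>i\<in>I. smooth_fun (\<lambda>t. \<beta> t i)) \<and>
    c = (\<lambda>t. tang (\<alpha> t) (\<beta> t))"
proof -
  interpret T: parametrized "X \<otimes>\<^sub>W DD" "I \<times> pow_basis 1" "tens_mk X DD (pow_basis 1) mk"
    by unfold_locales (rule param_tens[OF weil_D_pow])
  obtain v where v: "\<forall>z\<in>I \<times> pow_basis 1. smooth_fun (\<lambda>t. v t z)" "c = (\<lambda>t. tens_mk X DD (pow_basis 1) mk (v t))"
    using assms unfolding T.curves_eq by blast
  show ?thesis
  proof (rule exI[of _ "\<lambda>t i. v t (i, {#})"], rule exI[of _ "\<lambda>t i. v t (i, {#0#})"], intro conjI)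
    show "c = (\<lambda>t. tang (\<lambda>i. v t (i, {#})) (\<lambda>i. v t (i, {#0#})))"
      using v(2) unfolding tens_mk_eq_tang .
  qed (use v(1) in \<open>auto simp: pow_basis_1\<close>)
qed

lemma weil_map_scale: "i < n \<Longrightarrow> weil_map (D_pow n) (D_pow n) (scale i s)"
proof (rule weil_map_pow)
  fix k assume "k < n"
  then show "(\<forall>v. scale i s v k = 0) \<or> (\<exists>j<n. \<exists>c. smoothn c \<and> (\<forall>v. scale i s v k = c v * v j))"
    by (intro disjI2 exI[of _ k] conjI exI[of _ "\<lambda>_. if k = i then s else 1"]) (auto simp: scale_def)
qed (auto simp: scale_def pts_Rn fun_upd_def intro!: smoothn_if smoothn_mult)

lemma tang_scale: "wcomp X DD (scale 0 s) (tang \<alpha> \<beta>) = tang \<alpha> (\<lambda>i. s * \<beta> i)"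
proof -
  have "wcomp X DD (scale 0 s) (tang \<alpha> \<beta>) = cls X DD ((\<lambda>d. mk (\<lambda>i. \<alpha> i + \<beta> i * d 0)) \<circ> scale 0 s)"
    unfolding tang_def by (intro wcomp_cls weil_map_scale tang_smooth) simp
  then show ?thesis by (simp add: tang_def comp_def scale_def mult_ac)
qed

lemma tmap_tang: "\<phi> \<in> smooth_maps X Y \<Longrightarrow> tmap Y DD \<phi> (tang \<alpha> \<beta>) = cls Y DD (\<lambda>d. \<phi> (mk (\<lambda>i. \<alpha> i + \<beta> i * d 0)))"
  unfolding tang_def using tmap_cls[of \<phi> X Y _ DD] tang_smooth by (simp add: comp_def)

text \<open>Supplies the smoothness condition of \<open>mu_compatibleI\<close>. Scaling fixes the
  origin, so the scaled elements stay in the fibre.\<close>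

lemma scaling_smooth:
  assumes t: "t \<in> pts (fibre X (D_pow n) x)" and i: "i < n"
  shows "(\<lambda>e. wcomp X (D_pow n) (scale i (e 0)) t) \<in> smooth_maps (Rn 1) (fibre X (D_pow n) x)"
    "wcomp X (D_pow n) (scale i s) t \<in> pts (fibre X (D_pow n) x)"
proof -
  obtain v where v: "\<And>i. smoothn (\<lambda>d. v d i)" "t = cls X (D_pow n) (\<lambda>d. mk (v d))"
    using t tens_rep by (auto simp: fibre_pts)
  have sm: "(\<lambda>d. mk (v d)) \<in> smooth_maps (Rn (nvars (D_pow n))) X" using v(1) by (intro smooth_mk)
  have scale_smooth: "smoothn (\<lambda>d. v (scale i s d) k)" for k s
    by (rule smoothn_compose[OF v(1)]) (auto simp: scale_def fun_upd_def intro!: smoothn_if smoothn_mult)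
  have eq: "wcomp X (D_pow n) (scale i s) t = cls X (D_pow n) (\<lambda>d. mk (v (scale i s d)))" for s
    unfolding v(2) using wcomp_cls[OF weil_map_scale[OF i] sm] by (simp add: comp_def)
  have z: "scale i s (\<lambda>_. 0) = (\<lambda>_. 0)" for s by (auto simp: scale_def)
  have sm': "(\<lambda>d. mk (v (scale i s d))) \<in> smooth_maps (Rn (nvars (D_pow n))) X" for s
    using scale_smooth by (intro smooth_mk)
  have b: "base (wcomp X (D_pow n) (scale i s) t) = x" for s
  proof -
    have "base t = mk (v (\<lambda>_. 0))" unfolding v(2) by (rule base_cls[OF weil_D_pow sm])
    then show ?thesis unfolding eq using base_cls[OF weil_D_pow sm'] t by (simp add: z fibre_pts)
  qed
  show P: "wcomp X (D_pow n) (scale i s) t \<in> pts (fibre X (D_pow n) x)" for s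
    unfolding fibre_pts using b eq cls_pts[OF sm'] by simp
  show "(\<lambda>e. wcomp X (D_pow n) (scale i (e 0)) t) \<in> smooth_maps (Rn 1) (fibre X (D_pow n) x)"
  proof (rule smooth_mapsI)
    fix c assume c: "c \<in> curves (Rn 1)"
    have "(\<lambda>r. cls X (D_pow n) (\<lambda>d. mk (v (scale i (c r 0) d)))) \<in> curves (X \<otimes>\<^sub>W D_pow n)"
    proof (intro cls_curve mapping_curveI mk_pts curve_mk)
      fix g e k assume g: "smooth_fun g" "e \<in> curves (Rn (nvars (D_pow n)))"
      show "smooth_fun (\<lambda>r. v (scale i (c (g r) 0) (e r)) k)"
      proof (rule smoothnD[OF v(1), of "\<lambda>r. scale i (c (g r) 0) (e r)"])
        fix l
        have "smooth_fun (\<lambda>r. c (g r) 0)" by (rule smooth_compose[of "\<lambda>r. c r 0" g]) (use c g in \<open>auto simp: curves_Rn\<close>)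
        moreover have "smooth_fun (\<lambda>r. e r l)" "smooth_fun (\<lambda>r. e r i)" using g(2) by (auto simp: curves_Rn)
        ultimately show "smooth_fun (\<lambda>r. scale i (c (g r) 0) (e r) l)"
          by (cases "l = i") (simp_all add: scale_def smooth_mult)
      qed
    qed
    then show "(\<lambda>r. wcomp X (D_pow n) (scale i (c r 0)) t) \<in> curves (fibre X (D_pow n) x)"
      unfolding fibre_curves using b by (simp add: eq)
  qed (rule P)
qed

end

text \<open>Expand to first order with quotients F i. Homogeneity lets the quotients be evaluated at
  s v for any s \<noteq> 0 without changing the sum, and s \<rightarrow> 0 leaves their values at
  the origin as constant coefficients.\<close>

lemma homogeneous_linear:
  assumes f: "smoothn f" and h: "\<And>s v. f (\<lambda>i. s * v i) = s * f v"
  shows "\<exists>c. \<forall>v. f (trunc p v) = (\<Sum>i<p. c i * v i)"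
proof -
  obtain F where F: "\<And>i. smoothn (F i)" "\<And>v. f (trunc p v) = f (\<lambda>_. 0) + (\<Sum>i<p. v i * F i v)"
    using first_order_expansion[OF f] by blast
  have f0: "f (\<lambda>_. 0) = 0" using h[of 0 "\<lambda>_. 0"] by simp
  have "f (trunc p v) = (\<Sum>i<p. F i (\<lambda>_. 0) * v i)" for v
  proof -
    define g where "g s = (\<Sum>i<p. v i * F i (\<lambda>k. s * v k))" for s
    have "smooth_fun g"
      unfolding g_def [abs_def]
      by (intro smooth_sum smooth_mult smooth_const, rule smoothnD[OF F(1), of "\<lambda>s k. s * v k"])
        (simp add: smooth_mult)
    then have "(g \<longlongrightarrow> g 0) (at 0)" using smooth_fun_cont isCont_def by blast
    moreover have "g s = f (trunc p v)" if "s \<noteq> 0" for s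
    proof -
      have "trunc p (\<lambda>k. s * v k) = (\<lambda>k. s * trunc p v k)" by (auto simp: trunc_def)
      then have "s * f (trunc p v) = f (trunc p (\<lambda>k. s * v k))" by (simp add: h)
      also have "\<dots> = s * g s" unfolding F(2) f0 g_def by (simp add: sum_distrib_left mult.assoc)
      finally show ?thesis using that by simp
    qed
    then have "(g \<longlongrightarrow> f (trunc p v)) (at 0)"
      by (intro tendsto_eventually) (auto simp: eventually_at_filter)
    ultimately have "g 0 = f (trunc p v)" using LIM_unique by blast
    then show ?thesis by (simp add: g_def mult.commute)
  qed
  then show ?thesis by (intro exI[of _ "\<lambda>i. F i (\<lambda>_. 0)"] allI)
qed

declare One_nat_def [simp del]

section \<open>Coordinates on the iterated jet spaces\<close>

text \<open>\<open>Inl i\<close> stands for the coordinate x^i and \<open>Inr (j, K)\<close> for u^j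
  with lower indices \<open>K\<close>; multisets build in the symmetry of these indices.\<close>

definition jidx :: "nat \<Rightarrow> nat \<Rightarrow> nat \<Rightarrow> (nat + nat \<times> nat multiset) set" where
  "jidx p q n = Inl ` {..<p} \<union> Inr ` ({..<q} \<times> jet_basis p n)"

definition jmk :: "nat \<Rightarrow> nat \<Rightarrow> nat \<Rightarrow> (nat + nat \<times> nat multiset \<Rightarrow> real) \<Rightarrow> jtower" where
  "jmk p q n v = theta p q n (trunc p (\<lambda>i. v (Inl i))) (\<lambda>j K. v (Inr (j, K)))"

definition jvec :: "vec \<Rightarrow> (nat \<Rightarrow> nat multiset \<Rightarrow> real) \<Rightarrow> (nat + nat \<times> nat multiset \<Rightarrow> real)" where
  "jvec x u = case_sum x (\<lambda>(j, K). u j K)"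

lemma jvec_simps [simp]: "jvec x u (Inl i) = x i" "jvec x u (Inr (j, K)) = u j K"
  by (simp_all add: jvec_def)

lemma jmk_jvec: "x \<in> pts (Rn p) \<Longrightarrow> jmk p q n (jvec x u) = theta p q n x u"
  by (simp add: jmk_def trunc_id)

text \<open>The total derivative along \<open>y\<close>, which is the direction in which
  \<open>theta\<close> moves the fibre coordinates.\<close>

definition dshift :: "nat \<Rightarrow> vec \<Rightarrow> (nat \<Rightarrow> nat multiset \<Rightarrow> real) \<Rightarrow> nat \<Rightarrow> nat multiset \<Rightarrow> real" where
  "dshift p y u j K = (\<Sum>i<p. u j (add_mset i K) * y i)"

text \<open>The same expression for coefficients that are not yet known to depend on
  \<open>add_mset i K\<close> alone.\<close>

definition lin :: "nat \<Rightarrow> (nat \<Rightarrow> nat multiset \<Rightarrow> nat \<Rightarrow> real) \<Rightarrow> vec \<Rightarrow> nat \<Rightarrow> nat multiset \<Rightarrow> real" where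
  "lin p c y j K = (\<Sum>i<p. c j K i * y i)"

abbreviation mtang :: "nat \<Rightarrow> vec \<Rightarrow> vec \<Rightarrow> (vec \<Rightarrow> vec)" where
  "mtang p \<equiv> parametrized.tang (Rn p) (trunc p)"

abbreviation jtang where
  "jtang p q n \<equiv> parametrized.tang (jet_tower p q n) (jmk p q n)"

lemma add_mset_jet_basis: "K \<in> jet_basis p n \<Longrightarrow> i < p \<Longrightarrow> add_mset i K \<in> jet_basis p (Suc n)"
  by (auto simp: jet_basis_def)

lemma jet_basis_mono: "K \<in> jet_basis p n \<Longrightarrow> K \<in> jet_basis p (Suc n)"
  by (auto simp: jet_basis_def)

lemma theta_cong:
  "(\<And>j K. j < q \<Longrightarrow> K \<in> jet_basis p n \<Longrightarrow> u j K = u' j K) \<Longrightarrow> theta p q n x u = theta p q n x u'"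
proof (induction n arbitrary: x u u')
  case 0
  have "{#} \<in> jet_basis p 0" by (simp add: jet_basis_def)
  then have "u j {#} = u' j {#}" if "j < q" for j using 0 that by blast
  then show ?case by (auto simp: join_def)
next
  case (Suc n)
  have 1: "theta p q n x u = theta p q n x u'" by (rule Suc.IH) (use Suc.prems jet_basis_mono in blast)
  have 2: "theta p q n (\<lambda>i. x i + y i * s) (\<lambda>j K. u j K + (\<Sum>i<p. u j (add_mset i K) * y i) * s) =
      theta p q n (\<lambda>i. x i + y i * s) (\<lambda>j K. u' j K + (\<Sum>i<p. u' j (add_mset i K) * y i) * s)" for y s
  proof (rule Suc.IH)
    fix j K assume j: "j < q" and K: "K \<in> jet_basis p n"
    have "(\<Sum>i<p. u j (add_mset i K) * y i) = (\<Sum>i<p. u' j (add_mset i K) * y i)"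
      by (intro sum.cong refl) (simp add: Suc.prems[OF j add_mset_jet_basis[OF K]])
    then show "u j K + (\<Sum>i<p. u j (add_mset i K) * y i) * s = u' j K + (\<Sum>i<p. u' j (add_mset i K) * y i) * s"
      using Suc.prems[OF j jet_basis_mono[OF K]] by simp
  qed
  show ?case unfolding theta.simps 1 2 ..
qed

lemma jbase_theta: "jbase (theta p q n x u) = join p q x (\<lambda>j. u j {#})"
  by (induction n arbitrary: x u) simp_all

lemma join_pts: "join p q x u \<in> pts (Rn (p + q))"
  by (simp add: join_def pts_Rn)

lemma trunc_join: "trunc p (join p q x u) = trunc p x"
  by (auto simp: trunc_def join_def)

lemma jproj_theta: "x \<in> pts (Rn p) \<Longrightarrow> jproj p (theta p q n x u) = x"
  by (simp add: jproj_def jbase_theta trunc_join trunc_id)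

lemma jproj_jmk: "jproj p (jmk p q n v) = trunc p (\<lambda>i. v (Inl i))"
  unfolding jmk_def by (rule jproj_theta) simp

lemma under_jmk: "under (jmk p q (Suc n) v) = jmk p q n v"
  by (simp add: jmk_def)

lemma mtang_trunc: "mtang p (trunc p x) y = mtang p x y" "mtang p x (trunc p y) = mtang p x y"
  by (simp_all add: Rn.tang_eq trunc_def)

lemma mtang_fibre: "x \<in> pts (Rn p) \<Longrightarrow> mtang p x y \<in> pts (fibre (Rn p) DD x)"
  by (simp add: fibre_pts trunc_id)

lemma mtang_rep:
  assumes "t \<in> pts (fibre (Rn p) DD x)"
  obtains y where "y \<in> pts (Rn p)" "t = mtang p x y" "x \<in> pts (Rn p)"
proof -
  have "t \<in> pts (Rn p \<otimes>\<^sub>W DD)" using assms by (simp add: fibre_pts)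
  then obtain \<alpha> \<beta> where t: "t = mtang p \<alpha> \<beta>" by (rule Rn.tang_rep)
  then have x: "x = trunc p \<alpha>" using assms by (simp add: fibre_pts)
  show thesis by (rule that[of "trunc p \<beta>"]) (simp_all add: t x mtang_trunc)
qed

lemma mtang_coefs: "pow_coefs p 1 (mtang p x y) {#0#} = trunc p y"
proof -
  have "tc {#0#} (\<lambda>d. x j + y j * d 0) = y j" for j
  proof -
    have "tc {#0#} (\<lambda>d. x j + y j * d 0) = tc {#0#} (\<lambda>d. x j) + y j * tc {#0#} (mpow {#0#})"
      using tc_lincomb[of "\<lambda>d. x j" "mpow {#0#}"] by (simp add: smoothn_mpow mpow_def)
    then show ?thesis by (simp add: tc_const tc_mpow)
  qed
  then have 1: "tc {#0#} (\<lambda>d. trunc p (\<lambda>i. x i + y i * d 0) j) = y j" if "j < p" for j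
    using that by (simp add: trunc_def)
  have "pow_coefs p 1 (mtang p x y) = (\<lambda>K j. if K \<in> pow_basis 1 \<and> j < p then tc K (\<lambda>d. trunc p (\<lambda>i. x i + y i * d 0) j) else 0)"
    unfolding Rn.tang_def
    by (rule coefs_cls[OF weil_D_pow]) (auto simp: trunc_def pts_Rn intro!: smoothn_add smoothn_mult smoothn_if)
  then show ?thesis using 1 by (auto simp: pow_basis_1 trunc_def fun_eq_iff)
qed

lemma conn_theta:
  assumes x: "x \<in> pts (Rn p)" and y: "y \<in> pts (Rn p)" and J: "param (jet_tower p q n) (jidx p q n) (jmk p q n)"
  shows "conn (theta p q (Suc n) x u) (mtang p x y) = jtang p q n (jvec x u) (jvec y (dshift p y u))"
proof -
  interpret J: parametrized "jet_tower p q n" "jidx p q n" "jmk p q n" by unfold_locales (rule J)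
  have "(\<lambda>i. x i + y i * s) \<in> pts (Rn p)" for s using x y by (simp add: pts_Rn)
  then have "jmk p q n (\<lambda>i. jvec x u i + jvec y (dshift p y u) i * s) =
      theta p q n (\<lambda>i. x i + y i * s) (\<lambda>j K. u j K + (\<Sum>i<p. u j (add_mset i K) * y i) * s)" for s
    by (simp add: jmk_def trunc_id dshift_def)
  then show ?thesis
    using mtang_fibre[OF x, of y] mtang_coefs[of p x y] y by (simp add: J.tang_def Let_def trunc_id)
qed

lemma J1_fibre_extI:
  assumes x: "x \<in> pts (Rn p)" and N: "N \<in> extensional (pts (fibre (Rn p) DD x))"
    and eq: "\<And>y. y \<in> pts (Rn p) \<Longrightarrow> N (mtang p x y) = conn (theta p q (Suc n) x u) (mtang p x y)"
  shows "N = conn (theta p q (Suc n) x u)"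
proof (rule extensionalityI[OF N])
  show "conn (theta p q (Suc n) x u) \<in> extensional (pts (fibre (Rn p) DD x))" by (simp add: restrict_extensional)
  fix t assume "t \<in> pts (fibre (Rn p) DD x)"
  then show "N t = conn (theta p q (Suc n) x u) t" using eq mtang_rep by metis
qed

lemma jproj_smooth:
  assumes J: "param (jet_tower p q n) (jidx p q n) (jmk p q n)"
  shows "jproj p \<in> smooth_maps (jet_tower p q n) (Rn p)"
proof -
  interpret J: parametrized "jet_tower p q n" "jidx p q n" "jmk p q n" by unfold_locales (rule J)
  show ?thesis
  proof (rule smooth_mapsI)
    show "jproj p z \<in> pts (Rn p)" for z by (simp add: jproj_def)
    fix c assume "c \<in> curves (jet_tower p q n)"
    then obtain v where v: "\<forall>i\<in>jidx p q n. smooth_fun (\<lambda>t. v t i)" "c = (\<lambda>t. jmk p q n (v t))"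
      unfolding J.curves_eq by blast
    show "(\<lambda>t. jproj p (c t)) \<in> curves (Rn p)"
      unfolding v(2) jproj_jmk by (rule Rn.curve_mk) (use v(1) in \<open>auto simp: jidx_def\<close>)
  qed
qed

lemma smooth_trunc_curve: "(\<And>i. i < p \<Longrightarrow> smooth_fun (\<lambda>t. f t i)) \<Longrightarrow> smooth_fun (\<lambda>t. trunc p (f t) i)"
  by (cases "i < p") (simp_all add: trunc_def)

lemma jtang_proj:
  assumes J: "param (jet_tower p q n) (jidx p q n) (jmk p q n)"
  shows "tmap (Rn p) DD (jproj p) (jtang p q n \<alpha> \<beta>) = mtang p (\<lambda>i. \<alpha> (Inl i)) (\<lambda>i. \<beta> (Inl i))"
proof -
  interpret J: parametrized "jet_tower p q n" "jidx p q n" "jmk p q n" by unfold_locales (rule J)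
  show ?thesis unfolding J.tmap_tang[OF jproj_smooth[OF J]] jproj_jmk Rn.tang_def ..
qed

text \<open>In coordinates the direction of motion is linear in \<open>y\<close>. This gives
  smoothness and homogeneity, and \<open>mu_compatibleI\<close> turns homogeneity into the
  conditions over \<open>D_ord m\<close>.\<close>

lemma conn_J1_fibre:
  assumes x: "x \<in> pts (Rn p)" and J: "param (jet_tower p q n) (jidx p q n) (jmk p q n)"
  shows "conn (theta p q (Suc n) x u) \<in> J1_fibre (jet_tower p q n) (Rn p) (jproj p) (theta p q n x u)"
proof -
  interpret J: parametrized "jet_tower p q n" "jidx p q n" "jmk p q n" by unfold_locales (rule J)
  define N where "N = conn (theta p q (Suc n) x u)"
  define A where "A = fibre (Rn p) DD x"
  define B where "B = fibre (jet_tower p q n) DD (theta p q n x u)"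
  have N: "N (mtang p x y) = jtang p q n (jvec x u) (jvec y (dshift p y u))" if "y \<in> pts (Rn p)" for y
    unfolding N_def by (rule conn_theta[OF x that J])
  have NB: "N t \<in> pts B" if t: "t \<in> pts A" for t
  proof -
    obtain y where y: "y \<in> pts (Rn p)" "t = mtang p x y" "x \<in> pts (Rn p)" by (rule mtang_rep[OF t[unfolded A_def]])
    show ?thesis unfolding y(2) N[OF y(1)] by (simp add: B_def fibre_pts jmk_jvec x)
  qed
  have sm: "N \<in> smooth_maps A B"
  proof (rule smooth_mapsI[OF NB])
    fix c assume c: "c \<in> curves A"
    then have cM: "c \<in> curves (Rn p \<otimes>\<^sub>W DD)" unfolding A_def fibre_curves by blast
    from Rn.tang_curve_ex[OF cM] obtain \<alpha> \<beta> where \<beta>: "\<forall>i\<in>{..<p}. smooth_fun (\<lambda>t. \<beta> t i)"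
      and ct: "c = (\<lambda>t. mtang p (\<alpha> t) (\<beta> t))"
      by (elim exE conjE)
    have xt: "x = trunc p (\<alpha> t)" for t
      using c unfolding A_def fibre_curves ct by simp
    have ct': "c t = mtang p x (trunc p (\<beta> t))" for t
      unfolding ct by (subst xt[of t]) (simp add: mtang_trunc)
    have Nc: "N (c t) = jtang p q n (jvec x u) (jvec (trunc p (\<beta> t)) (dshift p (trunc p (\<beta> t)) u))" for t
      unfolding ct' by (rule N) simp
    have "(\<lambda>t. N (c t)) \<in> curves (jet_tower p q n \<otimes>\<^sub>W DD)"
      unfolding Nc
    proof (rule J.tang_curve)
      fix i assume "i \<in> jidx p q n"
      then show "smooth_fun (\<lambda>t. jvec (trunc p (\<beta> t)) (dshift p (trunc p (\<beta> t)) u) i)"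
        using \<beta> by (auto simp: jidx_def dshift_def intro!: smooth_trunc_curve smooth_sum smooth_mult)
    qed simp
    moreover have "base (N (c t)) = theta p q n x u" for t
      unfolding Nc by (simp add: jmk_jvec x)
    ultimately show "(\<lambda>t. N (c t)) \<in> curves B" unfolding B_def fibre_curves by blast
  qed
  have hom: "N (wcomp (Rn p) DD (scale 0 s) t) = wcomp (jet_tower p q n) DD (scale 0 s) (N t)" if tA: "t \<in> pts A" for t s
  proof -
    obtain y where y: "y \<in> pts (Rn p)" "t = mtang p x y" "x \<in> pts (Rn p)"
      by (rule mtang_rep[OF tA[unfolded A_def]])
    have "(\<lambda>i. s * y i) \<in> pts (Rn p)" using y(1) by (simp add: pts_Rn)
    moreover have "jvec (\<lambda>i. s * y i) (dshift p (\<lambda>i. s * y i) u) = (\<lambda>i. s * jvec y (dshift p y u) i)"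
      by (rule ext) (auto simp: jvec_def dshift_def sum_distrib_left mult_ac split: sum.split)
    ultimately show ?thesis using y by (simp add: Rn.tang_scale J.tang_scale N)
  qed
  have proj: "tmap (Rn p) DD (jproj p) (N t) = t" if tA: "t \<in> pts A" for t
  proof -
    obtain y where y: "y \<in> pts (Rn p)" "t = mtang p x y" "x \<in> pts (Rn p)"
      by (rule mtang_rep[OF tA[unfolded A_def]])
    then show ?thesis by (simp add: N jtang_proj[OF J])
  qed
  have mu: "mu_compatible (Rn p) DD A 0 (jet_tower p q n) DD B 0 m N" for m
    by (rule mu_compatibleI[OF sm]) (use Rn.scaling_smooth(1) hom in \<open>auto simp: A_def\<close>)
  show ?thesis
    unfolding J1_fibre_def Let_def jproj_theta[OF x] A_def[symmetric] B_def[symmetric] N_def[symmetric]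
    using sm proj hom mu by (auto simp: N_def A_def restrict_extensional)
qed

text \<open>The coordinates of the value are smooth functions of the tangent vector, because smooth
  curves of tangent vectors are mapped to smooth curves, and they are homogeneous;
  \<open>homogeneous_linear\<close> does the rest.\<close>

lemma J1_fibre_linear:
  assumes x: "x \<in> pts (Rn p)" and J: "param (jet_tower p q n) (jidx p q n) (jmk p q n)"
    and N: "N \<in> J1_fibre (jet_tower p q n) (Rn p) (jproj p) (theta p q n x u)"
  shows "\<exists>c. \<forall>y\<in>pts (Rn p). N (mtang p x y) = jtang p q n (jvec x u) (jvec y (lin p c y))"
proof -
  interpret J: parametrized "jet_tower p q n" "jidx p q n" "jmk p q n" by unfold_locales (rule J)
  define A where "A = fibre (Rn p) DD x"
  define B where "B = fibre (jet_tower p q n) DD (theta p q n x u)"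
  have sm: "N \<in> smooth_maps A B"
    and proj: "\<And>t. t \<in> pts A \<Longrightarrow> tmap (Rn p) DD (jproj p) (N t) = t"
    and hom: "\<And>s t. t \<in> pts A \<Longrightarrow> N (wcomp (Rn p) DD (scale 0 s) t) = wcomp (jet_tower p q n) DD (scale 0 s) (N t)"
    using N unfolding J1_fibre_def Let_def jproj_theta[OF x] A_def B_def by blast+
  have tA: "mtang p x y \<in> pts A" for y unfolding A_def by (rule mtang_fibre[OF x])
  have "\<exists>\<beta>. N (mtang p x y) = jtang p q n (jvec x u) \<beta>" for y
  proof -
    have "N (mtang p x y) \<in> pts B" by (rule smooth_mapsD(1)[OF sm tA])
    then have NJ: "N (mtang p x y) \<in> pts (jet_tower p q n \<otimes>\<^sub>W DD)" and Nb: "base (N (mtang p x y)) = theta p q n x u"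
      unfolding B_def fibre_pts by blast+
    obtain \<alpha> \<beta> where ab: "N (mtang p x y) = jtang p q n \<alpha> \<beta>" by (rule J.tang_rep[OF NJ])
    have "jmk p q n \<alpha> = jmk p q n (jvec x u)" using Nb by (simp add: ab jmk_jvec x)
    then have "jtang p q n \<alpha> \<beta> = jtang p q n (jvec x u) \<beta>" unfolding J.mk_eq J.tang_eq by blast
    then show ?thesis using ab by auto
  qed
  then obtain b where b: "\<And>y. N (mtang p x y) = jtang p q n (jvec x u) (b y)" by metis
  have smb: "smoothn (\<lambda>y. b y i)" if i: "i \<in> jidx p q n" for i
    unfolding smoothn_def
  proof (intro allI impI)
    fix y :: "real \<Rightarrow> vec" assume y: "\<forall>i. smooth_fun (\<lambda>t. y t i)"
    have "(\<lambda>t. mtang p x (y t)) \<in> curves (Rn p \<otimes>\<^sub>W DD)" by (rule Rn.tang_curve) (use y in auto)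
    then have "(\<lambda>t. mtang p x (y t)) \<in> curves A" unfolding A_def fibre_curves by (simp add: trunc_id x)
    then have "(\<lambda>t. N (mtang p x (y t))) \<in> curves (jet_tower p q n \<otimes>\<^sub>W DD)"
      using smooth_mapsD(2)[OF sm] unfolding B_def fibre_curves by blast
    from J.tang_curve_ex[OF this] obtain \<alpha> \<beta> where
      \<beta>: "\<forall>i\<in>jidx p q n. smooth_fun (\<lambda>t. \<beta> t i)"
      "(\<lambda>t. N (mtang p x (y t))) = (\<lambda>t. jtang p q n (\<alpha> t) (\<beta> t))"
      by (elim exE conjE)
    have "jtang p q n (jvec x u) (b (y t)) = jtang p q n (\<alpha> t) (\<beta> t)" for t
      using fun_cong[OF \<beta>(2), of t] b by simp
    then have "b (y t) i = \<beta> t i" for t using i unfolding J.tang_eq by blast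
    then show "smooth_fun (\<lambda>t. b (y t) i)" using \<beta>(1) i by simp
  qed
  have homb: "b (\<lambda>k. s * y k) i = s * b y i" if i: "i \<in> jidx p q n" for i s y
  proof -
    have "jtang p q n (jvec x u) (b (\<lambda>k. s * y k)) = N (wcomp (Rn p) DD (scale 0 s) (mtang p x y))"
      by (simp add: b Rn.tang_scale)
    also have "\<dots> = jtang p q n (jvec x u) (\<lambda>i. s * b y i)"
      by (simp add: hom[OF tA] b J.tang_scale)
    finally show ?thesis using i unfolding J.tang_eq by blast
  qed
  have "\<exists>c. \<forall>y. b (trunc p y) i = (\<Sum>k<p. c k * y k)" if i: "i \<in> jidx p q n" for i
    by (rule homogeneous_linear[OF smb[OF i] homb[OF i]])
  then obtain c where c: "\<And>i y. i \<in> jidx p q n \<Longrightarrow> b (trunc p y) i = (\<Sum>k<p. c i k * y k)" by metis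
  show ?thesis
  proof (intro exI[of _ "\<lambda>j K. c (Inr (j, K))"] ballI)
    fix y assume y: "y \<in> pts (Rn p)"
    \<comment> \<open>The projection condition leaves no freedom in the base coordinates: their
      direction is \<open>y\<close> itself.\<close>
    have "mtang p (\<lambda>i. jvec x u (Inl i)) (\<lambda>i. b y (Inl i)) = mtang p x y"
      using proj[OF tA[of y]] by (simp add: b jtang_proj[OF J])
    then have bl: "b y (Inl i) = y i" if "i < p" for i using that unfolding Rn.tang_eq by simp
    have "b y i = jvec y (lin p (\<lambda>j K. c (Inr (j, K))) y) i" if i: "i \<in> jidx p q n" for i
    proof (cases i)
      case (Inl k)
      then show ?thesis using bl i by (auto simp: jidx_def)
    next
      case (Inr jK)
      then show ?thesis using c[OF i, of y] y by (cases jK) (simp add: trunc_id lin_def)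
    qed
    then show "N (mtang p x y) = jtang p q n (jvec x u) (jvec y (lin p (\<lambda>j K. c (Inr (j, K))) y))"
      unfolding b J.tang_eq by blast
  qed
qed

text \<open>In coordinates evaluation is the polynomial \<open>dshift\<close> in both arguments. Its
  smoothness permits the prolongation of the evaluation by \<open>apply_pair_cls\<close>.\<close>

lemma ev_smooth:
  assumes J: "param (jet_tower p q k) (jidx p q k) (jmk p q k)"
    and J': "param (jet_tower p q (Suc k)) (jidx p q (Suc k)) (jmk p q (Suc k))"
  shows "(\<lambda>(z, t). conn z t) \<in> smooth_maps (fibre_product (jet_tower p q (Suc k)) (Rn p \<otimes>\<^sub>W DD) (jproj p) base)
    (jet_tower p q k \<otimes>\<^sub>W DD)"
proof -
  interpret J: parametrized "jet_tower p q k" "jidx p q k" "jmk p q k" by unfold_locales (rule J)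
  interpret J': parametrized "jet_tower p q (Suc k)" "jidx p q (Suc k)" "jmk p q (Suc k)" by unfold_locales (rule J')
  have ev: "conn (jmk p q (Suc k) a) (mtang p \<alpha> \<beta>) = jtang p q k (jvec (trunc p (\<lambda>i. a (Inl i))) (\<lambda>j K. a (Inr (j, K))))
      (jvec (trunc p \<beta>) (dshift p (trunc p \<beta>) (\<lambda>j K. a (Inr (j, K)))))"
    if "trunc p (\<lambda>i. a (Inl i)) = trunc p \<alpha>" for a \<alpha> \<beta>
  proof -
    have "mtang p \<alpha> \<beta> = mtang p (trunc p (\<lambda>i. a (Inl i))) (trunc p \<beta>)" by (simp add: that mtang_trunc)
    then show ?thesis
      using conn_theta[of "trunc p (\<lambda>i. a (Inl i))" p "trunc p \<beta>" q k "\<lambda>j K. a (Inr (j, K))"] J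
      by (simp add: jmk_def[of _ _ "Suc k"])
  qed
  show ?thesis
  proof (rule smooth_mapsI)
    fix z assume z: "z \<in> pts (fibre_product (jet_tower p q (Suc k)) (Rn p \<otimes>\<^sub>W DD) (jproj p) base)"
    obtain w t where wt: "z = (w, t)" by (cases z)
    obtain a where a: "w = jmk p q (Suc k) a" using z unfolding wt fibre_product_pts J'.pts_eq by blast
    have "t \<in> pts (Rn p \<otimes>\<^sub>W DD)" using z unfolding wt fibre_product_pts by blast
    then obtain \<alpha> \<beta> where t: "t = mtang p \<alpha> \<beta>" by (rule Rn.tang_rep)
    have "trunc p (\<lambda>i. a (Inl i)) = trunc p \<alpha>" using z unfolding wt fibre_product_pts a t jproj_jmk by simp
    then show "(case z of (z, t) \<Rightarrow> conn z t) \<in> pts (jet_tower p q k \<otimes>\<^sub>W DD)"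
      unfolding wt a t prod.case by (simp only: ev J.tang_pts)
  next
    fix c assume c: "c \<in> curves (fibre_product (jet_tower p q (Suc k)) (Rn p \<otimes>\<^sub>W DD) (jproj p) base)"
    obtain a where a: "\<forall>i\<in>jidx p q (Suc k). smooth_fun (\<lambda>t. a t i)" "(\<lambda>t. fst (c t)) = (\<lambda>t. jmk p q (Suc k) (a t))"
      using c unfolding fibre_product_curves J'.curves_eq by blast
    have "(\<lambda>t. snd (c t)) \<in> curves (Rn p \<otimes>\<^sub>W DD)" using c unfolding fibre_product_curves by blast
    from Rn.tang_curve_ex[OF this] obtain \<alpha> \<beta> where \<beta>: "\<forall>i\<in>{..<p}. smooth_fun (\<lambda>t. \<beta> t i)"
      and ct: "(\<lambda>t. snd (c t)) = (\<lambda>t. mtang p (\<alpha> t) (\<beta> t))"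
      by (elim exE conjE)
    have bs: "trunc p (\<lambda>i. a t (Inl i)) = trunc p (\<alpha> t)" for t
      using c unfolding fibre_product_curves by (simp add: fun_cong[OF a(2)] fun_cong[OF ct] jproj_jmk)
    have eq: "(case c t of (z, s) \<Rightarrow> conn z s) = jtang p q k (jvec (trunc p (\<lambda>i. a t (Inl i))) (\<lambda>j K. a t (Inr (j, K))))
      (jvec (trunc p (\<beta> t)) (dshift p (trunc p (\<beta> t)) (\<lambda>j K. a t (Inr (j, K)))))" for t
      using ev[OF bs[of t], of "\<beta> t"] fun_cong[OF a(2), of t] fun_cong[OF ct, of t] by (simp add: split_beta)
    have aK: "smooth_fun (\<lambda>t. a t (Inr (j, K)))" if "j < q" "K \<in> jet_basis p (Suc k)" for j K
      using a(1) that by (auto simp: jidx_def)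
    have tb: "smooth_fun (\<lambda>t. trunc p (\<beta> t) i)" for i using \<beta> by (intro smooth_trunc_curve) simp
    have ta: "smooth_fun (\<lambda>t. trunc p (\<lambda>i. a t (Inl i)) i)" for i
      using a(1) by (intro smooth_trunc_curve) (simp add: jidx_def)
    show "(\<lambda>t. case c t of (z, s) \<Rightarrow> conn z s) \<in> curves (jet_tower p q k \<otimes>\<^sub>W DD)"
      unfolding eq
    proof (rule J.tang_curve)
      fix i assume i: "i \<in> jidx p q k"
      show "smooth_fun (\<lambda>t. jvec (trunc p (\<lambda>i. a t (Inl i))) (\<lambda>j K. a t (Inr (j, K))) i)"
        using i ta aK jet_basis_mono by (auto simp: jidx_def)
      show "smooth_fun (\<lambda>t. jvec (trunc p (\<beta> t)) (dshift p (trunc p (\<beta> t)) (\<lambda>j K. a t (Inr (j, K)))) i)"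
        using i tb aK add_mset_jet_basis by (auto simp: jidx_def dshift_def intro!: smooth_sum smooth_mult)
    qed
  qed
qed

declare theta.simps(2) [simp del] jet_tower.simps(2,3) [simp del]

lemma ball_jidx: "(\<forall>i\<in>jidx p q n. P i) \<longleftrightarrow> (\<forall>i<p. P (Inl i)) \<and> (\<forall>j<q. \<forall>K\<in>jet_basis p n. P (Inr (j, K)))"
  by (auto simp: jidx_def)

section \<open>The holonomy conditions in coordinates\<close>

lemma split_pair: "split_map 1 0 (\<lambda>_. 1) (\<lambda>e d. vec2 (e 0) (d 0))"
proof
  have sets: "{..<1} = {0::nat}" "{..1} - {0} = {1::nat}" by auto
  show "bij_betw (\<lambda>_. 1) {..<1::nat} ({..1} - {0::nat})" unfolding sets by (simp add: bij_betw_def)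
  fix i :: nat
  show "(\<exists>k. \<forall>e d. vec2 (e 0) (d 0) i = d k) \<or> (\<forall>e d. vec2 (e 0) (d 0) i = e 0) \<or> (\<forall>e d. vec2 (e 0) (d 0) i = 0)"
    by (cases "i = 0"; cases "i = 1") (auto simp: vec2_def)
qed (auto simp: vec2_def pts_Rn)

lemma pow_basis_2: "pow_basis 2 = {{#}, {#0#}, {#1#}, {#0, 1#}}"
proof -
  have "{..<2} = {0, 1::nat}" by auto
  then have "Pow {..<2} = {{}, {0}, {1}, {0, 1::nat}}" by auto
  then show ?thesis by (simp add: pow_basis_def)
qed

text \<open>The two cubic terms occur in representatives of P(\<gamma>) and of its transpose. Each
  contains the square of a variable, so they leave the four coefficients on the basis alone.\<close>

lemma tc_quadratic:
  assumes f_def: "f = (\<lambda>d. a0 + a1 * d 0 + a2 * d 1 + a3 * (d 0 * d 1) + a4 * (d 0 * (d 0 * d 1)) + a5 * (d 0 * (d 1 * d 1)))"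
  shows "tc {#} f = a0" "tc {#0#} f = a1" "tc {#1#} f = a2" "tc {#0, 1#} f = a3"
proof -
  define c where "c K = (if K = {#} then a0 else if K = {#0#} then a1 else if K = {#1#} then a2 else
     if K = {#0, 1#} then a3 else if K = {#0, 0, 1#} then a4 else if K = {#0, 1, 1#} then a5 else 0)" for K :: "nat multiset"
  define B :: "nat multiset set" where "B = {{#}, {#0#}, {#1#}, {#0, 1#}, {#0, 0, 1#}, {#0, 1, 1#}}"
  have "f = (\<lambda>d. \<Sum>L\<in>B. c L * mpow L d)"
    unfolding f_def B_def c_def by (rule ext) (simp add: add_eq_conv_ex algebra_simps)
  then have "tc K f = c K" if "K \<in> B" for K using tc_poly[of B K c] that by (simp add: B_def)
  from this[of "{#}"] this[of "{#0#}"] this[of "{#1#}"] this[of "{#0, 1#}"]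
  show "tc {#} f = a0" "tc {#0#} f = a1" "tc {#1#} f = a2" "tc {#0, 1#} f = a3"
    by (simp_all add: B_def c_def del: tc_empty)
qed

definition sq :: "vec \<Rightarrow> vec \<Rightarrow> vec \<Rightarrow> vec \<Rightarrow> vec \<Rightarrow> vec" where
  "sq x y z w d = (\<lambda>i. x i + y i * d 0 + z i * d 1 + w i * (d 0 * d 1))"

text \<open>The jet coordinates of $P(\gamma)$ for the square \<open>\<gamma>\<close> given by \<open>sq\<close>, where \<open>c\<close> contains the coefficients of the
  linear map $\nabla_x$.\<close>

definition sqJ where
  "sqJ p c u y z w j K d = u j K + lin p c y j K * d 0 +
    (\<Sum>i<p. (u j (add_mset i K) + lin p c y j (add_mset i K) * d 0) * (z i + w i * d 0)) * d 1"

lemma smoothn_sq: "smoothn (\<lambda>d. sq x y z w d i)"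
  unfolding sq_def by (intro smoothn_add smoothn_mult smoothn_const smoothn_coord)

lemma smoothn_sqJ: "smoothn (sqJ p c u y z w j K)"
  unfolding sqJ_def by (intro smoothn_add smoothn_mult smoothn_const smoothn_coord smoothn_sum)

lemma sqJ_poly: "sqJ p c u y z w j K d = u j K + lin p c y j K * d 0 + dshift p z u j K * d 1 +
    (dshift p w u j K + (\<Sum>i<p. lin p c y j (add_mset i K) * z i)) * (d 0 * d 1) +
    (\<Sum>i<p. lin p c y j (add_mset i K) * w i) * (d 0 * (d 0 * d 1))"
proof -
  have "(\<Sum>i<p. (u j (add_mset i K) + lin p c y j (add_mset i K) * d 0) * (z i + w i * d 0))
      = dshift p z u j K + (dshift p w u j K + (\<Sum>i<p. lin p c y j (add_mset i K) * z i)) * d 0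
       + (\<Sum>i<p. lin p c y j (add_mset i K) * w i) * (d 0 * d 0)"
    unfolding dshift_def sum_distrib_right sum.distrib [symmetric]
    by (intro sum.cong refl) (simp add: algebra_simps)
  then show ?thesis unfolding sqJ_def by (simp add: algebra_simps)
qed

lemma sq_rep:
  assumes "\<gamma> \<in> pts (fibre (Rn p) (D_pow 2) x)"
  obtains y z w where "y \<in> pts (Rn p)" "z \<in> pts (Rn p)" "w \<in> pts (Rn p)" "x \<in> pts (Rn p)"
    "\<gamma> = cls (Rn p) (D_pow 2) (\<lambda>d. trunc p (sq x y z w d))"
proof -
  interpret T: parametrized "Rn p \<otimes>\<^sub>W D_pow 2" "{..<p} \<times> pow_basis 2" "tens_mk (Rn p) (D_pow 2) (pow_basis 2) (trunc p)"
    by unfold_locales (rule Rn.param_tens[OF weil_D_pow])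
  have "\<gamma> \<in> pts (Rn p \<otimes>\<^sub>W D_pow 2)" using assms by (simp add: fibre_pts)
  then obtain a where a: "\<gamma> = tens_mk (Rn p) (D_pow 2) (pow_basis 2) (trunc p) a" unfolding T.pts_eq by blast
  have sm: "(\<lambda>d. trunc p (\<lambda>i. \<Sum>L\<in>pow_basis 2. a (i, L) * mpow L d)) \<in> smooth_maps (Rn (nvars (D_pow 2))) (Rn p)"
    by (intro Rn.smooth_mk smoothn_poly)
  define x' where "x' = (\<lambda>i. a (i, {#}))"
  define y where "y = (\<lambda>i. a (i, {#0#}))"
  define z where "z = (\<lambda>i. a (i, {#1#}))"
  define w where "w = (\<lambda>i. a (i, {#0, 1#}))"
  have "(\<lambda>i. \<Sum>L\<in>pow_basis 2. a (i, L) * mpow L d) = sq x' y z w d" for d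
    unfolding pow_basis_2 sq_def x'_def y_def z_def w_def by (simp add: add_eq_conv_ex algebra_simps)
  then have \<gamma>: "\<gamma> = cls (Rn p) (D_pow 2) (\<lambda>d. trunc p (sq x' y z w d))" by (simp add: a tens_mk_def)
  have "base \<gamma> = trunc p x'"
    unfolding a tens_mk_def using Rn.base_cls[OF weil_D_pow sm] by (simp add: pow_basis_2 add_eq_conv_ex x'_def)
  then have x: "x = trunc p x'" using assms by (simp add: fibre_pts)
  have "trunc p (sq x' y z w d) = trunc p (sq x (trunc p y) (trunc p z) (trunc p w) d)" for d
    by (auto simp: x trunc_def sq_def)
  then show thesis using \<gamma> x by (intro that[of "trunc p y" "trunc p z" "trunc p w"]) simp_all
qed

definition unitv :: "nat \<Rightarrow> vec" where
  "unitv i = (\<lambda>j. if j = i then 1 else 0)"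

lemma unitv_pts: "i < p \<Longrightarrow> unitv i \<in> pts (Rn p)"
  by (simp add: unitv_def pts_Rn)

lemma lin_unitv: "i < p \<Longrightarrow> lin p c (unitv i) j K = c j K i"
  by (simp add: lin_def unitv_def if_distrib sum.delta cong: if_cong)

lemma dshift_unitv: "i < p \<Longrightarrow> dshift p (unitv i) u j K = u j (add_mset i K)"
  by (simp add: dshift_def unitv_def if_distrib sum.delta cong: if_cong)

lemma swap_weil: "weil_map (D_pow 2) (D_pow 2) (\<lambda>d. vec2 (d 1) (d 0))"
proof (rule weil_map_pow)
  fix i :: nat assume "i < 2"
  then have "i = 0 \<or> i = 1" by auto
  then show "(\<forall>v. vec2 (v 1) (v 0) i = 0) \<or> (\<exists>j<2. \<exists>c. smoothn c \<and> (\<forall>v :: vec. vec2 (v 1) (v 0) i = c v * v j))"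
    by (intro disjI2 exI[of _ "1 - i"]) (auto simp: vec2_def intro!: exI[of _ "\<lambda>_. 1"])
qed (auto simp: vec2_def pts_Rn intro!: smoothn_if)

context
  fixes p q k :: nat
  assumes Jk: "param (jet_tower p q k) (jidx p q k) (jmk p q k)"
    and Jn: "param (jet_tower p q (Suc k)) (jidx p q (Suc k)) (jmk p q (Suc k))"
begin

interpretation Jk: parametrized "jet_tower p q k" "jidx p q k" "jmk p q k" by unfold_locales (rule Jk)
interpretation Jn: parametrized "jet_tower p q (Suc k)" "jidx p q (Suc k)" "jmk p q (Suc k)" by unfold_locales (rule Jn)

lemma under_smooth: "under \<in> smooth_maps (jet_tower p q (Suc k)) (jet_tower p q k)"
proof (rule smooth_mapsI)
  show "under z \<in> pts (jet_tower p q k)" if "z \<in> pts (jet_tower p q (Suc k))" for z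
    using that unfolding Jn.pts_eq by (auto simp: under_jmk)
  fix c assume "c \<in> curves (jet_tower p q (Suc k))"
  then obtain v where v: "\<forall>i\<in>jidx p q (Suc k). smooth_fun (\<lambda>t. v t i)" "c = (\<lambda>t. jmk p q (Suc k) (v t))"
    unfolding Jn.curves_eq by blast
  show "(\<lambda>t. under (c t)) \<in> curves (jet_tower p q k)"
    unfolding v(2) under_jmk
    by (rule Jk.curve_mk) (use v(1) jet_basis_mono in \<open>auto simp: jidx_def\<close>)
qed

text \<open>The first edge of the square, with direction \<open>y\<close>, moves the jet by
  \<open>N\<close>; the moved jet is then evaluated on the tangent vector at x + y e with direction
  z + w e, where \<open>e\<close> is the first variable.\<close>

lemma iterate_conn_eq:
  assumes x: "x \<in> pts (Rn p)" and y: "y \<in> pts (Rn p)" and z: "z \<in> pts (Rn p)" and w: "w \<in> pts (Rn p)"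
    and N: "\<And>y. y \<in> pts (Rn p) \<Longrightarrow> N (mtang p x y) = jtang p q (Suc k) (jvec x u) (jvec y (lin p c y))"
  shows "iterate_conn p (jet_tower p q k) (jet_tower p q (Suc k)) N
      (cls (Rn p) (D_pow 2) (\<lambda>d. trunc p (sq x y z w d))) =
    cls (jet_tower p q k) (D_pow 2) (\<lambda>d. jmk p q k (jvec (sq x y z w d) (\<lambda>j K. sqJ p c u y z w j K d)))"
proof -
  let ?T = "Rn p \<otimes>\<^sub>W DD" and ?J = "jet_tower p q (Suc k)" and ?Z = "jet_tower p q k"
  let ?pair = "\<lambda>e d. vec2 (e 0) (d 0)"
  let ?\<gamma> = "cls (Rn p) (D_pow 2) (\<lambda>d. trunc p (sq x y z w d))"
  define mkT where "mkT = tens_mk (Rn p) DD (pow_basis 1) (trunc p)"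
  have two: "D_pow 2 = D_pow (Suc 1)" by (simp add: numeral_2_eq_2 One_nat_def)
  have parT: "param ?T ({..<p} \<times> pow_basis 1) mkT" unfolding mkT_def by (rule Rn.param_tens[OF weil_D_pow])
  have mkT: "mkT a = mtang p (\<lambda>i. a (i, {#})) (\<lambda>i. a (i, {#0#}))" for a
    unfolding mkT_def by (rule Rn.tens_mk_eq_tang)
  \<comment> \<open>\<open>a\<close> holds the coordinates of the jet moved along the first edge,
    and \<open>b\<close> those of the square viewed as a moving tangent vector; their base points
    agree for every \<open>e\<close>.\<close>
  define a where "a e = (\<lambda>i. jvec x u i + jvec y (lin p c y) i * e (0::nat))" for e
  define b where "b e = (\<lambda>(i, K). if K = ({#} :: nat multiset) then x i + y i * e (0::nat) else z i + w i * e 0)" for e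
  have b: "mkT (b e) = mtang p (\<lambda>i. x i + y i * e 0) (\<lambda>i. z i + w i * e 0)" for e
    unfolding mkT b_def by simp
  have sm\<gamma>: "(\<lambda>d. trunc p (sq x y z w d)) \<in> smooth_maps (Rn (nvars (D_pow 2))) (Rn p)"
    by (intro Rn.smooth_mk smoothn_sq)
  have wm: "weil_map DD (D_pow 2) (\<lambda>d. vec2 (d 0) 0)"
  proof (rule weil_map_pow)
    fix i :: nat assume "i < 2"
    then have "i = 0 \<or> i = 1" by auto
    then show "(\<forall>v. vec2 (v 0) 0 i = 0) \<or> (\<exists>j<1. \<exists>c. smoothn c \<and> (\<forall>v :: vec. vec2 (v 0) 0 i = c v * v j))"
      by (auto simp: vec2_def intro!: exI[of _ 0] exI[of _ "\<lambda>_. 1"])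
  qed (auto simp: vec2_def pts_Rn)
  have "wcomp (Rn p) DD (\<lambda>d. vec2 (d 0) 0) ?\<gamma> = cls (Rn p) DD ((\<lambda>d. trunc p (sq x y z w d)) \<circ> (\<lambda>d. vec2 (d 0) 0))"
    by (rule wcomp_cls[OF wm sm\<gamma>])
  also have "\<dots> = mtang p x y"
    unfolding Rn.tang_def by (simp add: comp_def sq_def vec2_def)
  finally have 1: "N (wcomp (Rn p) DD (\<lambda>d. vec2 (d 0) 0) ?\<gamma>) = cls ?J DD (\<lambda>d. jmk p q (Suc k) (a d))"
    by (simp add: N[OF y] Jn.tang_def a_def)
  have "wsplit (Rn p) DD DD ?pair ?\<gamma> = cls ?T DD (\<lambda>e. cls (Rn p) DD (\<lambda>d. trunc p (sq x y z w (?pair e d))))"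
    unfolding two by (rule Rn.wsplit_eq_tens_mk(1)[OF split_pair]) (rule smoothn_sq)
  also have "(\<lambda>e. cls (Rn p) DD (\<lambda>d. trunc p (sq x y z w (?pair e d)))) = (\<lambda>e. mkT (b e))"
    unfolding b Rn.tang_def by (simp add: sq_def vec2_def algebra_simps)
  finally have 2: "wsplit (Rn p) DD DD ?pair ?\<gamma> = cls ?T DD (\<lambda>e. mkT (b e))" .
  have "apply_pair ?J ?T (fibre_product ?J ?T (jproj p) base) (?Z \<otimes>\<^sub>W DD) DD (\<lambda>(z, t). conn z t)
        (cls ?J DD (\<lambda>d. jmk p q (Suc k) (a d))) (cls ?T DD (\<lambda>e. mkT (b e)))
      = cls (?Z \<otimes>\<^sub>W DD) DD (\<lambda>d. (\<lambda>(z, t). conn z t) (jmk p q (Suc k) (a d), mkT (b d)))"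
  \<comment> \<open>The coordinates tied in the fibre product are the constant terms of the tangent
    vector, that is, the coordinates of its base point.\<close>
  proof (rule apply_pair_cls[OF Jn parT, where C = "{..<p} \<times> {{#}}" and \<alpha> = "\<lambda>(i, _). Inl i" and B = "pow_basis 1"])
    show "{..<p} \<times> {{#}} \<subseteq> {..<p} \<times> pow_basis 1" by (auto simp: pow_basis_1)
    show "(\<lambda>(i, _). Inl i) ` ({..<p} \<times> {{#}}) \<subseteq> jidx p q (Suc k)" by (auto simp: jidx_def)
    show "jproj p (jmk p q (Suc k) v) = base (mkT w) \<longleftrightarrow> (\<forall>i\<in>{..<p} \<times> {{#}}. v ((\<lambda>(i, _). Inl i) i) = w i)" for v w
      unfolding jproj_jmk mkT Rn.tang_base Rn.mk_eq by auto
    show "smoothn (\<lambda>d. a d i)" for i unfolding a_def by (intro smoothn_add smoothn_mult smoothn_const smoothn_coord)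
    show "smoothn (\<lambda>d. b d i)" for i
      by (cases i) (simp add: b_def smoothn_if smoothn_add smoothn_mult)
    show "a d ((\<lambda>(i, _). Inl i) i) = b d i" if "i \<in> {..<p} \<times> {{#}}" for d i
      using that by (auto simp: a_def b_def)
  qed (rule weil_D_pow, rule ev_smooth[OF Jk Jn])
  also have "(\<lambda>d. (\<lambda>(z, t). conn z t) (jmk p q (Suc k) (a d), mkT (b d)))
      = (\<lambda>e. cls ?Z DD (\<lambda>d. jmk p q k (jvec (sq x y z w (?pair e d)) (\<lambda>j K. sqJ p c u y z w j K (?pair e d)))))"
  proof
    fix e :: vec
    have xe: "(\<lambda>i. x i + y i * e 0) \<in> pts (Rn p)" "(\<lambda>i. z i + w i * e 0) \<in> pts (Rn p)"
      using x y z w by (simp_all add: pts_Rn)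
    have "jmk p q (Suc k) (a e) = theta p q (Suc k) (\<lambda>i. x i + y i * e 0) (\<lambda>j K. u j K + lin p c y j K * e 0)"
      unfolding jmk_def a_def using xe(1) by (simp add: trunc_id)
    then have "conn (jmk p q (Suc k) (a e)) (mkT (b e)) = jtang p q k (jvec (\<lambda>i. x i + y i * e 0) (\<lambda>j K. u j K + lin p c y j K * e 0))
        (jvec (\<lambda>i. z i + w i * e 0) (dshift p (\<lambda>i. z i + w i * e 0) (\<lambda>j K. u j K + lin p c y j K * e 0)))"
      unfolding b by (simp only: conn_theta[OF xe Jk])
    also have "\<dots> = cls ?Z DD (\<lambda>d. jmk p q k (jvec (sq x y z w (?pair e d)) (\<lambda>j K. sqJ p c u y z w j K (?pair e d))))"
      unfolding Jk.tang_def
      by (intro arg_cong[where f = "cls ?Z DD"] ext arg_cong[where f = "jmk p q k"])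
        (auto simp: jvec_def sq_def sqJ_def vec2_def dshift_def algebra_simps split: sum.split)
    finally show "(\<lambda>(z, t). conn z t) (jmk p q (Suc k) (a e), mkT (b e)) =
        cls ?Z DD (\<lambda>d. jmk p q k (jvec (sq x y z w (?pair e d)) (\<lambda>j K. sqJ p c u y z w j K (?pair e d))))"
      by simp
  qed
  finally have 3: "apply_pair ?J ?T (fibre_product ?J ?T (jproj p) base) (?Z \<otimes>\<^sub>W DD) DD (\<lambda>(z, t). conn z t)
        (N (wcomp (Rn p) DD (\<lambda>d. vec2 (d 0) 0) ?\<gamma>)) (wsplit (Rn p) DD DD ?pair ?\<gamma>) =
      cls (?Z \<otimes>\<^sub>W DD) DD (\<lambda>e. cls ?Z DD (\<lambda>d. jmk p q k (jvec (sq x y z w (?pair e d)) (\<lambda>j K. sqJ p c u y z w j K (?pair e d)))))"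
    by (simp only: 1 2)
  have sv: "smoothn (\<lambda>d. jvec (sq x y z w d) (\<lambda>j K. sqJ p c u y z w j K d) i)" for i
    by (cases i) (auto simp: smoothn_sq smoothn_sqJ)
  show ?thesis
    unfolding iterate_conn_def Let_def 3
    using Jk.wunsplit_cls[OF split_pair, where v = "\<lambda>d. jvec (sq x y z w d) (\<lambda>j K. sqJ p c u y z w j K d)", OF sv]
    by (simp only: two)
qed

text \<open>Compatibility with the jet below fixes the coefficients of order up to \<open>k\<close>.
  Given this, P(\<gamma>) and its transpose can differ only in the coefficient of the product of the
  two variables, where the condition says that the last two indices of \<open>c\<close> may be
  exchanged.\<close>

lemma holonomic_iff:
  assumes x: "x \<in> pts (Rn p)"
    and N: "\<And>y. y \<in> pts (Rn p) \<Longrightarrow> N (mtang p x y) = jtang p q (Suc k) (jvec x u) (jvec y (lin p c y))"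
  shows "(theta p q (Suc k) x u, N) \<in> holonomic p (jet_tower p q k) (jet_tower p q (Suc k)) \<longleftrightarrow>
    (\<forall>j<q. \<forall>K\<in>jet_basis p k. \<forall>i<p. c j K i = u j (add_mset i K)) \<and>
    (\<forall>j<q. \<forall>K\<in>jet_basis p k. \<forall>i<p. \<forall>l<p. c j (add_mset i K) l = c j (add_mset l K) i)"
proof -
  let ?J = "jet_tower p q (Suc k)" and ?Z = "jet_tower p q k"
  let ?\<tau> = "\<lambda>d. vec2 (d 1) (d 0)"
  have "tmap ?Z DD under (N t) = conn (theta p q (Suc k) x u) t \<longleftrightarrow>
      (\<forall>j<q. \<forall>K\<in>jet_basis p k. lin p c y j K = dshift p y u j K)" if y: "y \<in> pts (Rn p)" and t: "t = mtang p x y" for t y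
  proof -
    have "tmap ?Z DD under (N t) = jtang p q k (jvec x u) (jvec y (lin p c y))"
      unfolding t N[OF y] Jn.tmap_tang[OF under_smooth] under_jmk Jk.tang_def ..
    then show ?thesis
      unfolding t conn_theta[OF x y Jk] by (simp add: Jk.tang_eq ball_jidx)
  qed
  then have "(\<forall>t\<in>pts (fibre (Rn p) DD x). tmap ?Z DD under (N t) = conn (theta p q (Suc k) x u) t) \<longleftrightarrow>
      (\<forall>y\<in>pts (Rn p). \<forall>j<q. \<forall>K\<in>jet_basis p k. lin p c y j K = dshift p y u j K)"
    using mtang_rep mtang_fibre[OF x] by (metis (no_types, lifting))
  also have "\<dots> \<longleftrightarrow> (\<forall>j<q. \<forall>K\<in>jet_basis p k. \<forall>i<p. c j K i = u j (add_mset i K))"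
  proof
    assume "\<forall>y\<in>pts (Rn p). \<forall>j<q. \<forall>K\<in>jet_basis p k. lin p c y j K = dshift p y u j K"
    then show "\<forall>j<q. \<forall>K\<in>jet_basis p k. \<forall>i<p. c j K i = u j (add_mset i K)"
      using unitv_pts lin_unitv dshift_unitv by metis
  next
    assume "\<forall>j<q. \<forall>K\<in>jet_basis p k. \<forall>i<p. c j K i = u j (add_mset i K)"
    then show "\<forall>y\<in>pts (Rn p). \<forall>j<q. \<forall>K\<in>jet_basis p k. lin p c y j K = dshift p y u j K"
      by (simp add: lin_def dshift_def)
  qed
  finally have i: "(\<forall>t\<in>pts (fibre (Rn p) DD x). tmap ?Z DD under (N t) = conn (theta p q (Suc k) x u) t) \<longleftrightarrow>
      (\<forall>j<q. \<forall>K\<in>jet_basis p k. \<forall>i<p. c j K i = u j (add_mset i K))" .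
  have ii: "iterate_conn p ?Z ?J N \<gamma> = wcomp ?Z (D_pow 2) ?\<tau> (iterate_conn p ?Z ?J N (wcomp (Rn p) (D_pow 2) ?\<tau> \<gamma>)) \<longleftrightarrow>
      (\<forall>j<q. \<forall>K\<in>jet_basis p k. (\<Sum>i<p. lin p c y j (add_mset i K) * z i) = (\<Sum>i<p. lin p c z j (add_mset i K) * y i))"
    if c: "\<forall>j<q. \<forall>K\<in>jet_basis p k. \<forall>i<p. c j K i = u j (add_mset i K)"
      and y: "y \<in> pts (Rn p)" and z: "z \<in> pts (Rn p)" and w: "w \<in> pts (Rn p)"
      and \<gamma>: "\<gamma> = cls (Rn p) (D_pow 2) (\<lambda>d. trunc p (sq x y z w d))" for \<gamma> y z w
  proof -
    have sm: "(\<lambda>d. trunc p (sq x y z w d)) \<in> smooth_maps (Rn (nvars (D_pow 2))) (Rn p)"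
      by (intro Rn.smooth_mk smoothn_sq)
    have swap_sq: "sq x y z w (?\<tau> d) = sq x z y w d" "sq x z y w (?\<tau> d) = sq x y z w d" for d :: vec
      by (auto simp: sq_def vec2_def algebra_simps)
    have \<gamma>': "wcomp (Rn p) (D_pow 2) ?\<tau> \<gamma> = cls (Rn p) (D_pow 2) (\<lambda>d. trunc p (sq x z y w d))"
      unfolding \<gamma> wcomp_cls[OF swap_weil sm] by (simp add: comp_def swap_sq)
    define f where "f d = jvec (sq x y z w d) (\<lambda>j K. sqJ p c u y z w j K d)" for d
    define g where "g d = jvec (sq x z y w d) (\<lambda>j K. sqJ p c u z y w j K d)" for d
    have sf: "smoothn (\<lambda>d. f d i)" and sg: "smoothn (\<lambda>d. g d i)" for i
      unfolding f_def g_def by (cases i; auto simp: smoothn_sq smoothn_sqJ)+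
    have smg: "(\<lambda>d. jmk p q k (g d)) \<in> smooth_maps (Rn (nvars (D_pow 2))) ?Z"
      using sg by (intro Jk.smooth_mk)
    have sg': "smoothn (\<lambda>d. g (?\<tau> d) i)" for i
      by (rule smoothn_compose[OF sg]) (auto simp: vec2_def intro!: smoothn_if)
    have e1: "iterate_conn p ?Z ?J N \<gamma> = cls ?Z (D_pow 2) (\<lambda>d. jmk p q k (f d))"
      unfolding \<gamma> f_def by (rule iterate_conn_eq[OF x y z w N])
    have e2: "wcomp ?Z (D_pow 2) ?\<tau> (iterate_conn p ?Z ?J N (wcomp (Rn p) (D_pow 2) ?\<tau> \<gamma>)) = cls ?Z (D_pow 2) (\<lambda>d. jmk p q k (g (?\<tau> d)))"
    proof -
      have "iterate_conn p ?Z ?J N (wcomp (Rn p) (D_pow 2) ?\<tau> \<gamma>) = cls ?Z (D_pow 2) (\<lambda>d. jmk p q k (g d))"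
        unfolding \<gamma>' g_def by (rule iterate_conn_eq[OF x z y w N])
      then show ?thesis using wcomp_cls[OF swap_weil smg] by (simp add: comp_def)
    qed
    have ceq: "lin p c y' j K = dshift p y' u j K" if "j < q" "K \<in> jet_basis p k" for y' j K
      using c that by (simp add: lin_def dshift_def)
    have f_poly: "(\<lambda>d. f d (Inr (j, K))) = (\<lambda>d. u j K + lin p c y j K * d 0 + dshift p z u j K * d 1 +
        (dshift p w u j K + (\<Sum>i<p. lin p c y j (add_mset i K) * z i)) * (d 0 * d 1) +
        (\<Sum>i<p. lin p c y j (add_mset i K) * w i) * (d 0 * (d 0 * d 1)) + 0 * (d 0 * (d 1 * d 1)))" for j K
      by (simp add: f_def sqJ_poly)
    have g_poly: "(\<lambda>d. g (?\<tau> d) (Inr (j, K))) = (\<lambda>d. u j K + dshift p y u j K * d 0 + lin p c z j K * d 1 +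
        (dshift p w u j K + (\<Sum>i<p. lin p c z j (add_mset i K) * y i)) * (d 0 * d 1) +
        0 * (d 0 * (d 0 * d 1)) + (\<Sum>i<p. lin p c z j (add_mset i K) * w i) * (d 0 * (d 1 * d 1)))" for j K
      by (simp add: g_def sqJ_poly vec2_def algebra_simps)
    \<comment> \<open>By \<open>ceq\<close> the linear coefficients agree, and the contributions of
      \<open>w\<close> to the mixed coefficient are the same on both sides; what remains is a
      bilinear expression in \<open>y\<close> and \<open>z\<close>.\<close>
    have "(\<forall>L\<in>pow_basis 2. tc L (\<lambda>d. f d (Inr (j, K))) = tc L (\<lambda>d. g (?\<tau> d) (Inr (j, K)))) \<longleftrightarrow>
        (\<Sum>i<p. lin p c y j (add_mset i K) * z i) = (\<Sum>i<p. lin p c z j (add_mset i K) * y i)"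
      if "j < q" "K \<in> jet_basis p k" for j K
      unfolding pow_basis_2 using ceq[OF that]
      by (simp add: tc_quadratic[OF f_poly] tc_quadratic[OF g_poly] del: tc_empty)
    moreover have "f d (Inl i) = g (?\<tau> d) (Inl i)" for d i
      by (simp add: f_def g_def swap_sq)
    ultimately show ?thesis
      unfolding e1 e2 Jk.cls_mk_eq[OF weil_D_pow sf sg'] by (auto simp: jidx_def)
  qed
  show ?thesis
    unfolding holonomic_def mem_Collect_eq prod.case jproj_theta[OF x] i Let_def
  proof (rule conj_cong[OF refl])
    assume c: "\<forall>j<q. \<forall>K\<in>jet_basis p k. \<forall>i<p. c j K i = u j (add_mset i K)"
    show "(\<forall>\<gamma>\<in>pts (fibre (Rn p) (D_pow 2) x). iterate_conn p ?Z ?J N \<gamma> = wcomp ?Z (D_pow 2) ?\<tau> (iterate_conn p ?Z ?J N (wcomp (Rn p) (D_pow 2) ?\<tau> \<gamma>))) \<longleftrightarrow>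
      (\<forall>j<q. \<forall>K\<in>jet_basis p k. \<forall>i<p. \<forall>l<p. c j (add_mset i K) l = c j (add_mset l K) i)" (is "?L = ?R")
    proof
      assume L: ?L
      show ?R
      proof (intro allI ballI impI)
        fix j K i l assume j: "j < q" "K \<in> jet_basis p k" "i < p" "l < p"
        \<comment> \<open>A square spanned by two coordinate vectors isolates a single pair of
          coefficients of the bilinear expression.\<close>
        define \<gamma> where "\<gamma> = cls (Rn p) (D_pow 2) (\<lambda>d. trunc p (sq x (unitv l) (unitv i) (\<lambda>_. 0) d))"
        have sm: "(\<lambda>d. trunc p (sq x (unitv l) (unitv i) (\<lambda>_. 0) d)) \<in> smooth_maps (Rn (nvars (D_pow 2))) (Rn p)"
          by (intro Rn.smooth_mk smoothn_sq)
        have "\<gamma> \<in> pts (fibre (Rn p) (D_pow 2) x)"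
          unfolding fibre_pts \<gamma>_def Rn.base_cls[OF weil_D_pow sm] using cls_pts[OF sm] x
          by (simp add: sq_def trunc_id)
        then have "iterate_conn p ?Z ?J N \<gamma> = wcomp ?Z (D_pow 2) ?\<tau> (iterate_conn p ?Z ?J N (wcomp (Rn p) (D_pow 2) ?\<tau> \<gamma>))" using L by blast
        then have "(\<Sum>m<p. lin p c (unitv l) j (add_mset m K) * unitv i m) = (\<Sum>m<p. lin p c (unitv i) j (add_mset m K) * unitv l m)"
          using ii[OF c unitv_pts[OF j(4)] unitv_pts[OF j(3)] zero_pts \<gamma>_def] j(1,2) by blast
        then show "c j (add_mset i K) l = c j (add_mset l K) i"
          using j(3,4) by (simp add: lin_unitv) (simp add: unitv_def if_distrib sum.delta cong: if_cong)
      qed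
    next
      assume R: ?R
      show ?L
      proof
        fix \<gamma> assume "\<gamma> \<in> pts (fibre (Rn p) (D_pow 2) x)"
        then obtain y z w where yzw: "y \<in> pts (Rn p)" "z \<in> pts (Rn p)" "w \<in> pts (Rn p)" "x \<in> pts (Rn p)"
          "\<gamma> = cls (Rn p) (D_pow 2) (\<lambda>d. trunc p (sq x y z w d))" by (rule sq_rep)
        have "(\<Sum>i<p. lin p c y j (add_mset i K) * z i) = (\<Sum>i<p. lin p c z j (add_mset i K) * y i)"
          if "j < q" "K \<in> jet_basis p k" for j K
        proof -
          have "(\<Sum>i<p. lin p c y j (add_mset i K) * z i) = (\<Sum>i<p. \<Sum>l<p. c j (add_mset i K) l * y l * z i)"
            by (simp add: lin_def sum_distrib_right)
          also have "\<dots> = (\<Sum>l<p. \<Sum>i<p. c j (add_mset i K) l * y l * z i)" by (rule sum.swap)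
          also have "\<dots> = (\<Sum>l<p. \<Sum>i<p. c j (add_mset l K) i * z i * y l)"
            using R that by (intro sum.cong refl) (simp add: mult_ac)
          also have "\<dots> = (\<Sum>i<p. lin p c z j (add_mset i K) * y i)"
            by (simp add: lin_def sum_distrib_right)
          finally show ?thesis .
        qed
        then show "iterate_conn p ?Z ?J N \<gamma> = wcomp ?Z (D_pow 2) ?\<tau> (iterate_conn p ?Z ?J N (wcomp (Rn p) (D_pow 2) ?\<tau> \<gamma>))"
          using ii[OF c yzw(1,2,3,5)] by blast
      qed
    qed
  qed
qed

end

section \<open>Induction along the jet tower\<close>

lemma J1_curve_iff: "c \<in> curves (J1 Y M \<rho>) \<longleftrightarrow> (\<forall>r. c r \<in> pts (J1 Y M \<rho>)) \<and> (\<lambda>r. fst (c r)) \<in> curves Y \<and>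
    (\<forall>g t. smooth_fun g \<longrightarrow> t \<in> curves (M \<otimes>\<^sub>W DD) \<longrightarrow> (\<forall>r. base (t r) = \<rho> (fst (c (g r)))) \<longrightarrow>
       (\<lambda>r. snd (c (g r)) (t r)) \<in> curves (Y \<otimes>\<^sub>W DD))"
  by (simp add: J1_def Let_def comp_def image_subset_iff)

lemma subspace_UNIV: "Defs.subspace X UNIV = X"
  by (cases X) (simp add: subspace_def)

lemma J1_pts: "(y, N) \<in> pts (J1 Y M \<rho>) \<longleftrightarrow> y \<in> pts Y \<and> N \<in> J1_fibre Y M \<rho> y"
  by (auto simp: J1_def Let_def)

text \<open>\<open>H\<close> is the set of all pairs for the step from order 0 to order 1, and \<open>holonomic\<close> afterwards.\<close>

lemma param_next:
  assumes J: "param (jet_tower p q n) (jidx p q n) (jmk p q n)"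
    and eq: "jet_tower p q (Suc n) = transport (\<lambda>(x, N). Nab x N) (Defs.subspace (J1 (jet_tower p q n) (Rn p) (jproj p)) H)"
    and H: "\<And>x u. x \<in> pts (Rn p) \<Longrightarrow> (theta p q n x u, conn (theta p q (Suc n) x u)) \<in> H"
    and surj: "\<And>x u c N. x \<in> pts (Rn p) \<Longrightarrow> (theta p q n x u, N) \<in> H \<Longrightarrow> N \<in> extensional (pts (fibre (Rn p) DD x)) \<Longrightarrow>
      (\<And>y. y \<in> pts (Rn p) \<Longrightarrow> N (mtang p x y) = jtang p q n (jvec x u) (jvec y (lin p c y))) \<Longrightarrow>
      \<exists>u'. theta p q n x u = theta p q n x u' \<and> N = conn (theta p q (Suc n) x u')"
  shows "param (jet_tower p q (Suc n)) (jidx p q (Suc n)) (jmk p q (Suc n))"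
proof -
  interpret J: parametrized "jet_tower p q n" "jidx p q n" "jmk p q n" by unfold_locales (rule J)
  let ?Y = "Defs.subspace (J1 (jet_tower p q n) (Rn p) (jproj p)) H"
  let ?mk = "\<lambda>v. (jmk p q n v, conn (jmk p q (Suc n) v))"
  have mk: "jmk p q (Suc n) v = Nab (jmk p q n v) (conn (jmk p q (Suc n) v))" for v
    by (simp add: jmk_def theta.simps)
  have mk_theta: "jmk p q m v = theta p q m (trunc p (\<lambda>i. v (Inl i))) (\<lambda>j K. v (Inr (j, K)))" for m v by (simp add: jmk_def)
  have Y_pts: "?mk v \<in> pts ?Y" for v
    using J.mk_pts[of v, unfolded mk_theta] conn_J1_fibre[OF trunc_pts J] H
    by (simp add: mk_theta subspace_def J1_pts)
  have pts_Y: "pts ?Y = range ?mk"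
  proof (intro equalityI subsetI)
    fix w assume w: "w \<in> pts ?Y"
    obtain z N where zN: "w = (z, N)" by (cases w)
    have z: "z \<in> pts (jet_tower p q n)" and N: "N \<in> J1_fibre (jet_tower p q n) (Rn p) (jproj p) z" and h: "(z, N) \<in> H"
      using w unfolding zN subspace_def by (simp_all add: J1_pts)
    obtain v where v: "z = jmk p q n v" using z unfolding J.pts_eq by blast
    define x where "x = trunc p (\<lambda>i. v (Inl i))"
    define u where "u = (\<lambda>j K. v (Inr (j, K)))"
    have x: "x \<in> pts (Rn p)" by (simp add: x_def)
    have zt: "z = theta p q n x u" by (simp add: v mk_theta x_def u_def)
    obtain c where c: "\<forall>y\<in>pts (Rn p). N (mtang p x y) = jtang p q n (jvec x u) (jvec y (lin p c y))"
      using J1_fibre_linear[OF x J N[unfolded zt]] by blast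
    have ext: "N \<in> extensional (pts (fibre (Rn p) DD x))"
      using N unfolding zt J1_fibre_def Let_def jproj_theta[OF x] by blast
    obtain u' where u': "theta p q n x u = theta p q n x u'" "N = conn (theta p q (Suc n) x u')"
      using surj[OF x h[unfolded zt] ext] c by blast
    have "w = ?mk (jvec x u')" unfolding zN zt u' jmk_jvec[OF x] ..
    then show "w \<in> range ?mk" by blast
  qed (use Y_pts in auto)
  have conn_eq: "conn (jmk p q (Suc n) v) (mtang p (trunc p (\<lambda>i. v (Inl i))) (trunc p y)) =
     jtang p q n (jvec (trunc p (\<lambda>i. v (Inl i))) (\<lambda>j K. v (Inr (j, K)))) (jvec (trunc p y) (dshift p (trunc p y) (\<lambda>j K. v (Inr (j, K)))))" for v y
    unfolding mk_theta[of "Suc n" v] by (rule conn_theta[OF trunc_pts trunc_pts J])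
  have split: "L \<in> jet_basis p (Suc n) \<Longrightarrow> L \<in> jet_basis p n \<or> (\<exists>K i. L = add_mset i K \<and> K \<in> jet_basis p n \<and> i < p)" for L
  proof -
    assume L: "L \<in> jet_basis p (Suc n)"
    show ?thesis
    proof (cases L)
      case (add i K)
      then show ?thesis using L by (auto simp: jet_basis_def)
    qed (auto simp: jet_basis_def)
  qed
  have jidx_sub: "i \<in> jidx p q n \<Longrightarrow> i \<in> jidx p q (Suc n)" for i using jet_basis_mono by (auto simp: jidx_def)
  show ?thesis
    unfolding param_def
  proof (intro conjI allI)
    show "finite (jidx p q (Suc n))" by (simp add: jidx_def finite_jet_basis)
    have "pts (jet_tower p q (Suc n)) = range (\<lambda>v. Nab (jmk p q n v) (conn (jmk p q (Suc n) v)))"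
      unfolding eq transport_def frolicher.simps pts_Y by (simp add: image_image)
    then show "pts (jet_tower p q (Suc n)) = range (jmk p q (Suc n))" by (simp flip: mk)
  next
    fix v v'
    show "jmk p q (Suc n) v = jmk p q (Suc n) v' \<longleftrightarrow> (\<forall>i\<in>jidx p q (Suc n). v i = v' i)"
    proof
      assume e: "jmk p q (Suc n) v = jmk p q (Suc n) v'"
      then have "jmk p q n v = jmk p q n v'" using under_jmk by metis
      then have e1: "v i = v' i" if "i \<in> jidx p q n" for i using that unfolding J.mk_eq by blast
      have xx: "trunc p (\<lambda>i. v (Inl i)) = trunc p (\<lambda>i. v' (Inl i))"
        using e1 by (auto simp: trunc_def jidx_def)
      \<comment> \<open>A coordinate of order one higher is the component of the value on a
        coordinate vector, by \<open>dshift_unitv\<close>.\<close>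
      have e2: "v (Inr (j, add_mset i K)) = v' (Inr (j, add_mset i K))" if "j < q" "K \<in> jet_basis p n" "i < p" for j K i
      proof -
        have "jtang p q n (jvec (trunc p (\<lambda>i. v (Inl i))) (\<lambda>j K. v (Inr (j, K)))) (jvec (trunc p (unitv i)) (dshift p (trunc p (unitv i)) (\<lambda>j K. v (Inr (j, K)))))
          = jtang p q n (jvec (trunc p (\<lambda>i. v' (Inl i))) (\<lambda>j K. v' (Inr (j, K)))) (jvec (trunc p (unitv i)) (dshift p (trunc p (unitv i)) (\<lambda>j K. v' (Inr (j, K)))))"
          using conn_eq[of v "unitv i"] conn_eq[of v' "unitv i"] unfolding e xx by metis
        then have "dshift p (trunc p (unitv i)) (\<lambda>j K. v (Inr (j, K))) j K = dshift p (trunc p (unitv i)) (\<lambda>j K. v' (Inr (j, K))) j K"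
          unfolding J.tang_eq ball_jidx using that by simp
        then show ?thesis using that(3) by (simp add: trunc_id unitv_pts dshift_unitv)
      qed
      show "\<forall>i\<in>jidx p q (Suc n). v i = v' i"
      proof
        fix i assume i: "i \<in> jidx p q (Suc n)"
        show "v i = v' i"
        proof (cases "i \<in> jidx p q n")
          case False
          then obtain j L where jL: "i = Inr (j, L)" "j < q" "L \<in> jet_basis p (Suc n)" "L \<notin> jet_basis p n"
            using i by (auto simp: jidx_def)
          then show ?thesis using split e2 by metis
        qed (rule e1)
      qed
    next
      assume e: "\<forall>i\<in>jidx p q (Suc n). v i = v' i"
      have "trunc p (\<lambda>i. v (Inl i)) = trunc p (\<lambda>i. v' (Inl i))" using e by (auto simp: trunc_def jidx_def)
      then show "jmk p q (Suc n) v = jmk p q (Suc n) v'"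
        unfolding mk_theta by (simp only:) (rule theta_cong, use e in \<open>auto simp: jidx_def\<close>)
    qed
  next
    show "curves (jet_tower p q (Suc n)) = {c. \<exists>v. (\<forall>i\<in>jidx p q (Suc n). smooth_fun (\<lambda>t. v t i)) \<and> c = (\<lambda>t. jmk p q (Suc n) (v t))}"
    proof (intro equalityI subsetI)
      fix c assume "c \<in> curves (jet_tower p q (Suc n))"
      then obtain b where b: "b \<in> curves ?Y" "c = (\<lambda>t. Nab (fst (b t)) (snd (b t)))"
        unfolding eq transport_def by (auto simp: comp_def split_beta)
      have bJ: "b \<in> curves (J1 (jet_tower p q n) (Rn p) (jproj p))" and bH: "range b \<subseteq> H"
        using b(1) unfolding subspace_def by simp_all
      have "b t \<in> pts ?Y" for t
        using bJ bH unfolding subspace_def J1_curve_iff by auto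
      then have "\<exists>v. b t = ?mk v" for t unfolding pts_Y by blast
      then obtain v where v: "\<And>t. b t = ?mk (v t)" by metis
      have c: "c = (\<lambda>t. jmk p q (Suc n) (v t))"
        unfolding b(2) by (rule ext) (simp only: v fst_conv snd_conv mk[symmetric])
      have "(\<lambda>t. jmk p q n (v t)) \<in> curves (jet_tower p q n)" using bJ unfolding J1_curve_iff v by simp
      note cc = J.curve_coord[OF this]
      have s1: "smooth_fun (\<lambda>t. v t i)" if "i \<in> jidx p q n" for i
        using that cc[of i] by (simp add: J.coord_mk)
      \<comment> \<open>The curve of jets is applied to a fixed direction carried along its moving
        base point; the structure of \<open>J1\<close> makes the result a smooth curve, whose
        components are the new coordinates.\<close>
      have s2: "smooth_fun (\<lambda>t. v t (Inr (j, add_mset i K)))" if jKi: "j < q" "K \<in> jet_basis p n" "i < p" for j K i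
      proof -
        let ?x = "\<lambda>t. trunc p (\<lambda>i. v t (Inl i))"
        have "(\<lambda>t. mtang p (?x t) (trunc p (unitv i))) \<in> curves (Rn p \<otimes>\<^sub>W DD)"
          by (rule Rn.tang_curve) (use s1 in \<open>auto simp: jidx_def intro!: smooth_trunc_curve\<close>)
        moreover have "base (mtang p (?x t) (trunc p (unitv i))) = jproj p (fst (b t))" for t
          by (simp add: v jproj_jmk trunc_id)
        ultimately have "(\<lambda>t. snd (b t) (mtang p (?x t) (trunc p (unitv i)))) \<in> curves (jet_tower p q n \<otimes>\<^sub>W DD)"
          using bJ[unfolded J1_curve_iff, THEN conjunct2, THEN conjunct2, rule_format, of "\<lambda>t. t" "\<lambda>t. mtang p (?x t) (trunc p (unitv i))"]
          by simp
        from J.tang_curve_ex[OF this] obtain \<alpha> \<beta> where \<beta>: "\<forall>i\<in>jidx p q n. smooth_fun (\<lambda>t. \<beta> t i)"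
          and e: "(\<lambda>t. snd (b t) (mtang p (?x t) (trunc p (unitv i)))) = (\<lambda>t. jtang p q n (\<alpha> t) (\<beta> t))" by (elim exE conjE)
        have "v t (Inr (j, add_mset i K)) = \<beta> t (Inr (j, K))" for t
        proof -
          have "jtang p q n (jvec (?x t) (\<lambda>j K. v t (Inr (j, K)))) (jvec (trunc p (unitv i)) (dshift p (trunc p (unitv i)) (\<lambda>j K. v t (Inr (j, K))))) = jtang p q n (\<alpha> t) (\<beta> t)"
            using fun_cong[OF e, of t] conn_eq[of "v t" "unitv i"] by (simp add: v)
          then have "dshift p (trunc p (unitv i)) (\<lambda>j K. v t (Inr (j, K))) j K = \<beta> t (Inr (j, K))"
            unfolding J.tang_eq ball_jidx using jKi by simp
          then show ?thesis using jKi(3) by (simp add: trunc_id unitv_pts dshift_unitv)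
        qed
        then show ?thesis using \<beta> jKi by (simp add: jidx_def)
      qed
      have "smooth_fun (\<lambda>t. v t i)" if i: "i \<in> jidx p q (Suc n)" for i
      proof (cases "i \<in> jidx p q n")
        case False
        then obtain j L where jL: "i = Inr (j, L)" "j < q" "L \<in> jet_basis p (Suc n)" "L \<notin> jet_basis p n"
          using i by (auto simp: jidx_def)
        then show ?thesis using split s2 by metis
      qed (rule s1)
      then show "c \<in> {c. \<exists>v. (\<forall>i\<in>jidx p q (Suc n). smooth_fun (\<lambda>t. v t i)) \<and> c = (\<lambda>t. jmk p q (Suc n) (v t))}"
        using c by blast
    next
      fix c assume "c \<in> {c. \<exists>v. (\<forall>i\<in>jidx p q (Suc n). smooth_fun (\<lambda>t. v t i)) \<and> c = (\<lambda>t. jmk p q (Suc n) (v t))}"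
      then obtain v where v: "\<forall>i\<in>jidx p q (Suc n). smooth_fun (\<lambda>t. v t i)" "c = (\<lambda>t. jmk p q (Suc n) (v t))"
        by (elim CollectE exE conjE)
      define b where "b t = ?mk (v t)" for t
      have vK: "smooth_fun (\<lambda>t. v t (Inr (j, K)))" if "j < q" "K \<in> jet_basis p (Suc n)" for j K
        using v(1) that by (auto simp: jidx_def)
      have vx: "smooth_fun (\<lambda>t. trunc p (\<lambda>i. v t (Inl i)) i)" for i
        using v(1) by (intro smooth_trunc_curve) (simp add: jidx_def)
      have Yb: "b t \<in> pts ?Y" for t unfolding b_def by (rule Y_pts)
      have "b \<in> curves (J1 (jet_tower p q n) (Rn p) (jproj p))"
        unfolding J1_curve_iff
      proof (intro conjI allI impI)
        show "b r \<in> pts (J1 (jet_tower p q n) (Rn p) (jproj p))" for r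
          using Yb unfolding subspace_def by simp
        show "(\<lambda>r. fst (b r)) \<in> curves (jet_tower p q n)"
          unfolding b_def fst_conv by (rule J.curve_mk) (use v(1) jidx_sub in blast)
        fix g t assume g: "smooth_fun g" and t: "t \<in> curves (Rn p \<otimes>\<^sub>W DD)" and bs: "\<forall>r. base (t r) = jproj p (fst (b (g r)))"
        from Rn.tang_curve_ex[OF t] obtain \<alpha> \<beta> where \<beta>: "\<forall>i\<in>{..<p}. smooth_fun (\<lambda>t. \<beta> t i)"
          and te: "t = (\<lambda>r. mtang p (\<alpha> r) (\<beta> r))" by (elim exE conjE)
        have "trunc p (\<alpha> r) = trunc p (\<lambda>i. v (g r) (Inl i))" for r
          using bs by (simp add: te b_def jproj_jmk)
        then have "t r = mtang p (trunc p (\<lambda>i. v (g r) (Inl i))) (trunc p (\<beta> r))" for r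
          unfolding te using mtang_trunc by metis
        then have e: "snd (b (g r)) (t r) = jtang p q n (jvec (trunc p (\<lambda>i. v (g r) (Inl i))) (\<lambda>j K. v (g r) (Inr (j, K))))
            (jvec (trunc p (\<beta> r)) (dshift p (trunc p (\<beta> r)) (\<lambda>j K. v (g r) (Inr (j, K)))))" for r
          using conn_eq[of "v (g r)" "\<beta> r"] by (simp add: b_def)
        have vKg: "smooth_fun (\<lambda>t. v (g t) (Inr (j, K)))" if "j < q" "K \<in> jet_basis p (Suc n)" for j K
          by (rule smooth_compose[OF vK[OF that] g])
        have tb: "smooth_fun (\<lambda>t. trunc p (\<beta> t) i)" for i using \<beta> by (intro smooth_trunc_curve) simp
        show "(\<lambda>r. snd (b (g r)) (t r)) \<in> curves (jet_tower p q n \<otimes>\<^sub>W DD)"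
          unfolding e
        proof (rule J.tang_curve)
          fix i assume i: "i \<in> jidx p q n"
          show "smooth_fun (\<lambda>t. jvec (trunc p (\<lambda>i. v (g t) (Inl i))) (\<lambda>j K. v (g t) (Inr (j, K))) i)"
            using i vKg jet_basis_mono smooth_compose[OF vx g] by (auto simp: jidx_def)
          show "smooth_fun (\<lambda>t. jvec (trunc p (\<beta> t)) (dshift p (trunc p (\<beta> t)) (\<lambda>j K. v (g t) (Inr (j, K)))) i)"
            using i tb vKg add_mset_jet_basis by (auto simp: jidx_def dshift_def intro!: smooth_sum smooth_mult)
        qed
      qed
      then have "b \<in> curves ?Y" using Yb unfolding subspace_def by auto
      moreover have "c = (\<lambda>(x, N). Nab x N) \<circ> b" unfolding v(2) b_def comp_def prod.case using mk by blast
      ultimately show "c \<in> curves (jet_tower p q (Suc n))" unfolding eq transport_def by simp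
    qed
  qed
qed

lemma param_jet_tower_0: "param (jet_tower p q 0) (jidx p q 0) (jmk p q 0)"
proof -
  have jb: "jet_basis p 0 = {{#}}" by (auto simp: jet_basis_def)
  define v' where "v' v = (\<lambda>i. if i < p then v (Inl i) else v (Inr (i - p, {#})))" for v :: "nat + nat \<times> nat multiset \<Rightarrow> real"
  define v'' where "v'' w = jvec w (\<lambda>j K. w (p + j))" for w :: vec
  have mk: "jmk p q 0 v = Pt (trunc (p + q) (v' v))" for v
    by (auto simp: jmk_def join_def trunc_def v'_def)
  have inv: "v' (v'' w) = w" for w by (auto simp: v'_def v''_def)
  show ?thesis
    unfolding param_def
  proof (intro conjI allI)
    show "finite (jidx p q 0)" by (simp add: jidx_def finite_jet_basis)
    have "range (jmk p q 0) = Pt ` range (trunc (p + q))"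
      unfolding mk using inv by (auto simp: image_iff) metis
    then show "pts (jet_tower p q 0) = range (jmk p q 0)"
      using Rn.pts_eq[of "p + q"] by (simp add: transport_def)
    show "jmk p q 0 v = jmk p q 0 w \<longleftrightarrow> (\<forall>i\<in>jidx p q 0. v i = w i)" for v w
    proof -
      have "jmk p q 0 v = jmk p q 0 w \<longleftrightarrow> (\<forall>i<p + q. v' v i = v' w i)"
        unfolding mk jtower.inject Rn.mk_eq by auto
      also have "\<dots> \<longleftrightarrow> (\<forall>i<p. v (Inl i) = w (Inl i)) \<and> (\<forall>j<q. v (Inr (j, {#})) = w (Inr (j, {#})))"
      proof (intro iffI conjI allI impI)
        fix j assume "\<forall>i<p + q. v' v i = v' w i" "j < q"
        then show "v (Inr (j, {#})) = w (Inr (j, {#}))" by (auto simp: v'_def dest!: spec[of _ "p + j"])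
      next
        fix i assume "\<forall>i<p + q. v' v i = v' w i" "i < p"
        then show "v (Inl i) = w (Inl i)" by (auto simp: v'_def dest!: spec[of _ i])
      next
        fix i assume "(\<forall>i<p. v (Inl i) = w (Inl i)) \<and> (\<forall>j<q. v (Inr (j, {#})) = w (Inr (j, {#})))" "i < p + q"
        then show "v' v i = v' w i" by (auto simp: v'_def)
      qed
      also have "\<dots> \<longleftrightarrow> (\<forall>i\<in>jidx p q 0. v i = w i)" unfolding jidx_def jb by auto
      finally show ?thesis .
    qed
    show "curves (jet_tower p q 0) = {c. \<exists>v. (\<forall>i\<in>jidx p q 0. smooth_fun (\<lambda>t. v t i)) \<and> c = (\<lambda>t. jmk p q 0 (v t))}"
    proof (intro equalityI subsetI)
      fix c assume "c \<in> curves (jet_tower p q 0)"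
      then obtain b where b: "b \<in> curves (Rn (p + q))" "c = (\<lambda>t. Pt (b t))" by (auto simp: transport_def comp_def)
      have "c = (\<lambda>t. jmk p q 0 (v'' (b t)))"
        unfolding mk inv b(2) using b(1) by (simp add: curves_Rn trunc_id)
      moreover have "smooth_fun (\<lambda>t. v'' (b t) i)" for i
        using b(1) by (cases i) (auto simp: v''_def curves_Rn)
      ultimately show "c \<in> {c. \<exists>v. (\<forall>i\<in>jidx p q 0. smooth_fun (\<lambda>t. v t i)) \<and> c = (\<lambda>t. jmk p q 0 (v t))}"
        by (intro CollectI exI[of _ "\<lambda>t. v'' (b t)"]) simp
    next
      fix c assume "c \<in> {c. \<exists>v. (\<forall>i\<in>jidx p q 0. smooth_fun (\<lambda>t. v t i)) \<and> c = (\<lambda>t. jmk p q 0 (v t))}"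
      then obtain v where v: "\<forall>i\<in>jidx p q 0. smooth_fun (\<lambda>t. v t i)" "c = (\<lambda>t. jmk p q 0 (v t))" by (elim CollectE exE conjE)
      have "(\<lambda>t. trunc (p + q) (v' (v t))) \<in> curves (Rn (p + q))"
      proof (rule Rn.curve_mk)
        show "smooth_fun (\<lambda>t. v' (v t) i)" if "i \<in> {..<p + q}" for i
          using v(1) that by (cases "i < p") (auto simp: v'_def jidx_def jb)
      qed
      then show "c \<in> curves (jet_tower p q 0)" unfolding v(2) mk by (auto simp: transport_def comp_def)
    qed
  qed
qed

theorem param_jet_tower: "param (jet_tower p q n) (jidx p q n) (jmk p q n)"
proof (induction n rule: less_induct)
  case (less n)
  consider "n = 0" | "n = Suc 0" | k where "n = Suc (Suc k)" by (metis not0_implies_Suc)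
  then show ?case
  proof cases
    case 1
    then show ?thesis by (simp only: param_jet_tower_0)
  next
    case 2
    show ?thesis
      unfolding 2
    proof (rule param_next[where H = UNIV, OF param_jet_tower_0])
      show "jet_tower p q (Suc 0) = transport (\<lambda>(x, N). Nab x N) (Defs.subspace (J1 (jet_tower p q 0) (Rn p) (jproj p)) UNIV)"
        by (simp only: jet_tower.simps subspace_UNIV)
      fix x u c N assume x: "x \<in> pts (Rn p)" and ext: "N \<in> extensional (pts (fibre (Rn p) DD x))"
        and N: "\<And>y. y \<in> pts (Rn p) \<Longrightarrow> N (mtang p x y) = jtang p q 0 (jvec x u) (jvec y (lin p c y))"
      \<comment> \<open>A nonempty index of order at most 1 is a singleton, so the coefficients of
        the linear map are already coordinates.\<close>
      define u' where "u' j L = (if L = {#} then u j {#} else c j {#} (THE i. L = {#i#}))" for j L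
      have th: "theta p q 0 x u = theta p q 0 x u'" by (rule theta_cong) (auto simp: u'_def jet_basis_def)
      interpret J: parametrized "jet_tower p q 0" "jidx p q 0" "jmk p q 0" by unfold_locales (rule param_jet_tower_0)
      have "N = conn (theta p q (Suc 0) x u')"
      proof (rule J1_fibre_extI[OF x ext])
        fix y assume y: "y \<in> pts (Rn p)"
        show "N (mtang p x y) = conn (theta p q (Suc 0) x u') (mtang p x y)"
          unfolding N[OF y] conn_theta[OF x y param_jet_tower_0] J.tang_eq
          by (auto simp: jidx_def jet_basis_def u'_def lin_def dshift_def)
      qed
      then show "\<exists>u'. theta p q 0 x u = theta p q 0 x u' \<and> N = conn (theta p q (Suc 0) x u')" using th by blast
    qed simp
  next
    case (3 k)
    have Jk: "param (jet_tower p q k) (jidx p q k) (jmk p q k)" and Jn: "param (jet_tower p q (Suc k)) (jidx p q (Suc k)) (jmk p q (Suc k))"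
      using less.IH[of k] less.IH[of "Suc k"] 3 by simp_all
    interpret J: parametrized "jet_tower p q (Suc k)" "jidx p q (Suc k)" "jmk p q (Suc k)" by unfold_locales (rule Jn)
    show ?thesis
      unfolding 3
    proof (rule param_next[where H = "holonomic p (jet_tower p q k) (jet_tower p q (Suc k))", OF Jn])
      show "jet_tower p q (Suc (Suc k)) = transport (\<lambda>(x, N). Nab x N)
          (Defs.subspace (J1 (jet_tower p q (Suc k)) (Rn p) (jproj p)) (holonomic p (jet_tower p q k) (jet_tower p q (Suc k))))"
        by (simp only: jet_tower.simps)
    next
      fix x u assume x: "x \<in> pts (Rn p)"
      have "conn (theta p q (Suc (Suc k)) x u) (mtang p x y) = jtang p q (Suc k) (jvec x u) (jvec y (lin p (\<lambda>j K i. u j (add_mset i K)) y))"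
        if "y \<in> pts (Rn p)" for y
        using conn_theta[OF x that Jn, of u] unfolding lin_def dshift_def by simp
      note hol = holonomic_iff[OF Jk Jn x this]
      show "(theta p q (Suc k) x u, conn (theta p q (Suc (Suc k)) x u)) \<in> holonomic p (jet_tower p q k) (jet_tower p q (Suc k))"
        by (rule iffD2[OF hol], assumption) (intro conjI allI ballI impI refl arg_cong[where f = "u _"] add_mset_commute)
    next
      fix x u c N assume x: "x \<in> pts (Rn p)" and ext: "N \<in> extensional (pts (fibre (Rn p) DD x))"
        and h: "(theta p q (Suc k) x u, N) \<in> holonomic p (jet_tower p q k) (jet_tower p q (Suc k))"
        and N: "\<And>y. y \<in> pts (Rn p) \<Longrightarrow> N (mtang p x y) = jtang p q (Suc k) (jvec x u) (jvec y (lin p c y))"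
      have c1: "\<And>j K i. j < q \<Longrightarrow> K \<in> jet_basis p k \<Longrightarrow> i < p \<Longrightarrow> c j K i = u j (add_mset i K)"
        and c2: "\<And>j K i l. j < q \<Longrightarrow> K \<in> jet_basis p k \<Longrightarrow> i < p \<Longrightarrow> l < p \<Longrightarrow> c j (add_mset i K) l = c j (add_mset l K) i"
        using iffD1[OF holonomic_iff[OF Jk Jn x N] h] by blast+
      \<comment> \<open>A new coordinate of order k + 2 is read off by removing its least index.
        Holonomy shows below that the removal of any other index gives the same number.\<close>
      define u' where "u' j L = (if size L \<le> Suc k then u j L else c j (L - {#Min_mset L#}) (Min_mset L))" for j L
      have th: "theta p q (Suc k) x u = theta p q (Suc k) x u'" by (rule theta_cong) (auto simp: u'_def jet_basis_def)
      have cu: "c j K i = u' j (add_mset i K)" if j: "j < q" and K: "K \<in> jet_basis p (Suc k)" and i: "i < p" for j K i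
      proof (cases "size K \<le> k")
        case True
        then show ?thesis using c1[OF j _ i, of K] K by (simp add: u'_def jet_basis_def)
      next
        case False
        define m where "m = Min_mset (add_mset i K)"
        have "m \<in># add_mset i K" unfolding m_def by (intro Min_in) auto
        have u'm: "u' j (add_mset i K) = c j (add_mset i K - {#m#}) m" using False by (simp add: u'_def m_def)
        show ?thesis
        proof (cases "m = i")
          case True
          then show ?thesis by (simp add: u'm)
        next
          case neq: False
          then obtain K0 where K0: "K = add_mset m K0" using \<open>m \<in># add_mset i K\<close> by (auto dest: multi_member_split)
          then have "K0 \<in> jet_basis p k" "m < p" using K by (auto simp: jet_basis_def)
          then have "c j (add_mset m K0) i = c j (add_mset i K0) m" using c2[OF j _ _ i, of K0 m] by simp
          then show ?thesis unfolding u'm unfolding K0 by simp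
        qed
      qed
      have "N = conn (theta p q (Suc (Suc k)) x u')"
      proof (rule J1_fibre_extI[OF x ext])
        fix y assume y: "y \<in> pts (Rn p)"
        show "N (mtang p x y) = conn (theta p q (Suc (Suc k)) x u') (mtang p x y)"
          unfolding N[OF y] conn_theta[OF x y Jn] J.tang_eq
          using cu by (auto simp: jidx_def lin_def dshift_def u'_def jet_basis_def)
      qed
      then show "\<exists>u'. theta p q (Suc k) x u = theta p q (Suc k) x u' \<and> N = conn (theta p q (Suc (Suc k)) x u')" using th by blast
    qed
  qed
qed

section \<open>Sections and their derivatives\<close>

text \<open>\<open>\<sigma> j K\<close> stands for the iterated partial derivative of \<open>\<sigma> j {#}\<close> with respect to the variables in \<open>K\<close>.\<close>

definition hol_family :: "nat \<Rightarrow> (nat \<Rightarrow> nat multiset \<Rightarrow> vec \<Rightarrow> real) \<Rightarrow> bool" where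
  "hol_family p \<sigma> \<longleftrightarrow> (\<forall>j K. smoothn (\<sigma> j K)) \<and>
    (\<forall>j K x y. ((\<lambda>s. \<sigma> j K (\<lambda>i. x i + y i * s)) has_real_derivative (\<Sum>i<p. \<sigma> j (add_mset i K) x * y i)) (at 0))"

lemma hol_familyD:
  assumes "hol_family p \<sigma>"
  shows "smoothn (\<sigma> j K)"
    "((\<lambda>s. \<sigma> j K (\<lambda>i. x i + y i * s)) has_real_derivative (\<Sum>i<p. \<sigma> j (add_mset i K) x * y i)) (at 0)"
  using assms unfolding hol_family_def by blast+

definition secmap :: "nat \<Rightarrow> nat \<Rightarrow> (nat \<Rightarrow> nat multiset \<Rightarrow> vec \<Rightarrow> real) \<Rightarrow> vec \<Rightarrow> vec" where
  "secmap p q \<sigma> x = join p q x (\<lambda>j. \<sigma> j {#} x)"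

definition sectang :: "nat \<Rightarrow> nat \<Rightarrow> nat \<Rightarrow> (nat \<Rightarrow> nat multiset \<Rightarrow> vec \<Rightarrow> real) \<Rightarrow> vec \<Rightarrow> tangential" where
  "sectang p q n \<sigma> x = (secmap p q \<sigma> x,
     \<lambda>\<gamma>\<in>pts (fibre (Rn p) (D_pow n) x). tmap (Rn (p + q)) (D_pow n) (secmap p q \<sigma>) \<gamma>)"

lemma smoothn_secmap: "(\<And>j. smoothn (\<sigma> j {#})) \<Longrightarrow> smoothn (\<lambda>x. secmap p q \<sigma> x i)"
  unfolding secmap_def join_def by (intro smoothn_if smoothn_coord smoothn_const)

lemma secmap_smooth: "hol_family p \<sigma> \<Longrightarrow> secmap p q \<sigma> \<in> smooth_maps (Rn k) (Rn (p + q))"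
  by (intro smooth_maps_Rn smoothn_secmap hol_familyD(1)) (auto simp: secmap_def join_pts)

lemma trunc_secmap: "trunc (p + q) (secmap p q \<sigma> x) = secmap p q \<sigma> x" "trunc p (secmap p q \<sigma> x) = trunc p x"
  by (simp_all add: secmap_def trunc_id join_pts trunc_join)

definition jet_of :: "nat \<Rightarrow> nat \<Rightarrow> nat \<Rightarrow> (nat \<Rightarrow> nat multiset \<Rightarrow> vec \<Rightarrow> real) \<Rightarrow> vec \<Rightarrow> jtower" where
  "jet_of p q n \<sigma> x = theta p q n x (\<lambda>j K. \<sigma> j K x)"

lemma jet_of_jmk: "x \<in> pts (Rn p) \<Longrightarrow> jet_of p q n \<sigma> x = jmk p q n (jvec x (\<lambda>j K. \<sigma> j K x))"
  by (simp add: jet_of_def jmk_jvec)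

lemma smooth_jvec_family:
  assumes "hol_family p \<sigma>" and f: "\<And>i. smoothn (\<lambda>d. f d i)"
  shows "smoothn (\<lambda>d. jvec (f d) (\<lambda>j K. \<sigma> j K (f d)) i)"
  by (cases i) (auto simp: f intro!: smoothn_compose[OF hol_familyD(1)[OF assms(1)]])

lemma jet_of_smooth:
  assumes "hol_family p \<sigma>" shows "jet_of p q n \<sigma> \<in> smooth_maps (Rn p) (jet_tower p q n)"
proof -
  interpret J: parametrized "jet_tower p q n" "jidx p q n" "jmk p q n" by unfold_locales (rule param_jet_tower)
  show ?thesis
  proof (rule smooth_mapsI)
    show "jet_of p q n \<sigma> x \<in> pts (jet_tower p q n)" if "x \<in> pts (Rn p)" for x
      unfolding jet_of_jmk[OF that] by simp
    fix c assume c: "c \<in> curves (Rn p)"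
    then have "(\<lambda>t. jet_of p q n \<sigma> (c t)) = (\<lambda>t. jmk p q n (jvec (c t) (\<lambda>j K. \<sigma> j K (c t))))"
      by (auto simp: curves_Rn jet_of_jmk)
    also have "\<dots> \<in> curves (jet_tower p q n)"
      by (intro J.curve_mk smoothnD[OF smooth_jvec_family[OF assms, of "\<lambda>d. d"]]) (use c in \<open>auto simp: curves_Rn\<close>)
    finally show "(\<lambda>t. jet_of p q n \<sigma> (c t)) \<in> curves (jet_tower p q n)" .
  qed
qed

lemma tc_single: "tc {#k#} f = deriv (\<lambda>s. f ((\<lambda>_. 0)(k := s))) 0"
  by (simp add: tc_def Q_def quo_def)

text \<open>A derivative of the section changes along \<open>y\<close> at the rate
  \<open>dshift\<close> of the derivatives of one order more. So the line of coordinates in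
  \<open>theta\<close> agrees to first order with the jet of the section taken along the line in the
  base, and over \<open>DD\<close> nothing more is seen.\<close>

lemma conn_jet_of:
  assumes \<sigma>: "hol_family p \<sigma>" and t: "t \<in> pts (fibre (Rn p) DD x)"
  shows "conn (jet_of p q (Suc n) \<sigma> x) t = tmap (jet_tower p q n) DD (jet_of p q n \<sigma>) t"
proof -
  interpret J: parametrized "jet_tower p q n" "jidx p q n" "jmk p q n" by unfold_locales (rule param_jet_tower)
  obtain y where y: "y \<in> pts (Rn p)" "t = mtang p x y" and x: "x \<in> pts (Rn p)" by (rule mtang_rep[OF t])
  let ?l = "\<lambda>d i. x i + y i * d (0::nat)"
  have l: "?l d \<in> pts (Rn p)" for d using x y by (simp add: pts_Rn)
  have sl: "smoothn (\<lambda>d. ?l d i)" for i by (intro smoothn_add smoothn_mult smoothn_const smoothn_coord)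
  have "tmap (jet_tower p q n) DD (jet_of p q n \<sigma>) t = cls (jet_tower p q n) DD (\<lambda>d. jet_of p q n \<sigma> (trunc p (?l d)))"
    unfolding y(2) by (rule Rn.tmap_tang[OF jet_of_smooth[OF \<sigma>]])
  also have "\<dots> = cls (jet_tower p q n) DD (\<lambda>d. jmk p q n (jvec (?l d) (\<lambda>j K. \<sigma> j K (?l d))))"
    by (simp add: trunc_id l jet_of_jmk)
  also have "\<dots> = jtang p q n (jvec x (\<lambda>j K. \<sigma> j K x)) (jvec y (dshift p y (\<lambda>j K. \<sigma> j K x)))"
    unfolding J.tang_def
  proof (subst J.cls_mk_eq[OF weil_D_pow])
    show sm: "smoothn (\<lambda>d. jvec (?l d) (\<lambda>j K. \<sigma> j K (?l d)) i)" for i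
      by (rule smooth_jvec_family[OF \<sigma>]) (rule sl)
    show sm': "smoothn (\<lambda>d. jvec x (\<lambda>j K. \<sigma> j K x) i + jvec y (dshift p y (\<lambda>j K. \<sigma> j K x)) i * d 0)" for i
      by (intro smoothn_add smoothn_mult smoothn_const smoothn_coord)
    show "\<forall>i\<in>jidx p q n. \<forall>K\<in>pow_basis 1. tc K (\<lambda>d. jvec (?l d) (\<lambda>j K. \<sigma> j K (?l d)) i) =
        tc K (\<lambda>d. jvec x (\<lambda>j K. \<sigma> j K x) i + jvec y (dshift p y (\<lambda>j K. \<sigma> j K x)) i * d 0)"
    proof (intro ballI)
      fix i K assume "K \<in> pow_basis 1"
      then consider "K = {#}" | "K = {#0#}" by (auto simp: pow_basis_1)
      then show "tc K (\<lambda>d. jvec (?l d) (\<lambda>j K. \<sigma> j K (?l d)) i) =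
        tc K (\<lambda>d. jvec x (\<lambda>j K. \<sigma> j K x) i + jvec y (dshift p y (\<lambda>j K. \<sigma> j K x)) i * d 0)"
      proof cases
        case 1
        then show ?thesis by (cases i) auto
      next
        case 2
        show ?thesis
        proof (cases i)
          case (Inl k)
          then show ?thesis by simp
        next
          case (Inr jL)
          obtain j L where jL: "jL = (j, L)" by (cases jL)
          have "((\<lambda>s. \<sigma> j L x + dshift p y (\<lambda>j K. \<sigma> j K x) j L * s) has_real_derivative dshift p y (\<lambda>j K. \<sigma> j K x) j L) (at 0)"
            by (auto intro!: derivative_eq_intros)
          moreover note hol_familyD(2)[OF \<sigma>, of j L x y]
          ultimately show ?thesis
            unfolding 2 tc_single by (simp add: Inr jL dshift_def DERIV_imp_deriv)
        qed
      qed
    qed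
  qed
  also have "\<dots> = conn (jet_of p q (Suc n) \<sigma> x) t"
    unfolding y(2) jet_of_def by (rule conn_theta[OF x y(1) param_jet_tower, symmetric])
  finally show ?thesis ..
qed

lemma split_append: "split_map n n (\<lambda>k. k) (\<lambda>e d. d(n := e 0))"
proof
  have "{..n} - {n} = {..<n}" by auto
  then show "bij_betw (\<lambda>k. k) {..<n} ({..n} - {n})" by (simp add: bij_betw_def)
  show "(\<exists>k. \<forall>e d. (d(n := e 0)) i = d k) \<or> (\<forall>e d. (d(n := e 0)) i = e 0) \<or> (\<forall>e d. (d(n := e 0)) i = 0)" for i
    by (cases "i = n") auto
qed (auto simp: pts_Rn)

lemma base_tens_mk:
  assumes X: "param X I mk" and W: "weil W B" shows "base (tens_mk X W B mk a) = mk (\<lambda>i. a (i, {#}))"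
proof -
  interpret X: parametrized X I mk by unfold_locales (rule X)
  have sm: "(\<lambda>d. mk (\<lambda>i. \<Sum>L\<in>B. a (i, L) * mpow L d)) \<in> smooth_maps (Rn (nvars W)) X"
    by (intro X.smooth_mk smoothn_poly)
  have "mpow L (\<lambda>_. 0) = (if L = {#} then 1 else 0)" for L by (cases L) auto
  then have "(\<Sum>L\<in>B. a (i, L) * mpow L (\<lambda>_. 0)) = (\<Sum>L\<in>B. if L = {#} then a (i, {#}) else 0)" for i
    by (intro sum.cong refl) (metis mult.right_neutral mult_zero_right)
  then have "(\<Sum>L\<in>B. a (i, L) * mpow L (\<lambda>_. 0)) = a (i, {#})" for i
    using weilD(1,2)[OF W] by (simp add: sum.delta)
  then show ?thesis unfolding tens_mk_def X.base_cls[OF W sm] by simp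
qed

section \<open>The polynomial section with given derivatives at a point\<close>

text \<open>The divided power h^L / L!, for which a partial derivative removes an index from
  \<open>L\<close> without producing a factor.\<close>

definition smono :: "nat \<Rightarrow> nat multiset \<Rightarrow> vec \<Rightarrow> real" where
  "smono p L h = (\<Prod>i<p. h i ^ count L i / fact (count L i))"

text \<open>The derivative with respect to \<open>K\<close> of the Taylor polynomial with centre
  \<open>x\<close>, obtained by shifting the coefficients by \<open>K\<close>. The bound on
  \<open>size (K + L)\<close> removes all derivatives of order above \<open>N\<close>.\<close>

definition sec :: "nat \<Rightarrow> nat \<Rightarrow> vec \<Rightarrow> (nat \<Rightarrow> nat multiset \<Rightarrow> real) \<Rightarrow> nat \<Rightarrow> nat multiset \<Rightarrow> vec \<Rightarrow> real" where
  "sec p N x u j K \<xi> = (\<Sum>L\<in>jet_basis p N. (if size (K + L) \<le> N then u j (K + L) else 0) * smono p L (\<lambda>i. \<xi> i - x i))"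

lemma smono_Suc: "smono (Suc p) L h = smono p L h * (h p ^ count L p / fact (count L p))"
  by (simp add: smono_def)

lemma smono_minus: "p \<le> k \<Longrightarrow> smono p (L - {#k#}) h = smono p L h"
  unfolding smono_def by (intro prod.cong refl) auto

lemma smono_deriv:
  "((\<lambda>s. smono p L (\<lambda>i. h i + y i * s)) has_real_derivative
    (\<Sum>i<p. (if i \<in># L then smono p (L - {#i#}) h else 0) * y i)) (at 0)"
proof (induction p)
  case 0
  show ?case by (simp add: smono_def)
next
  case (Suc p)
  define c where "c = count L p"
  have "((\<lambda>s. (h p + y p * s) ^ c / fact c) has_real_derivative
     (if p \<in># L then h p ^ (c - 1) / fact (c - 1) else 0) * y p) (at 0)"
  proof (cases c)
    case 0
    then have "p \<notin># L" by (simp add: c_def not_in_iff)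
    then show ?thesis by (simp add: 0)
  next
    case (Suc m)
    then have "p \<in># L" by (simp add: c_def flip: count_greater_zero_iff)
    moreover have "((\<lambda>s. (h p + y p * s) ^ Suc m / fact (Suc m)) has_real_derivative h p ^ m / fact m * y p) (at 0)"
      by (rule derivative_eq_intros refl | simp add: field_simps del: of_nat_Suc)+
    ultimately show ?thesis by (simp add: Suc)
  qed
  from DERIV_mult[OF Suc.IH this]
  have "((\<lambda>s. smono (Suc p) L (\<lambda>i. h i + y i * s)) has_real_derivative
      (\<Sum>i<p. (if i \<in># L then smono p (L - {#i#}) h else 0) * y i) * (h p ^ c / fact c) +
      (if p \<in># L then h p ^ (c - 1) / fact (c - 1) else 0) * y p * smono p L h) (at 0)"
    by (simp add: smono_Suc c_def)
  also have "(\<Sum>i<p. (if i \<in># L then smono p (L - {#i#}) h else 0) * y i) * (h p ^ c / fact c) +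
      (if p \<in># L then h p ^ (c - 1) / fact (c - 1) else 0) * y p * smono p L h =
      (\<Sum>i<Suc p. (if i \<in># L then smono (Suc p) (L - {#i#}) h else 0) * y i)"
  proof -
    have *: "smono (Suc p) (L - {#i#}) h = smono p (L - {#i#}) h * (h p ^ c / fact c)" if "i < p" for i
      using that by (simp add: smono_Suc c_def)
    have "smono (Suc p) (L - {#p#}) h = smono p L h * (h p ^ (c - 1) / fact (c - 1))"
      by (simp add: smono_Suc smono_minus c_def One_nat_def)
    moreover have "(\<Sum>i<p. (if i \<in># L then smono p (L - {#i#}) h else 0) * y i) * (h p ^ c / fact c) =
        (\<Sum>i<p. (if i \<in># L then smono (Suc p) (L - {#i#}) h else 0) * y i)"
      unfolding sum_distrib_right by (intro sum.cong refl) (simp add: *)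
    ultimately show ?thesis by simp
  qed
  finally show ?case .
qed

lemma smoothn_smono: "(\<And>i. smoothn (\<lambda>d. h d i)) \<Longrightarrow> smoothn (\<lambda>d. smono p L (h d))"
proof (induction p)
  case 0 show ?case by (simp add: smono_def)
next
  case (Suc p)
  have "smoothn (\<lambda>d. h d p ^ m)" for m by (induction m) (simp_all add: smoothn_mult Suc.prems)
  then have "smoothn (\<lambda>d. h d p ^ count L p * (1 / fact (count L p)))" by (intro smoothn_mult smoothn_const)
  from smoothn_mult[OF Suc.IH[OF Suc.prems] this] show ?case by (simp add: smono_Suc)
qed

lemma smooth_smono: "(\<And>i. smooth_fun (\<lambda>r. h r i)) \<Longrightarrow> smooth_fun (\<lambda>r. smono p L (h r))"
  by (rule smoothnD[OF smoothn_smono[of "\<lambda>d. d"]]) simp_all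

lemma sec_at_center: "sec p N x u j K x = (if size K \<le> N then u j K else 0)"
proof -
  have "smono p L (\<lambda>i. 0) = (if L = {#} then 1 else 0)" if L: "L \<in> jet_basis p N" for L
  proof (cases "L = {#}")
    case False
    then obtain i where "i \<in># L" by blast
    then have "i < p" "count L i \<noteq> 0" using L by (auto simp: jet_basis_def)
    then have "\<exists>i\<in>{..<p}. (0::real) ^ count L i / fact (count L i) = 0" by (intro bexI[of _ i]) auto
    then show ?thesis using False by (simp add: smono_def prod_zero)
  qed (simp add: smono_def)
  then have "sec p N x u j K x = (\<Sum>L\<in>jet_basis p N. if L = {#} then (if size (K + L) \<le> N then u j (K + L) else 0) else 0)"
    unfolding sec_def by (intro sum.cong refl) simp
  also have "\<dots> = (if size K \<le> N then u j K else 0)"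
    using finite_jet_basis[of p N] by (simp add: sum.delta jet_basis_def)
  finally show ?thesis .
qed

lemma smoothn_sec: "smoothn (sec p N x u j K)"
  unfolding sec_def [abs_def]
  by (intro smoothn_sum smoothn_mult smoothn_const smoothn_smono smoothn_diff smoothn_coord)

lemma hol_family_sec: "hol_family p (sec p N x u)"
  unfolding hol_family_def
proof (intro conjI allI)
  show "smoothn (sec p N x u j K)" for j K by (rule smoothn_sec)
  fix j K and \<xi> y :: vec
  define h where "h = (\<lambda>i. \<xi> i - x i)"
  define c where "c = (\<lambda>M. if size M \<le> N then u j M else 0)"
  have eq: "(\<lambda>s. sec p N x u j K (\<lambda>i. \<xi> i + y i * s)) = (\<lambda>s. \<Sum>L\<in>jet_basis p N. c (K + L) * smono p L (\<lambda>i. h i + y i * s))"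
    unfolding sec_def h_def c_def by (simp add: add_diff_eq diff_add_eq)
  have "((\<lambda>s. \<Sum>L\<in>jet_basis p N. c (K + L) * smono p L (\<lambda>i. h i + y i * s)) has_real_derivative
      (\<Sum>L\<in>jet_basis p N. c (K + L) * (\<Sum>i<p. (if i \<in># L then smono p (L - {#i#}) h else 0) * y i))) (at 0)"
    by (intro DERIV_sum DERIV_cmult smono_deriv)
  also have "(\<Sum>L\<in>jet_basis p N. c (K + L) * (\<Sum>i<p. (if i \<in># L then smono p (L - {#i#}) h else 0) * y i))
      = (\<Sum>L\<in>jet_basis p N. \<Sum>i<p. c (K + L) * (if i \<in># L then smono p (L - {#i#}) h else 0) * y i)"
    by (simp add: sum_distrib_left mult.assoc)
  also have "\<dots> = (\<Sum>i<p. \<Sum>L\<in>jet_basis p N. c (K + L) * (if i \<in># L then smono p (L - {#i#}) h else 0) * y i)"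
    by (rule sum.swap)
  also have "\<dots> = (\<Sum>i<p. sec p N x u j (add_mset i K) \<xi> * y i)"
  proof (intro sum.cong refl)
    fix i assume i: "i \<in> {..<p}"
    \<comment> \<open>Differentiation moves the index \<open>i\<close> from \<open>L\<close> to
      \<open>K\<close>. The sum \<open>K + L\<close> is unchanged, and so is the bound on its size,
      which makes the two index sets correspond.\<close>
    have "(\<Sum>L\<in>jet_basis p N. c (K + L) * (if i \<in># L then smono p (L - {#i#}) h else 0))
        = (\<Sum>L\<in>{L \<in> jet_basis p N. i \<in># L \<and> size (K + L) \<le> N}. c (K + L) * smono p (L - {#i#}) h)"
      by (rule sum.mono_neutral_cong_right) (auto simp: finite_jet_basis c_def)
    also have "\<dots> = (\<Sum>L\<in>{L \<in> jet_basis p N. size (add_mset i K + L) \<le> N}. c (add_mset i K + L) * smono p L h)"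
      by (rule sum.reindex_bij_witness[where j = "\<lambda>L. L - {#i#}" and i = "\<lambda>L. add_mset i L"])
        (use i in \<open>auto simp: jet_basis_def size_Diff_singleton dest: in_diffD multi_member_split\<close>)
    also have "\<dots> = (\<Sum>L\<in>jet_basis p N. c (add_mset i K + L) * smono p L h)"
      by (rule sum.mono_neutral_cong_left) (auto simp: finite_jet_basis c_def)
    also have "\<dots> = sec p N x u j (add_mset i K) \<xi>" unfolding sec_def c_def h_def ..
    finally show "(\<Sum>L\<in>jet_basis p N. c (K + L) * (if i \<in># L then smono p (L - {#i#}) h else 0) * y i) = sec p N x u j (add_mset i K) \<xi> * y i"
      by (simp flip: sum_distrib_right)
  qed
  finally show "((\<lambda>s. sec p N x u j K (\<lambda>i. \<xi> i + y i * s)) has_real_derivative (\<Sum>i<p. sec p N x u j (add_mset i K) \<xi> * y i)) (at 0)"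
    unfolding eq .
qed

text \<open>At its centre the polynomial section has the derivatives \<open>u j K\<close> up to
  order \<open>n\<close>, and these are all that \<open>theta\<close> looks at.\<close>

lemma theta_eq_jet_of: "theta p q n x u = jet_of p q n (sec p n x u) x"
  unfolding jet_of_def by (rule theta_cong) (simp add: sec_at_center jet_basis_def)

section \<open>The tangential of an iterated jet\<close>

text \<open>Prolonging the evaluation of \<open>phi\<close> requires smoothness on all jets at once.
  Each jet is the jet of a \<open>sec\<close> whose coefficients are the coordinates of the jet, so
  the formula of the hypothesis depends smoothly on jet and argument together.\<close>

lemma phi_smooth:
  assumes IH: "\<And>\<sigma> x. hol_family p \<sigma> \<Longrightarrow> x \<in> pts (Rn p) \<Longrightarrow> phi p q n (jet_of p q n \<sigma> x) = sectang p q n \<sigma> x"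
  shows "(\<lambda>(z, \<gamma>). snd (phi p q n z) \<gamma>) \<in>
    smooth_maps (fibre_product (jet_tower p q n) (Rn p \<otimes>\<^sub>W D_pow n) (jproj p) base) (Rn (p + q) \<otimes>\<^sub>W D_pow n)"
proof -
  let ?T = "Rn p \<otimes>\<^sub>W D_pow n" and ?mkT = "tens_mk (Rn p) (D_pow n) (pow_basis n) (trunc p)"
  interpret J: parametrized "jet_tower p q n" "jidx p q n" "jmk p q n" by unfold_locales (rule param_jet_tower)
  interpret T: parametrized ?T "{..<p} \<times> pow_basis n" ?mkT by unfold_locales (rule Rn.param_tens[OF weil_D_pow])
  define S where "S a = secmap p q (sec p n (\<lambda>i. a (Inl i)) (\<lambda>j K. a (Inr (j, K))))" for a :: "nat + nat \<times> nat multiset \<Rightarrow> real"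
  define P where "P b d = trunc p (\<lambda>i. \<Sum>L\<in>pow_basis n. b (i, L) * mpow L d)" for b :: "nat \<times> nat multiset \<Rightarrow> real" and d
  have S: "S a \<in> smooth_maps (Rn p) (Rn (p + q))" for a
    unfolding S_def by (intro secmap_smooth hol_family_sec)
  have P: "P b \<in> smooth_maps (Rn (nvars (D_pow n))) (Rn p)" for b
    unfolding P_def by (intro Rn.smooth_mk smoothn_poly)
  have S_trunc: "secmap p q (sec p n (trunc p (\<lambda>i. a (Inl i))) (\<lambda>j K. a (Inr (j, K)))) = S a" for a
  proof -
    have "smono p L (\<lambda>i. \<xi> i - trunc p (\<lambda>i. a (Inl i)) i) = smono p L (\<lambda>i. \<xi> i - a (Inl i))" for L \<xi>
      unfolding smono_def by (intro prod.cong refl) (simp add: trunc_def)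
    then show ?thesis by (simp add: S_def secmap_def sec_def fun_eq_iff)
  qed
  have val: "snd (phi p q n (jmk p q n a)) (?mkT b) = cls (Rn (p + q)) (D_pow n) (\<lambda>d. S a (P b d))"
    if "jproj p (jmk p q n a) = base (?mkT b)" for a b
  proof -
    let ?x = "trunc p (\<lambda>i. a (Inl i))" and ?u = "\<lambda>j K. a (Inr (j, K))"
    have "?mkT b \<in> pts (fibre (Rn p) (D_pow n) ?x)"
      using that by (simp add: fibre_pts jproj_jmk)
    moreover have "phi p q n (jmk p q n a) = sectang p q n (sec p n ?x ?u) ?x"
      unfolding jmk_def theta_eq_jet_of by (intro IH hol_family_sec trunc_pts)
    ultimately have "snd (phi p q n (jmk p q n a)) (?mkT b) = tmap (Rn (p + q)) (D_pow n) (S a) (?mkT b)"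
      by (simp add: sectang_def S_trunc)
    also have "\<dots> = cls (Rn (p + q)) (D_pow n) (S a \<circ> P b)"
      unfolding tens_mk_def P_def [symmetric] by (rule tmap_cls[OF S P])
    finally show ?thesis by (simp add: comp_def)
  qed
  show ?thesis
  proof (rule smooth_mapsI)
    fix w assume w: "w \<in> pts (fibre_product (jet_tower p q n) ?T (jproj p) base)"
    obtain z \<gamma> where z\<gamma>: "w = (z, \<gamma>)" by (cases w)
    obtain a b where ab: "z = jmk p q n a" "\<gamma> = ?mkT b" "jproj p (jmk p q n a) = base (?mkT b)"
      using w unfolding z\<gamma> fibre_product_pts J.pts_eq T.pts_eq by blast
    have "(\<lambda>d. S a (P b d)) \<in> smooth_maps (Rn (nvars (D_pow n))) (Rn (p + q))"
      using smooth_maps_comp[OF S P] by (simp add: comp_def)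
    then show "(case w of (z, \<gamma>) \<Rightarrow> snd (phi p q n z) \<gamma>) \<in> pts (Rn (p + q) \<otimes>\<^sub>W D_pow n)"
      unfolding z\<gamma> ab(1,2) prod.case val[OF ab(3)] by (rule cls_pts)
  next
    fix c assume c: "c \<in> curves (fibre_product (jet_tower p q n) ?T (jproj p) base)"
    obtain a where a: "\<forall>i\<in>jidx p q n. smooth_fun (\<lambda>t. a t i)" "(\<lambda>t. fst (c t)) = (\<lambda>t. jmk p q n (a t))"
      using c unfolding fibre_product_curves J.curves_eq by blast
    obtain b where b: "\<forall>i\<in>{..<p} \<times> pow_basis n. smooth_fun (\<lambda>t. b t i)" "(\<lambda>t. snd (c t)) = (\<lambda>t. ?mkT (b t))"
      using c unfolding fibre_product_curves T.curves_eq by blast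
    have "jproj p (jmk p q n (a t)) = base (?mkT (b t))" for t
      using c unfolding fibre_product_curves by (simp add: fun_cong[OF a(2)] fun_cong[OF b(2)])
    then have v: "(case c t of (z, \<gamma>) \<Rightarrow> snd (phi p q n z) \<gamma>) = cls (Rn (p + q)) (D_pow n) (\<lambda>d. S (a t) (P (b t) d))" for t
      using val fun_cong[OF a(2), of t] fun_cong[OF b(2), of t] by (simp add: split_beta)
    show "(\<lambda>t. case c t of (z, \<gamma>) \<Rightarrow> snd (phi p q n z) \<gamma>) \<in> curves (Rn (p + q) \<otimes>\<^sub>W D_pow n)"
      unfolding v
    proof (intro cls_curve mapping_curveI)
      show "S (a r) (P (b r) d) \<in> pts (Rn (p + q))" for r d by (simp add: S_def secmap_def join_pts)
      fix g e assume g: "smooth_fun g" and e: "e \<in> curves (Rn (nvars (D_pow n)))"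
      have sP: "smooth_fun (\<lambda>r. P (b (g r)) (e r) i)" for i
        unfolding P_def
      proof (rule smooth_trunc_curve, intro smooth_sum smooth_mult)
        fix i L assume "i < p" "L \<in> pow_basis n"
        then show "smooth_fun (\<lambda>r. b (g r) (i, L))" using b(1) by (intro smooth_compose[OF _ g, of "\<lambda>t. b t (i, L)"]) auto
        show "smooth_fun (\<lambda>r. mpow L (e r))" by (rule smoothnD[OF smoothn_mpow]) (use e in \<open>simp add: curves_Rn\<close>)
      qed
      have ax: "smooth_fun (\<lambda>r. a (g r) (Inl i))" if "i < p" for i
        using a(1) that by (intro smooth_compose[OF _ g, of "\<lambda>t. a t (Inl i)"]) (simp add: ball_jidx)
      have au: "smooth_fun (\<lambda>r. a (g r) (Inr (j, K)))" if "j < q" "K \<in> jet_basis p n" for j K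
        using a(1) that by (intro smooth_compose[OF _ g, of "\<lambda>t. a t (Inr (j, K))"]) (simp add: ball_jidx)
      have sec: "smooth_fun (\<lambda>r. sec p n (\<lambda>i. a (g r) (Inl i)) (\<lambda>j K. a (g r) (Inr (j, K))) j {#} (P (b (g r)) (e r)))" if j: "j < q" for j
      proof -
        \<comment> \<open>Only the coordinates below \<open>p\<close> enter the monomials, and only
          those are known to vary smoothly; the truncation makes this visible.\<close>
        have tr: "sec p n (\<lambda>i. a (g r) (Inl i)) (\<lambda>j K. a (g r) (Inr (j, K))) j {#} (P (b (g r)) (e r)) =
          (\<Sum>L\<in>jet_basis p n. (if size L \<le> n then a (g r) (Inr (j, L)) else 0) * smono p L (trunc p (\<lambda>i. P (b (g r)) (e r) i - a (g r) (Inl i))))" for r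
          unfolding sec_def smono_def by (intro sum.cong refl arg_cong2[where f = "(*)"] prod.cong) (auto simp: trunc_def)
        show ?thesis
          unfolding tr
        proof (intro smooth_sum smooth_mult smooth_smono smooth_trunc_curve smooth_diff sP ax)
          show "smooth_fun (\<lambda>r. if size L \<le> n then a (g r) (Inr (j, L)) else 0)" if "L \<in> jet_basis p n" for L
            using au[OF j that] by (intro smooth_if) auto
        qed
      qed
      have "smooth_fun (\<lambda>r. S (a (g r)) (P (b (g r)) (e r)) i)" for i
        using sP sec unfolding S_def secmap_def join_def by (cases "i < p"; cases "i < p + q") auto
      then show "(\<lambda>r. S (a (g r)) (P (b (g r)) (e r))) \<in> curves (Rn (p + q))"
        unfolding curves_Rn by (auto simp: S_def secmap_def join_pts)
    qed
  qed
qed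

lemma wcomp_axis:
  "weil_map DD (D_pow (Suc n)) (\<lambda>d i. if i = n then d 0 else 0)"
proof (rule weil_map_pow)
  fix i
  show "(\<forall>v. (if i = n then v 0 else 0) = 0) \<or> (\<exists>j<1. \<exists>c. smoothn c \<and> (\<forall>v :: vec. (if i = n then v 0 else 0) = c v * v j))"
    by (cases "i = n") (auto intro!: exI[of _ "\<lambda>_. 1"] exI[of _ 0])
qed (auto simp: pts_Rn intro!: smoothn_if)

text \<open>Along the last variable the connection yields the jets of the same section at the moving
  points v(0, ..., 0, e). The induction hypothesis at each of these points composes the section with
  the corresponding slice of \<gamma>, and undoing the split assembles the slices. Hence the claim
  is proved for all base points at once.\<close>

theorem phi_jet_of:
  assumes \<sigma>: "hol_family p \<sigma>" and x: "x \<in> pts (Rn p)"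
  shows "phi p q (Suc n) (jet_of p q (Suc n) \<sigma> x) = sectang p q (Suc n) \<sigma> x"
  using assms
proof (induction n arbitrary: \<sigma> x)
  case 0
  note \<sigma> = 0(1) and x = 0(2)
  interpret J: parametrized "jet_tower p q 0" "jidx p q 0" "jmk p q 0" by unfold_locales (rule param_jet_tower)
  have D1: "D_pow (Suc 0) = DD" by (simp add: One_nat_def)
  have unPt: "unPt \<in> smooth_maps (jet_tower p q 0) (Rn (p + q))"
    by (rule smooth_mapsI) (auto simp: transport_def comp_def)
  have "tmap (Rn (p + q)) DD unPt (conn (jet_of p q (Suc 0) \<sigma> x) \<gamma>) = tmap (Rn (p + q)) DD (secmap p q \<sigma>) \<gamma>"
    if \<gamma>: "\<gamma> \<in> pts (fibre (Rn p) DD x)" for \<gamma>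
  proof -
    have "\<gamma> \<in> pts (Rn p \<otimes>\<^sub>W DD)" using \<gamma> by (simp add: fibre_pts)
    then obtain f where f: "f \<in> smooth_maps (Rn (nvars DD)) (Rn p)" "\<gamma> = cls (Rn p) DD f" unfolding pts_tens by blast
    have "unPt \<circ> (jet_of p q 0 \<sigma> \<circ> f) = secmap p q \<sigma> \<circ> f" by (simp add: fun_eq_iff jet_of_def secmap_def)
    then show ?thesis
      unfolding conn_jet_of[OF \<sigma> \<gamma>]
      unfolding f(2) tmap_cls[OF jet_of_smooth[OF \<sigma>] f(1)] tmap_cls[OF secmap_smooth[OF \<sigma>] f(1)]
        tmap_cls[OF unPt smooth_maps_comp[OF jet_of_smooth[OF \<sigma>] f(1)]]
      by (rule arg_cong)
  qed
  moreover have "jproj p (jet_of p q (Suc 0) \<sigma> x) = x" "jbase (jet_of p q (Suc 0) \<sigma> x) = secmap p q \<sigma> x"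
    unfolding jet_of_def secmap_def by (rule jproj_theta[OF x]) (rule jbase_theta)
  ultimately show ?case
    unfolding phi.simps(1) sectang_def D1 by (auto intro!: restrict_ext)
next
  case (Suc k)
  note \<sigma> = Suc.prems(1) and x = Suc.prems(2)
  define n where "n = Suc k"
  let ?z = "jet_of p q (Suc n) \<sigma> x" and ?M = "Rn p" and ?E = "Rn (p + q)"
  let ?J = "jet_tower p q n" and ?T = "Rn p \<otimes>\<^sub>W D_pow n" and ?append = "\<lambda>e d. d(n := e (0::nat))"
  let ?\<Phi> = "\<lambda>(z, \<gamma>). snd (phi p q n z) \<gamma>"
  let ?mkT = "tens_mk (Rn p) (D_pow n) (pow_basis n) (trunc p)"
  interpret J: parametrized ?J "jidx p q n" "jmk p q n" by unfold_locales (rule param_jet_tower)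
  interpret A: split_map n n "\<lambda>k. k" ?append by (rule split_append)
  have IH: "phi p q n (jet_of p q n \<sigma> x) = sectang p q n \<sigma> x" if "hol_family p \<sigma>" "x \<in> pts (Rn p)" for \<sigma> x
    unfolding n_def by (rule Suc.IH[OF that])
  have parT: "param ?T ({..<p} \<times> pow_basis n) ?mkT" by (rule Rn.param_tens[OF weil_D_pow])
  have main: "wunsplit ?E (D_pow (n + 1)) (D_pow n) DD ?append
      (apply_pair ?J ?T (fibre_product ?J ?T (jproj p) base) (?E \<otimes>\<^sub>W D_pow n) DD ?\<Phi>
        (conn ?z (wcomp ?M DD (\<lambda>d i. if i = n then d 0 else 0) \<gamma>)) (wsplit ?M (D_pow n) DD ?append \<gamma>))
    = tmap ?E (D_pow (n + 1)) (secmap p q \<sigma>) \<gamma>" if \<gamma>: "\<gamma> \<in> pts (fibre ?M (D_pow (n + 1)) x)" for \<gamma>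
  proof -
    let ?\<iota> = "\<lambda>d i. if i = n then d (0::nat) else (0::real)"
    have S1: "n + 1 = Suc n" by simp
    have "\<gamma> \<in> pts (?M \<otimes>\<^sub>W D_pow (Suc n))" using \<gamma> unfolding S1 by (simp add: fibre_pts)
    then obtain v where v: "\<And>i. smoothn (\<lambda>d. v d i)" "\<gamma> = cls ?M (D_pow (Suc n)) (\<lambda>d. trunc p (v d))"
      by (rule Rn.tens_rep) blast
    have sv: "(\<lambda>d. trunc p (v d)) \<in> smooth_maps (Rn k') ?M" for k' using v(1) by (intro Rn.smooth_mk)
    have s\<iota>: "smoothn (\<lambda>d. v (?\<iota> d) i)" for i
      by (rule smoothn_compose[OF v(1)]) (intro smoothn_if smoothn_coord smoothn_const)
    have wc: "wcomp ?M DD ?\<iota> \<gamma> = cls ?M DD (\<lambda>d. trunc p (v (?\<iota> d)))"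
      unfolding v(2) wcomp_cls[OF wcomp_axis sv] by (simp add: comp_def)
    have "base \<gamma> = trunc p (v (\<lambda>_. 0))" unfolding v(2) by (rule Rn.base_cls[OF weil_D_pow sv])
    then have bx: "x = trunc p (v (\<lambda>_. 0))" using \<gamma> by (simp add: fibre_pts)
    have sv\<iota>: "(\<lambda>d. trunc p (v (?\<iota> d))) \<in> smooth_maps (Rn (nvars DD)) ?M" using s\<iota> by (intro Rn.smooth_mk)
    have z\<iota>: "?\<iota> (\<lambda>_. 0) = (\<lambda>_. 0)" by auto
    have wcf: "wcomp ?M DD ?\<iota> \<gamma> \<in> pts (fibre ?M DD x)"
      unfolding fibre_pts wc Rn.base_cls[OF weil_D_pow sv\<iota>] z\<iota> using cls_pts[OF sv\<iota>] bx by simp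
    \<comment> \<open>\<open>a\<close> describes the jet over the point where the slice of \<gamma>
      begins, and \<open>b\<close> the slice itself. Both use the representative \<open>v\<close>,
      so the base points agree exactly and not only modulo the ideal.\<close>
    define a where "a e = jvec (trunc p (v (?\<iota> e))) (\<lambda>j K. \<sigma> j K (trunc p (v (?\<iota> e))))" for e
    define b where "b e = (\<lambda>(i, K). tc K (\<lambda>d. v (?append e d) i))" for e :: vec
    have 1: "conn ?z (wcomp ?M DD ?\<iota> \<gamma>) = cls ?J DD (\<lambda>e. jmk p q n (a e))"
      unfolding conn_jet_of[OF \<sigma> wcf]
      unfolding wc tmap_cls[OF jet_of_smooth[OF \<sigma>] sv\<iota>] a_def by (simp add: comp_def jet_of_jmk)
    have cb: "cls ?M (D_pow n) (\<lambda>d. trunc p (v (?append e d))) = ?mkT (b e)" for e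
      unfolding b_def by (rule Rn.cls_eq_tens_mk[OF weil_D_pow A.smoothn_j[OF v(1)]])
    have 2: "wsplit ?M (D_pow n) DD ?append \<gamma> = cls ?T DD (\<lambda>e. ?mkT (b e))"
      unfolding v(2) cb[symmetric] by (rule Rn.wsplit_eq_tens_mk(1)[OF split_append v(1)])
    have "apply_pair ?J ?T (fibre_product ?J ?T (jproj p) base) (?E \<otimes>\<^sub>W D_pow n) DD ?\<Phi>
        (cls ?J DD (\<lambda>e. jmk p q n (a e))) (cls ?T DD (\<lambda>e. ?mkT (b e)))
      = cls (?E \<otimes>\<^sub>W D_pow n) DD (\<lambda>e. ?\<Phi> (jmk p q n (a e), ?mkT (b e)))"
    proof (rule apply_pair_cls[OF J.par parT, where C = "{..<p} \<times> {{#}}" and \<alpha> = "\<lambda>(i, _). Inl i" and B = "pow_basis 1"])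
      show "{..<p} \<times> {{#}} \<subseteq> {..<p} \<times> pow_basis n" by (auto simp: pow_basis_iff)
      show "(\<lambda>(i, _). Inl i) ` ({..<p} \<times> {{#}}) \<subseteq> jidx p q n" by (auto simp: jidx_def)
      show "jproj p (jmk p q n v) = base (?mkT w) \<longleftrightarrow> (\<forall>i\<in>{..<p} \<times> {{#}}. v ((\<lambda>(i, _). Inl i) i) = w i)" for v w
        unfolding jproj_jmk base_tens_mk[OF param_Rn weil_D_pow] Rn.mk_eq by auto
      show "smoothn (\<lambda>e. a e i)" for i
        unfolding a_def by (rule smooth_jvec_family[OF \<sigma>]) (auto simp: trunc_def intro!: smoothn_if s\<iota>)
      show "smoothn (\<lambda>e. b e i)" for i
        by (cases i) (simp add: b_def A.smoothn_tc_j[OF v(1)])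
      show "a e ((\<lambda>(i, _). Inl i) i) = b e i" if "i \<in> {..<p} \<times> {{#}}" for e i
      proof -
        have "(\<lambda>_. 0)(n := e 0) = ?\<iota> e" by auto
        then show ?thesis using that by (auto simp: a_def b_def trunc_def)
      qed
      show "?\<Phi> \<in> smooth_maps (fibre_product ?J ?T (jproj p) base) (?E \<otimes>\<^sub>W D_pow n)"
        by (rule phi_smooth[OF IH])
    qed (rule weil_D_pow)
    also have "(\<lambda>e. ?\<Phi> (jmk p q n (a e), ?mkT (b e))) =
        (\<lambda>e. cls ?E (D_pow n) (\<lambda>d. trunc (p + q) (secmap p q \<sigma> (trunc p (v (?append e d))))))"
    proof
      fix e :: vec
      let ?y = "trunc p (v (?\<iota> e))"
      have sa: "(\<lambda>d. trunc p (v (?append e d))) \<in> smooth_maps (Rn (nvars (D_pow n))) ?M"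
        using A.smoothn_j[OF v(1)] by (intro Rn.smooth_mk)
      have "(\<lambda>_. 0)(n := e 0) = ?\<iota> e" by auto
      then have "cls ?M (D_pow n) (\<lambda>d. trunc p (v (?append e d))) \<in> pts (fibre ?M (D_pow n) ?y)"
        unfolding fibre_pts Rn.base_cls[OF weil_D_pow sa] using cls_pts[OF sa] by simp
      moreover have "phi p q n (jmk p q n (a e)) = sectang p q n \<sigma> ?y"
        unfolding a_def using IH[OF \<sigma> trunc_pts] by (simp add: jet_of_jmk)
      ultimately have "?\<Phi> (jmk p q n (a e), ?mkT (b e)) = tmap ?E (D_pow n) (secmap p q \<sigma>) (cls ?M (D_pow n) (\<lambda>d. trunc p (v (?append e d))))"
        by (simp add: sectang_def flip: cb)
      also have "\<dots> = cls ?E (D_pow n) (\<lambda>d. trunc (p + q) (secmap p q \<sigma> (trunc p (v (?append e d)))))"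
        unfolding tmap_cls[OF secmap_smooth[OF \<sigma>] sa] by (simp add: comp_def trunc_secmap)
      finally show "?\<Phi> (jmk p q n (a e), ?mkT (b e)) = \<dots>" .
    qed
    finally have 3: "apply_pair ?J ?T (fibre_product ?J ?T (jproj p) base) (?E \<otimes>\<^sub>W D_pow n) DD ?\<Phi>
        (conn ?z (wcomp ?M DD ?\<iota> \<gamma>)) (wsplit ?M (D_pow n) DD ?append \<gamma>) =
      cls (?E \<otimes>\<^sub>W D_pow n) DD (\<lambda>e. cls ?E (D_pow n) (\<lambda>d. trunc (p + q) (secmap p q \<sigma> (trunc p (v (?append e d))))))"
      unfolding 1 2 .
    have ss: "smoothn (\<lambda>d. secmap p q \<sigma> (trunc p (v d)) i)" for i
    proof (rule smoothn_compose[OF smoothn_secmap])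
      show "smoothn (\<sigma> j {#})" for j by (rule hol_familyD(1)[OF \<sigma>])
      show "smoothn (\<lambda>d. trunc p (v d) i)" for i using v(1) by (auto simp: trunc_def intro!: smoothn_if)
    qed
    show ?thesis
      unfolding 3 S1 Rn.wunsplit_cls[where v = "\<lambda>d. secmap p q \<sigma> (trunc p (v d))", OF split_append ss]
      unfolding v(2) tmap_cls[OF secmap_smooth[OF \<sigma>] sv] by (simp add: comp_def trunc_secmap)
  qed
  have "jproj p ?z = x" "jbase ?z = secmap p q \<sigma> x"
    unfolding jet_of_def secmap_def by (rule jproj_theta[OF x]) (rule jbase_theta)
  then have "phi p q (Suc n) ?z = (secmap p q \<sigma> x, \<lambda>\<gamma>\<in>pts (fibre ?M (D_pow (n + 1)) x).
      wunsplit ?E (D_pow (n + 1)) (D_pow n) DD ?append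
      (apply_pair ?J ?T (fibre_product ?J ?T (jproj p) base) (?E \<otimes>\<^sub>W D_pow n) DD ?\<Phi>
        (conn ?z (wcomp ?M DD (\<lambda>d i. if i = n then d 0 else 0) \<gamma>)) (wsplit ?M (D_pow n) DD ?append \<gamma>)))"
    unfolding n_def phi.simps(2) Let_def by simp
  also have "\<dots> = sectang p q (Suc n) \<sigma> x"
    unfolding sectang_def Suc_eq_plus1 by (intro arg_cong[where f = "Pair _"] restrict_ext main[unfolded Suc_eq_plus1])
  finally show ?case unfolding n_def .
qed

section \<open>Sections give tangentials\<close>

lemma tmap_wcomp:
  assumes \<phi>: "\<phi> \<in> smooth_maps X Y" and g: "weil_map W W' g" and t: "t \<in> pts (X \<otimes>\<^sub>W W')"
  shows "tmap Y W \<phi> (wcomp X W g t) = wcomp Y W g (tmap Y W' \<phi> t)"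
proof -
  obtain f where f: "f \<in> smooth_maps (Rn (nvars W')) X" "t = cls X W' f" using t unfolding pts_tens by blast
  have "f \<circ> g \<in> smooth_maps (Rn (nvars W)) X" by (rule smooth_maps_comp[OF f(1) weil_map_smooth[OF g]])
  then show ?thesis
    unfolding f(2) wcomp_cls[OF g f(1)] tmap_cls[OF \<phi> f(1)] wcomp_cls[OF g smooth_maps_comp[OF \<phi> f(1)]]
    by (simp add: tmap_cls[OF \<phi>] comp_assoc)
qed

lemma wcomp_fibre:
  assumes g: "weil_map (D_pow n) (D_pow m) g" "g (\<lambda>_. 0) = (\<lambda>_. 0)" and t: "t \<in> pts (fibre (Rn k) (D_pow m) x)"
  shows "wcomp (Rn k) (D_pow n) g t \<in> pts (fibre (Rn k) (D_pow n) x)"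
proof -
  have tp: "t \<in> pts (Rn k \<otimes>\<^sub>W D_pow m)" and b: "base t = x" using t by (simp_all add: fibre_pts)
  obtain f where f: "f \<in> smooth_maps (Rn (nvars (D_pow m))) (Rn k)" "t = cls (Rn k) (D_pow m) f" using tp unfolding pts_tens by blast
  have "base (wcomp (Rn k) (D_pow n) g t) = x"
    unfolding f(2) wcomp_cls[OF g(1) f(1)] Rn.base_cls[OF weil_D_pow smooth_maps_comp[OF f(1) weil_map_smooth[OF g(1)]]]
    using b by (simp add: f(2) Rn.base_cls[OF weil_D_pow f(1)] g(2))
  then show ?thesis by (simp add: fibre_pts wcomp_pts[OF g(1) tp])
qed

lemma tmap_fibre:
  assumes \<phi>: "\<phi> \<in> smooth_maps (Rn k) (Rn l)" and t: "t \<in> pts (fibre (Rn k) (D_pow n) x)"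
  shows "tmap (Rn l) (D_pow n) \<phi> t \<in> pts (fibre (Rn l) (D_pow n) (\<phi> x))"
proof -
  have tp: "t \<in> pts (Rn k \<otimes>\<^sub>W D_pow n)" and b: "base t = x" using t by (simp_all add: fibre_pts)
  obtain f where f: "f \<in> smooth_maps (Rn (nvars (D_pow n))) (Rn k)" "t = cls (Rn k) (D_pow n) f" using tp unfolding pts_tens by blast
  have "base (tmap (Rn l) (D_pow n) \<phi> t) = \<phi> x"
    unfolding f(2) tmap_cls[OF \<phi> f(1)] Rn.base_cls[OF weil_D_pow smooth_maps_comp[OF \<phi> f(1)]]
    using b by (simp add: f(2) Rn.base_cls[OF weil_D_pow f(1)])
  then show ?thesis using smooth_mapsD(1)[OF tmap_smooth[OF \<phi>] tp] by (simp add: fibre_pts)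
qed

lemma restrict_tmap_smooth:
  assumes \<phi>: "\<phi> \<in> smooth_maps (Rn k) (Rn l)"
  shows "restrict (tmap (Rn l) (D_pow n) \<phi>) (pts (fibre (Rn k) (D_pow n) x)) \<in>
    smooth_maps (fibre (Rn k) (D_pow n) x) (fibre (Rn l) (D_pow n) (\<phi> x))"
proof (rule smooth_mapsI)
  fix c assume c: "c \<in> curves (fibre (Rn k) (D_pow n) x)"
  then have p: "c r \<in> pts (fibre (Rn k) (D_pow n) x)" for r
    by (simp add: fibre_curves fibre_pts curves_tens)
  have "(\<lambda>r. tmap (Rn l) (D_pow n) \<phi> (c r)) \<in> curves (Rn l \<otimes>\<^sub>W D_pow n)"
    using c by (intro smooth_mapsD(2)[OF tmap_smooth[OF \<phi>]]) (simp add: fibre_curves)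
  then show "(\<lambda>r. restrict (tmap (Rn l) (D_pow n) \<phi>) (pts (fibre (Rn k) (D_pow n) x)) (c r)) \<in> curves (fibre (Rn l) (D_pow n) (\<phi> x))"
    using tmap_fibre[OF \<phi> p] unfolding restrict_apply' [OF p] by (simp add: fibre_curves fibre_pts)
qed (simp add: tmap_fibre[OF \<phi>])

lemma weil_map_perm:
  assumes "\<sigma> permutes {..<n}" shows "weil_map (D_pow n) (D_pow n) (\<lambda>d. d \<circ> \<sigma>)"
proof (rule weil_map_pow)
  fix v assume "v \<in> pts (Rn n)"
  then show "v \<circ> \<sigma> \<in> pts (Rn n)" using assms by (auto simp: pts_Rn permutes_not_in)
next
  fix i assume "i < n"
  then have "\<sigma> i < n" using permutes_in_image[OF assms, of i] by simp
  then show "(\<forall>v :: vec. (v \<circ> \<sigma>) i = 0) \<or> (\<exists>j<n. \<exists>c. smoothn c \<and> (\<forall>v :: vec. (v \<circ> \<sigma>) i = c v * v j))"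
    by (intro disjI2 exI[of _ "\<sigma> i"] conjI exI[of _ "\<lambda>_. 1"]) auto
qed simp

lemma weil_map_trunc: "weil_map (D_pow (Suc n)) (D_pow n) (trunc n)"
proof (rule weil_map_pow)
  fix i assume "i < n"
  then show "(\<forall>v :: vec. trunc n v i = 0) \<or> (\<exists>j<Suc n. \<exists>c. smoothn c \<and> (\<forall>v :: vec. trunc n v i = c v * v j))"
    by (intro disjI2 exI[of _ i] conjI exI[of _ "\<lambda>_. 1"]) (auto simp: trunc_def)
next
  show "smoothn (\<lambda>v. trunc n v i)" for i unfolding trunc_def by (intro smoothn_if smoothn_coord smoothn_const)
qed simp

text \<open>The additional equation pulls back to a function that is zero on the points of
  \<open>Rn n\<close>, where the coordinate \<open>n\<close> vanishes.\<close>

lemma weil_map_incl: "weil_map (D_pow n) (D_pow (Suc n)) (\<lambda>d. d)"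
  unfolding weil_map_def
proof (intro conjI ballI allI)
  fix e assume "e \<in> eqns (D_pow (Suc n))"
  then obtain i where i: "i < Suc n" "e = mpow {#i, i#}" unfolding eqns_D_pow by blast
  show "(\<lambda>v. e v) \<in> ideal (D_pow n)"
  proof (cases "i = n")
    case True
    show ?thesis by (rule ideal_cong[OF ideal_zero]) (simp add: i True pts_Rn)
  next
    case False
    then have "e \<in> eqns (D_pow n)" using i by (auto simp: eqns_D_pow)
    then show ?thesis by (simp add: ideal_gen)
  qed
qed (auto simp: pts_Rn)

lemma weil_map_kappa: "n \<ge> 1 \<Longrightarrow> weil_map (D_pow (Suc n)) (D_pow n) (kappa n)"
proof (rule weil_map_pow)
  fix i assume n: "n \<ge> 1" and i: "i < n"
  show "(\<forall>v :: vec. kappa n v i = 0) \<or> (\<exists>j<Suc n. \<exists>c. smoothn c \<and> (\<forall>v :: vec. kappa n v i = c v * v j))"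
  proof (cases "i = n - 1")
    case True
    then show ?thesis using i by (intro disjI2 exI[of _ i] conjI exI[of _ "\<lambda>v. v n"]) (auto simp: kappa_def)
  next
    case False
    then show ?thesis using i by (intro disjI2 exI[of _ i] conjI exI[of _ "\<lambda>v. 1"]) (auto simp: kappa_def)
  qed
next
  show "smoothn (\<lambda>v. kappa n v i)" for i
    unfolding kappa_def by (intro smoothn_if smoothn_mult smoothn_coord smoothn_const)
next
  fix v :: vec assume "1 \<le> n"
  then show "kappa n v \<in> pts (Rn n)" by (auto simp: pts_Rn kappa_def)
qed

lemma at_zero [simp]: "scale i \<alpha> (\<lambda>_. 0) = (\<lambda>_. 0)" "kappa n (\<lambda>_. 0) = (\<lambda>_. 0)" "trunc n (\<lambda>_. 0) = (\<lambda>_. 0)"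
  by (auto simp: scale_def kappa_def trunc_def)

lemma wcomp_incl_trunc:
  assumes "\<gamma> \<in> pts (X \<otimes>\<^sub>W D_pow n)"
  shows "wcomp X (D_pow n) (\<lambda>d. d) (wcomp X (D_pow (Suc n)) (trunc n) \<gamma>) = \<gamma>"
proof -
  obtain f where f: "f \<in> smooth_maps (Rn (nvars (D_pow n))) X" "\<gamma> = cls X (D_pow n) f"
    using assms unfolding pts_tens by blast
  have ft: "f \<circ> trunc n \<in> smooth_maps (Rn (nvars (D_pow (Suc n)))) X"
    by (rule smooth_maps_comp[OF f(1) weil_map_smooth[OF weil_map_trunc]])
  have "wcomp X (D_pow n) (\<lambda>d. d) (wcomp X (D_pow (Suc n)) (trunc n) \<gamma>) = cls X (D_pow n) (f \<circ> trunc n \<circ> (\<lambda>d. d))"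
    unfolding f(2) wcomp_cls[OF weil_map_trunc f(1)] by (rule wcomp_cls[OF weil_map_incl ft])
  also have "\<dots> = \<gamma>"
    unfolding f(2) by (rule cls_eqI[OF weil_equiv_sym[OF weil_equiv_cong[OF f(1)]]]) (simp add: trunc_id)
  finally show ?thesis .
qed

lemma sectang_pseudotangential:
  assumes \<sigma>: "hol_family p \<sigma>" and x: "x \<in> pts (Rn p)"
  shows "sectang p q n \<sigma> x \<in> pseudotangentials p q n"
proof -
  define A where "A = fibre (Rn p) (D_pow n) x"
  define B where "B = fibre (Rn (p + q)) (D_pow n) (secmap p q \<sigma> x)"
  define N where "N = restrict (tmap (Rn (p + q)) (D_pow n) (secmap p q \<sigma>)) (pts A)"
  note S = secmap_smooth[OF \<sigma>, of q p]
  have Nsm: "N \<in> smooth_maps A B"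
    unfolding N_def A_def B_def by (rule restrict_tmap_smooth[OF S])
  have funct: "N (wcomp (Rn p) (D_pow n) g \<gamma>) = wcomp (Rn (p + q)) (D_pow n) g (N \<gamma>)"
    if g: "weil_map (D_pow n) (D_pow n) g" "g (\<lambda>_. 0) = (\<lambda>_. 0)" and \<gamma>: "\<gamma> \<in> pts A" for g \<gamma>
  proof -
    have "wcomp (Rn p) (D_pow n) g \<gamma> \<in> pts A" using \<gamma> unfolding A_def by (rule wcomp_fibre[OF g])
    then show ?thesis using \<gamma> tmap_wcomp[OF S g(1)] by (simp add: N_def A_def fibre_pts)
  qed
  have hom: "N (wcomp (Rn p) (D_pow n) (scale i \<alpha>) \<gamma>) = wcomp (Rn (p + q)) (D_pow n) (scale i \<alpha>) (N \<gamma>)"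
    if "i < n" "\<gamma> \<in> pts A" for i \<alpha> \<gamma>
    using that by (intro funct Rn.weil_map_scale) simp_all
  have proj: "tmap (Rn p) (D_pow n) (trunc p) (N \<gamma>) = \<gamma>" if \<gamma>: "\<gamma> \<in> pts A" for \<gamma>
  proof -
    have "\<gamma> \<in> pts (Rn p \<otimes>\<^sub>W D_pow n)" using \<gamma> by (simp add: A_def fibre_pts)
    then obtain v where v: "\<And>i. smoothn (\<lambda>d. v d i)" "\<gamma> = cls (Rn p) (D_pow n) (\<lambda>d. trunc p (v d))"
      by (rule Rn.tens_rep) blast
    have sv: "(\<lambda>d. trunc p (v d)) \<in> smooth_maps (Rn (nvars (D_pow n))) (Rn p)" using v(1) by (intro Rn.smooth_mk)
    have tr: "trunc p \<in> smooth_maps (Rn (p + q)) (Rn p)"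
      by (rule smooth_maps_Rn, rule trunc_pts) (auto simp: trunc_def intro!: smoothn_if)
    have "tmap (Rn p) (D_pow n) (trunc p) (N \<gamma>) =
        cls (Rn p) (D_pow n) (trunc p \<circ> (secmap p q \<sigma> \<circ> (\<lambda>d. trunc p (v d))))"
      using \<gamma> unfolding N_def by (simp add: v(2) tmap_cls[OF S sv] tmap_cls[OF tr smooth_maps_comp[OF S sv]])
    also have "trunc p \<circ> (secmap p q \<sigma> \<circ> (\<lambda>d. trunc p (v d))) = (\<lambda>d. trunc p (v d))"
      by (simp add: fun_eq_iff trunc_secmap trunc_id)
    finally show ?thesis using v(2) by simp
  qed
  have mu: "mu_compatible (Rn p) (D_pow n) A i (Rn (p + q)) (D_pow n) B i m N" if i: "i < n" for i m
    by (rule mu_compatibleI[OF Nsm]) (use Rn.scaling_smooth(1) i hom in \<open>auto simp: A_def\<close>)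
  have perm: "N (wcomp (Rn p) (D_pow n) (\<lambda>d. d \<circ> \<tau>) \<gamma>) = wcomp (Rn (p + q)) (D_pow n) (\<lambda>d. d \<circ> \<tau>) (N \<gamma>)"
    if "\<tau> permutes {..<n}" "\<gamma> \<in> pts A" for \<tau> \<gamma>
    using that by (intro funct weil_map_perm) auto
  have xE: "secmap p q \<sigma> x \<in> pts (Rn (p + q))" by (rule smooth_mapsD(1)[OF S x])
  have ext: "N \<in> extensional (pts A)" by (simp add: N_def)
  have "(secmap p q \<sigma> x, N) \<in> pseudotangentials p q n"
    unfolding pseudotangentials_def mem_Collect_eq prod.case Let_def trunc_secmap(2) trunc_id[OF x] A_def[symmetric] B_def[symmetric]
    using xE Nsm ext proj hom mu perm by blast
  then show ?thesis by (simp add: sectang_def N_def A_def)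
qed

lemma pi_hat_sectang:
  assumes \<sigma>: "hol_family p \<sigma>" and x: "x \<in> pts (Rn p)"
  shows "pi_hat p q n (sectang p q (Suc n) \<sigma> x) = sectang p q n \<sigma> x"
proof -
  note S = secmap_smooth[OF \<sigma>, of q p]
  have "wcomp (Rn (p + q)) (D_pow n) (\<lambda>d. d)
      (restrict (tmap (Rn (p + q)) (D_pow (Suc n)) (secmap p q \<sigma>)) (pts (fibre (Rn p) (D_pow (Suc n)) x))
        (wcomp (Rn p) (D_pow (Suc n)) (trunc n) \<gamma>)) = tmap (Rn (p + q)) (D_pow n) (secmap p q \<sigma>) \<gamma>"
    if \<gamma>: "\<gamma> \<in> pts (fibre (Rn p) (D_pow n) x)" for \<gamma>
  proof -
    have \<gamma>p: "\<gamma> \<in> pts (Rn p \<otimes>\<^sub>W D_pow n)" using \<gamma> by (simp add: fibre_pts)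
    have "wcomp (Rn p) (D_pow (Suc n)) (trunc n) \<gamma> \<in> pts (fibre (Rn p) (D_pow (Suc n)) x)"
      by (rule wcomp_fibre[OF weil_map_trunc _ \<gamma>]) simp
    then show ?thesis
      using tmap_wcomp[OF S weil_map_incl wcomp_pts[OF weil_map_trunc \<gamma>p]] wcomp_incl_trunc[OF \<gamma>p] by simp
  qed
  then show ?thesis
    unfolding pi_hat_def sectang_def prod.case trunc_secmap(2) trunc_id[OF x] Suc_eq_plus1[symmetric]
    by (intro arg_cong[where f = "Pair _"] restrict_ext)
qed

lemma sectang_tangential:
  assumes \<sigma>: "hol_family p \<sigma>" and x: "x \<in> pts (Rn p)"
  shows "sectang p q (Suc k) \<sigma> x \<in> tangentials p q (Suc k)"
proof (induction k)
  case 0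
  show ?case using sectang_pseudotangential[OF assms, of q 1] by (simp add: One_nat_def)
next
  case (Suc k)
  note S = secmap_smooth[OF \<sigma>, of q p]
  have n: "k + 1 = Suc k" "k + 2 = Suc (Suc k)" by simp_all
  have ka: "weil_map (D_pow (Suc (Suc k))) (D_pow (Suc k)) (kappa (Suc k))" by (rule weil_map_kappa) simp
  have "snd (sectang p q (Suc (Suc k)) \<sigma> x) (wcomp (Rn p) (D_pow (Suc (Suc k))) (kappa (Suc k)) \<gamma>) =
      wcomp (Rn (p + q)) (D_pow (Suc (Suc k))) (kappa (Suc k)) (snd (sectang p q (Suc k) \<sigma> x) \<gamma>)"
    if \<gamma>: "\<gamma> \<in> pts (fibre (Rn p) (D_pow (Suc k)) x)" for \<gamma>
  proof -
    have "wcomp (Rn p) (D_pow (Suc (Suc k))) (kappa (Suc k)) \<gamma> \<in> pts (fibre (Rn p) (D_pow (Suc (Suc k))) x)"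
      by (rule wcomp_fibre[OF ka _ \<gamma>]) simp
    then show ?thesis using tmap_wcomp[OF S ka] \<gamma> by (simp add: sectang_def fibre_pts)
  qed
  moreover have "fst (sectang p q (Suc (Suc k)) \<sigma> x) = secmap p q \<sigma> x" by (simp add: sectang_def)
  ultimately show ?case
    using sectang_pseudotangential[OF assms, of q "Suc (Suc k)"] Suc.IH trunc_secmap(2)[of p q \<sigma> x] trunc_id[OF x]
    unfolding tangentials.simps n mem_Collect_eq split_beta prod.collapse pi_hat_sectang[OF assms]
    by simp
qed

section \<open>The top Taylor coefficient along a linear map\<close>

text \<open>Quotients in other variables commute with setting \<open>k\<close> to 0. After a
  quotient in \<open>k\<close> one may therefore pass to d k = 0, where that quotient is a
  derivative.\<close>

lemma tcl_upd: "k \<notin> set l \<Longrightarrow> tcl l (\<lambda>d. g (d(k := 0))) = tcl l g"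
proof (induction l arbitrary: g)
  case (Cons i l)
  have "Q i (\<lambda>d. g (d(k := 0))) = (\<lambda>d. Q i g (d(k := 0)))"
    using Cons.prems by (simp add: Q_def fun_eq_iff fun_upd_twist)
  then show ?case using Cons.IH[of "Q i g"] Cons.prems unfolding tcl.simps by (metis list.set_intros(2))
qed (simp add: fun_upd_idem)

lemma tcl_sum: "(\<And>i. smoothn (f i)) \<Longrightarrow> tcl l (\<lambda>v. \<Sum>i<(p::nat). c i * f i v) = (\<Sum>i<p. c i * tcl l (f i))"
proof (induction p)
  case (Suc p)
  have "smoothn (\<lambda>v. \<Sum>i<p. c i * f i v)" by (intro smoothn_sum smoothn_mult smoothn_const Suc.prems)
  from tcl_lincomb[OF this Suc.prems[of p]] show ?case using Suc by simp
qed (simp add: tcl_const)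

lemma sum_PiE_insert:
  assumes "k \<notin> A"
  shows "(\<Sum>f\<in>insert k A \<rightarrow>\<^sub>E B. h f) = (\<Sum>i\<in>B. \<Sum>g\<in>A \<rightarrow>\<^sub>E B. h (g(k := i)))"
proof -
  have "(\<Sum>f\<in>insert k A \<rightarrow>\<^sub>E B. h f) = (\<Sum>(i, g)\<in>B \<times> (A \<rightarrow>\<^sub>E B). h (g(k := i)))"
    unfolding PiE_insert_eq
    by (subst sum.reindex[OF inj_combinator[OF assms]]) (simp add: comp_def split_beta)
  then show ?thesis by (simp add: sum.cartesian_product)
qed

text \<open>Along an affine map every quotient is a directional derivative of the section, which
  contributes a sum over one new index. The indices chosen for the different variables make up the
  function \<open>f\<close>, and the multiset of its values is the order of derivative
  reached.\<close>

lemma tcl_hol_family: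
  assumes \<sigma>: "hol_family p \<sigma>"
  shows "distinct l \<Longrightarrow> tcl l (\<lambda>d. \<sigma> j K (\<lambda>i. x i + (\<Sum>k\<in>set l. y k i * d k))) =
    (\<Sum>f\<in>set l \<rightarrow>\<^sub>E {..<p}. (\<Prod>k\<in>set l. y k (f k)) * \<sigma> j (K + image_mset f (mset_set (set l))) x)"
proof (induction l arbitrary: K)
  case (Cons k l)
  let ?F = "\<lambda>d. \<sigma> j K (\<lambda>i. x i + (\<Sum>m\<in>set (k # l). y m i * d m))"
  let ?X = "\<lambda>d i. x i + (\<Sum>m\<in>set l. y m i * d m)"
  have k: "k \<notin> set l" and d: "distinct l" using Cons.prems by auto
  have "Q k ?F (d(k := 0)) = (\<Sum>i<p. y k i * \<sigma> j (add_mset i K) (?X d))" for d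
  proof -
    have "?F (d(k := s)) = \<sigma> j K (\<lambda>i. ?X d i + y k i * s)" for s
    proof -
      have "(\<Sum>m\<in>set l. y m i * (d(k := s)) m) = (\<Sum>m\<in>set l. y m i * d m)" for i
        using k by (intro sum.cong) auto
      then show ?thesis using k by (simp add: algebra_simps)
    qed
    then have "Q k ?F (d(k := 0)) = deriv (\<lambda>s. \<sigma> j K (\<lambda>i. ?X d i + y k i * s)) 0"
      by (simp add: Q_def quo_def)
    also have "\<dots> = (\<Sum>i<p. \<sigma> j (add_mset i K) (?X d) * y k i)"
      by (rule DERIV_imp_deriv[OF hol_familyD(2)[OF \<sigma>]])
    finally show ?thesis by (simp add: mult.commute)
  qed
  then have "tcl (k # l) ?F = tcl l (\<lambda>d. \<Sum>i<p. y k i * \<sigma> j (add_mset i K) (?X d))"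
    using tcl_upd[OF k, of "Q k ?F"] by simp
  also have "\<dots> = (\<Sum>i<p. y k i * tcl l (\<lambda>d. \<sigma> j (add_mset i K) (?X d)))"
    by (rule tcl_sum, rule smoothn_compose[OF hol_familyD(1)[OF \<sigma>]])
      (intro smoothn_add smoothn_sum smoothn_mult smoothn_const smoothn_coord)
  also have "\<dots> = (\<Sum>i<p. \<Sum>g\<in>set l \<rightarrow>\<^sub>E {..<p}. (\<Prod>m\<in>set (k # l). y m ((g(k := i)) m)) *
      \<sigma> j (K + image_mset (g(k := i)) (mset_set (set (k # l)))) x)"
  proof (rule sum.cong[OF refl])
    fix i
    have "(\<Prod>m\<in>set (k # l). y m ((g(k := i)) m)) = y k i * (\<Prod>m\<in>set l. y m (g m))" for g
    proof -
      have "(\<Prod>m\<in>set l. y m ((g(k := i)) m)) = (\<Prod>m\<in>set l. y m (g m))" using k by (intro prod.cong) auto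
      then show ?thesis using k by simp
    qed
    moreover have "image_mset (g(k := i)) (mset_set (set (k # l))) = add_mset i (image_mset g (mset_set (set l)))" for g
    proof -
      have "image_mset (g(k := i)) (mset_set (set l)) = image_mset g (mset_set (set l))"
        using k by (intro image_mset_cong) auto
      then show ?thesis using k by simp
    qed
    ultimately show "y k i * tcl l (\<lambda>d. \<sigma> j (add_mset i K) (?X d)) =
      (\<Sum>g\<in>set l \<rightarrow>\<^sub>E {..<p}. (\<Prod>m\<in>set (k # l). y m ((g(k := i)) m)) *
      \<sigma> j (K + image_mset (g(k := i)) (mset_set (set (k # l)))) x)"
      unfolding Cons.IH[OF d] by (simp add: sum_distrib_left mult.assoc)
  qed
  also have "\<dots> = (\<Sum>f\<in>set (k # l) \<rightarrow>\<^sub>E {..<p}. (\<Prod>m\<in>set (k # l). y m (f m)) * \<sigma> j (K + image_mset f (mset_set (set (k # l)))) x)"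
    unfolding list.set sum_PiE_insert[OF k] ..
  finally show ?case .
qed simp

lemma tc_hol_family:
  assumes "hol_family p \<sigma>" "finite A"
  shows "tc (mset_set A) (\<lambda>d. \<sigma> j K (\<lambda>i. x i + (\<Sum>k\<in>A. y k i * d k))) =
    (\<Sum>f\<in>A \<rightarrow>\<^sub>E {..<p}. (\<Prod>k\<in>A. y k (f k)) * \<sigma> j (K + image_mset f (mset_set A)) x)"
  using tcl_hol_family[OF assms(1), of "sorted_list_of_set A"] assms(2)
  by (simp add: tc_def)

lemma tc_hol_family_unit:
  assumes "hol_family p \<sigma>" "set L \<subseteq> {..<p}"
  shows "tc (mset_set {..<length L}) (\<lambda>d. \<sigma> j {#} (\<lambda>i. x i + (\<Sum>k<length L. (if L ! k = i then 1 else 0) * d k))) = \<sigma> j (mset L) x"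
proof -
  let ?A = "{..<length L}" and ?g = "\<lambda>k\<in>{..<length L}. L ! k"
  let ?h = "\<lambda>f. (\<Prod>k\<in>?A. if L ! k = f k then 1 else 0) * \<sigma> j ({#} + image_mset f (mset_set ?A)) x"
  \<comment> \<open>The product of Kronecker symbols is nonzero only if \<open>f\<close> picks the
    entries of \<open>L\<close>. As functions in \<open>PiE\<close> are \<open>undefined\<close>
    elsewhere, this leaves exactly one of them.\<close>
  have g: "?g \<in> ?A \<rightarrow>\<^sub>E {..<p}" using assms(2) by (auto dest: nth_mem)
  have "(\<Sum>f\<in>?A \<rightarrow>\<^sub>E {..<p}. ?h f) = sum ?h {?g}"
  proof (rule sum.mono_neutral_right)
    show "\<forall>f\<in>(?A \<rightarrow>\<^sub>E {..<p}) - {?g}. ?h f = 0"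
    proof
      fix f assume f: "f \<in> (?A \<rightarrow>\<^sub>E {..<p}) - {?g}"
      then have "\<exists>k\<in>?A. L ! k \<noteq> f k" by (metis DiffE PiE_restrict insertI1 restrict_ext)
      then show "?h f = 0" by (auto intro!: prod_zero)
    qed
  qed (use g in \<open>auto intro!: finite_PiE\<close>)
  also have "\<dots> = \<sigma> j (image_mset ?g (mset_set ?A)) x" by simp
  also have "image_mset ?g (mset_set ?A) = image_mset (\<lambda>k. L ! k) (mset_set ?A)"
    by (intro image_mset_cong) auto
  also have "\<dots> = mset (map (\<lambda>k. L ! k) [0..<length L])"
    by (simp only: mset_map mset_upt atLeast0LessThan)
  also have "\<dots> = mset L" by (simp add: map_nth)
  finally show ?thesis unfolding tc_hol_family[OF assms(1) finite_lessThan] .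
qed

section \<open>Tangentials of sections determine the derivatives\<close>

lemma sectang_eq_iff:
  assumes \<sigma>: "hol_family p \<sigma>" and \<sigma>': "hol_family p \<sigma>'" and x: "x \<in> pts (Rn p)" and x': "x' \<in> pts (Rn p)"
  shows "sectang p q (Suc m) \<sigma> x = sectang p q (Suc m) \<sigma>' x' \<longleftrightarrow>
    x = x' \<and> (\<forall>j<q. \<forall>K\<in>jet_basis p (Suc m). \<sigma> j K x = \<sigma>' j K x')"
proof (intro iffI conjI allI impI ballI)
  assume "x = x' \<and> (\<forall>j<q. \<forall>K\<in>jet_basis p (Suc m). \<sigma> j K x = \<sigma>' j K x')"
  \<comment> \<open>The derivatives at the point determine the iterated jet, and by
    \<open>phi_jet_of\<close> the tangential is a function of that jet.\<close>
  then have "jet_of p q (Suc m) \<sigma> x = jet_of p q (Suc m) \<sigma>' x'"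
    unfolding jet_of_def by (auto intro!: theta_cong)
  then show "sectang p q (Suc m) \<sigma> x = sectang p q (Suc m) \<sigma>' x'"
    using phi_jet_of[OF \<sigma> x, of q m] phi_jet_of[OF \<sigma>' x', of q m] by simp
next
  assume eq: "sectang p q (Suc m) \<sigma> x = sectang p q (Suc m) \<sigma>' x'"
  then have b: "secmap p q \<sigma> x = secmap p q \<sigma>' x'" by (simp add: sectang_def)
  then show xx: "x = x'" by (metis trunc_secmap(2) trunc_id x x')
  fix j K assume j: "j < q" and K: "K \<in> jet_basis p (Suc m)"
  obtain L where L: "mset L = K" using ex_mset by blast
  have sL: "set L \<subseteq> {..<p}" and lL: "length L \<le> Suc m" using K by (auto simp: jet_basis_def simp flip: L)
  \<comment> \<open>One variable for each entry of \<open>L\<close>, moving in the direction of that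
    entry. A list shorter than m + 1 occupies the first variables, and the point stays fixed in the
    others.\<close>
  define v :: "vec \<Rightarrow> vec" where "v d i = x i + (\<Sum>k<length L. (if L ! k = i then 1 else 0) * d k)" for d i
  have sv: "smoothn (\<lambda>d. v d i)" for i
    unfolding v_def by (intro smoothn_add smoothn_sum smoothn_mult smoothn_const smoothn_coord)
  have vp: "v d \<in> pts (Rn p)" for d
  proof -
    have "L ! k \<noteq> i" if "i \<ge> p" "k < length L" for i k using sL nth_mem[OF that(2)] that(1) by fastforce
    then show ?thesis using x by (auto simp: pts_Rn v_def intro!: sum.neutral)
  qed
  have svm: "v \<in> smooth_maps (Rn (nvars (D_pow (Suc m)))) (Rn p)" by (rule smooth_maps_Rn) (auto simp: vp sv)
  define \<gamma> where "\<gamma> = cls (Rn p) (D_pow (Suc m)) v"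
  have "v (\<lambda>_. 0) = x" by (simp add: v_def fun_eq_iff)
  then have \<gamma>: "\<gamma> \<in> pts (fibre (Rn p) (D_pow (Suc m)) x)"
    unfolding \<gamma>_def fibre_pts Rn.base_cls[OF weil_D_pow svm] using cls_pts[OF svm] by simp
  have tr: "cls (Rn (p + q)) (D_pow (Suc m)) (secmap p q \<tau> \<circ> v) =
      cls (Rn (p + q)) (D_pow (Suc m)) (\<lambda>d. trunc (p + q) (secmap p q \<tau> (v d)))" for \<tau>
    by (simp add: comp_def trunc_secmap)
  have "tmap (Rn (p + q)) (D_pow (Suc m)) (secmap p q \<sigma>) \<gamma> = tmap (Rn (p + q)) (D_pow (Suc m)) (secmap p q \<sigma>') \<gamma>"
    using eq \<gamma> fun_cong[of _ _ \<gamma>] by (auto simp: sectang_def xx dest!: fun_cong[where x = \<gamma>])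
  then have "cls (Rn (p + q)) (D_pow (Suc m)) (\<lambda>d. trunc (p + q) (secmap p q \<sigma> (v d))) =
      cls (Rn (p + q)) (D_pow (Suc m)) (\<lambda>d. trunc (p + q) (secmap p q \<sigma>' (v d)))"
    unfolding \<gamma>_def tmap_cls[OF secmap_smooth[OF \<sigma>] svm] tmap_cls[OF secmap_smooth[OF \<sigma>'] svm] tr .
  moreover have "smoothn (\<lambda>d. secmap p q \<tau> (v d) i)" if "hol_family p \<tau>" for \<tau> i
    by (rule smoothn_compose[OF smoothn_secmap sv]) (rule hol_familyD(1)[OF that])
  ultimately have "\<forall>i\<in>{..<p + q}. \<forall>K\<in>pow_basis (Suc m). tc K (\<lambda>d. secmap p q \<sigma> (v d) i) = tc K (\<lambda>d. secmap p q \<sigma>' (v d) i)"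
    using Rn.cls_mk_eq[OF weil_D_pow, where v = "\<lambda>d. secmap p q \<sigma> (v d)" and w = "\<lambda>d. secmap p q \<sigma>' (v d)"] \<sigma> \<sigma>' by blast
  moreover have "mset_set {..<length L} \<in> pow_basis (Suc m)" using lL by (auto simp: pow_basis_def)
  moreover have "p + j \<in> {..<p + q}" using j by simp
  ultimately have "tc (mset_set {..<length L}) (\<lambda>d. secmap p q \<sigma> (v d) (p + j)) =
      tc (mset_set {..<length L}) (\<lambda>d. secmap p q \<sigma>' (v d) (p + j))" by blast
  then have "tc (mset_set {..<length L}) (\<lambda>d. \<sigma> j {#} (v d)) = tc (mset_set {..<length L}) (\<lambda>d. \<sigma>' j {#} (v d))"
    using j by (simp add: secmap_def join_def)
  then show "\<sigma> j K x = \<sigma>' j K x'"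
    unfolding v_def tc_hol_family_unit[OF \<sigma> sL] tc_hol_family_unit[OF \<sigma>' sL] L xx .
qed

section \<open>Coordinate jets\<close>

lemma poly_elt_eq_iff:
  assumes W: "weil W B" and b: "\<And>K. b K \<in> pts (Rn m)" "\<And>K. b' K \<in> pts (Rn m)"
  shows "poly_elt m W B b = poly_elt m W B b' \<longleftrightarrow> (\<forall>K\<in>B. b K = b' K)"
proof -
  have tr: "poly_elt m W B b = cls (Rn m) W (\<lambda>d. trunc m (\<lambda>j. \<Sum>K\<in>B. b K j * mpow K d))"
    if "\<And>K. b K \<in> pts (Rn m)" for b
  proof -
    have "(\<lambda>j. \<Sum>K\<in>B. b K j * mpow K d) \<in> pts (Rn m)" for d using that by (auto simp: pts_Rn)
    then show ?thesis by (simp add: poly_elt_def trunc_id mpow_def)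
  qed
  have "poly_elt m W B b = poly_elt m W B b' \<longleftrightarrow> (\<forall>j\<in>{..<m}. \<forall>K\<in>B. b K j = b' K j)"
    unfolding tr[OF b(1)] tr[OF b(2)]
    by (subst Rn.cls_mk_eq[OF W smoothn_poly smoothn_poly]) (simp add: tc_poly[OF weilD(1)[OF W]])
  also have "\<dots> \<longleftrightarrow> (\<forall>K\<in>B. b K = b' K)"
  proof
    assume *: "\<forall>j\<in>{..<m}. \<forall>K\<in>B. b K j = b' K j"
    show "\<forall>K\<in>B. b K = b' K"
    proof (intro ballI ext)
      fix K j assume "K \<in> B"
      then show "b K j = b' K j" using * b[of K] by (cases "j < m") (simp_all add: pts_Rn)
    qed
  qed simp
  finally show ?thesis .
qed

text \<open>The second fact expresses that the projection to M is constant: its nonconstant Taylor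
  coefficients vanish. Hence a jet is determined by its coordinates x and u.\<close>

lemma coord_jet_coefs:
  assumes "\<gamma> \<in> coord_jets p q N"
  shows "jet_coefs p q N \<gamma> K \<in> pts (Rn (p + q))"
    "i < p \<Longrightarrow> K \<noteq> {#} \<Longrightarrow> jet_coefs p q N \<gamma> K i = 0"
proof -
  let ?W = "D_jet p N" and ?B = "jet_basis p N"
  obtain x where x: "x \<in> pts (Rn p)" "tmap (Rn p) ?W (trunc p) \<gamma> = cls (Rn p) ?W (\<lambda>_. x)"
    and \<gamma>: "\<gamma> \<in> pts (Rn (p + q) \<otimes>\<^sub>W ?W)"
    using assms unfolding coord_jets_def by blast
  obtain v where v: "\<And>i. smoothn (\<lambda>d. v d i)" "\<gamma> = cls (Rn (p + q)) ?W (\<lambda>d. trunc (p + q) (v d))"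
    using \<gamma> by (rule Rn.tens_rep) blast
  have sv: "(\<lambda>d. trunc (p + q) (v d)) \<in> smooth_maps (Rn (nvars ?W)) (Rn (p + q))" using v(1) by (intro Rn.smooth_mk)
  have tr: "trunc p \<in> smooth_maps (Rn (p + q)) (Rn p)"
    by (rule smooth_maps_Rn, rule trunc_pts) (auto simp: trunc_def intro!: smoothn_if)
  have a: "jet_coefs p q N \<gamma> = (\<lambda>K j. if K \<in> ?B \<and> j < p + q then tc K (\<lambda>d. trunc (p + q) (v d) j) else 0)"
    unfolding jet_coefs_def v(2)
    by (rule coefs_cls[OF weil_D_jet _ trunc_pts]) (auto simp: v(1) trunc_def intro!: smoothn_if)
  then show "jet_coefs p q N \<gamma> K \<in> pts (Rn (p + q))" by (simp add: pts_Rn)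
  have "cls (Rn p) ?W (\<lambda>d. trunc p (v d)) = cls (Rn p) ?W (\<lambda>d. trunc p x)"
  proof -
    have "trunc p \<circ> (\<lambda>d. trunc (p + q) (v d)) = (\<lambda>d. trunc p (v d))" by (auto simp: trunc_def fun_eq_iff)
    then show ?thesis using x(2) unfolding v(2) tmap_cls[OF tr sv] by (simp add: trunc_id[OF x(1)])
  qed
  then have "\<forall>i\<in>{..<p}. \<forall>K\<in>?B. tc K (\<lambda>d. v d i) = tc K (\<lambda>d. x i)"
    using Rn.cls_mk_eq[OF weil_D_jet, where v = v and w = "\<lambda>d. x"] v(1) by blast
  then show "jet_coefs p q N \<gamma> K i = 0" if "i < p" "K \<noteq> {#}"
    using that by (simp add: a trunc_def tc_const)
qed

lemma coord_jet_proj_eq_iff: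
  assumes \<gamma>: "\<gamma> \<in> coord_jets p q (n + 1)" and \<gamma>': "\<gamma>' \<in> coord_jets p q (n + 1)"
  shows "coord_jet_proj p q n \<gamma> = coord_jet_proj p q n \<gamma>' \<longleftrightarrow>
    jet_x p q (n + 1) \<gamma> = jet_x p q (n + 1) \<gamma>' \<and>
    (\<forall>j<q. \<forall>K\<in>jet_basis p n. jet_u p q (n + 1) \<gamma> j K = jet_u p q (n + 1) \<gamma>' j K)" (is "_ \<longleftrightarrow> ?R")
proof -
  let ?a = "jet_coefs p q (n + 1) \<gamma>" and ?a' = "jet_coefs p q (n + 1) \<gamma>'"
  have "coord_jet_proj p q n \<gamma> = coord_jet_proj p q n \<gamma>' \<longleftrightarrow> (\<forall>K\<in>jet_basis p n. ?a K = ?a' K)"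
    unfolding coord_jet_proj_def
    by (subst poly_elt_eq_iff[OF weil_D_jet]) (auto simp: coord_jet_coefs(1)[OF \<gamma>] coord_jet_coefs(1)[OF \<gamma>'] jet_basis_def)
  also have "\<dots> \<longleftrightarrow> ?R"
  proof
    assume "\<forall>K\<in>jet_basis p n. ?a K = ?a' K"
    moreover have "{#} \<in> jet_basis p n" by (simp add: jet_basis_def)
    ultimately show ?R by (simp add: jet_x_def jet_u_def)
  next
    assume R: ?R
    show "\<forall>K\<in>jet_basis p n. ?a K = ?a' K"
    proof (intro ballI ext)
      fix K i assume K: "K \<in> jet_basis p n"
      consider "i < p" "K = {#}" | "i < p" "K \<noteq> {#}" | j where "i = p + j" "j < q" | "i \<ge> p + q"
        by (metis add_less_cancel_left le_add_diff_inverse linorder_not_less)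
      then show "?a K i = ?a' K i"
      proof cases
        case 1
        have "trunc p (?a {#}) i = trunc p (?a' {#}) i" using R by (simp add: jet_x_def)
        then show ?thesis using 1 by (simp add: trunc_def)
      next
        case 2
        then show ?thesis by (simp add: coord_jet_coefs(2)[OF \<gamma>] coord_jet_coefs(2)[OF \<gamma>'])
      next
        case 3
        then show ?thesis using R K by (simp add: jet_u_def)
      next
        case 4
        then show ?thesis using coord_jet_coefs(1)[OF \<gamma>, of K] coord_jet_coefs(1)[OF \<gamma>', of K] by (simp add: pts_Rn)
      qed
    qed
  qed
  finally show ?thesis .
qed

section \<open>First-order coefficients\<close>

lemma single_pow_basis: "k < n \<Longrightarrow> {#k#} \<in> pow_basis n"
  by (simp add: pow_basis_iff)

lemma pow_coefs_cls:
  assumes v: "\<And>i. smoothn (\<lambda>d. v d i)" and K: "K \<in> pow_basis n"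
  shows "pow_coefs p n (cls (Rn p) (D_pow n) (\<lambda>d. trunc p (v d))) K = trunc p (\<lambda>i. tc K (\<lambda>d. v d i))"
proof -
  have "smoothn (\<lambda>d. trunc p (v d) i)" for i using v by (auto simp: trunc_def intro!: smoothn_if)
  from coefs_cls[OF weil_D_pow this trunc_pts] show ?thesis using K by (simp add: trunc_def fun_eq_iff)
qed

lemma pow_coefs_tens_mk:
  assumes "k < n"
  shows "pow_coefs p n (tens_mk (Rn p) (D_pow n) (pow_basis n) (trunc p) b) {#k#} = trunc p (\<lambda>i. b (i, {#k#}))"
  unfolding tens_mk_def pow_coefs_cls[OF smoothn_poly single_pow_basis[OF assms]]
    tc_poly[OF weilD(1)[OF weil_D_pow] single_pow_basis[OF assms]] ..

text \<open>A coefficient of order one is the derivative along an axis, so only the restriction of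
  \<open>g\<close> to that axis enters. The factor \<open>a\<close> covers scalings, permutations,
  and, with \<open>a = 0\<close>, axes that are collapsed to the origin.\<close>

lemma pow_coefs_wcomp:
  assumes g: "weil_map (D_pow n) (D_pow m) g" and \<gamma>: "\<gamma> \<in> pts (Rn p \<otimes>\<^sub>W D_pow m)"
    and k: "k < n" "k' < m" and line: "\<And>s. g ((\<lambda>_. 0)(k := s)) = (\<lambda>_. 0)(k' := a * s)"
  shows "pow_coefs p n (wcomp (Rn p) (D_pow n) g \<gamma>) {#k#} = (\<lambda>i. a * pow_coefs p m \<gamma> {#k'#} i)"
proof -
  obtain v where v: "\<And>i. smoothn (\<lambda>d. v d i)" "\<gamma> = cls (Rn p) (D_pow m) (\<lambda>d. trunc p (v d))"
    using \<gamma> by (rule Rn.tens_rep) blast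
  have sv: "(\<lambda>d. trunc p (v d)) \<in> smooth_maps (Rn (nvars (D_pow m))) (Rn p)" using v(1) by (intro Rn.smooth_mk)
  have sg: "smoothn (\<lambda>d. v (g d) i)" for i
    by (rule smoothn_compose[OF v(1)]) (use g in \<open>simp add: weil_map_def\<close>)
  have "tc {#k#} (\<lambda>d. v (g d) i) = a * tc {#k'#} (\<lambda>d. v d i)" for i
  proof -
    define F where "F = (\<lambda>s. v ((\<lambda>_. 0)(k' := s)) i)"
    have "smooth_fun F" unfolding F_def by (rule smooth_section[OF v(1)])
    then have "(F has_real_derivative deriv F 0) (at (a * 0))" using smooth_fun_deriv(1) by simp
    moreover have "((\<lambda>s. a * s) has_real_derivative a) (at 0)" by (auto intro!: derivative_eq_intros)
    ultimately have "((\<lambda>s. F (a * s)) has_real_derivative deriv F 0 * a) (at 0)" by (rule DERIV_chain2)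
    then show ?thesis unfolding tc_single line by (simp add: F_def DERIV_imp_deriv mult.commute)
  qed
  then show ?thesis
    unfolding v(2) wcomp_cls[OF g sv] comp_def
      pow_coefs_cls[OF sg single_pow_basis[OF k(1)]] pow_coefs_cls[OF v(1) single_pow_basis[OF k(2)]]
    by (auto simp: trunc_def)
qed

section \<open>The symmetric form of a symbol\<close>

definition symval :: "nat \<Rightarrow> nat \<Rightarrow> (nat \<Rightarrow> nat multiset \<Rightarrow> real) \<Rightarrow> nat \<Rightarrow> (nat \<Rightarrow> vec) \<Rightarrow> real" where
  "symval p n w j y = (\<Sum>f\<in>{..<n} \<rightarrow>\<^sub>E {..<p}. (\<Prod>k<n. y k (f k)) * w j (image_mset f (mset_set {..<n})))"

lemma symval_cong:
  "(\<And>k i. k < n \<Longrightarrow> i < p \<Longrightarrow> y k i = y' k i) \<Longrightarrow> symval p n w j y = symval p n w j y'"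
  unfolding symval_def by (intro sum.cong refl arg_cong2[where f = "(*)"] prod.cong) (auto simp: PiE_def Pi_def)

lemma symval_scale:
  assumes "i < n" shows "symval p n w j (\<lambda>k. if k = i then (\<lambda>m. a * y k m) else y k) = a * symval p n w j y"
proof -
  have "(\<Prod>k<n. (if k = i then (\<lambda>m. a * y k m) else y k) (f k)) = a * (\<Prod>k<n. y k (f k))" for f
  proof -
    have "(\<Prod>k<n. (if k = i then (\<lambda>m. a * y k m) else y k) (f k)) = (\<Prod>k<n. (if k = i then a else 1) * y k (f k))"
      by (intro prod.cong) auto
    also have "\<dots> = a * (\<Prod>k<n. y k (f k))" using assms by (simp add: prod.distrib prod.delta)
    finally show ?thesis .
  qed
  then show ?thesis by (simp add: symval_def sum_distrib_left mult.assoc)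
qed

text \<open>Permuting the arguments amounts to precomposing the index functions with the
  permutation, which does not change the multiset of their values.\<close>

lemma symval_perm:
  assumes s: "s permutes {..<n}" shows "symval p n w j (\<lambda>k. y (inv s k)) = symval p n w j y"
  unfolding symval_def
proof (rule sum.reindex_bij_witness[where i = "\<lambda>f. f \<circ> inv s" and j = "\<lambda>f. f \<circ> s"])
  let ?P = "{..<n} \<rightarrow>\<^sub>E {..<p}"
  have mem: "f \<circ> t \<in> ?P" if f: "f \<in> ?P" and t: "t permutes {..<n}" for f t
  proof (rule PiE_I)
    show "(f \<circ> t) k \<in> {..<p}" if "k \<in> {..<n}" for k
      using f that permutes_in_image[OF t, of k] by auto
    show "(f \<circ> t) k = undefined" if "k \<notin> {..<n}" for k
      using f that permutes_not_in[OF t that] by auto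
  qed
  fix f assume f: "f \<in> ?P"
  show "f \<circ> s \<in> ?P" "f \<circ> inv s \<in> ?P" using mem[OF f] s permutes_inv[OF s] by blast+
  show "f \<circ> s \<circ> inv s = f" "f \<circ> inv s \<circ> s = f"
    by (simp_all add: comp_assoc permutes_inv_o[OF s])
  have "(\<Prod>k<n. y (inv s k) (f k)) = (\<Prod>k<n. y k (f (s k)))"
    by (rule prod.reindex_bij_witness[where i = s and j = "inv s"])
      (use permutes_in_image[OF s] permutes_in_image[OF permutes_inv[OF s]] permutes_inverses[OF s] in auto)
  moreover have "image_mset (f \<circ> s) (mset_set {..<n}) = image_mset f (mset_set {..<n})"
    using image_mset_mset_set[OF permutes_inj_on[OF s]] permutes_image[OF s]
    by (metis multiset.map_comp)
  ultimately show "(\<Prod>k<n. y k ((f \<circ> s) k)) * w j (image_mset (f \<circ> s) (mset_set {..<n})) =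
      (\<Prod>k<n. y (inv s k) (f k)) * w j (image_mset f (mset_set {..<n}))" by simp
qed

lemma symval_zero:
  assumes "k < n" "y k = (\<lambda>_. 0)" shows "symval p n w j y = 0"
proof -
  have "(\<Prod>k<n. y k (f k)) = 0" for f
    by (rule prod_zero[OF finite_lessThan], rule bexI[of _ k]) (use assms in auto)
  then show ?thesis unfolding symval_def by (simp only: mult_zero_left sum.neutral_const)
qed

lemma smooth_prod: "(\<And>k. k < (n::nat) \<Longrightarrow> smooth_fun (\<lambda>t. f t k)) \<Longrightarrow> smooth_fun (\<lambda>t. \<Prod>k<n. f t k)"
  by (induction n) (simp_all add: smooth_mult)

lemma theta_SD_alt:
  "theta_SD p q n (x, u, w) = (join p q x u, \<lambda>\<gamma>\<in>pts (fibre (Rn p) (D_pow n) x).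
     cls (Rn (p + q)) DD (\<lambda>\<delta>. join p q x (\<lambda>j. u j + \<delta> 0 * symval p n w j (\<lambda>k. pow_coefs p n \<gamma> {#k#}))))"
  unfolding theta_SD_def prod.case Let_def symval_def ..

text \<open>The form depends only on the first-order coefficients of its argument. Each condition
  thus becomes a property of \<open>symval\<close>: linearity in every slot, symmetry, and vanishing
  when a slot is zero.\<close>

theorem theta_SD_symmetric:
  assumes x: "x \<in> pts (Rn p)"
  shows "theta_SD p q n (x, u, w) \<in> symmetric_forms p q n"
proof -
  let ?E = "Rn (p + q)" and ?M = "Rn p"
  define e where "e = join p q x u"
  define A where "A = fibre ?M (D_pow n) x"
  define B where "B = vertical p q e"
  define c where "c \<gamma> j = symval p n w j (\<lambda>k. pow_coefs p n \<gamma> {#k#})" for \<gamma> j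
  define tg where "tg = parametrized.tang ?E (trunc (p + q))"
  define \<omega> where "\<omega> = (\<lambda>\<gamma>\<in>pts A. tg e (join p q (\<lambda>_. 0) (c \<gamma>)))"
  have ex: "trunc p e = x" unfolding e_def trunc_join by (rule trunc_id[OF x])
  have eE: "e \<in> pts ?E" unfolding e_def by (rule join_pts)
  have tg: "cls ?E DD (\<lambda>\<delta>. join p q x (\<lambda>j. u j + \<delta> 0 * b j)) = tg e (join p q (\<lambda>_. 0) b)" for b
  proof -
    have "(\<lambda>i. join p q x u i + join p q (\<lambda>_. 0) b i * d 0) = join p q x (\<lambda>j. u j + d 0 * b j)" for d :: vec
      by (auto simp: join_def)
    then show ?thesis unfolding tg_def e_def Rn.tang_def by (simp add: trunc_id[OF join_pts])
  qed
  have \<omega>: "theta_SD p q n (x, u, w) = (e, \<omega>)"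
    unfolding theta_SD_alt tg \<omega>_def A_def c_def[abs_def] e_def ..
  have tr: "trunc p \<in> smooth_maps ?E ?M"
    by (rule smooth_maps_Rn, rule trunc_pts) (auto simp: trunc_def intro!: smoothn_if)
  have vert: "tg e (join p q (\<lambda>_. 0) b) \<in> pts B" for b
  proof -
    have "trunc p (trunc (p + q) (\<lambda>i. e i + join p q (\<lambda>_. 0) b i * d 0)) = trunc p e" for d :: vec
      by (auto simp: trunc_def join_def)
    then have "tmap ?M DD (trunc p) (tg e (join p q (\<lambda>_. 0) b)) = cls ?M DD (\<lambda>_. trunc p e)"
      unfolding tg_def Rn.tmap_tang[OF tr] by simp
    then show ?thesis by (simp add: B_def vertical_def Defs.subspace_def fibre_pts tg_def trunc_id[OF eE])
  qed
  have sm: "\<omega> \<in> smooth_maps A B"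
  proof (rule smooth_mapsI)
    show "\<omega> \<gamma> \<in> pts B" if "\<gamma> \<in> pts A" for \<gamma> using that vert by (simp add: \<omega>_def)
    fix r assume r: "r \<in> curves A"
    then have rA: "r t \<in> pts A" for t by (simp add: A_def fibre_curves fibre_pts curves_tens)
    interpret T: parametrized "?M \<otimes>\<^sub>W D_pow n" "{..<p} \<times> pow_basis n" "tens_mk ?M (D_pow n) (pow_basis n) (trunc p)"
      by unfold_locales (rule Rn.param_tens[OF weil_D_pow])
    have "r \<in> curves (?M \<otimes>\<^sub>W D_pow n)" using r by (simp add: A_def fibre_curves)
    then obtain b where b: "\<forall>i\<in>{..<p} \<times> pow_basis n. smooth_fun (\<lambda>t. b t i)"
        "r = (\<lambda>t. tens_mk ?M (D_pow n) (pow_basis n) (trunc p) (b t))"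
      unfolding T.curves_eq by blast
    have sc: "smooth_fun (\<lambda>t. c (r t) j)" for j
    proof -
      have "c (r t) j = symval p n w j (\<lambda>k i. b t (i, {#k#}))" for t
        unfolding c_def b(2) by (rule symval_cong) (simp add: pow_coefs_tens_mk trunc_def)
      moreover have "smooth_fun (\<lambda>t. symval p n w j (\<lambda>k i. b t (i, {#k#})))"
        unfolding symval_def
      proof (intro smooth_sum smooth_mult smooth_prod smooth_const)
        fix f k assume "f \<in> {..<n} \<rightarrow>\<^sub>E {..<p}" "k < n"
        then show "smooth_fun (\<lambda>t. b t (f k, {#k#}))" using b(1) single_pow_basis[of k n] by auto
      qed
      ultimately show ?thesis by simp
    qed
    have "(\<lambda>t. tg e (join p q (\<lambda>_. 0) (c (r t)))) \<in> curves (?E \<otimes>\<^sub>W DD)"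
      unfolding tg_def
      by (rule Rn.tang_curve) (auto simp: join_def sc intro!: smooth_if smooth_const)
    moreover have "\<omega> (r t) = tg e (join p q (\<lambda>_. 0) (c (r t)))" for t by (simp add: \<omega>_def rA)
    ultimately show "(\<lambda>t. \<omega> (r t)) \<in> curves B"
      using vert by (auto simp: B_def vertical_def Defs.subspace_def fibre_curves fibre_pts)
  qed
  have memA: "wcomp ?M (D_pow n) g \<gamma> \<in> pts A" and cA: "c (wcomp ?M (D_pow n) g \<gamma>) j = symval p n w j (\<lambda>k i. a k * pow_coefs p m \<gamma> {#\<tau> k#} i)"
    if g: "weil_map (D_pow n) (D_pow m) g" "g (\<lambda>_. 0) = (\<lambda>_. 0)"
      and \<gamma>: "\<gamma> \<in> pts (fibre ?M (D_pow m) x)"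
      and line: "\<And>k s. k < n \<Longrightarrow> g ((\<lambda>_. 0)(k := s)) = (\<lambda>_. 0)(\<tau> k := a k * s)"
      and \<tau>: "\<And>k. k < n \<Longrightarrow> \<tau> k < m" for g \<gamma> m j a \<tau>
  proof -
    show "wcomp ?M (D_pow n) g \<gamma> \<in> pts A" unfolding A_def by (rule wcomp_fibre[OF g \<gamma>])
    have "\<gamma> \<in> pts (?M \<otimes>\<^sub>W D_pow m)" using \<gamma> by (simp add: fibre_pts)
    then show "c (wcomp ?M (D_pow n) g \<gamma>) j = symval p n w j (\<lambda>k i. a k * pow_coefs p m \<gamma> {#\<tau> k#} i)"
      unfolding c_def by (intro symval_cong) (simp add: pow_coefs_wcomp[OF g(1) _ _ \<tau> line])
  qed
  have hom: "\<omega> (wcomp ?M (D_pow n) (scale i \<alpha>) \<gamma>) = wcomp ?E DD (scale 0 \<alpha>) (\<omega> \<gamma>)"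
    if i: "i < n" and \<gamma>: "\<gamma> \<in> pts A" for i \<alpha> \<gamma>
  proof -
    have line: "scale i \<alpha> ((\<lambda>_. 0)(k := s)) = (\<lambda>_. 0)(k := (if k = i then \<alpha> else 1) * s)" for k s
      by (auto simp: scale_def)
    note g = Rn.weil_map_scale[OF i, of \<alpha>] at_zero(1) \<gamma>[unfolded A_def] line
    have m: "wcomp ?M (D_pow n) (scale i \<alpha>) \<gamma> \<in> pts A" by (rule memA[OF g])
    have "c (wcomp ?M (D_pow n) (scale i \<alpha>) \<gamma>) j = \<alpha> * c \<gamma> j" for j
    proof -
      have "c (wcomp ?M (D_pow n) (scale i \<alpha>) \<gamma>) j = symval p n w j (\<lambda>k m. (if k = i then \<alpha> else 1) * pow_coefs p n \<gamma> {#k#} m)"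
        by (rule cA[OF g])
      also have "\<dots> = symval p n w j (\<lambda>k. if k = i then (\<lambda>m. \<alpha> * pow_coefs p n \<gamma> {#k#} m) else pow_coefs p n \<gamma> {#k#})"
        by (rule symval_cong) simp
      also have "\<dots> = \<alpha> * c \<gamma> j" unfolding symval_scale[OF i] c_def ..
      finally show ?thesis .
    qed
    then have "join p q (\<lambda>_. 0) (c (wcomp ?M (D_pow n) (scale i \<alpha>) \<gamma>)) = (\<lambda>j. \<alpha> * join p q (\<lambda>_. 0) (c \<gamma>) j)"
      by (auto simp: join_def)
    then show ?thesis using m \<gamma> by (simp add: \<omega>_def tg_def Rn.tang_scale)
  qed
  have mu: "mu_compatible ?M (D_pow n) A i ?E DD B 0 m \<omega>" if i: "i < n" for i m
    by (rule mu_compatibleI[OF sm]) (use Rn.scaling_smooth(1) i hom in \<open>auto simp: A_def\<close>)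
  have perm: "\<omega> (wcomp ?M (D_pow n) (\<lambda>d. d \<circ> s) \<gamma>) = \<omega> \<gamma>" if s: "s permutes {..<n}" and \<gamma>: "\<gamma> \<in> pts A" for s \<gamma>
  proof -
    have "(\<lambda>_. 0)(k := t) \<circ> s = (\<lambda>_. 0)(inv s k := 1 * t)" for k and t :: real
      using permutes_inverses[OF s] by (auto simp: fun_eq_iff)
    moreover have "inv s k < n" if "k < n" for k
      using that permutes_in_image[OF permutes_inv[OF s], of k] by simp
    ultimately have g: "weil_map (D_pow n) (D_pow n) (\<lambda>d. d \<circ> s)" "(\<lambda>_. 0) \<circ> s = (\<lambda>_. 0 :: real)" "\<gamma> \<in> pts (fibre ?M (D_pow n) x)"
        "\<And>k t. (\<lambda>_. 0)(k := t) \<circ> s = (\<lambda>_. 0)(inv s k := 1 * (t :: real))" "\<And>k. k < n \<Longrightarrow> inv s k < n"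
      using weil_map_perm[OF s] \<gamma> by (auto simp: A_def)
    have "c (wcomp ?M (D_pow n) (\<lambda>d. d \<circ> s) \<gamma>) j = symval p n w j (\<lambda>k m. 1 * pow_coefs p n \<gamma> {#inv s k#} m)" for j
      by (rule cA[OF g])
    then have "c (wcomp ?M (D_pow n) (\<lambda>d. d \<circ> s) \<gamma>) = c \<gamma>"
      using symval_perm[OF s, of p w _ "\<lambda>k. pow_coefs p n \<gamma> {#k#}"] by (simp add: c_def fun_eq_iff)
    moreover have "wcomp ?M (D_pow n) (\<lambda>d. d \<circ> s) \<gamma> \<in> pts A" by (rule memA[OF g])
    ultimately show ?thesis using \<gamma> unfolding \<omega>_def by (simp only: restrict_apply' if_True)
  qed
  have kap: "\<omega> (wcomp ?M (D_pow n) (kappa (n - 1)) \<gamma>) = cls ?E DD (\<lambda>_. e)"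
    if n: "n \<ge> 2" and \<gamma>: "\<gamma> \<in> pts (fibre ?M (D_pow (n - 1)) x)" for \<gamma>
  proof -
    have "weil_map (D_pow (Suc (n - 1))) (D_pow (n - 1)) (kappa (n - 1))" by (rule weil_map_kappa) (use n in simp)
    then have kw: "weil_map (D_pow n) (D_pow (n - 1)) (kappa (n - 1))" using n by simp
    \<comment> \<open>On the last two axes \<open>kappa\<close> vanishes, being a product of two
      variables there, and on the others it is the identity. The minimum only supplies an admissible
      target where the factor is 0.\<close>
    define a where "a k = (if k < n - 2 then 1 else 0 :: real)" for k
    have line: "kappa (n - 1) ((\<lambda>_. 0)(k := s)) = (\<lambda>_. 0)(min k (n - 2) := a k * s)" if "k < n" for k s
      using n that by (auto simp: kappa_def a_def fun_eq_iff)
    have \<tau>: "min k (n - 2) < n - 1" for k using n by auto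
    note g = kw at_zero(2) \<gamma> line \<tau>
    have "c (wcomp ?M (D_pow n) (kappa (n - 1)) \<gamma>) j = symval p n w j (\<lambda>k m. a k * pow_coefs p (n - 1) \<gamma> {#min k (n - 2)#} m)" for j
      by (rule cA[OF g])
    moreover have "symval p n w j (\<lambda>k m. a k * pow_coefs p (n - 1) \<gamma> {#min k (n - 2)#} m) = 0" for j
      by (rule symval_zero[of "n - 1"]) (use n in \<open>auto simp: a_def\<close>)
    ultimately have "c (wcomp ?M (D_pow n) (kappa (n - 1)) \<gamma>) = (\<lambda>_. 0)" by (simp add: fun_eq_iff)
    then have "\<omega> (wcomp ?M (D_pow n) (kappa (n - 1)) \<gamma>) = tg e (join p q (\<lambda>_. 0) (\<lambda>_. 0))"
      using memA[OF g] by (simp add: \<omega>_def)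
    also have "\<dots> = cls ?E DD (\<lambda>_. e)"
      using tg[of "\<lambda>_. 0"] by (simp add: e_def)
    finally show ?thesis .
  qed
  have ext: "\<omega> \<in> extensional (pts A)" by (simp add: \<omega>_def)
  show ?thesis
    unfolding \<omega> symmetric_forms_def mem_Collect_eq prod.case Let_def ex A_def[symmetric] B_def[symmetric]
    using eE sm ext hom mu perm kap by blast
qed

section \<open>The top coefficient of a homogeneous polynomial\<close>

text \<open>Orders of vanishing add up. The ideal of \<open>D_jet k m\<close> consists of functions
  vanishing to order m + 1, so the product has order (m + 1) + (m' + 1), which belongs to the index
  \<open>Suc (m + m')\<close>.\<close>

lemma jet_ideal_mult:
  assumes a: "a \<in> ideal (D_jet k m)" and b: "b \<in> ideal (D_jet k m')"
  shows "(\<lambda>x. a x * b x) \<in> ideal (D_jet k (Suc (m + m')))"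
proof -
  have gen: "(\<lambda>x. mpow K x * b x) \<in> ideal (D_jet k (m' + size K))" if "set_mset K \<subseteq> {..<k}" for K
    using that
  proof (induction K)
    case (add i K)
    then have "(\<lambda>x. mpow K x * b x) \<in> ideal (D_jet k (m' + size K))" "i < k" by auto
    from jet_ideal_var[OF this] show ?case by (simp add: mult.assoc)
  qed (use b in simp)
  obtain S c where S: "S \<subseteq> eqns (D_jet k m)" "\<forall>g\<in>S. c g \<in> funs (Rn k)" "\<forall>x\<in>pts (Rn k). a x = (\<Sum>g\<in>S. c g x * g x)"
    using a unfolding ideal_def by auto
  have "(\<lambda>x. \<Sum>g\<in>S. c g x * (g x * b x)) \<in> ideal (D_jet k (Suc (m + m')))"
  proof (rule ideal_sum)
    fix g assume g: "g \<in> S"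
    then obtain K where K: "g = mpow K" "set_mset K \<subseteq> {..<k}" "size K = m + 1"
      using S(1) unfolding eqns_D_jet by blast
    have "m' + size K = Suc (m + m')" using K(3) by simp
    from gen[OF K(2), unfolded this] have "(\<lambda>x. g x * b x) \<in> ideal (D_jet k (Suc (m + m')))"
      unfolding K(1) .
    then show "(\<lambda>x. c g x * (g x * b x)) \<in> ideal (D_jet k (Suc (m + m')))"
      by (rule ideal_mult) (use S(2) g in simp)
  qed
  then show ?thesis by (rule ideal_cong) (simp add: S(3) sum_distrib_right mult.assoc)
qed

lemma mpow_ideal:
  assumes "\<And>i. i \<in># L \<Longrightarrow> (\<lambda>d. l d i) \<in> ideal (D_jet k 0)" "L \<noteq> {#}"
  shows "(\<lambda>d. mpow L (l d)) \<in> ideal (D_jet k (size L - 1))"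
  using assms
proof (induction L)
  case (add i L)
  show ?case
  proof (cases "L = {#}")
    case True
    then show ?thesis using add.prems(1)[of i] by simp
  next
    case False
    then have s: "Suc (0 + (size L - 1)) = size (add_mset i L) - 1" by (cases L) auto
    have 1: "(\<lambda>d. l d i) \<in> ideal (D_jet k 0)" using add.prems(1) by simp
    have "(\<lambda>d. mpow L (l d)) \<in> ideal (D_jet k (size L - 1))" using add.prems False by (intro add.IH) auto
    from jet_ideal_mult[OF 1 this] show ?thesis unfolding s mpow_add_mset .
  qed
qed simp

text \<open>By h H - l L = h (H - L) + (h - l) L one factor is exchanged at a time. All factors
  vanish to first order and the differences to second order, so one order is gained over the
  degree.\<close>

lemma mpow_diff_ideal:
  assumes "\<And>i. i \<in># L \<Longrightarrow> (\<lambda>d. h d i) \<in> ideal (D_jet k 0)" "\<And>i. i \<in># L \<Longrightarrow> (\<lambda>d. l d i) \<in> ideal (D_jet k 0)"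
    and "\<And>i. i \<in># L \<Longrightarrow> (\<lambda>d. h d i - l d i) \<in> ideal (D_jet k 1)"
  shows "(\<lambda>d. mpow L (h d) - mpow L (l d)) \<in> ideal (D_jet k (size L))"
  using assms
proof (induction L)
  case (add i L)
  have h: "(\<lambda>d. h d i) \<in> ideal (D_jet k 0)" and hl: "(\<lambda>d. h d i - l d i) \<in> ideal (D_jet k 1)"
    using add.prems by auto
  have "(\<lambda>d. mpow L (h d) - mpow L (l d)) \<in> ideal (D_jet k (size L))" using add.prems by (intro add.IH) auto
  from jet_ideal_mult[OF h this]
  have 1: "(\<lambda>d. h d i * (mpow L (h d) - mpow L (l d))) \<in> ideal (D_jet k (Suc (size L)))" by simp
  have 2: "(\<lambda>d. (h d i - l d i) * mpow L (l d)) \<in> ideal (D_jet k (Suc (size L)))"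
  proof (cases "L = {#}")
    case True
    then show ?thesis using hl by (simp add: One_nat_def)
  next
    case False
    then have s: "Suc (1 + (size L - 1)) = Suc (size L)" by (cases L) auto
    have "(\<lambda>d. mpow L (l d)) \<in> ideal (D_jet k (size L - 1))" using add.prems False by (intro mpow_ideal) auto
    from jet_ideal_mult[OF hl this] show ?thesis unfolding s .
  qed
  from ideal_add[OF 1 2] show ?case by (simp add: algebra_simps)
qed simp

lemma smono_mpow:
  assumes "set_mset L \<subseteq> {..<p}" shows "smono p L h = (1 / (\<Prod>i<p. fact (count L i))) * mpow L h"
proof -
  have "mpow L h = (\<Prod>i\<in>set_mset L. h i ^ count L i)"
    unfolding mpow_def by (rule image_prod_mset_multiplicity)
  also have "\<dots> = (\<Prod>i<p. h i ^ count L i)"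
    by (rule prod.mono_neutral_left) (use assms in \<open>auto simp: not_in_iff\<close>)
  finally show ?thesis by (simp add: smono_def prod_dividef)
qed

text \<open>Up to terms of order $n + 1$, a monomial of degree \<open>n\<close> in \<open>v - x\<close> depends only on the linear part of \<open>v\<close>.\<close>

lemma tc_top_sec:
  assumes v: "\<And>i. smoothn (\<lambda>d. v d i)" "\<And>i. v (\<lambda>_. 0) i = x i" and w: "\<And>K. size K \<noteq> n \<Longrightarrow> w j K = 0"
  shows "tc (mset_set {..<n}) (\<lambda>d. sec p n x w j {#} (v d)) = symval p n w j (\<lambda>k i. tc {#k#} (\<lambda>d. v d i))"
proof -
  let ?top = "mset_set {..<n}"
  define y where "y k i = tc {#k#} (\<lambda>d. v d i)" for k i
  \<comment> \<open>The affine part of \<open>v\<close> at the origin; it differs from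
    \<open>v\<close> by terms of second order and by products of distinct variables.\<close>
  define l where "l d i = x i + (\<Sum>k<n. y k i * d k)" for d i
  have sl: "smoothn (\<lambda>d. l d i)" for i
    unfolding l_def by (intro smoothn_add smoothn_sum smoothn_mult smoothn_const smoothn_coord)
  have ssec: "smoothn (\<lambda>d. sec p n x w j {#} (f d))" if "\<And>i. smoothn (\<lambda>d. f d i)" for f
    by (rule smoothn_compose[OF smoothn_sec that])
  have tl: "tc {#k#} (\<lambda>d. l d i) = y k i" if "k < n" for k i
  proof -
    have m: "(\<lambda>d. l d i) = (\<lambda>d. x i + (\<Sum>m<n. y m i * mpow {#m#} d))" by (simp add: l_def)
    have "tc {#k#} (\<lambda>d. l d i) = tc {#k#} (\<lambda>d. x i) + tc {#k#} (\<lambda>d. \<Sum>m<n. y m i * mpow {#m#} d)"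
      unfolding m by (intro tc_add smoothn_sum smoothn_mult smoothn_const smoothn_mpow)
    also have "tc {#k#} (\<lambda>d. \<Sum>m<n. y m i * mpow {#m#} d) = (\<Sum>m<n. y m i * tc {#k#} (mpow {#m#}))"
      by (subst tc_sum) (auto intro: smoothn_mult smoothn_mpow simp: tc_cmult smoothn_mpow simp del: mpow_add_mset)
    also have "\<dots> = y k i" using that by (simp add: tc_mpow if_distrib cong: if_cong)
    finally show ?thesis by (simp add: tc_const)
  qed
  have shift0: "(\<lambda>d. f d i - x i) \<in> ideal (D_jet n 0)" if "\<And>i. smoothn (\<lambda>d. f d i)" "f (\<lambda>_. 0) i = x i" for f :: "vec \<Rightarrow> vec" and i
    by (subst weilD(4)[OF weil_D_jet]) (auto simp: jet_basis_def that intro: smoothn_diff)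
  have shift1: "(\<lambda>d. (v d i - x i) - (l d i - x i)) \<in> ideal (D_jet n 1)" for i
  proof (subst weilD(4)[OF weil_D_jet])
    show "smoothn (\<lambda>d. v d i - x i - (l d i - x i))" by (intro smoothn_diff v sl smoothn_const)
    show "\<forall>K\<in>jet_basis n 1. tc K (\<lambda>d. v d i - x i - (l d i - x i)) = 0"
    proof
      fix K assume K: "K \<in> jet_basis n 1"
      then consider "K = {#}" | k where "K = {#k#}" "k < n"
        by (cases K) (auto simp: jet_basis_def One_nat_def)
      then show "tc K (\<lambda>d. v d i - x i - (l d i - x i)) = 0"
      proof cases
        case 1
        then show ?thesis by (simp add: v(2) l_def)
      next
        case 2
        have "tc K (\<lambda>d. v d i - l d i) = 0"
          by (subst tc_diff[OF v(1) sl]) (use 2 tl in \<open>simp add: y_def\<close>)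
        then show ?thesis by simp
      qed
    qed
  qed
  have "(\<lambda>d. sec p n x w j {#} (v d) - sec p n x w j {#} (l d)) \<in> ideal (D_jet n n)"
  proof -
    have "(\<lambda>d. \<Sum>L\<in>jet_basis p n. w j L * (smono p L (\<lambda>i. v d i - x i) - smono p L (\<lambda>i. l d i - x i))) \<in> ideal (D_jet n n)"
    proof (intro ideal_sum)
      fix L assume L: "L \<in> jet_basis p n"
      show "(\<lambda>d. w j L * (smono p L (\<lambda>i. v d i - x i) - smono p L (\<lambda>i. l d i - x i))) \<in> ideal (D_jet n n)"
      proof (cases "size L = n")
        case True
        have "(\<lambda>d. mpow L (\<lambda>i. v d i - x i) - mpow L (\<lambda>i. l d i - x i)) \<in> ideal (D_jet n (size L))"
          by (intro mpow_diff_ideal shift0 shift1 v sl) (simp add: l_def)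
        then have "(\<lambda>d. (w j L * (1 / (\<Prod>i<p. fact (count L i)))) * (mpow L (\<lambda>i. v d i - x i) - mpow L (\<lambda>i. l d i - x i))) \<in> ideal (D_jet n n)"
          unfolding True by (rule ideal_cmult)
        moreover have "set_mset L \<subseteq> {..<p}" using L by (simp add: jet_basis_def)
        ultimately show ?thesis unfolding smono_mpow[OF \<open>set_mset L \<subseteq> {..<p}\<close>] by (simp add: algebra_simps)
      next
        case False
        then show ?thesis by (simp add: w)
      qed
    qed
    then show ?thesis
      by (rule ideal_cong) (simp add: sec_def jet_basis_def right_diff_distrib sum_subtractf)
  qed
  moreover have "?top \<in> jet_basis n n" by (simp add: jet_basis_def)
  moreover have "smoothn (\<lambda>d. sec p n x w j {#} (v d) - sec p n x w j {#} (l d))"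
    by (intro smoothn_diff ssec v sl)
  ultimately have "tc ?top (\<lambda>d. sec p n x w j {#} (v d) - sec p n x w j {#} (l d)) = 0"
    using weilD(4)[OF weil_D_jet] by blast
  then have "tc ?top (\<lambda>d. sec p n x w j {#} (v d)) = tc ?top (\<lambda>d. sec p n x w j {#} (l d))"
    by (simp add: tc_diff[OF ssec[OF v(1)] ssec[OF sl]])
  \<comment> \<open>Along an affine map the top coefficient is a sum over all index tuples of
    derivatives of order \<open>n\<close>, and at the centre these are the numbers
    \<open>w j K\<close>.\<close>
  also have "\<dots> = symval p n w j y"
    unfolding l_def tc_hol_family[OF hol_family_sec finite_lessThan] symval_def by (simp add: sec_at_center)
  finally show ?thesis unfolding y_def .
qed

section \<open>The difference of two tangentials\<close>

lemma theta_JD_eq: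
  "theta_JD p q (Suc n) \<gamma> =
    sectang p q (Suc n) (sec p (Suc n) (jet_x p q (Suc n) \<gamma>) (jet_u p q (Suc n) \<gamma>)) (jet_x p q (Suc n) \<gamma>)"
  unfolding theta_JD_def theta_J_def theta_eq_jet_of by (rule phi_jet_of[OF hol_family_sec]) (simp add: jet_x_def)

lemma tangential_diff_sectang:
  assumes x: "x \<in> pts (Rn p)" and u: "\<And>j K. j < q \<Longrightarrow> K \<in> jet_basis p n \<Longrightarrow> u j K = u' j K"
  shows "tangential_diff p q (Suc n) (sectang p q (Suc n) (sec p (Suc n) x u) x) (sectang p q (Suc n) (sec p (Suc n) x u') x) =
    theta_SD p q (Suc n) (x, \<lambda>j. u j {#}, \<lambda>j K. if size K = Suc n then u j K - u' j K else 0)"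
proof -
  let ?E = "Rn (p + q)" and ?N = "Suc n" and ?top = "mset_set {..<Suc n}"
  let ?S = "\<lambda>u. secmap p q (sec p ?N x u)"
  define w where "w j K = (if size K = ?N then u j K - u' j K else 0)" for j K
  have Sx: "?S u x = join p q x (\<lambda>j. u j {#})" for u by (simp add: secmap_def sec_at_center)
  \<comment> \<open>All coefficients of order at most \<open>n\<close> cancel, so the two sections
    differ by the polynomial section of \<open>w\<close>, which is homogeneous of degree n + 1 about
    \<open>x\<close>.\<close>
  have sec_diff: "sec p ?N x u j {#} \<xi> - sec p ?N x u' j {#} \<xi> = sec p ?N x w j {#} \<xi>" if j: "j < q" for j \<xi>
  proof -
    have "u j L - u' j L = w j L" if "L \<in> jet_basis p ?N" for L
      using u[OF j, of L] that by (auto simp: w_def jet_basis_def le_Suc_eq)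
    then show ?thesis
      unfolding sec_def sum_subtractf[symmetric] left_diff_distrib[symmetric]
      by (intro sum.cong refl) (auto simp: jet_basis_def simp flip: left_diff_distrib)
  qed
  have main: "elt_diff (p + q) ?N (tmap ?E (D_pow ?N) (?S u) \<gamma>) (tmap ?E (D_pow ?N) (?S u') \<gamma>) =
      cls ?E DD (\<lambda>\<delta>. join p q x (\<lambda>j. u j {#} + \<delta> 0 * symval p ?N w j (\<lambda>k. pow_coefs p ?N \<gamma> {#k#})))"
    if \<gamma>: "\<gamma> \<in> pts (fibre (Rn p) (D_pow ?N) x)" for \<gamma>
  proof -
    have \<gamma>p: "\<gamma> \<in> pts (Rn p \<otimes>\<^sub>W D_pow ?N)" and \<gamma>b: "base \<gamma> = x" using \<gamma> by (simp_all add: fibre_pts)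
    obtain v where v: "\<And>i. smoothn (\<lambda>d. v d i)" "\<gamma> = cls (Rn p) (D_pow ?N) (\<lambda>d. trunc p (v d))"
      using \<gamma>p by (rule Rn.tens_rep) blast
    define V where "V d = trunc p (v d)" for d
    have sV: "smoothn (\<lambda>d. V d i)" for i unfolding V_def trunc_def by (intro smoothn_if v smoothn_const)
    have V: "V \<in> smooth_maps (Rn (nvars (D_pow ?N))) (Rn p)"
      unfolding V_def using v(1) by (intro Rn.smooth_mk)
    have \<gamma>V: "\<gamma> = cls (Rn p) (D_pow ?N) V" unfolding v(2) V_def[abs_def] ..
    have V0: "V (\<lambda>_. 0) = x" using \<gamma>b unfolding \<gamma>V Rn.base_cls[OF weil_D_pow V] .
    have sS: "smoothn (\<lambda>d. ?S u (V d) i)" for u i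
      by (rule smoothn_compose[OF smoothn_secmap sV]) (rule smoothn_sec)
    have tm: "tmap ?E (D_pow ?N) (?S u) \<gamma> = cls ?E (D_pow ?N) (\<lambda>d. trunc (p + q) (?S u (V d)))" for u
      unfolding \<gamma>V tmap_cls[OF secmap_smooth[OF hol_family_sec] V] by (simp add: comp_def trunc_secmap)
    have sE: "(\<lambda>d. trunc (p + q) (?S u (V d))) \<in> smooth_maps (Rn (nvars (D_pow ?N))) ?E"
      using sS by (intro Rn.smooth_mk)
    have bs: "base (tmap ?E (D_pow ?N) (?S u) \<gamma>) = join p q x (\<lambda>j. u j {#})"
      unfolding tm Rn.base_cls[OF weil_D_pow sE] V0 Sx by (rule trunc_id[OF join_pts])
    have top: "?top \<in> pow_basis ?N" by (auto simp: pow_basis_def)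
    have pc: "pow_coefs (p + q) ?N (tmap ?E (D_pow ?N) (?S u) \<gamma>) ?top = trunc (p + q) (\<lambda>i. tc ?top (\<lambda>d. ?S u (V d) i))" for u
      unfolding tm by (rule pow_coefs_cls[OF sS top])
    have pv: "pow_coefs p ?N \<gamma> {#k#} = trunc p (\<lambda>i. tc {#k#} (\<lambda>d. v d i))" if "k < ?N" for k
      unfolding v(2) by (rule pow_coefs_cls[OF v(1) single_pow_basis[OF that]])
    have tops: "tc ?top (\<lambda>d. sec p ?N x u j {#} (V d)) - tc ?top (\<lambda>d. sec p ?N x u' j {#} (V d)) =
        symval p ?N w j (\<lambda>k. pow_coefs p ?N \<gamma> {#k#})" if j: "j < q" for j
    proof -
      have ss: "smoothn (\<lambda>d. sec p ?N x u j {#} (V d))" for u by (rule smoothn_compose[OF smoothn_sec sV])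
      have "tc ?top (\<lambda>d. sec p ?N x u j {#} (V d)) - tc ?top (\<lambda>d. sec p ?N x u' j {#} (V d)) =
          tc ?top (\<lambda>d. sec p ?N x w j {#} (V d))"
        unfolding tc_diff[OF ss ss, symmetric] sec_diff[OF j] ..
      also have "\<dots> = symval p ?N w j (\<lambda>k i. tc {#k#} (\<lambda>d. V d i))"
        by (rule tc_top_sec[OF sV]) (simp_all add: V0 w_def)
      also have "\<dots> = symval p ?N w j (\<lambda>k. pow_coefs p ?N \<gamma> {#k#})"
        by (rule symval_cong) (simp add: pv V_def trunc_def)
      finally show ?thesis .
    qed
    have "join p q x (\<lambda>j. u j {#}) j + \<delta> 0 * (trunc (p + q) (\<lambda>i. tc ?top (\<lambda>d. ?S u (V d) i)) j -
        trunc (p + q) (\<lambda>i. tc ?top (\<lambda>d. ?S u' (V d) i)) j) =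
        join p q x (\<lambda>j. u j {#} + \<delta> 0 * symval p ?N w j (\<lambda>k. pow_coefs p ?N \<gamma> {#k#})) j" for \<delta> :: vec and j
    proof -
      consider "j < p" | i where "j = p + i" "i < q" | "j \<ge> p + q"
        by (metis add_less_cancel_left le_add_diff_inverse linorder_not_less)
      then show ?thesis
      proof cases
        case 2
        then show ?thesis by (simp add: join_def secmap_def trunc_def tops)
      qed (simp_all add: join_def secmap_def trunc_def)
    qed
    then show ?thesis unfolding elt_diff_def Let_def pc bs by simp
  qed
  have f: "fst (sectang p q ?N (sec p ?N x u) x) = join p q x (\<lambda>j. u j {#})"
    unfolding sectang_def fst_conv Sx ..
  show ?thesis
    unfolding tangential_diff_def f trunc_join trunc_id[OF x] theta_SD_alt w_def[abs_def, symmetric]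
  proof (intro arg_cong[where f = "Pair _"] restrict_ext)
    fix \<gamma> assume \<gamma>: "\<gamma> \<in> pts (fibre (Rn p) (D_pow ?N) x)"
    have "snd (sectang p q ?N (sec p ?N x u) x) \<gamma> = tmap ?E (D_pow ?N) (?S u) \<gamma>" for u
      using \<gamma> by (simp add: sectang_def)
    then show "elt_diff (p + q) ?N (snd (sectang p q ?N (sec p ?N x u) x) \<gamma>) (snd (sectang p q ?N (sec p ?N x u') x) \<gamma>) =
      cls ?E DD (\<lambda>\<delta>. join p q x (\<lambda>j. u j {#} + \<delta> 0 * symval p ?N w j (\<lambda>k. pow_coefs p ?N \<gamma> {#k#})))"
      using main[OF \<gamma>] by simp
  qed
qed

theorem proposition83:
  fixes p q n :: nat and \<gamma> \<gamma>' :: "vec \<Rightarrow> vec"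
  assumes "n \<ge> 1"
    and "\<gamma> \<in> coord_jets p q (n + 1)" and "\<gamma>' \<in> coord_jets p q (n + 1)"
  shows "(coord_jet_proj p q n \<gamma> = coord_jet_proj p q n \<gamma>' \<longleftrightarrow>
            tangential_proj p q n (theta_JD p q (n + 1) \<gamma>) =
            tangential_proj p q n (theta_JD p q (n + 1) \<gamma>')) \<and>
         (coord_jet_proj p q n \<gamma> = coord_jet_proj p q n \<gamma>' \<longrightarrow>
            theta_SD p q (n + 1) (coord_jet_diff p q (n + 1) \<gamma> \<gamma>') \<in> symmetric_forms p q (n + 1) \<and>
            theta_SD p q (n + 1) (coord_jet_diff p q (n + 1) \<gamma> \<gamma>') =
            tangential_diff p q (n + 1) (theta_JD p q (n + 1) \<gamma>) (theta_JD p q (n + 1) \<gamma>'))"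
proof -
  \<comment> \<open>Tangentials begin at order 1, so the projected tangentials have an order of the
    form \<open>Suc m\<close>, as in \<open>sectang_eq_iff\<close>.\<close>
  obtain m where m: "n = Suc m" using assms(1) by (cases n) (auto simp: One_nat_def)
  have N: "n + 1 = Suc n" by simp
  let ?x = "jet_x p q (Suc n) \<gamma>" and ?u = "jet_u p q (Suc n) \<gamma>"
  let ?x' = "jet_x p q (Suc n) \<gamma>'" and ?u' = "jet_u p q (Suc n) \<gamma>'"
  have x: "?x \<in> pts (Rn p)" "?x' \<in> pts (Rn p)" by (simp_all add: jet_x_def)
  \<comment> \<open>The projection is \<open>undefined\<close> outside the tangentials, so
    membership is established before \<open>pi_hat\<close> is computed.\<close>
  have tp: "tangential_proj p q n (sectang p q (Suc n) \<sigma> x) = sectang p q n \<sigma> x"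
    if "hol_family p \<sigma>" "x \<in> pts (Rn p)" for \<sigma> x
    unfolding tangential_proj_def N using sectang_tangential[OF that, of q n] pi_hat_sectang[OF that] by simp
  have coord: "coord_jet_proj p q n \<gamma> = coord_jet_proj p q n \<gamma>' \<longleftrightarrow>
      ?x = ?x' \<and> (\<forall>j<q. \<forall>K\<in>jet_basis p n. ?u j K = ?u' j K)"
    using coord_jet_proj_eq_iff[OF assms(2,3)] unfolding N .
  have "tangential_proj p q n (theta_JD p q (Suc n) \<gamma>) = tangential_proj p q n (theta_JD p q (Suc n) \<gamma>') \<longleftrightarrow>
      ?x = ?x' \<and> (\<forall>j<q. \<forall>K\<in>jet_basis p n. sec p (Suc n) ?x ?u j K ?x = sec p (Suc n) ?x' ?u' j K ?x')"
    unfolding theta_JD_eq tp[OF hol_family_sec x(1)] tp[OF hol_family_sec x(2)]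
    unfolding m by (rule sectang_eq_iff[OF hol_family_sec hol_family_sec x[unfolded m]])
  also have "\<dots> \<longleftrightarrow> coord_jet_proj p q n \<gamma> = coord_jet_proj p q n \<gamma>'"
    unfolding coord sec_at_center by (auto simp: jet_basis_def)
  finally have iff: "coord_jet_proj p q n \<gamma> = coord_jet_proj p q n \<gamma>' \<longleftrightarrow>
      tangential_proj p q n (theta_JD p q (Suc n) \<gamma>) = tangential_proj p q n (theta_JD p q (Suc n) \<gamma>')" ..
  have "theta_SD p q (Suc n) (coord_jet_diff p q (Suc n) \<gamma> \<gamma>') \<in> symmetric_forms p q (Suc n)"
    unfolding coord_jet_diff_def by (rule theta_SD_symmetric[OF x(1)])
  moreover have "theta_SD p q (Suc n) (coord_jet_diff p q (Suc n) \<gamma> \<gamma>') =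
      tangential_diff p q (Suc n) (theta_JD p q (Suc n) \<gamma>) (theta_JD p q (Suc n) \<gamma>')"
    if eq: "coord_jet_proj p q n \<gamma> = coord_jet_proj p q n \<gamma>'"
  proof -
    have xx: "?x' = ?x" and u: "\<And>j K. j < q \<Longrightarrow> K \<in> jet_basis p n \<Longrightarrow> ?u j K = ?u' j K"
      using eq unfolding coord by auto
    show ?thesis
      unfolding coord_jet_diff_def theta_JD_eq xx by (rule tangential_diff_sectang[OF x(1) u, symmetric])
  qed
  ultimately show ?thesis unfolding N using iff by blast
qed

end
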